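(* Let $E=\mathbb{C}^d$, $p\in\mathbb{R}^d\subset E$, let $K_0\subset E$ be a compact absolutely convex neighbourhood of $0$ and $K:=p+K_0$. Let $V:K\to E$ be an analytic map with $V(p)=0$, and suppose $T>0$ is such that for any $z^0\in K$ the ODE $\dot z=V(z)$, $z(0)=z^0$, has a solution on $[0,T]$. Let $m,n\in\mathbb{Z}_{\ge0}$ with $m\le n$ and $N\in\mathbb{Z}_{>0}$. Let $\mu$ be a Borel probability measure on $K_0\cap\mathbb{R}^d$ with $\mathrm{supp}(\mu)\subset K_0\cap\mathbb{R}^d$. Let $z_0^1,\dots,z_0^N\in\mathrm{supp}(\mu)$, $\widehat\mu_N:=N^{-1}\sum_{i=1}^N\delta_{z_0^i}$ and $Z_N:=(p+z_0^1,\dots,p+z_0^N)\in K^N$. Let $\widehat{\mathbf{C}}_{m,n,Z_N}$ be formed from the map $f=\phi^T$. Assume that (i) the eigenvalues of the Jacobian matrix $\mathrm{d}V_p$ are real; (ii) $\mathbf{D}_n(\mu)$ is invertible and there exists $\gamma_1\in(0,1)$ such that $\big\|\mathbf{I}-\mathbf{D}_n(\mu)^{-1/2}\mathbf{D}_n(\widehat\mu_N)\mathbf{D}_n(\mu)^{-1/2}\big\|_{\rm op}\le1-\gamma_1$; (iii) there exists $\gamma_2\in(0,1)$ such that $\big\|\mathbf{C}^{(T)}_m-\widehat{\mathbf{C}}_{m,n,Z_N}\big\|_{\rm op}<(1-\gamma_2)B_m^{-1}$. Let $\widehat{\mathbf{A}}_{m,n,Z_N}:=\frac1T\log\widehat{\mathbf{C}}_{m,n,Z_N}$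 and define $\widehat{V}_{m,n,Z_N}:E\to E$ by $\widehat{V}_{m,n,Z_N,i}(z):=\mathbf{u}_{p,m}(z)\,\widehat{\mathbf{A}}_{m,n,Z_N}^*\big(\partial_{z_i}\mathbf{u}_{p,m}(0)\big)^*$, $i=1,\dots,d$. Then, for any compact subset $K_1\Subset K_0$, $$\sup_{z\in p+K_1}\big\|\widehat{V}_{m,n,Z_N}(z)-V(z)\big\|_E\le C'\Big(\frac{B_m^2}{\gamma_2}\sqrt{\frac{m!}{\gamma_1}}\,\frac{R_\mu^n}{\Lambda_n(\mu)^{1/2}}+R_{K_1}^m\Big),$$ where $R_\mu:=\sup_{x\in\mathrm{supp}(\mu)}|x|_{K_0}$, $R_{K_1}:=\sup_{z\in K_1}|z|_{K_0}$, and, $T$ being fixed, $C'$ is a constant depending only on $V,p,K_0,K_1$ and $\mu$.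
   Context: $E=\mathbb{C}^d$ carries the standard Hermitian inner product $\langle z,w\rangle=w^*z$ and norm. A set $S$ is absolutely convex if $ax+by\in S$ whenever $x,y\in S$ and $a,b\in\mathbb{C}$, $|a|+|b|\le1$. $|z|_{K_0}:=\inf\{t>0: z\in tK_0\}$. $K_1\Subset K_0$ means $K_1\subset\mathrm{int}(K_0)$. $\mathbf{e}_\zeta(z):=e^{\zeta^*z}$. $^*$ on matrices and vectors is conjugate transpose, $\dagger$ the Moore–Penrose pseudo-inverse, $\|\cdot\|_{\rm op}$ the operator norm. A map on a compact set $K$ is analytic if it is the restriction of a holomorphic map on an open neighbourhood of $K$. The flow map $\phi^t:K\to E$, $t\in[0,T]$, is $\phi^t(w):=z(t)$ where $z$ solves $\dot z=V(z)$, $z(0)=w$; it is regarded as an analytic map on $K$, and $\phi^t(p)=p$ since $V(p)=0$. For a square matrix $\mathbf{A}$ with no non-positive real eigenvalues, $\log(\mathbf{A}):=(\mathbf{A}-\mathbf{I})\int_0^1(\mathbf{I}+t(\mathbf{A}-\mathbf{I}))^{-1}dt$; $\widehat{\mathbf{A}}_{m,n,Z}$ is defined when $\widehat{\mathbf{C}}_{m,n,Z}$ has no non-positive real eigenvalues (this holds under the hypotheses of the theorem). Bases and matrices. Fix a numbering $\{\alpha^{(i)}\}_{i\ge1}$ of $\mathbb{Z}_{\ge0}^d$ with $\alpha^{(1)}=0$, $\alpha^{(i+1)}$ the $i$-th elementary vector for $1\le i\le d$, and $|\alpha^{(i)}|\le|\alpha^{(j)}|$ for $i\le j$. Put $r_n^E=\binom{n+d}{d}$,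 $u_{p,i}(z)=\frac{e^{-\|p\|^2/2}}{\sqrt{\alpha^{(i)}!}}(z-p)^{\alpha^{(i)}}e^{p^*z}$ and the row vector $\mathbf{u}_{p,n}(z)=(u_{p,1}(z),\dots,u_{p,r_n^E}(z))$. For $Z=(z^1,\dots,z^N)\in E^N$ let $\mathbf{U}_{p,n,Z}\in\mathbb{C}^{N\times r_n^E}$ be the matrix with rows $\mathbf{u}_{p,n}(z^i)$. With $f=\phi^T$, $Z\in K^N$, $W=(f(z^1),\dots,f(z^N))$ and $m\le n$, $\widehat{\mathbf{C}}_{m,n,Z}\in\mathbb{C}^{r_m^E\times r_m^E}$ consists of the first $r_m^E$ columns of $\mathbf{U}_{p,m,W}^*(\mathbf{U}_{p,n,Z}^* )^\dagger$. Moment matrices. For a Borel measure $\mu$ on $E$ (with the relevant moments finite), $\mathbf{D}_n(\mu)=\big(\int\overline{z^{\alpha^{(i)}}}z^{\alpha^{(j)}}d\mu(z)\big)_{i,j=1}^{r_n^E}$ and $\Lambda_n(\mu)$ is its smallest eigenvalue. Push-forward. For compact $S$, $\mathcal{O}_E(S)$ is the space of germs on $S$ of holomorphic functions (inductive limit of $\mathcal{O}_E(U)$ over open $U\supset S$), and $'$ denotes the continuous dual. For analytic $f:K\to E$, $f_*:\mathcal{O}_E(K)'\to\mathcal{O}_E(E)'$ is $f_*(\nu)(h)=\nu(h\circ f)$. $\overline{\mathbf{FB}}_E(\nu)(\zeta):=\overline{\nu(\mathbf{e}_\zeta)}$ is an injective antilinear map from functionals to entire functions on $E$, and $\widetilde{f_*}:=\overline{\mathbf{FB}}_E\circ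 f_*\circ\overline{\mathbf{FB}}_E^{-1}$. $\widetilde{\mathfrak{D}}_{p,n}=\{P\mathbf{e}_p:P\text{ polynomial on }E,\ \deg P\le n\}$ is the image under $\overline{\mathbf{FB}}_E$ of the span of $h\mapsto(\partial^\alpha h)(p)$, $|\alpha|\le n$; it has basis $(u_{p,i})_{i\le r_n^E}$ and, as $\phi^t(p)=p$, is preserved by $\widetilde{\phi^t_*}$. $\mathbf{C}_n^{(t)}$ is the matrix of $\widetilde{\phi^t_*}|_{\widetilde{\mathfrak{D}}_{p,n}}$ in the basis $(u_{p,i})_{i=1}^{r_n^E}$ (matrix $(C_{ij})$ of $L$ given by $L(b_j)=\sum_iC_{ij}b_i$), and $$B_n:=\sup_{t\in[0,1]}\big\|\big(\mathbf{I}+t(\mathbf{C}_n^{(T)}-\mathbf{I})\big)^{-1}\big\|_{\rm op}.$$ *)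

theory Defs
  imports
    "HOL-Analysis.Analysis"
    "HOL-Probability.Probability"
    "Jordan_Normal_Form.Gauss_Jordan_Elimination"
    "Jordan_Normal_Form.Char_Poly"
    "Jordan_Normal_Form.Schur_Decomposition"
begin

(* The space E = C^d is complex ^ 'd, whose norm is the standard Hermitian one.  Matrices whose
   size depends on a degree are matrices of Jordan_Normal_Form, with indices starting at 0. *)

no_notation vec_index (infixl "$" 100)

section \<open>Geometry of the complex space\<close>

definition absolutely_convex :: "(complex ^ 'd) set \<Rightarrow> bool" where
  "absolutely_convex S \<longleftrightarrow>
     (\<forall>x\<in>S. \<forall>y\<in>S. \<forall>a b. cmod a + cmod b \<le> 1 \<longrightarrow> a *s x + b *s y \<in> S)"

definition gauge_norm :: "(complex ^ 'd) set \<Rightarrow> complex ^ 'd \<Rightarrow> real" where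
  "gauge_norm S z = Inf {t. t > 0 \<and> z \<in> (*\<^sub>R) t ` S}"

definition real_points :: "(complex ^ 'd) set" where
  "real_points = {z. \<forall>k. Im (z $ k) = 0}"

(* star_prod w z is w^* z, and exp_fun w is the function z |-> exp (w^* z). *)
definition star_prod :: "complex ^ 'd \<Rightarrow> complex ^ 'd \<Rightarrow> complex" where
  "star_prod w z = (\<Sum>k\<in>UNIV. cnj (w $ k) * z $ k)"

definition exp_fun :: "complex ^ 'd \<Rightarrow> complex ^ 'd \<Rightarrow> complex" where
  "exp_fun w z = exp (star_prod w z)"


section \<open>Holomorphic functions of several variables\<close>

(* Only used for open U: complex Frechet differentiability at every point. *)
definition hol_on :: "(complex ^ 'd \<Rightarrow> complex) \<Rightarrow> (complex ^ 'd) set \<Rightarrow> bool" where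
  "hol_on h U \<longleftrightarrow>
     (\<forall>z\<in>U. \<exists>h'. (h has_derivative h') (at z) \<and> (\<forall>c v. h' (c *s v) = c * h' v))"

(* As with the library's "analytic_on", an analytic map on S is represented by a total function
   that is holomorphic on some open neighbourhood of S. *)
definition analytic_fun :: "(complex ^ 'd \<Rightarrow> complex) \<Rightarrow> (complex ^ 'd) set \<Rightarrow> bool" where
  "analytic_fun h S \<longleftrightarrow> (\<exists>U. open U \<and> S \<subseteq> U \<and> hol_on h U)"

definition analytic_map :: "(complex ^ 'd \<Rightarrow> complex ^ 'e) \<Rightarrow> (complex ^ 'd) set \<Rightarrow> bool" where
  "analytic_map F S \<longleftrightarrow> (\<exists>U. open U \<and> S \<subseteq> U \<and> (\<forall>k. hol_on (\<lambda>z. F z $ k) U))"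

definition partial_deriv :: "'d \<Rightarrow> (complex ^ 'd \<Rightarrow> complex) \<Rightarrow> complex ^ 'd \<Rightarrow> complex" where
  "partial_deriv k h z = deriv (\<lambda>s. h (z + s *s axis k 1)) 0"

definition complex_jacobian :: "(complex ^ 'd \<Rightarrow> complex ^ 'd) \<Rightarrow> complex ^ 'd \<Rightarrow> complex ^ 'd ^ 'd" where
  "complex_jacobian F z = (\<chi> i j. partial_deriv j (\<lambda>x. F x $ i) z)"


section \<open>The flow\<close>

(* The trajectory has to stay where V is analytic.  This includes every trajectory staying
   in a set S with "analytic_map V S", and it makes trajectories unique. *)
definition ode_solution ::
    "(complex ^ 'd \<Rightarrow> complex ^ 'd) \<Rightarrow> real \<Rightarrow> complex ^ 'd \<Rightarrow> (real \<Rightarrow> complex ^ 'd) \<Rightarrow> bool" where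
  "ode_solution V T w z \<longleftrightarrow> z 0 = w \<and>
     (\<forall>t\<in>{0..T}. analytic_map V {z t} \<and> (z has_vector_derivative V (z t)) (at t within {0..T}))"

definition flow :: "(complex ^ 'd \<Rightarrow> complex ^ 'd) \<Rightarrow> real \<Rightarrow> complex ^ 'd \<Rightarrow> complex ^ 'd" where
  "flow V t w = (THE x. \<exists>z. ode_solution V t w z \<and> z t = x)"


section \<open>Analytic functionals and push-forward\<close>

(* The continuous dual of the space of germs of holomorphic functions on S.  Germs are handled
   through representatives: a functional is defined on all functions that are analytic on S, takes
   the same value on functions that agree near S, and is 0 (a dummy value making functionals
   extensional) on all other functions.  The last clause is continuity for the inductive limit
   topology: a linear functional is continuous iff its restriction to the space of holomorphic
   functions on U, with the topology of uniform convergence on compact sets, is continuous for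
   every open U containing S.  For S = UNIV this is the dual of the space of entire functions. *)
definition germ_dual :: "(complex ^ 'd) set \<Rightarrow> ((complex ^ 'd \<Rightarrow> complex) \<Rightarrow> complex) set" where
  "germ_dual S = {\<nu>.
     (\<forall>h. \<not> analytic_fun h S \<longrightarrow> \<nu> h = 0) \<and>
     (\<forall>g h. analytic_fun g S \<and> analytic_fun h S \<and>
        (\<exists>U. open U \<and> S \<subseteq> U \<and> (\<forall>z\<in>U. g z = h z)) \<longrightarrow> \<nu> g = \<nu> h) \<and>
     (\<forall>g h a b. analytic_fun g S \<and> analytic_fun h S \<longrightarrow>
        \<nu> (\<lambda>z. a * g z + b * h z) = a * \<nu> g + b * \<nu> h) \<and>
     (\<forall>U. open U \<and> S \<subseteq> U \<longrightarrow>
        (\<exists>L c. compact L \<and> L \<noteq> {} \<and> L \<subseteq> U \<and>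
           (\<forall>h. hol_on h U \<longrightarrow> cmod (\<nu> h) \<le> c * (SUP z\<in>L. cmod (h z)))))}"

definition push_forward :: "(complex ^ 'd \<Rightarrow> complex ^ 'd) \<Rightarrow>
    ((complex ^ 'd \<Rightarrow> complex) \<Rightarrow> complex) \<Rightarrow> ((complex ^ 'd \<Rightarrow> complex) \<Rightarrow> complex)" where
  "push_forward f \<nu> = (\<lambda>h. if analytic_fun h UNIV then \<nu> (h \<circ> f) else 0)"

(* The conjugated Fourier-Borel transform. *)
definition FB_conj :: "((complex ^ 'd \<Rightarrow> complex) \<Rightarrow> complex) \<Rightarrow> complex ^ 'd \<Rightarrow> complex" where
  "FB_conj \<nu> w = cnj (\<nu> (exp_fun w))"

definition push_forward_tilde :: "(complex ^ 'd) set \<Rightarrow> (complex ^ 'd \<Rightarrow> complex ^ 'd) \<Rightarrow>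
    (complex ^ 'd \<Rightarrow> complex) \<Rightarrow> (complex ^ 'd \<Rightarrow> complex)" where
  "push_forward_tilde K f = FB_conj \<circ> push_forward f \<circ> inv_into (germ_dual K) FB_conj"


section \<open>Multi-indices and the basis functions\<close>

definition mi_deg :: "('d::finite \<Rightarrow> nat) \<Rightarrow> nat" where
  "mi_deg a = (\<Sum>k\<in>UNIV. a k)"

definition mi_fact :: "('d::finite \<Rightarrow> nat) \<Rightarrow> nat" where
  "mi_fact a = (\<Prod>k\<in>UNIV. fact (a k))"

definition mi_power :: "complex ^ 'd \<Rightarrow> ('d::finite \<Rightarrow> nat) \<Rightarrow> complex" where
  "mi_power z a = (\<Prod>k\<in>UNIV. (z $ k) ^ a k)"

(* Numbering of the multi-indices from 0, so that \<alpha> i is the multi-index number i + 1 of a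
   numbering starting at 1.  The index type 'd has no distinguished order; c lists the
   coordinates as 1st, ..., d-th. *)
definition mi_numbering :: "(nat \<Rightarrow> ('d::finite \<Rightarrow> nat)) \<Rightarrow> bool" where
  "mi_numbering \<alpha> \<longleftrightarrow> bij \<alpha> \<and> \<alpha> 0 = (\<lambda>_. 0) \<and>
     (\<exists>c. bij_betw c {1..CARD('d)} UNIV \<and>
        (\<forall>i\<in>{1..CARD('d)}. \<alpha> i = (\<lambda>k. if k = c i then 1 else 0))) \<and>
     (\<forall>i j. i \<le> j \<longrightarrow> mi_deg (\<alpha> i) \<le> mi_deg (\<alpha> j))"

definition rE :: "'d::finite itself \<Rightarrow> nat \<Rightarrow> nat" where
  "rE _ n = (n + CARD('d)) choose CARD('d)"

definition u_fun :: "(nat \<Rightarrow> ('d::finite \<Rightarrow> nat)) \<Rightarrow> complex ^ 'd \<Rightarrow> nat \<Rightarrow> complex ^ 'd \<Rightarrow> complex" where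
  "u_fun \<alpha> p i z =
     of_real (exp (- (norm p)\<^sup>2 / 2) / sqrt (real (mi_fact (\<alpha> i)))) *
     mi_power (z - p) (\<alpha> i) * exp_fun p z"


section \<open>Matrices\<close>

definition vec_l2 :: "complex Matrix.vec \<Rightarrow> real" where
  "vec_l2 v = sqrt (\<Sum>i<dim_vec v. (cmod (vec_index v i))\<^sup>2)"

definition op_norm :: "complex Matrix.mat \<Rightarrow> real" where
  "op_norm A = (SUP v\<in>{v \<in> carrier_vec (dim_col A). vec_l2 v \<le> 1}. vec_l2 (A *\<^sub>v v))"

(* Only meaningful for invertible A. *)
definition minv :: "complex Matrix.mat \<Rightarrow> complex Matrix.mat" where
  "minv A = the (mat_inverse A)"

(* Moore-Penrose pseudo-inverse, by the four Penrose equations. *)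
definition pinv :: "complex Matrix.mat \<Rightarrow> complex Matrix.mat" where
  "pinv A = (THE X. X \<in> carrier_mat (dim_col A) (dim_row A) \<and>
     A * X * A = A \<and> X * A * X = X \<and>
     mat_adjoint (A * X) = A * X \<and> mat_adjoint (X * A) = X * A)"

definition mat_psd :: "complex Matrix.mat \<Rightarrow> bool" where
  "mat_psd A \<longleftrightarrow> square_mat A \<and> mat_adjoint A = A \<and>
     (\<forall>v\<in>carrier_vec (dim_row A). 0 \<le> Re (scalar_prod (conjugate v) (A *\<^sub>v v)))"

definition mat_sqrt :: "complex Matrix.mat \<Rightarrow> complex Matrix.mat" where
  "mat_sqrt A = (THE S. S \<in> carrier_mat (dim_row A) (dim_row A) \<and> mat_psd S \<and> S * S = A)"

definition segment_inv :: "complex Matrix.mat \<Rightarrow> real \<Rightarrow> complex Matrix.mat" where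
  "segment_inv A t =
     minv (1\<^sub>m (dim_row A) + complex_of_real t \<cdot>\<^sub>m (A - 1\<^sub>m (dim_row A)))"

definition mat_log :: "complex Matrix.mat \<Rightarrow> complex Matrix.mat" where
  "mat_log A = (A - 1\<^sub>m (dim_row A)) *
     Matrix.mat (dim_row A) (dim_row A) (\<lambda>ij. integral {0..1} (\<lambda>t. segment_inv A t $$ ij))"


section \<open>Moment matrices\<close>

definition measure_supp :: "(complex ^ 'd) measure \<Rightarrow> (complex ^ 'd) set" where
  "measure_supp \<mu> = {x. \<forall>U. open U \<and> x \<in> U \<longrightarrow> emeasure \<mu> U > 0}"

definition moment_mat ::
    "(nat \<Rightarrow> ('d::finite \<Rightarrow> nat)) \<Rightarrow> nat \<Rightarrow> (complex ^ 'd) measure \<Rightarrow> complex Matrix.mat" where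
  "moment_mat \<alpha> n \<mu> = Matrix.mat (rE TYPE('d) n) (rE TYPE('d) n)
     (\<lambda>(i, j). integral\<^sup>L \<mu> (\<lambda>z. cnj (mi_power z (\<alpha> i)) * mi_power z (\<alpha> j)))"

(* Moment matrices are Hermitian, so all their eigenvalues are real. *)
definition min_eigenvalue :: "complex Matrix.mat \<Rightarrow> real" where
  "min_eigenvalue A = Min {l. eigenvalue A (complex_of_real l)}"

(* Every index i < N carries mass 1/N, so this is the average of the N Dirac measures at z i. *)
definition empirical_measure :: "nat \<Rightarrow> (nat \<Rightarrow> complex ^ 'd) \<Rightarrow> (complex ^ 'd) measure" where
  "empirical_measure N z = distr (uniform_count_measure {..<N}) borel z"


section \<open>The matrices of the push-forward and their estimators\<close>

(* The matrix, in the basis (u_fun \<alpha> p i) for i < rE n of its span, of the operator induced on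
   this span by f. *)
definition push_forward_mat :: "(nat \<Rightarrow> ('d::finite \<Rightarrow> nat)) \<Rightarrow> complex ^ 'd \<Rightarrow> (complex ^ 'd) set \<Rightarrow>
    (complex ^ 'd \<Rightarrow> complex ^ 'd) \<Rightarrow> nat \<Rightarrow> complex Matrix.mat" where
  "push_forward_mat \<alpha> p K f n =
     (THE C. C \<in> carrier_mat (rE TYPE('d) n) (rE TYPE('d) n) \<and>
        (\<forall>j<rE TYPE('d) n. push_forward_tilde K f (u_fun \<alpha> p j) =
            (\<lambda>z. \<Sum>i<rE TYPE('d) n. C $$ (i, j) * u_fun \<alpha> p i z)))"

definition B_const :: "complex Matrix.mat \<Rightarrow> real" where
  "B_const C = (SUP t\<in>{0..1}. op_norm (segment_inv C t))"

definition U_mat :: "(nat \<Rightarrow> ('d::finite \<Rightarrow> nat)) \<Rightarrow> complex ^ 'd \<Rightarrow> nat \<Rightarrow> nat \<Rightarrow>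
    (nat \<Rightarrow> complex ^ 'd) \<Rightarrow> complex Matrix.mat" where
  "U_mat \<alpha> p n N Z = Matrix.mat N (rE TYPE('d) n) (\<lambda>(k, i). u_fun \<alpha> p i (Z k))"

definition C_hat :: "(nat \<Rightarrow> ('d::finite \<Rightarrow> nat)) \<Rightarrow> complex ^ 'd \<Rightarrow> (complex ^ 'd \<Rightarrow> complex ^ 'd) \<Rightarrow>
    nat \<Rightarrow> nat \<Rightarrow> nat \<Rightarrow> (nat \<Rightarrow> complex ^ 'd) \<Rightarrow> complex Matrix.mat" where
  "C_hat \<alpha> p f m n N Z = Matrix.mat (rE TYPE('d) m) (rE TYPE('d) m)
     (\<lambda>ij. (mat_adjoint (U_mat \<alpha> p m N (f \<circ> Z)) * pinv (mat_adjoint (U_mat \<alpha> p n N Z))) $$ ij)"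

definition A_hat :: "(nat \<Rightarrow> ('d::finite \<Rightarrow> nat)) \<Rightarrow> complex ^ 'd \<Rightarrow> (complex ^ 'd \<Rightarrow> complex ^ 'd) \<Rightarrow>
    real \<Rightarrow> nat \<Rightarrow> nat \<Rightarrow> nat \<Rightarrow> (nat \<Rightarrow> complex ^ 'd) \<Rightarrow> complex Matrix.mat" where
  "A_hat \<alpha> p f T m n N Z = complex_of_real (1 / T) \<cdot>\<^sub>m mat_log (C_hat \<alpha> p f m n N Z)"

(* In each component, the row vector u(z) times A^* times the conjugate transpose of the row
   vector of partial derivatives of u at the origin (not at p). *)
definition V_hat :: "(nat \<Rightarrow> ('d::finite \<Rightarrow> nat)) \<Rightarrow> complex ^ 'd \<Rightarrow> (complex ^ 'd \<Rightarrow> complex ^ 'd) \<Rightarrow>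
    real \<Rightarrow> nat \<Rightarrow> nat \<Rightarrow> nat \<Rightarrow> (nat \<Rightarrow> complex ^ 'd) \<Rightarrow> complex ^ 'd \<Rightarrow> complex ^ 'd" where
  "V_hat \<alpha> p f T m n N Z z = (\<chi> k.
     scalar_prod (Matrix.vec (rE TYPE('d) m) (\<lambda>i. u_fun \<alpha> p i z))
       (mat_adjoint (A_hat \<alpha> p f T m n N Z) *\<^sub>v
        Matrix.vec (rE TYPE('d) m) (\<lambda>i. cnj (partial_deriv k (u_fun \<alpha> p i) 0))))"

end

theory Submission
 imports Defs "HOL-Complex_Analysis.Complex_Analysis"
begin

no_notation fps_nth (infixl "$" 75)

text \<open>Let \<open>nu\<^sub>j\<close> be the functionals dual to the basis \<open>u\<^sub>j\<close> (weighted Taylor coefficients at \<open>p\<close>). Since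
\<open>nu\<^sub>j\<close> of \<open>e\<^sub>w\<close> is the conjugate of \<open>u\<^sub>j w\<close>, the entries of \<open>C(t)\<close> are the conjugates of \<open>nu\<^sub>j\<close> of \<open>u\<^sub>i\<close> composed
with the flow at time \<open>t\<close>. As the flow fixes \<open>p\<close>, passing to jets is multiplicative and \<open>C' = A C\<close>, where \<open>A\<close>
represents the Lie derivative along \<open>V\<close>. The eigenvalues of \<open>A\<close> are sums of eigenvalues of the Jacobian, hence
real, so \<open>C(t)\<close> has no eigenvalue in the nonpositive reals and \<open>log C(T) = T A\<close>. The coordinate functions satisfy
\<open>nu\<^sub>j z\<^sub>k = cnj (\<partial>\<^sub>k u\<^sub>j 0)\<close>, so inserting the exact \<open>A\<close> into the definition of the estimated field yields precisely
the truncated Taylor expansion of \<open>V\<close>; this is the error term \<open>R_K1 ^ m\<close>. The estimated matrix differs from \<open>C(T)\<close>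
by Taylor remainders at the sample points, of size \<open>R_\<mu> ^ n\<close>, multiplied by a pseudo-inverse that is bounded through
the moment matrix, and the resolvent identity for the logarithm costs the factor \<open>B\<^sup>2 / \<gamma>2\<close>.\<close>

section \<open>Holomorphic functions of several variables\<close>

text \<open>The constant in the estimate has to be independent of the degrees, the sample and the
  numbering, so no bound may pay for the dimension of the jet space. Remainders are therefore never
  estimated entry by entry, but for whole combinations of basis functions: \<open>u_bound\<close>
  dominates the sum of all squared basis functions, an exponential series, and so bounds a
  combination by the norm of its coefficient vector. The sample size cancels, because Cauchy-Schwarz
  over the samples costs \<open>sqrt N\<close> while the Gram matrix of the samples grows like
  \<open>N\<close>. Real spectrum enters through the segment from the identity to
  \<open>C T\<close>: in a Schur basis its diagonal entries are
  \<open>1 - s + s * exp (T * b)\<close> with \<open>b\<close> real, hence positive. Orders of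
  vanishing are measured by growth at \<open>p\<close> and not by derivatives, which makes
  truncation compatible with composition and with the Lie derivative without a chain rule for higher
  derivatives. The push-forward is defined through a chosen inverse of the Fourier-Borel transform;
  the choice is immaterial because functionals are determined by their values on
  exponentials.\<close>

definition hol_at :: "(complex ^ 'd => complex) => complex ^ 'd => bool" where
 "hol_at h z \<longleftrightarrow> (\<exists>h'. (h has_derivative h') (at z) \<and> (\<forall>c v. h' (c *s v) = c * h' v))"

definition dd :: "complex ^ 'd => (complex ^ 'd => complex) => complex ^ 'd => complex" where
 "dd v h z = deriv (%s. h (z + s *s v)) 0"

lemma partial_deriv_eq_dd: "partial_deriv k h z = dd (axis k 1) h z"
 by (simp add: partial_deriv_def dd_def)

lemma hol_on_iff_hol_at: "hol_on h U \<longleftrightarrow> (\<forall>z\<in>U. hol_at h z)"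
 by (simp add: hol_on_def hol_at_def)

lemma hol_on_subset: "hol_on h U ==> S \<subseteq> U ==> hol_on h S"
 by (auto simp: hol_on_def)

lemma scaleR_smult_vec: "r *\<^sub>R ((c::complex) *s v) = (r *\<^sub>R c) *s (v :: complex ^ 'd)"
 by (simp add: Finite_Cartesian_Product.vec_eq_iff)

lemma scaleR_eq_smult: "r *\<^sub>R (v :: complex ^ 'd) = complex_of_real r *s v"
 by (simp only: Finite_Cartesian_Product.vec_eq_iff vector_scaleR_component vector_smult_component)
   (simp add: scaleR_conv_of_real)

lemma norm_smult_vec: "norm ((c::complex) *s v) = cmod c * norm (v :: complex ^ 'd)"
proof -
 have "(\<Sum>i\<in>UNIV. (norm (c * v $ i))\<^sup>2) = (cmod c)\<^sup>2 * (\<Sum>i\<in>UNIV. (norm (v $ i))\<^sup>2)"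
  by (simp add: norm_mult power_mult_distrib sum_distrib_left)
 then show ?thesis
  by (simp add: norm_vec_def L2_set_def real_sqrt_mult)
qed

lemma bounded_linear_smult_left: "bounded_linear (%c::complex. c *s (v :: complex ^ 'd))"
 by (rule bounded_linear_intro[where K = "norm v"])
   (auto simp: norm_smult_vec mult.commute vec.scale_left_distrib scaleR_smult_vec)

lemma continuous_on_line [continuous_intros]: "continuous_on S (%s. z + s *s (v :: complex ^ 'd))"
 by (intro continuous_intros bounded_linear.continuous_on[OF bounded_linear_smult_left])

lemma DERIV_line:
 fixes h :: "complex ^ 'd => complex"
 assumes "(h has_derivative h') (at (z + s *s v))" "!!c v. h' (c *s v) = c * h' v"
 shows "((%s. h (z + s *s v)) has_field_derivative h' v) (at s)"
proof -
 have 1: "((%s. z + s *s v) has_derivative (%c. c *s v)) (at s)"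
  using has_derivative_add[OF has_derivative_const[of z] bounded_linear_imp_has_derivative[OF bounded_linear_smult_left[of v]]]
  by simp
 have "((%s. h (z + s *s v)) has_derivative (%c. h' (c *s v))) (at s)"
  by (rule has_derivative_compose[OF 1 assms(1)])
 moreover have "(*) (h' v) = (%c. c * h' v)"
  by (rule ext) simp
 ultimately show ?thesis
  unfolding has_field_derivative_def assms(2) by simp
qed

lemma dd_eq:
 fixes h :: "complex ^ 'd => complex"
 assumes "(h has_derivative h') (at z)" "!!c v. h' (c *s v) = c * h' v"
 shows "dd v h z = h' v"
 unfolding dd_def using DERIV_line[of h h' z 0 v] assms by (auto intro!: DERIV_imp_deriv)

lemma hol_at_has_derivative:
 assumes "hol_at h z"
 shows "(h has_derivative (%v. dd v h z)) (at z)" "dd (c *s v) h z = c * dd v h z"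
  "dd (v + w) h z = dd v h z + dd w h z"
proof -
 obtain h' where h': "(h has_derivative h') (at z)" "!!c v. h' (c *s v) = c * h' v"
  using assms by (auto simp: hol_at_def)
 have eq: "dd v h z = h' v" for v
  by (rule dd_eq[OF h'])
 show "(h has_derivative (%v. dd v h z)) (at z)" "dd (c *s v) h z = c * dd v h z"
  using h' by (auto simp: eq)
 show "dd (v + w) h z = dd v h z + dd w h z"
  unfolding eq using has_derivative_linear[OF h'(1)] by (rule linear_add)
qed

lemma hol_at_DERIV_line:
 assumes "hol_at h (z + s *s v)"
 shows "((%s. h (z + s *s v)) has_field_derivative dd v h (z + s *s v)) (at s)"
 using DERIV_line[OF hol_at_has_derivative(1)[OF assms]] hol_at_has_derivative(2)[OF assms] by auto

lemma hol_at_isCont: "hol_at h z ==> isCont h z"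
 by (auto simp: hol_at_def dest: has_derivative_continuous)

lemma hol_on_continuous_on: "hol_on h U ==> continuous_on U h"
 by (meson continuous_at_imp_continuous_on hol_at_isCont hol_on_iff_hol_at)

lemma hol_on_line:
 assumes "hol_on h U" "!!s. s \<in> S ==> z + s *s v \<in> U"
 shows "(%s. h (z + s *s v)) holomorphic_on S"
 unfolding holomorphic_on_def field_differentiable_def
proof
 fix s assume "s \<in> S"
 then have "hol_at h (z + s *s v)"
  using assms by (auto simp: hol_on_iff_hol_at)
 from hol_at_DERIV_line[OF this]
 show "\<exists>f'. ((%s. h (z + s *s v)) has_field_derivative f') (at s within S)"
  using has_field_derivative_at_within by blast
qed

lemma hol_at_cong:
 assumes "hol_at g z" "open U" "z \<in> U" "!!x. x \<in> U ==> g x = h x"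
 shows "hol_at h z"
 using assms unfolding hol_at_def by (meson has_derivative_transform_within_open)

lemma dd_cong:
 assumes "open U" "z \<in> U" "!!x. x \<in> U ==> g x = h x"
 shows "dd v g z = dd v h z"
 unfolding dd_def
proof (rule deriv_cong_ev)
 have "open ((%s. z + s *s v) -` U)"
  using continuous_on_line[of UNIV z v] assms(1) by (simp add: open_vimage)
 then have "\<forall>\<^sub>F s in nhds 0. s \<in> (%s. z + s *s v) -` U"
  using assms(2) by (intro eventually_nhds_in_open) auto
 then show "\<forall>\<^sub>F s in nhds 0. g (z + s *s v) = h (z + s *s v)"
  by eventually_elim (use assms(3) in auto)
qed simp

lemma hol_at_const: "hol_at (%z. c) z"
 unfolding hol_at_def by (intro exI[of _ "%_. 0"]) auto

lemma hol_at_coord: "hol_at (%z. z $ k) z"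
 unfolding hol_at_def
 by (intro exI[of _ "%v. v $ k"]) (auto intro!: bounded_linear_imp_has_derivative bounded_linear_vec_nth)

lemma dd_const: "dd v (%z. c) z = 0"
 by (simp add: dd_def)

lemma dd_coord: "dd v (%z. z $ k) z = v $ k"
 by (rule dd_eq) (auto intro!: bounded_linear_imp_has_derivative bounded_linear_vec_nth)

context
 fixes g h :: "complex ^ 'd => complex" and z
 assumes g: "hol_at g z" and h: "hol_at h z"
begin

lemma hol_at_add: "hol_at (%z. g z + h z) z" and dd_add: "dd v (%z. g z + h z) z = dd v g z + dd v h z"
 and hol_at_diff: "hol_at (%z. g z - h z) z" and dd_diff: "dd v (%z. g z - h z) z = dd v g z - dd v h z"
 and hol_at_mult: "hol_at (%z. g z * h z) z"
 and dd_mult: "dd v (%z. g z * h z) z = dd v g z * h z + g z * dd v h z"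
proof -
 note gd = hol_at_has_derivative[OF g] and hd = hol_at_has_derivative[OF h]
 have 1: "((%z. g z + h z) has_derivative (%v. dd v g z + dd v h z)) (at z)"
  using gd hd by (auto intro!: derivative_eq_intros)
 have 2: "((%z. g z * h z) has_derivative (%v. dd v g z * h z + g z * dd v h z)) (at z)"
  by (rule has_derivative_eq_rhs[OF has_derivative_mult[OF gd(1) hd(1)]]) (auto simp: algebra_simps)
 have 3: "((%z. g z - h z) has_derivative (%v. dd v g z - dd v h z)) (at z)"
  using gd hd by (auto intro!: derivative_eq_intros)
 show "hol_at (%z. g z + h z) z"
  unfolding hol_at_def by (rule exI, rule conjI[OF 1]) (simp add: gd hd algebra_simps)
 show "hol_at (%z. g z * h z) z"
  unfolding hol_at_def by (rule exI, rule conjI[OF 2]) (simp add: gd hd algebra_simps)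
 show "hol_at (%z. g z - h z) z"
  unfolding hol_at_def by (rule exI, rule conjI[OF 3]) (simp add: gd hd algebra_simps)
 show "dd v (%z. g z + h z) z = dd v g z + dd v h z"
  by (rule dd_eq[OF 1]) (simp add: gd hd algebra_simps)
 show "dd v (%z. g z - h z) z = dd v g z - dd v h z"
  by (rule dd_eq[OF 3]) (simp add: gd hd algebra_simps)
 show "dd v (%z. g z * h z) z = dd v g z * h z + g z * dd v h z"
  by (rule dd_eq[OF 2]) (simp add: gd hd algebra_simps)
qed

end

lemma hol_at_cmult: "hol_at h z ==> hol_at (%z. c * h z) z"
 by (intro hol_at_mult hol_at_const)

lemma dd_cmult: "hol_at h z ==> dd v (%z. c * h z) z = c * dd v h z"
 by (simp add: dd_mult hol_at_const dd_const)

lemma hol_at_sum: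
 assumes "finite I" "!!i. i \<in> I ==> hol_at (h i) z"
 shows "hol_at (%z. \<Sum>i\<in>I. h i z) z \<and> dd v (%z. \<Sum>i\<in>I. h i z) z = (\<Sum>i\<in>I. dd v (h i) z)"
 using assms by (induction I rule: finite_induct) (auto simp: hol_at_add dd_add hol_at_const dd_const)

lemma hol_at_power: "hol_at h z ==> hol_at (%z. h z ^ n) z"
 by (induction n) (auto simp: hol_at_const hol_at_mult)

lemma hol_at_prod:
 assumes "finite I" "!!i. i \<in> I ==> hol_at (h i) z"
 shows "hol_at (%z. \<Prod>i\<in>I. h i z) z"
 using assms by (induction I rule: finite_induct) (auto simp: hol_at_mult hol_at_const)

lemma has_derivative_vec_componentwise:
 assumes "!!k. hol_at (%z. F z $ k) z"
 shows "(F has_derivative (%v. \<chi> k. dd v (%z. F z $ k) z)) (at z)"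
proof -
 have "((%z. \<Sum>k\<in>UNIV. (F z $ k) *s axis k 1) has_derivative
    (%v. \<Sum>k\<in>UNIV. dd v (%z. F z $ k) z *s axis k 1)) (at z)"
  by (intro has_derivative_sum bounded_linear.has_derivative[OF bounded_linear_smult_left]
    hol_at_has_derivative assms)
 then show ?thesis
  using basis_expansion[of "\<chi> k. dd _ (%z. F z $ k) z"] by (simp add: basis_expansion)
qed

lemma hol_at_compose:
 assumes "!!k. hol_at (%z. F z $ k) z" "hol_at h (F z)"
 shows "hol_at (%z. h (F z)) z"
proof -
 have 1: "((%z. h (F z)) has_derivative (%v. dd (\<chi> k. dd v (%z. F z $ k) z) h (F z))) (at z)"
  by (rule has_derivative_compose[OF has_derivative_vec_componentwise hol_at_has_derivative(1)])
    (use assms in auto)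
 have eq: "(\<chi> k. dd (c *s v) (%z. F z $ k) z) = c *s (\<chi> k. dd v (%z. F z $ k) z)" for c v
  by (simp add: Finite_Cartesian_Product.vec_eq_iff hol_at_has_derivative(2)[OF assms(1)])
 show "hol_at (%z. h (F z)) z"
  unfolding hol_at_def
  by (rule exI, rule conjI[OF 1]) (simp add: eq hol_at_has_derivative(2)[OF assms(2)])
qed

lemma dd_eq_sum:
 assumes "hol_at h z"
 shows "dd v h z = (\<Sum>k\<in>UNIV. v $ k * partial_deriv k h z)"
proof -
 obtain h' where h': "(h has_derivative h') (at z)" "!!c v. h' (c *s v) = c * h' v"
  using assms by (auto simp: hol_at_def)
 have "h' v = h' (\<Sum>k\<in>UNIV. (v $ k) *s axis k 1)"
  by (simp add: basis_expansion)
 also have "\<dots> = (\<Sum>k\<in>UNIV. v $ k * h' (axis k 1))"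
  by (subst linear_sum[OF has_derivative_linear[OF h'(1)]]) (simp add: h'(2))
 finally show ?thesis
  by (simp add: partial_deriv_eq_dd dd_eq[OF h'])
qed

lemma hol_at_cexp: "hol_at h z ==> hol_at (%z. exp (h z)) z"
 and dd_cexp: "hol_at h z ==> dd v (%z. exp (h z)) z = exp (h z) * dd v h z"
proof -
 assume h: "hol_at h z"
 note hd = hol_at_has_derivative[OF h]
 have 1: "((%z. exp (h z)) has_derivative (%v. exp (h z) * dd v h z)) (at z)"
  using has_derivative_compose[OF hd(1) DERIV_exp[unfolded has_field_derivative_def]] .
 show "hol_at (%z. exp (h z)) z"
  unfolding hol_at_def using 1 hd(2) by force
 show "dd v (%z. exp (h z)) z = exp (h z) * dd v h z"
  by (rule dd_eq[OF 1]) (simp add: hd)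
qed

lemma hol_at_star_prod: "hol_at (star_prod w) z"
 unfolding star_prod_def[abs_def]
 by (rule conjunct1[OF hol_at_sum]) (auto intro: hol_at_cmult hol_at_coord)

lemma dd_star_prod: "dd v (star_prod w) z = star_prod w v"
 unfolding star_prod_def[abs_def]
 by (subst conjunct2[OF hol_at_sum]) (auto intro: hol_at_cmult hol_at_coord simp: dd_cmult hol_at_coord dd_coord)

lemma hol_at_exp_fun: "hol_at (exp_fun w) z"
 unfolding exp_fun_def[abs_def] by (intro hol_at_cexp hol_at_star_prod)

lemma dd_exp_fun: "dd v (exp_fun w) z = star_prod w v * exp_fun w z"
 unfolding exp_fun_def[abs_def] by (simp add: dd_cexp hol_at_star_prod dd_star_prod)

lemma hol_at_mi_power: "hol_at (%z. mi_power (z - p) a) z"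
 unfolding mi_power_def
 by (intro hol_at_prod hol_at_power) (auto intro!: hol_at_diff hol_at_coord hol_at_const)

subsection \<open>Cauchy estimates and separate holomorphy\<close>

text \<open>Cauchy's inequality on the complex line through \<open>z\<close> in direction
  \<open>v\<close>: in the line parameter the ball of radius \<open>r\<close> contains the disc of
  radius \<open>r / norm v\<close>.\<close>

lemma dd_bound:
 assumes "hol_on h (cball z r)" "r > 0" "!!x. x \<in> cball z r ==> cmod (h x) \<le> M"
 shows "cmod (dd v h z) \<le> M * norm v / r"
proof (cases "v = 0")
 case True
 then show ?thesis
  by (simp add: dd_def)
next
 case False
 define q where "q = r / norm v"
 have q: "q > 0"
  using False assms by (simp add: q_def)
 have mem: "z + s *s v \<in> cball z r" if "s \<in> cball 0 q" for s
  using that False by (simp add: dist_norm norm_smult_vec q_def field_simps)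
 have "cmod ((deriv ^^ 1) (%s. h (z + s *s v)) 0) \<le> fact 1 * M / q ^ 1"
 proof (rule Cauchy_inequality)
  show "(%s. h (z + s *s v)) holomorphic_on ball 0 q"
   using mem by (intro hol_on_line[OF assms(1)]) auto
  show "continuous_on (cball 0 q) (%s. h (z + s *s v))"
   using mem by (intro holomorphic_on_imp_continuous_on hol_on_line[OF assms(1)]) auto
  show "cmod (h (z + x *s v)) \<le> M" if "cmod (0 - x) = q" for x
   using that by (intro assms(3) mem) auto
 qed (use q in auto)
 then show ?thesis
  using False by (simp add: dd_def q_def field_simps)
qed

text \<open>Differentiability is assumed at parameter 0 only, but for every base point in
  \<open>U\<close>; moving the base point along the line turns this into holomorphy in the
  parameter. The hypothesis is this weak because the lemma prepares Osgood's lemma, where complex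
  differentiability is still to be shown.\<close>

lemma line_holomorphic:
 assumes "!!z. z \<in> U ==> (%s. h (z + s *s v)) field_differentiable at 0" "!!s. s \<in> S ==> z + s *s v \<in> U"
 shows "!!s. s \<in> S ==> ((%s. h (z + s *s v)) has_field_derivative dd v h (z + s *s v)) (at s)"
  and "(%s. h (z + s *s v)) holomorphic_on S"
proof -
 show *: "((%s. h (z + s *s v)) has_field_derivative dd v h (z + s *s v)) (at s)" if "s \<in> S" for s
 proof -
  have "((%t. h (z + s *s v + t *s v)) has_field_derivative dd v h (z + s *s v)) (at 0)"
   using assms(1)[OF assms(2)[OF that]] by (simp add: dd_def field_differentiable_derivI)
  then have "((%t. h (z + (t + s) *s v)) has_field_derivative dd v h (z + s *s v)) (at 0)"
   by (simp add: vec.scale_left_distrib algebra_simps)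
  then show ?thesis
   using DERIV_shift[of "%t. h (z + t *s v)" _ 0 s] by simp
 qed
 then show "(%s. h (z + s *s v)) holomorphic_on S"
  unfolding holomorphic_on_def field_differentiable_def
  using has_field_derivative_at_within by blast
qed

text \<open>On a disc of fixed radius in direction \<open>v\<close> the restrictions of
  \<open>h\<close> to parallel lines through nearby points are uniformly close. Cauchy's inequality
  for their difference transfers this to the derivatives at the centre.\<close>

lemma dd_continuous_on_aux:
 fixes h :: "complex ^ 'd => complex"
 assumes U: "open U" and c: "continuous_on U h"
  and d: "!!z. z \<in> U ==> (%s. h (z + s *s v)) field_differentiable at 0"
 shows "continuous_on U (dd v h)"
proof (cases "v = 0")
 case True
 then show ?thesis by (simp add: dd_def[abs_def])
next
 case False
 have "isCont (dd v h) z" if "z \<in> U" for z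
  unfolding continuous_at_eps_delta
 proof (intro allI impI)
  fix e :: real assume e: "e > 0"
  have "\<exists>e>0. cball z e \<subseteq> U"
   using U \<open>z \<in> U\<close> open_contains_cball_eq[OF U] by simp
  then obtain R0 where R0: "R0 > 0" "cball z R0 \<subseteq> U"
   by (elim exE conjE)
  define R where "R = R0 / 2"
  have R: "R > 0" "cball z (2 * R) \<subseteq> U"
   using R0 by (auto simp: R_def)
  \<comment> \<open>For base points within \<open>R\<close> of \<open>z\<close>, discs of radius
    \<open>q\<close> stay within \<open>2 * R\<close>, where \<open>h\<close> is uniformly
    continuous.\<close>
  define q where "q = R / norm v"
  have q: "q > 0"
   using False R by (simp add: q_def)
  have uc: "uniformly_continuous_on (cball z (2 * R)) h"
   by (intro compact_uniformly_continuous continuous_on_subset[OF c]) (use R in auto)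
  obtain \<delta> where \<delta>: "\<delta> > 0" "!!x y. x \<in> cball z (2 * R) ==> y \<in> cball z (2 * R) ==> dist y x < \<delta> ==> dist (h y) (h x) < e * q / 2"
   using uniformly_continuous_onE[OF uc, of "e * q / 2"] e q by auto
  show "\<exists>\<delta>>0. \<forall>x'. dist x' z < \<delta> --> dist (dd v h x') (dd v h z) < e"
  proof (intro exI[of _ "min \<delta> R"] conjI allI impI)
   show "0 < min \<delta> R"
    using \<delta> R by auto
   fix x assume x: "dist x z < min \<delta> R"
   have mem: "y + s *s v \<in> cball z (2 * R)" if "dist y z < R" "s \<in> cball 0 q" for y s
   proof -
    have "norm (s *s v) \<le> R"
     using that False by (simp add: norm_smult_vec q_def field_simps)
    then show ?thesis
     using that norm_triangle_ineq[of "y - z" "s *s v"]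
     by (simp add: dist_norm norm_minus_commute[of z] algebra_simps)
    qed
   have zR: "dist z z < R" "dist x z < R"
    using R x by auto
   let ?g = "%s. h (x + s *s v) - h (z + s *s v)"
   have hx: "(%s. h (y + s *s v)) holomorphic_on cball 0 q" if "dist y z < R" for y
   proof (rule line_holomorphic(2)[where U = U])
    show "(%s. h (z + s *s v)) field_differentiable at 0" if "z \<in> U" for z
     by (rule d[OF that])
    show "y + s *s v \<in> U" if "s \<in> cball 0 q" for s
     using mem[OF \<open>dist y z < R\<close> that] R by (rule_tac subsetD)
   qed
   note hx = hx[OF zR(2)] hx[OF zR(1)]
   have "cmod ((deriv ^^ 1) ?g 0) \<le> fact 1 * (e * q / 2) / q ^ 1"
   proof (rule Cauchy_inequality)
    show "?g holomorphic_on ball 0 q"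
     by (intro holomorphic_intros holomorphic_on_subset[OF hx(1)] holomorphic_on_subset[OF hx(2)]) auto
    show "continuous_on (cball 0 q) ?g"
     by (intro holomorphic_on_imp_continuous_on holomorphic_intros hx)
    show "cmod (h (x + s *s v) - h (z + s *s v)) \<le> e * q / 2" if "cmod (0 - s) = q" for s
     using \<delta>(2)[OF mem[OF zR(1)] mem[OF zR(2)], of s s] that x by (simp add: dist_norm algebra_simps)
   qed (use q in auto)
   also have "(deriv ^^ 1) ?g 0 = dd v h x - dd v h z"
    unfolding dd_def using d zR R x q
    by (auto intro!: deriv_diff simp: subset_iff dist_commute)
   finally show "dist (dd v h x) (dd v h z) < e"
    using q e by (simp add: dist_norm)
  qed
 qed
 then show ?thesis
  by (simp add: continuous_at_imp_continuous_on)
qed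

text \<open>From \<open>z\<close> to \<open>y\<close> one coordinate is changed at a time. On each
  step the mean value inequality compares the increment with the partial derivative at
  \<open>z\<close>, and continuity of the partial derivatives makes the error small.\<close>

theorem osgood:
 fixes h :: "complex ^ 'd => complex"
 assumes U: "open U" and c: "continuous_on U h"
  and d: "!!z k. z \<in> U ==> (%s. h (z + s *s axis k 1)) field_differentiable at 0"
 shows "hol_on h U"
 unfolding hol_on_def
proof
 fix z assume z: "z \<in> U"
 define h' where "h' v = (\<Sum>k\<in>UNIV. v $ k * dd (axis k 1) h z)" for v
 have "bounded_linear h'"
  unfolding h'_def by (intro bounded_linear_sum bounded_linear_mult_const bounded_linear_vec_nth)
 moreover have "\<exists>\<delta>>0. \<forall>y. norm (y - z) < \<delta> --> norm (h y - h z - h' (y - z)) \<le> e * norm (y - z)"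
  if e: "e > 0" for e
 proof -
  \<comment> \<open>There are as many steps as coordinates, and each may contribute this share of
    \<open>e\<close>.\<close>
  define e' where "e' = e / CARD('d)"
  have e': "e' > 0" using e by (simp add: e'_def)
  have "\<forall>\<^sub>F x in nhds z. x \<in> U \<and> (\<forall>k. dist (dd (axis k 1) h x) (dd (axis k 1) h z) < e')"
  proof (intro eventually_conj eventually_all_finite)
   show "\<forall>\<^sub>F x in nhds z. x \<in> U"
    using U z by (rule eventually_nhds_in_open)
   fix k
   have "isCont (dd (axis k 1) h) z"
    using dd_continuous_on_aux[OF U c d] U z by (simp add: continuous_on_eq_continuous_at)
   then show "\<forall>\<^sub>F x in nhds z. dist (dd (axis k 1) h x) (dd (axis k 1) h z) < e'"
    using e' by (simp add: isCont_def tendsto_at_iff_tendsto_nhds tendstoD)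
  qed
  then obtain \<delta> where \<delta>: "\<delta> > 0" "!!x. dist x z < \<delta> ==> x \<in> U"
   "!!x k. dist x z < \<delta> ==> dist (dd (axis k 1) h x) (dd (axis k 1) h z) < e'"
   unfolding eventually_nhds_metric by blast
  show ?thesis
  proof (intro exI conjI allI impI)
   show "\<delta> > 0" by fact
   fix y assume y: "norm (y - z) < \<delta>"
   define w where "w = y - z"
   \<comment> \<open>In \<open>pt S\<close> the coordinates in \<open>S\<close> have already moved
     from \<open>z\<close> to \<open>y\<close>; every point on the way stays within
     \<open>norm w\<close> of \<open>z\<close>.\<close>
   define pt where "pt S = (\<chi> k. if k \<in> S then y $ k else z $ k)" for S
   have claim: "cmod (h (pt S) - h z - (\<Sum>k\<in>S. w $ k * dd (axis k 1) h z)) \<le> card S * e' * norm w"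
    if "finite S" for S
    using that
   proof (induction S rule: finite_induct)
    case empty
    have "pt {} = z" by (simp add: pt_def Finite_Cartesian_Product.vec_eq_iff)
    then show ?case by simp
   next
    case (insert k S)
    have pt: "pt (insert k S) = pt S + w $ k *s axis k 1"
     using insert by (auto simp: pt_def Finite_Cartesian_Product.vec_eq_iff w_def axis_def)
    have near: "dist (pt S + s *s axis k 1) z < \<delta>" if s: "s \<in> closed_segment 0 (w $ k)" for s
    proof -
     have "cmod s \<le> cmod (w $ k)"
      using segment_bound(1)[OF s] by simp
     then have "norm (pt S + s *s axis k 1 - z) \<le> norm w"
      using insert by (intro norm_le_componentwise_cart) (auto simp: pt_def w_def axis_def)
     then show ?thesis
      using y by (simp add: dist_norm w_def)
    qed
    let ?g = "%s. h (pt S + s *s axis k 1) - s * dd (axis k 1) h z"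
    have "cmod (?g (w $ k) - ?g 0) \<le> e' * cmod (w $ k - 0)"
    proof (rule field_differentiable_bound)
     show "convex (closed_segment 0 (w $ k))" by simp
     fix s assume s: "s \<in> closed_segment 0 (w $ k)"
     have "((%s. h (pt S + s *s axis k 1)) has_field_derivative dd (axis k 1) h (pt S + s *s axis k 1)) (at s)"
      by (rule line_holomorphic[OF d, of _ "closed_segment 0 (w $ k)"]) (use near \<delta>(2) s in auto)
     then have "(?g has_field_derivative dd (axis k 1) h (pt S + s *s axis k 1) - 1 * dd (axis k 1) h z) (at s)"
      by (intro DERIV_diff DERIV_cmult_right DERIV_ident)
     then show "(?g has_field_derivative dd (axis k 1) h (pt S + s *s axis k 1) - dd (axis k 1) h z)
       (at s within closed_segment 0 (w $ k))"
      by (simp add: has_field_derivative_at_within)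
     show "cmod (dd (axis k 1) h (pt S + s *s axis k 1) - dd (axis k 1) h z) \<le> e'"
      using \<delta>(3)[OF near[OF s], of k] by (simp add: dist_norm)
    qed auto
    also have "\<dots> \<le> e' * norm w"
     using e' by (simp add: Finite_Cartesian_Product.norm_nth_le)
    finally have "cmod (h (pt (insert k S)) - h (pt S) - w $ k * dd (axis k 1) h z) \<le> e' * norm w"
     by (simp add: pt algebra_simps)
    moreover have "h (pt (insert k S)) - h z - (\<Sum>k\<in>insert k S. w $ k * dd (axis k 1) h z)
      = (h (pt S) - h z - (\<Sum>k\<in>S. w $ k * dd (axis k 1) h z))
       + (h (pt (insert k S)) - h (pt S) - w $ k * dd (axis k 1) h z)"
     using insert by simp
    ultimately have "cmod (h (pt (insert k S)) - h z - (\<Sum>k\<in>insert k S. w $ k * dd (axis k 1) h z))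
      \<le> card S * e' * norm w + e' * norm w"
     using norm_triangle_mono[OF insert.IH] by presburger
    then show ?case
     using insert by (simp add: algebra_simps)
   qed
   have "pt UNIV = y" by (simp add: pt_def Finite_Cartesian_Product.vec_eq_iff)
   then show "norm (h y - h z - h' (y - z)) \<le> e * norm (y - z)"
    using claim[of UNIV] by (simp add: h'_def w_def e'_def)
  qed
 qed
 ultimately have "(h has_derivative h') (at z)"
  unfolding has_derivative_at_alt by blast
 moreover have "h' (c *s v) = c * h' v" for c v
  by (simp add: h'_def sum_distrib_left mult_ac)
 ultimately show "\<exists>h'. (h has_derivative h') (at z) \<and> (\<forall>c v. h' (c *s v) = c * h' v)"
  by blast
qed

section \<open>Mean value estimates, locally uniform limits and second derivatives\<close>

lemma line_mean:
 assumes "!!s. s \<in> closed_segment 0 t ==> hol_at h (z + s *s v)"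
  "!!s. s \<in> closed_segment 0 t ==> cmod (dd v h (z + s *s v) - D) \<le> e"
 shows "cmod (h (z + t *s v) - h z - t * D) \<le> e * cmod t"
proof -
 let ?g = "%s. h (z + s *s v) - s * D"
 have "cmod (?g t - ?g 0) \<le> e * cmod (t - 0)"
 proof (rule field_differentiable_bound)
  show "convex (closed_segment 0 t)" by simp
  fix s assume s: "s \<in> closed_segment 0 t"
  have "(?g has_field_derivative dd v h (z + s *s v) - 1 * D) (at s)"
   by (intro DERIV_diff DERIV_cmult_right DERIV_ident hol_at_DERIV_line assms s)
  then show "(?g has_field_derivative dd v h (z + s *s v) - D) (at s within closed_segment 0 t)"
   by (simp add: has_field_derivative_at_within)
  show "cmod (dd v h (z + s *s v) - D) \<le> e"
   by (rule assms(2)[OF s])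
 qed auto
 then show ?thesis by (simp add: algebra_simps)
qed

text \<open>Holomorphy on the ball of twice the radius leaves room for a ball of radius
  \<open>r\<close> around each point of the segment from \<open>b\<close> to \<open>a\<close>, so
  \<open>dd_bound\<close> applies all along it.\<close>

lemma hol_lipschitz:
 assumes "hol_on h (cball x0 (2 * r))" "r > 0" "!!x. x \<in> cball x0 (2 * r) ==> cmod (h x) \<le> M"
  and ab: "a \<in> cball x0 r" "b \<in> cball x0 r"
 shows "cmod (h a - h b) \<le> M / r * norm (a - b)"
proof -
 define v where "v = a - b"
 have near: "cball (b + s *s v) r \<subseteq> cball x0 (2 * r)" and mem: "b + s *s v \<in> cball x0 (2 * r)"
  if s: "s \<in> closed_segment 0 1" for s
 proof -
  obtain u where u: "s = complex_of_real u" "0 \<le> u" "u \<le> 1"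
   using s unfolding closed_segment_def by (auto simp: scaleR_conv_of_real)
  have "b + s *s v = (1 - u) *\<^sub>R b + u *\<^sub>R a"
   unfolding u(1) v_def by (simp flip: scaleR_eq_smult add: algebra_simps)
  also have "\<dots> \<in> cball x0 r"
   using convex_cball[of x0 r] ab u unfolding convex_alt by blast
  finally have *: "dist x0 (b + s *s v) \<le> r" by simp
  show "cball (b + s *s v) r \<subseteq> cball x0 (2 * r)"
  proof
   fix y assume "y \<in> cball (b + s *s v) r"
   then show "y \<in> cball x0 (2 * r)"
    using * dist_triangle[of x0 y "b + s *s v"] by simp
  qed
  show "b + s *s v \<in> cball x0 (2 * r)"
   using * assms(2) by simp
 qed
 have "cmod (h (b + 1 *s v) - h b - 1 * 0) \<le> (M * norm v / r) * cmod 1"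
 proof (rule line_mean)
  fix s :: complex assume s: "s \<in> closed_segment 0 1"
  show "hol_at h (b + s *s v)"
   using assms(1) mem[OF s] by (auto simp: hol_on_iff_hol_at)
  have "cmod (dd v h (b + s *s v)) \<le> M * norm v / r"
   by (rule dd_bound[OF hol_on_subset[OF assms(1) near[OF s]]]) (use near[OF s] assms in auto)
  then show "cmod (dd v h (b + s *s v) - 0) \<le> M * norm v / r" by simp
 qed
 then show ?thesis by (simp add: v_def)
qed

text \<open>On each complex line the one-variable theorem of Weierstrass gives holomorphy of the
  limit and convergence of the derivatives. Continuity of the limit and Osgood's lemma lead back to
  several variables.\<close>

theorem hol_on_uniform_limit:
 fixes f :: "'i => complex ^ 'd => complex"
 assumes U: "open U" and ev: "\<forall>\<^sub>F n in F. hol_on (f n) U" and F: "F \<noteq> bot"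
  and ul: "!!z. z \<in> U ==> \<exists>e>0. ball z e \<subseteq> U \<and> uniform_limit (ball z e) f h F"
 shows "hol_on h U" and "!!z v. z \<in> U ==> ((%n. dd v (f n) z) \<longlongrightarrow> dd v h z) F"
proof -
 have line: "\<exists>g'. ((%s. h (z + s *s v)) has_field_derivative g') (at 0) \<and> ((%n. dd v (f n) z) \<longlongrightarrow> g') F"
  if z: "z \<in> U" for z v
 proof -
  obtain e where e: "e > 0" "ball z e \<subseteq> U" "uniform_limit (ball z e) f h F"
   using ul[OF z] by blast
  define q where "q = e / (2 * (norm v + 1))"
  have nv: "norm v + 1 > 0" by (simp add: add_nonneg_pos)
  have q: "q > 0" using e nv by (simp add: q_def)
  have mem: "z + s *s v \<in> ball z e" if "s \<in> cball 0 q" for s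
  proof -
   have "cmod s * norm v \<le> q * (norm v + 1)"
    using that q by (intro mult_mono) auto
   also have "\<dots> = e / 2" using nv by (simp add: q_def field_simps)
   finally show ?thesis using e by (simp add: dist_norm norm_smult_vec)
  qed
  obtain g' where g': "!!w. w \<in> ball 0 q ==> ((%s. h (z + s *s v)) has_field_derivative g' w) (at w) \<and>
    ((%n. dd v (f n) (z + w *s v)) \<longlongrightarrow> g' w) F"
  proof (rule has_complex_derivative_uniform_limit[of 0 q "%n s. f n (z + s *s v)" "%n s. dd v (f n) (z + s *s v)" F "%s. h (z + s *s v)"])
   show "\<forall>\<^sub>F n in F. continuous_on (cball 0 q) (%s. f n (z + s *s v)) \<and>
    (\<forall>w\<in>ball 0 q. ((%s. f n (z + s *s v)) has_field_derivative dd v (f n) (z + w *s v)) (at w))"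
    using ev
   proof eventually_elim
    case (elim n)
    have "(%s. f n (z + s *s v)) holomorphic_on cball 0 q"
     by (rule hol_on_line[OF elim]) (use mem e in blast)
    moreover have "hol_at (f n) (z + w *s v)" if "w \<in> ball 0 q" for w
    proof -
     have "z + w *s v \<in> U" using mem[of w] that e(2) by auto
     then show ?thesis using elim by (simp add: hol_on_iff_hol_at)
    qed
    ultimately show ?case
     using hol_at_DERIV_line holomorphic_on_imp_continuous_on by blast
   qed
   show "uniform_limit (cball 0 q) (%n s. f n (z + s *s v)) (%s. h (z + s *s v)) F"
    unfolding uniform_limit_iff
   proof (intro allI impI)
    fix \<epsilon> :: real assume "\<epsilon> > 0"
    with e(3) have "\<forall>\<^sub>F n in F. \<forall>x\<in>ball z e. dist (f n x) (h x) < \<epsilon>"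
     by (simp add: uniform_limit_iff)
    then show "\<forall>\<^sub>F n in F. \<forall>s\<in>cball 0 q. dist (f n (z + s *s v)) (h (z + s *s v)) < \<epsilon>"
     by eventually_elim (use mem in blast)
   qed
  qed (use F q in auto)
  show ?thesis
   using g'[of 0] q by (intro exI[of _ "g' 0"]) simp
 qed
 have "continuous_on U h"
  unfolding continuous_on_eq_continuous_at[OF U]
 proof
  fix z assume "z \<in> U"
  then obtain e where e: "e > 0" "ball z e \<subseteq> U" "uniform_limit (ball z e) f h F"
   using ul by blast
  have "continuous_on (ball z e) h"
  proof (rule uniform_limit_theorem[OF _ e(3) F])
   show "\<forall>\<^sub>F n in F. continuous_on (ball z e) (f n)"
    using ev by eventually_elim (rule hol_on_continuous_on[OF hol_on_subset[OF _ e(2)]])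
  qed
  then show "isCont h z"
   using e(1) continuous_on_interior[of "ball z e" h z] by simp
 qed
 then show "hol_on h U"
  by (rule osgood[OF U]) (use line field_differentiable_def in blast)
 show "((%n. dd v (f n) z) \<longlongrightarrow> dd v h z) F" if "z \<in> U" for z v
  using line[OF that, of v] unfolding dd_def by (auto dest!: DERIV_imp_deriv)
qed

lemma hol_at_translate: "hol_at h (z + c) ==> hol_at (%z. h (z + c)) z"
proof -
 have "hol_at (%z. (z + c) $ k) z" for k
  by (simp add: hol_at_add hol_at_coord hol_at_const)
 then show "hol_at h (z + c) ==> hol_at (%z. h (z + c)) z"
  by (rule hol_at_compose)
qed

lemma dd_translate: "dd v (%z. h (z + c)) z = dd v h (z + c)"
 by (simp add: dd_def algebra_simps)

text \<open>The difference quotients of \<open>h\<close> in direction \<open>v\<close> are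
  holomorphic and converge locally uniformly to \<open>dd v h\<close>, so the limit is holomorphic.
  Convergence of their derivatives in direction \<open>w\<close> gives the symmetry of second
  derivatives.\<close>

theorem
 fixes h :: "complex ^ 'd => complex"
 assumes U: "open U" and h: "hol_on h U"
 shows hol_on_dd: "hol_on (dd v h) U"
  and dd_commute: "z \<in> U ==> dd w (dd v h) z = dd v (dd w h) z"
proof -
 \<comment> \<open>The symmetry presupposes that \<open>dd w h\<close> is complex differentiable,
   which is itself an instance of the claim with \<open>w\<close> for \<open>v\<close>. The
   disjunction lets one argument deliver differentiability unconditionally and the symmetry as soon
   as that is known.\<close>
 have main: "hol_at (dd v h) z0 \<and> dd w (dd v h) z0 = dd v (dd w h) z0 \<or> \<not> hol_at (dd w h) z0 \<and> hol_at (dd v h) z0"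
  if z0: "z0 \<in> U" for z0 v w
 proof -
  have "\<exists>R>0. cball z0 R \<subseteq> U"
   using open_contains_cball_eq[OF U] z0 by simp
  then obtain R0 where R0: "R0 > 0" "cball z0 R0 \<subseteq> U" by (elim exE conjE)
  define R where "R = R0 / 2"
  have R: "R > 0" "cball z0 (2 * R) \<subseteq> U" using R0 by (auto simp: R_def)
  define f where "f t z = (h (z + t *s v) - h z) / t" for t z
  have cdd: "continuous_on U (dd v h)"
  proof (rule dd_continuous_on_aux[OF U hol_on_continuous_on[OF h]])
   fix z assume "z \<in> U"
   then have "hol_at h (z + 0 *s v)" using h by (simp add: hol_on_iff_hol_at)
   from hol_at_DERIV_line[OF this] show "(%s. h (z + s *s v)) field_differentiable at 0"
    unfolding field_differentiable_def by blast
  qed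
  have mem: "z + s *s v \<in> cball z0 (2 * R)" if "z \<in> ball z0 R" "cmod s * norm v < R" for z s
  proof -
   have "dist z0 (z + s *s v) \<le> dist z0 z + dist z (z + s *s v)"
    by (rule dist_triangle)
   then show ?thesis using that by (simp add: dist_norm norm_smult_vec)
  qed
  have ev: "\<forall>\<^sub>F t in at 0. cmod t * norm v < \<delta>" if "\<delta> > 0" for \<delta>
  proof -
   have "((%t. cmod t * norm v) \<longlongrightarrow> cmod 0 * norm v) (at 0)"
    by (intro tendsto_intros)
   then show ?thesis using that by (simp add: order_tendstoD(2))
  qed
  have W1: "\<forall>\<^sub>F t in at 0. hol_on (f t) (ball z0 R)"
   using ev[OF R(1)]
  proof eventually_elim
   case (elim t)
   show ?case
    unfolding hol_on_iff_hol_at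
   proof
    fix z assume z: "z \<in> ball z0 R"
    have "hol_at h (z + t *s v)" "hol_at h (z + 0 *s v)"
     using mem[OF z elim] mem[OF z, of 0] R h by (auto simp: hol_on_iff_hol_at)
    then have "hol_at (%z. inverse t * (h (z + t *s v) - h z)) z"
     by (intro hol_at_cmult hol_at_diff hol_at_translate) auto
    then show "hol_at (f t) z"
     by (simp add: f_def[abs_def] field_simps)
   qed
  qed
  have W2: "uniform_limit (ball z0 R) f (dd v h) (at 0)"
   unfolding uniform_limit_iff
  proof (intro allI impI)
   fix \<epsilon> :: real assume \<epsilon>: "\<epsilon> > 0"
   have uc: "uniformly_continuous_on (cball z0 (2 * R)) (dd v h)"
    by (intro compact_uniformly_continuous continuous_on_subset[OF cdd]) (use R in auto)
   obtain \<delta> where \<delta>: "\<delta> > 0" "!!x y. x \<in> cball z0 (2 * R) ==> y \<in> cball z0 (2 * R) ==> dist y x < \<delta> ==> dist (dd v h y) (dd v h x) < \<epsilon> / 2"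
    using uniformly_continuous_onE[OF uc, of "\<epsilon> / 2"] \<epsilon> by auto
   have "\<forall>\<^sub>F t in at 0. cmod t * norm v < min \<delta> R \<and> t \<noteq> 0"
    by (intro eventually_conj ev eventually_neq_at_within) (use \<delta> R in auto)
   then show "\<forall>\<^sub>F t in at 0. \<forall>z\<in>ball z0 R. dist (f t z) (dd v h z) < \<epsilon>"
   proof eventually_elim
    case (elim t)
    show ?case
    proof
     fix z assume z: "z \<in> ball z0 R"
     have small: "cmod s * norm v < min \<delta> R" if "s \<in> closed_segment 0 t" for s
     proof -
      have "cmod s \<le> cmod t" using segment_bound(1)[OF that] by simp
      then have "cmod s * norm v \<le> cmod t * norm v" by (simp add: mult_right_mono)
      then show ?thesis using elim by linarith
     qed
     have "cmod (h (z + t *s v) - h z - t * dd v h z) \<le> \<epsilon> / 2 * cmod t"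
     proof (rule line_mean)
      fix s assume s: "s \<in> closed_segment 0 t"
      have m: "z + s *s v \<in> cball z0 (2 * R)"
       by (rule mem[OF z]) (use small[OF s] in auto)
      then show "hol_at h (z + s *s v)"
       using R h by (auto simp: hol_on_iff_hol_at)
      have "dist (dd v h (z + s *s v)) (dd v h z) < \<epsilon> / 2"
       by (rule \<delta>(2)[OF _ m]) (use z R small[OF s] in \<open>auto simp: dist_norm norm_smult_vec\<close>)
      then show "cmod (dd v h (z + s *s v) - dd v h z) \<le> \<epsilon> / 2"
       by (simp add: dist_norm)
     qed
     moreover have "f t z - dd v h z = (h (z + t *s v) - h z - t * dd v h z) / t"
      using elim by (simp add: f_def field_simps)
     ultimately have "cmod (f t z - dd v h z) \<le> \<epsilon> / 2"
      using elim by (simp add: norm_divide divide_le_eq)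
     then show "dist (f t z) (dd v h z) < \<epsilon>"
      using \<epsilon> by (simp add: dist_norm)
    qed
   qed
  qed
  have W3: "\<exists>e>0. ball z e \<subseteq> ball z0 R \<and> uniform_limit (ball z e) f (dd v h) (at 0)" if "z \<in> ball z0 R" for z
  proof -
   have "\<exists>e>0. ball z e \<subseteq> ball z0 R"
    using open_ball[of z0 R] that unfolding open_contains_ball by blast
   then show ?thesis
    using uniform_limit_on_subset[OF W2] by blast
  qed
  note W = hol_on_uniform_limit[OF open_ball W1 at_neq_bot W3]
  have a: "hol_at (dd v h) z0"
   using W(1) R by (simp add: hol_on_iff_hol_at)
  show ?thesis
  proof (cases "hol_at (dd w h) z0")
   case True
   have l1: "((%t. dd w (f t) z0) \<longlongrightarrow> dd w (dd v h) z0) (at 0)"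
    by (rule W(2)) (use R in auto)
   have "((%s. dd w h (z0 + s *s v)) has_field_derivative dd v (dd w h) z0) (at 0)"
    using hol_at_DERIV_line[of "dd w h" z0 0 v] True by simp
   then have l2: "((%t. (dd w h (z0 + t *s v) - dd w h z0) / t) \<longlongrightarrow> dd v (dd w h) z0) (at 0)"
    by (simp add: DERIV_def)
   have "\<forall>\<^sub>F t in at 0. (dd w h (z0 + t *s v) - dd w h z0) / t = dd w (f t) z0"
    using ev[OF R(1)]
   proof eventually_elim
    case (elim t)
    have zz: "z0 \<in> ball z0 R" using R by simp
    have hh: "hol_at h (z0 + t *s v)" "hol_at h z0"
     using mem[OF zz elim] z0 R h by (auto simp: hol_on_iff_hol_at)
    have "dd w (%z. inverse t * (h (z + t *s v) - h z)) z0 = inverse t * (dd w h (z0 + t *s v) - dd w h z0)"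
     using hh by (simp add: dd_cmult dd_diff dd_translate hol_at_translate hol_at_diff)
    then show ?case
     by (simp add: f_def[abs_def] field_simps)
   qed
   then have "((%t. dd w (f t) z0) \<longlongrightarrow> dd v (dd w h) z0) (at 0)"
    using tendsto_cong l2 by fastforce
   then show ?thesis
    using a tendsto_unique[OF at_neq_bot l1] by blast
  qed (use a in blast)
 qed
 have hol: "hol_at (dd v h) z" if "z \<in> U" for v z
  using main[OF that, of v v] by blast
 then show "hol_on (dd v h) U"
  by (simp add: hol_on_iff_hol_at)
 show "dd w (dd v h) z = dd v (dd w h) z" if "z \<in> U"
  using main[OF that, of v w] hol[OF that] by blast
qed

lemma hol_on_partial_deriv: "open U ==> hol_on h U ==> hol_on (partial_deriv k h) U"
 using hol_on_dd[of U h "axis k 1"] by (simp add: partial_deriv_eq_dd[abs_def])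

subsection \<open>Taylor coefficients\<close>

text \<open>For \<open>mi_deg a = k\<close> this is the coefficient of \<open>(z - p)\<^sup>a\<close> in the expansion at \<open>p\<close>. Averaging the recursion over all
coordinates avoids choosing an order of differentiation.\<close>

primrec tc :: "complex ^ 'd => nat => (complex ^ 'd => complex) => ('d => nat) => complex" where
 "tc p 0 h a = (if a = (%_. 0) then h p else 0)"
| "tc p (Suc k) h a = (\<Sum>i\<in>UNIV. if a i > 0 then tc p k (partial_deriv i h) (a(i := a i - 1)) else 0) / of_nat (Suc k)"

lemma partial_deriv_cong:
 assumes "open U" "z \<in> U" "!!x. x \<in> U ==> g x = h x"
 shows "partial_deriv i g z = partial_deriv i h z"
 using dd_cong[OF assms] by (simp add: partial_deriv_eq_dd)

lemma tc_cong:
 assumes "open U" "p \<in> U" "!!x. x \<in> U ==> g x = h x"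
 shows "tc p k g a = tc p k h a"
 using assms(3)
proof (induction k arbitrary: g h a)
 case 0
 then show ?case using assms by simp
next
 case (Suc k)
 have "tc p k (partial_deriv i g) b = tc p k (partial_deriv i h) b" for i b
  by (rule Suc.IH) (rule partial_deriv_cong[OF assms(1) _ Suc.prems])
 then show ?case unfolding tc.simps by presburger
qed

lemma tc_lin:
 assumes "open U" "p \<in> U" "hol_on g U" "hol_on h U"
 shows "tc p k (%z. c * g z + d * h z) a = c * tc p k g a + d * tc p k h a"
 using assms(3,4)
proof (induction k arbitrary: g h a)
 case (Suc k)
 have "tc p k (partial_deriv i (%z. c * g z + d * h z)) b
   = c * tc p k (partial_deriv i g) b + d * tc p k (partial_deriv i h) b" for i b
 proof -
  have "tc p k (partial_deriv i (%z. c * g z + d * h z)) b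
    = tc p k (%z. c * partial_deriv i g z + d * partial_deriv i h z) b"
  proof (rule tc_cong[OF assms(1,2)])
   fix x assume "x \<in> U"
   then have "hol_at g x" "hol_at h x" using Suc.prems by (auto simp: hol_on_iff_hol_at)
   then show "partial_deriv i (%z. c * g z + d * h z) x = c * partial_deriv i g x + d * partial_deriv i h x"
    by (simp add: partial_deriv_eq_dd dd_add dd_cmult hol_at_cmult)
  qed
  then show ?thesis
   using Suc.IH[of "partial_deriv i g" "partial_deriv i h" b] Suc.prems hol_on_partial_deriv[OF assms(1)] by simp
 qed
 then have "(if P then tc p k (partial_deriv i (%z. c * g z + d * h z)) b else 0)
   = c * (if P then tc p k (partial_deriv i g) b else 0) + d * (if P then tc p k (partial_deriv i h) b else 0)" for P i b
  by simp
 then have "(\<Sum>i\<in>UNIV. if a i > 0 then tc p k (partial_deriv i (%z. c * g z + d * h z)) (a(i := a i - 1)) else 0)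
   = c * (\<Sum>i\<in>UNIV. if a i > 0 then tc p k (partial_deriv i g) (a(i := a i - 1)) else 0)
    + d * (\<Sum>i\<in>UNIV. if a i > 0 then tc p k (partial_deriv i h) (a(i := a i - 1)) else 0)"
  unfolding sum_distrib_left sum.distrib[symmetric] by (intro sum.cong refl)
 then show ?case
  unfolding tc.simps(2) by (simp only: add_divide_distrib times_divide_eq_right)
qed simp

lemma norm_axis_complex: "norm (axis i (1::complex) :: complex ^ 'd) = 1"
proof -
 have "(\<Sum>j\<in>UNIV. (norm ((axis i 1 :: complex ^ 'd) $ j))\<^sup>2) = (\<Sum>j\<in>UNIV. if j = i then 1 else 0)"
  by (rule sum.cong) (auto simp: axis_def)
 then show ?thesis unfolding norm_vec_def L2_set_def by simp
qed

text \<open>The constant depends on \<open>p\<close>, \<open>k\<close> and \<open>a\<close> only.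
  Linearity in \<open>M\<close> and the exact power of \<open>r\<close> are what later turns growth
  conditions at \<open>p\<close> into vanishing of coefficients.\<close>

lemma tc_bound: "\<exists>c\<ge>0. \<forall>h r M. r > 0 --> hol_on h (ball p r) --> (\<forall>x\<in>ball p r. cmod (h x) \<le> M) -->
  cmod (tc p k h a) \<le> c * M / r ^ k" for p :: "complex ^ 'd"
proof (induction k arbitrary: a)
 case 0
 show ?case
 proof (intro exI[of _ 1] conjI allI impI)
  fix h r M assume *: "r > (0::real)" "hol_on h (ball p r)" "\<forall>x\<in>ball p r. cmod (h x) \<le> M"
  then have "cmod (h p) \<le> M" by simp
  moreover have "0 \<le> M" using calculation norm_ge_zero[of "h p"] by linarith
  ultimately show "cmod (tc p 0 h a) \<le> 1 * M / r ^ 0" by simp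
 qed simp
next
 case (Suc k)
 then have "\<forall>b. \<exists>c\<ge>0. \<forall>h r M. r > 0 --> hol_on h (ball p r) --> (\<forall>x\<in>ball p r. cmod (h x) \<le> M) -->
   cmod (tc p k h b) \<le> c * M / r ^ k" by blast
 then obtain c where c: "!!b. c b \<ge> 0" "!!b h r M. r > 0 ==> hol_on h (ball p r) ==> (!!x. x\<in>ball p r ==> cmod (h x) \<le> M) ==>
   cmod (tc p k h b) \<le> c b * M / r ^ k" by metis
 \<comment> \<open>Balls of radius \<open>r/3\<close> around points of \<open>ball p (r/2)\<close>
   stay in \<open>ball p r\<close>, which gives the factor 3; the induction hypothesis is used at
   radius \<open>r/2\<close>, which gives \<open>2 ^ k\<close>.\<close>
 define C where "C = (\<Sum>i\<in>UNIV. c (a(i := a i - 1))) * (3 * 2 ^ k)"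
 show ?case
 proof (intro exI[of _ C] conjI allI impI)
  show "C \<ge> 0" unfolding C_def using c(1) by (simp add: sum_nonneg)
  fix h r M assume *: "r > (0::real)" "hol_on h (ball p r)" "\<forall>x\<in>ball p r. cmod (h x) \<le> M"
  then have "cmod (h p) \<le> M" by simp
  then have M: "0 \<le> M" using norm_ge_zero[of "h p"] by linarith
  have b: "cmod (partial_deriv i h x) \<le> 3 * M / r" if "x \<in> ball p (r/2)" for x i
  proof -
   have sub: "cball x (r/3) \<subseteq> ball p r"
   proof
    fix y assume "y \<in> cball x (r/3)"
    then show "y \<in> ball p r"
     using that dist_triangle[of p y x] *(1) by simp
   qed
   have "cmod (dd (axis i 1) h x) \<le> M * norm (axis i 1 :: complex ^ 'd) / (r/3)"
    by (rule dd_bound) (use hol_on_subset[OF *(2) sub] sub * in auto)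
   then show ?thesis
    by (simp add: partial_deriv_eq_dd norm_axis_complex mult.commute)
  qed
  have t: "cmod (tc p k (partial_deriv i h) b) \<le> c b * (3 * 2 ^ k * M / r ^ Suc k)" for i b
  proof -
   have "hol_on (partial_deriv i h) (ball p (r/2))"
    by (rule hol_on_subset[OF hol_on_partial_deriv[OF open_ball *(2)]]) (use * in auto)
   from c(2)[OF _ this b] have "cmod (tc p k (partial_deriv i h) b) \<le> c b * (3 * M / r) / (r/2) ^ k"
    using * by auto
   then show ?thesis using *(1) by (simp add: power_divide field_simps)
  qed
  have "cmod (\<Sum>i\<in>UNIV. if a i > 0 then tc p k (partial_deriv i h) (a(i := a i - 1)) else 0)
    \<le> (\<Sum>i\<in>UNIV. c (a(i := a i - 1)) * (3 * 2 ^ k * M / r ^ Suc k))"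
   by (rule sum_norm_le) (use t c(1) M * in auto)
  also have "\<dots> = C * M / r ^ Suc k"
   by (simp add: C_def sum_distrib_right sum_distrib_left mult_ac sum_divide_distrib)
  finally have le: "cmod (\<Sum>i\<in>UNIV. if a i > 0 then tc p k (partial_deriv i h) (a(i := a i - 1)) else 0) \<le> C * M / r ^ Suc k" .
  have "cmod (tc p (Suc k) h a) \<le> cmod (\<Sum>i\<in>UNIV. if a i > 0 then tc p k (partial_deriv i h) (a(i := a i - 1)) else 0)"
   unfolding tc.simps norm_divide norm_of_nat
   by (rule order_trans[OF divide_left_mono[of 1]]) auto
  with le show "cmod (tc p (Suc k) h a) \<le> C * M / r ^ Suc k" by linarith
 qed
qed

lemma mi_deg_decr:
 assumes "a i > 0"
 shows "mi_deg a = Suc (mi_deg (a(i := a i - 1)))"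
proof -
 have "(\<Sum>k\<in>UNIV - {i}. (a(i := a i - 1)) k) = (\<Sum>k\<in>UNIV - {i}. a k)"
  by (rule sum.cong) auto
 then show ?thesis
  using assms sum.remove[of UNIV i a] sum.remove[of UNIV i "a(i := a i - 1)"] by (simp add: mi_deg_def)
qed

lemma mi_power_decr:
 assumes "a i > 0"
 shows "mi_power z a = z $ i * mi_power z (a(i := a i - 1))"
proof -
 have "(\<Prod>k\<in>UNIV - {i}. (z $ k) ^ (a(i := a i - 1)) k) = (\<Prod>k\<in>UNIV - {i}. (z $ k) ^ a k)"
  by (rule prod.cong) auto
 moreover have "(z $ i) ^ a i = z $ i * (z $ i) ^ (a i - 1)"
  using assms by (simp add: power_eq_if)
 ultimately show ?thesis
  using prod.remove[of UNIV i "%k. (z $ k) ^ a k"] prod.remove[of UNIV i "%k. (z $ k) ^ (a(i := a i - 1)) k"]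
  by (simp add: mi_power_def)
qed

lemma mi_fact_decr:
 assumes "a i > 0"
 shows "mi_fact a = a i * mi_fact (a(i := a i - 1))"
proof -
 have "(\<Prod>k\<in>UNIV - {i}. fact ((a(i := a i - 1)) k) :: nat) = (\<Prod>k\<in>UNIV - {i}. fact (a k))"
  by (rule prod.cong) auto
 moreover have "(fact (a i) :: nat) = a i * fact (a i - 1)"
  using assms by (simp add: fact_reduce)
 ultimately show ?thesis
  using prod.remove[of UNIV i "%k. fact (a k) :: nat"] prod.remove[of UNIV i "%k. fact ((a(i := a i - 1)) k) :: nat"]
  by (simp add: mi_fact_def)
qed

lemma mi_fact_pos: "mi_fact a > 0"
 by (simp add: mi_fact_def prod_pos)

lemma partial_deriv_mi_power:
 "partial_deriv i (%z. mi_power (z - p) b) z = of_nat (b i) * mi_power (z - p) (b(i := b i - 1))"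
proof -
 define c where "c = (\<Prod>k\<in>UNIV - {i}. ((z - p) $ k) ^ b k)"
 have "(%s. mi_power (z + s *s axis i 1 - p) b) = (%s. (z $ i + s - p $ i) ^ b i * c)"
  unfolding mi_power_def c_def
  by (rule ext, subst prod.remove[of UNIV i]) (auto simp: axis_def intro!: prod.cong)
 moreover have "((%s. (z $ i + s - p $ i) ^ b i * c) has_field_derivative
    (of_nat (b i) * (z $ i - p $ i) ^ (b i - 1) * c)) (at 0)"
  by (auto intro!: derivative_eq_intros)
 ultimately have "partial_deriv i (%z. mi_power (z - p) b) z = of_nat (b i) * (z $ i - p $ i) ^ (b i - 1) * c"
  unfolding partial_deriv_def by (simp add: DERIV_imp_deriv)
 also have "\<dots> = of_nat (b i) * mi_power (z - p) (b(i := b i - 1))"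
  unfolding mi_power_def c_def
  by (subst prod.remove[of UNIV i "%k. ((z - p) $ k) ^ (b(i := b i - 1)) k"]) (auto intro!: prod.cong)
 finally show ?thesis .
qed

lemma mi_deg_0_iff: "mi_deg a = 0 \<longleftrightarrow> a = (%_. 0)"
 by (auto simp: mi_deg_def fun_eq_iff)

text \<open>Coordinate \<open>i\<close> contributes \<open>a i\<close>; these numbers add up to the
  degree, which cancels the averaging factor in \<open>tc\<close>.\<close>

lemma tc_mi_power:
 "mi_deg a = k ==> tc p k (%z. mi_power (z - p) b) a = (if a = b then 1 else 0)"
proof (induction k arbitrary: a b)
 case 0
 then have a: "a = (%_. 0)" by (simp add: mi_deg_0_iff)
 show ?case
 proof (cases "b = (%_. 0)")
  case False
  then obtain i where "b i \<noteq> 0" by auto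
  then have "mi_power 0 b = 0" by (auto simp: mi_power_def)
  then show ?thesis using a False by auto
 qed (use a in \<open>simp add: mi_power_def\<close>)
next
 case (Suc k)
 have *: "(if a i > 0 then tc p k (partial_deriv i (%z. mi_power (z - p) b)) (a(i := a i - 1)) else 0)
   = (if a = b then of_nat (a i) else 0)" for i
 proof (cases "a i > 0")
  case True
  have H: "hol_on (%z. mi_power (z - p) (b(i := b i - 1))) UNIV"
   by (simp add: hol_on_iff_hol_at hol_at_mi_power)
  have d: "mi_deg (a(i := a i - 1)) = k" using mi_deg_decr[of a i, OF True] Suc.prems by simp
  have "tc p k (partial_deriv i (%z. mi_power (z - p) b)) (a(i := a i - 1))
    = tc p k (%z. of_nat (b i) * mi_power (z - p) (b(i := b i - 1)) + 0 * mi_power (z - p) (b(i := b i - 1))) (a(i := a i - 1))"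
   by (rule tc_cong[of UNIV]) (auto simp: partial_deriv_mi_power)
  also have "\<dots> = of_nat (b i) * (if a(i := a i - 1) = b(i := b i - 1) then 1 else 0)"
   unfolding tc_lin[OF open_UNIV UNIV_I H H] Suc.IH[OF d] by simp
  also have "\<dots> = (if a = b then of_nat (a i) else 0)"
  proof (cases "b i = 0")
   case bi: False
   have "a(i := a i - 1) = b(i := b i - 1) \<longleftrightarrow> a = b"
   proof
    assume eq: "a(i := a i - 1) = b(i := b i - 1)"
    show "a = b"
    proof
     fix j show "a j = b j"
      using fun_cong[OF eq, of j] fun_cong[OF eq, of i] True bi by (cases "j = i") auto
    qed
   qed auto
   then show ?thesis by auto
  qed (use True in auto)
  finally show ?thesis using True by simp
 qed auto
 have "(\<Sum>i\<in>UNIV. of_nat (a i)) = (of_nat (Suc k) :: complex)"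
  using Suc.prems by (simp add: mi_deg_def flip: of_nat_sum)
 then show ?case
  unfolding tc.simps * by (cases "a = b") (auto simp del: of_nat_Suc)
qed

lemma partial_deriv_exp_fun: "partial_deriv i (exp_fun w) z = cnj (w $ i) * exp_fun w z"
proof -
 have "star_prod w (axis i 1) = cnj (w $ i)"
  unfolding star_prod_def axis_def by (simp add: if_distrib cong: if_cong)
 then show ?thesis by (simp add: partial_deriv_eq_dd dd_exp_fun)
qed

lemma tc_exp_fun:
 "mi_deg a = k ==> tc p k (exp_fun w) a = cnj (mi_power w a) / of_nat (mi_fact a) * exp_fun w p"
proof (induction k arbitrary: a)
 case 0
 then have "a = (%_. 0)" by (simp add: mi_deg_0_iff)
 then show ?case by (simp add: mi_power_def mi_fact_def)
next
 case (Suc k)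
 define X where "X = cnj (mi_power w a) / of_nat (mi_fact a) * exp_fun w p"
 have *: "(if a i > 0 then tc p k (partial_deriv i (exp_fun w)) (a(i := a i - 1)) else 0) = of_nat (a i) * X" for i
 proof (cases "a i > 0")
  case True
  have H: "hol_on (exp_fun w) UNIV"
   by (simp add: hol_on_iff_hol_at hol_at_exp_fun)
  have d: "mi_deg (a(i := a i - 1)) = k" using mi_deg_decr[of a i, OF True] Suc.prems by simp
  have "tc p k (partial_deriv i (exp_fun w)) (a(i := a i - 1))
    = tc p k (%z. cnj (w $ i) * exp_fun w z + 0 * exp_fun w z) (a(i := a i - 1))"
   by (rule tc_cong[of UNIV]) (auto simp: partial_deriv_exp_fun)
  also have "\<dots> = cnj (w $ i) * (cnj (mi_power w (a(i := a i - 1))) / of_nat (mi_fact (a(i := a i - 1))) * exp_fun w p)"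
   unfolding tc_lin[OF open_UNIV UNIV_I H H] Suc.IH[OF d] by simp
  also have "\<dots> = of_nat (a i) * X"
   unfolding X_def mi_power_decr[of a i w, OF True] mi_fact_decr[of a i, OF True] using True by (simp add: field_simps)
  finally show ?thesis using True by simp
 qed simp
 have "(\<Sum>i\<in>UNIV. of_nat (a i) * X) = of_nat (Suc k) * X"
  using Suc.prems by (simp add: mi_deg_def flip: of_nat_sum sum_distrib_right)
 then show ?case
  unfolding tc.simps * X_def[symmetric] by (simp del: of_nat_Suc)
qed

section \<open>Taylor expansion along complex lines, with remainder\<close>

lemma higher_deriv_lincomb:
 assumes "finite I" "open S" "z \<in> S" "!!i. i \<in> I ==> g i holomorphic_on S"
 shows "(deriv ^^ k) (%s. \<Sum>i\<in>I. c i * g i s) z = (\<Sum>i\<in>I. c i * (deriv ^^ k) (g i) z)"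
 using assms(1,4)
proof (induction I rule: finite_induct)
 case empty
 have "(deriv ^^ k) (%s. 0) z = (0::complex)"
  by (induction k arbitrary: z) simp_all
 then show ?case by simp
next
 case (insert i I)
 have "(deriv ^^ k) (%s. c i * g i s + (\<Sum>i\<in>I. c i * g i s)) z
   = (deriv ^^ k) (%s. c i * g i s) z + (deriv ^^ k) (%s. \<Sum>i\<in>I. c i * g i s) z"
  by (rule higher_deriv_add[of _ S]) (use insert assms in \<open>auto intro!: holomorphic_intros\<close>)
 then show ?case
  using insert assms higher_deriv_cmult[of "g i" S z k "c i"] by simp
qed

lemma finite_mi_le: "finite {a :: 'd::finite => nat. mi_deg a \<le> n}"
proof (rule finite_subset)
 show "{a. mi_deg a \<le> n} \<subseteq> PiE UNIV (%_::'d. {..n})"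
 proof
  fix a :: "'d => nat" assume a: "a \<in> {a. mi_deg a \<le> n}"
  have "a k \<le> mi_deg a" for k
   unfolding mi_deg_def by (rule member_le_sum) auto
  then have "a k \<le> n" for k using a order_trans by blast
  then show "a \<in> PiE UNIV (%_::'d. {..n})" by (simp add: PiE_UNIV_domain)
 qed
qed (simp add: finite_PiE)

lemma finite_mi_eq: "finite {a :: 'd::finite => nat. mi_deg a = n}"
 by (rule finite_subset[OF _ finite_mi_le[of n]]) auto

text \<open>Restriction to a complex line collects all coefficients of one degree into a single
  coefficient of a function of one variable. This reduces the estimate of multivariate remainders to
  the one-variable case.\<close>

lemma tc_line:
 fixes h :: "complex ^ 'd => complex"
 assumes U: "open U" "p \<in> U" and h: "hol_on h U"
 shows "(deriv ^^ k) (%s. h (p + s *s v)) 0 / fact k = (\<Sum>a | mi_deg a = k. tc p k h a * mi_power v a)"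
 using h
proof (induction k arbitrary: h)
 case 0
 have "{a :: 'd => nat. mi_deg a = 0} = {%_. 0}" by (auto simp: mi_deg_0_iff)
 then show ?case by (simp add: mi_power_def)
next
 case (Suc k)
 define S where "S = (%s. p + s *s v) -` U"
 have S: "open S" "0 \<in> S"
  using continuous_on_line[of UNIV p v] U by (auto simp: S_def open_vimage)
 have hol: "(%s. partial_deriv i h (p + s *s v)) holomorphic_on S" for i
  by (rule hol_on_line[OF hol_on_partial_deriv[OF U(1) Suc.prems]]) (simp add: S_def)
 have "(deriv ^^ Suc k) (%s. h (p + s *s v)) 0 = (deriv ^^ k) (deriv (%s. h (p + s *s v))) 0"
  by (simp add: funpow_swap1)
 also have "\<dots> = (deriv ^^ k) (%s. \<Sum>i\<in>UNIV. v $ i * partial_deriv i h (p + s *s v)) 0"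
 proof (rule higher_deriv_transform_within_open[OF _ _ S])
  show "deriv (%s. h (p + s *s v)) holomorphic_on S"
   by (rule holomorphic_deriv[OF hol_on_line[OF Suc.prems] S(1)]) (simp add: S_def)
  show "(%s. \<Sum>i\<in>UNIV. v $ i * partial_deriv i h (p + s *s v)) holomorphic_on S"
   by (intro holomorphic_intros hol)
  fix s assume "s \<in> S"
  then have "hol_at h (p + s *s v)" using Suc.prems by (simp add: S_def hol_on_iff_hol_at)
  then show "deriv (%s. h (p + s *s v)) s = (\<Sum>i\<in>UNIV. v $ i * partial_deriv i h (p + s *s v))"
   by (simp add: DERIV_imp_deriv[OF hol_at_DERIV_line] dd_eq_sum)
 qed
 also have "\<dots> = (\<Sum>i\<in>UNIV. v $ i * (deriv ^^ k) (%s. partial_deriv i h (p + s *s v)) 0)"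
  by (rule higher_deriv_lincomb[OF _ S hol]) simp
 also have "\<dots> = (\<Sum>i\<in>UNIV. v $ i * (fact k * (\<Sum>a | mi_deg a = k. tc p k (partial_deriv i h) a * mi_power v a)))"
  by (intro sum.cong refl, subst Suc.IH[symmetric]) (use hol_on_partial_deriv[OF U(1) Suc.prems] in auto)
 also have "\<dots> = fact k * (\<Sum>i\<in>UNIV. \<Sum>a | mi_deg a = k. tc p k (partial_deriv i h) a * (v $ i * mi_power v a))"
  by (simp add: sum_distrib_left mult_ac)
 \<comment> \<open>Raising entry \<open>i\<close> by one is a bijection from the multi-indices of
   degree \<open>k\<close> onto those of degree \<open>k + 1\<close> whose entry \<open>i\<close> is
   positive.\<close>
 also have "(\<Sum>i\<in>UNIV. \<Sum>a | mi_deg a = k. tc p k (partial_deriv i h) a * (v $ i * mi_power v a))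
   = (\<Sum>i\<in>UNIV. \<Sum>a | mi_deg a = Suc k. if a i > 0 then tc p k (partial_deriv i h) (a(i := a i - 1)) * mi_power v a else 0)"
 proof (rule sum.cong[OF refl])
  fix i
  have "(\<Sum>a | mi_deg a = k. tc p k (partial_deriv i h) a * (v $ i * mi_power v a))
    = (\<Sum>a\<in>{a \<in> {a. mi_deg a = Suc k}. a i > 0}. tc p k (partial_deriv i h) (a(i := a i - 1)) * mi_power v a)"
  proof (rule sum.reindex_bij_witness[where i = "%a. a(i := a i - 1)" and j = "%a. a(i := a i + 1)"])
   fix b :: "'d => nat" assume b: "b \<in> {a. mi_deg a = k}"
   have 1: "(b(i := b i + 1))(i := (b(i := b i + 1)) i - 1) = b" by (auto simp: fun_eq_iff)
   then show "(b(i := b i + 1))(i := (b(i := b i + 1)) i - 1) = b" .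
   have 2: "(b(i := b i + 1)) i > 0" by simp
   show "b(i := b i + 1) \<in> {a \<in> {a. mi_deg a = Suc k}. 0 < a i}"
    using mi_deg_decr[of "b(i := b i + 1)" i, OF 2, unfolded 1] b by simp
   show "tc p k (partial_deriv i h) ((b(i := b i + 1))(i := (b(i := b i + 1)) i - 1)) * mi_power v (b(i := b i + 1))
     = tc p k (partial_deriv i h) b * (v $ i * mi_power v b)"
    unfolding 1 mi_power_decr[of "b(i := b i + 1)" i v, OF 2, unfolded 1] by simp
  next
   fix a :: "'d => nat" assume a: "a \<in> {a \<in> {a. mi_deg a = Suc k}. 0 < a i}"
   then show "(a(i := a i - 1))(i := (a(i := a i - 1)) i + 1) = a" by (auto simp: fun_eq_iff)
   show "a(i := a i - 1) \<in> {a. mi_deg a = k}"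
    using mi_deg_decr[of a i] a by simp
  qed
  then show "(\<Sum>a | mi_deg a = k. tc p k (partial_deriv i h) a * (v $ i * mi_power v a))
    = (\<Sum>a | mi_deg a = Suc k. if a i > 0 then tc p k (partial_deriv i h) (a(i := a i - 1)) * mi_power v a else 0)"
   by (simp only: sum.inter_filter[OF finite_mi_eq])
 qed
 also have "\<dots> = (\<Sum>a | mi_deg a = Suc k. of_nat (Suc k) * (tc p (Suc k) h a * mi_power v a))"
 proof (rule trans[OF sum.swap], rule sum.cong[OF refl])
  fix a :: "'d => nat"
  have "(\<Sum>i\<in>UNIV. if a i > 0 then tc p k (partial_deriv i h) (a(i := a i - 1)) * mi_power v a else 0)
    = (\<Sum>i\<in>UNIV. if a i > 0 then tc p k (partial_deriv i h) (a(i := a i - 1)) else 0) * mi_power v a"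
   unfolding sum_distrib_right by (intro sum.cong refl) auto
  then show "(\<Sum>i\<in>UNIV. if a i > 0 then tc p k (partial_deriv i h) (a(i := a i - 1)) * mi_power v a else 0)
    = of_nat (Suc k) * (tc p (Suc k) h a * mi_power v a)"
   unfolding tc.simps(2) by (simp del: of_nat_Suc)
 qed
 also have "\<dots> = of_nat (Suc k) * (\<Sum>a | mi_deg a = Suc k. tc p (Suc k) h a * mi_power v a)"
  by (simp only: sum_distrib_left)
 finally show ?case
  by (simp only: fact_Suc of_nat_mult of_nat_fact) (simp add: field_simps del: of_nat_Suc tc.simps)
qed

text \<open>Cauchy's inequality bounds the coefficient of order \<open>k\<close> by
  \<open>M / R ^ k\<close>, so the tail at the point 1 is dominated by a geometric series with ratio
  \<open>1/R\<close>.\<close>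

lemma taylor_remainder_disc:
 assumes "open S" "cball 0 R \<subseteq> S" "R > 1" "g holomorphic_on S" "!!s. s \<in> cball 0 R ==> cmod (g s) \<le> M"
 shows "cmod (g 1 - (\<Sum>k\<le>n. (deriv ^^ k) g 0 / fact k)) \<le> M / R ^ Suc n * (R / (R - 1))"
proof -
 let ?a = "%k. (deriv ^^ k) g 0 / fact k"
 have hol: "g holomorphic_on ball 0 R" "g holomorphic_on cball 0 R"
  using assms(2,4) holomorphic_on_subset ball_subset_cball by blast+
 have "?a sums g 1"
  using holomorphic_power_series[OF hol(1), of 1] assms(3) by simp
 then have s: "(%k. ?a (k + Suc n)) sums (g 1 - (\<Sum>k<Suc n. ?a k))"
  using sums_iff_shift[of ?a "Suc n"] by auto
 have a: "cmod (?a m) \<le> M / R ^ m" for m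
 proof -
  have "cmod ((deriv ^^ m) g 0) \<le> fact m * M / R ^ m"
   by (rule Cauchy_inequality[OF hol(1) holomorphic_on_imp_continuous_on[OF hol(2)]]) (use assms in auto)
  then show ?thesis by (simp add: norm_divide divide_le_eq mult_ac)
 qed
 have b: "cmod (?a (k + Suc n)) \<le> M / R ^ Suc n * (1/R) ^ k" for k
  using a[of "k + Suc n"] by (simp add: power_add power_one_over field_simps)
 have geo: "(%k. M / R ^ Suc n * (1/R) ^ k) sums (M / R ^ Suc n * (1 / (1 - 1/R)))"
  by (intro sums_mult geometric_sums) (use assms(3) in auto)
 have "cmod (suminf (%k. ?a (k + Suc n))) \<le> M / R ^ Suc n * (1 / (1 - 1/R))"
  using norm_suminf_le[OF b sums_summable[OF geo]] unfolding sums_unique[OF geo, symmetric] .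
 moreover have "1 / (1 - 1/R) = R / (R - 1)" using assms(3) by (simp add: field_simps)
 ultimately show ?thesis
  unfolding sums_unique[OF s, symmetric] lessThan_Suc_atMost by simp
qed

lemma tc_remainder:
 fixes h :: "complex ^ 'd => complex"
 assumes U: "open U" and h: "hol_on h U" and R: "R > 1"
  and M: "!!s. cmod s \<le> R ==> p + s *s v \<in> U \<and> cmod (h (p + s *s v)) \<le> M"
 shows "cmod (h (p + v) - (\<Sum>k\<le>n. \<Sum>a | mi_deg a = k. tc p k h a * mi_power v a)) \<le> M / R ^ Suc n * (R / (R - 1))"
proof -
 define S where "S = (%s. p + s *s v) -` U"
 have S: "open S" using continuous_on_line[of UNIV p v] U by (auto simp: S_def open_vimage)
 have p: "p \<in> U" using M[of 0] R by simp
 have "cmod ((%s. h (p + s *s v)) 1 - (\<Sum>k\<le>n. (deriv ^^ k) (%s. h (p + s *s v)) 0 / fact k)) \<le> M / R ^ Suc n * (R / (R - 1))"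
  by (rule taylor_remainder_disc[OF S _ R hol_on_line[OF h]]) (use M in \<open>auto simp: S_def\<close>)
 then show ?thesis by (simp add: tc_line[OF U p h])
qed

subsection \<open>Numbering of the multi-indices\<close>

text \<open>Stars and bars: the slack \<open>n - mi_deg a\<close> is prepended as one more entry, so
  that the bound on the degree becomes a prescribed sum.\<close>

lemma card_mi_le: "card {a :: 'd::finite => nat. mi_deg a \<le> n} = rE TYPE('d) n"
proof -
 let ?d = "CARD('d)"
 obtain e :: "nat => 'd" where e: "bij_betw e {..<?d} UNIV"
  using ex_bij_betw_nat_finite[of "UNIV :: 'd set"] by (auto simp: atLeast0LessThan)
 define xs where "xs = map e [0..<?d]"
 have ran: "e ` {..<?d} = UNIV" and inj: "inj_on e {..<?d}" using e by (auto simp: bij_betw_def)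
 have xs: "set xs = UNIV" "distinct xs" "length xs = ?d"
  using ran inj by (auto simp: xs_def distinct_map atLeast0LessThan)
 have deg: "sum_list (map a xs) = mi_deg a" for a :: "'d => nat"
  using sum_list_distinct_conv_sum_set[OF xs(2), of a] xs(1) by (simp add: mi_deg_def)
 have "bij_betw (%a. (n - mi_deg a) # map a xs) {a. mi_deg a \<le> n} {l. length l = ?d + 1 \<and> sum_list l = n}"
  unfolding bij_betw_def
 proof
  show "inj_on (%a. (n - mi_deg a) # map a xs) {a. mi_deg a \<le> n}"
   using xs(1) by (auto simp: inj_on_def fun_eq_iff)
  show "(%a. (n - mi_deg a) # map a xs) ` {a. mi_deg a \<le> n} = {l. length l = ?d + 1 \<and> sum_list l = n}"
  proof (intro equalityI subsetI)
   fix l :: "nat list" assume "l \<in> {l. length l = ?d + 1 \<and> sum_list l = n}"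
   then obtain x ys where l: "l = x # ys" "length ys = ?d" "x + sum_list ys = n"
    by (cases l) auto
   define a where "a = (%k. ys ! (inv_into {..<?d} e k))"
   have "map a xs = map (%j. ys ! j) [0..<?d]"
    unfolding xs_def by (auto simp: a_def inv_into_f_f[OF inj])
   also have "\<dots> = ys" using map_nth[of ys] l(2) by simp
   finally have m: "map a xs = ys" .
   then have "sum_list ys = mi_deg a" using deg[of a] by simp
   then show "l \<in> (%a. (n - mi_deg a) # map a xs) ` {a. mi_deg a \<le> n}"
    using l m by (intro image_eqI[of _ _ a]) auto
  qed (auto simp: xs(3) deg)
 qed
 then have "card {a :: 'd => nat. mi_deg a \<le> n} = card {l :: nat list. length l = ?d + 1 \<and> sum_list l = n}"
  by (rule bij_betw_same_card)
 also have "\<dots> = (n + ?d) choose n"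
  using card_length_sum_list[of "?d + 1" n] by simp
 finally show ?thesis
  using binomial_symmetric[of n "n + ?d"] by (simp add: rE_def)
qed

text \<open>By monotonicity of the degree the indices in question form an initial segment, and its
  length is the number of multi-indices of degree at most \<open>n\<close>.\<close>

lemma numbering_image:
 assumes "mi_numbering (\<alpha> :: nat => 'd::finite => nat)"
 shows "i < rE TYPE('d) n \<longleftrightarrow> mi_deg (\<alpha> i) \<le> n"
proof -
 have bij: "bij \<alpha>" and mono: "!!i j. i \<le> j ==> mi_deg (\<alpha> i) \<le> mi_deg (\<alpha> j)"
  using assms by (auto simp: mi_numbering_def)
 define S where "S = {i. mi_deg (\<alpha> i) \<le> n}"
 have "\<alpha> ` S = {a. mi_deg a \<le> n}"
  using bij_is_surj[OF bij] by (force simp: S_def)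
 then have card: "card S = rE TYPE('d) n" and fin: "finite S"
  using card_image[of \<alpha> S] bij_is_inj[OF bij] card_mi_le[where ?'d = 'd, of n]
   finite_imageD[of \<alpha> S] finite_mi_le[where ?'d = 'd, of n]
  by (auto simp: inj_on_subset)
 obtain m where m: "m \<notin> S" using fin ex_new_if_finite[OF infinite_UNIV_nat] by blast
 define l where "l = (LEAST m. m \<notin> S)"
 have l1: "l \<notin> S"
  unfolding l_def by (rule LeastI[of "%m. m \<notin> S", OF m])
 have l2: "i \<in> S" if "i < l" for i
  using not_less_Least[of i "%m. m \<notin> S"] that by (auto simp: l_def)
 have "S = {..<l}"
 proof (intro equalityI subsetI)
  fix i assume i: "i \<in> S"
  show "i \<in> {..<l}"
  proof (rule ccontr)
   assume "i \<notin> {..<l}"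
   then have "mi_deg (\<alpha> l) \<le> mi_deg (\<alpha> i)" using mono by simp
   then show False using i l1 by (simp add: S_def)
  qed
 qed (use l2 in auto)
 then have "S = {..<rE TYPE('d) n}" using card by simp
 then show ?thesis by (auto simp: S_def)
qed

lemma sum_numbering:
 assumes "mi_numbering (\<alpha> :: nat => 'd::finite => nat)"
 shows "(\<Sum>i<rE TYPE('d) n. F (\<alpha> i)) = (\<Sum>k\<le>n. \<Sum>a | mi_deg a = k. F a)"
proof -
 have bij: "bij \<alpha>" using assms by (simp add: mi_numbering_def)
 have "{a. mi_deg a \<le> n} = \<alpha> ` {..<rE TYPE('d) n}"
 proof (intro equalityI subsetI)
  fix a :: "'d => nat" assume a: "a \<in> {a. mi_deg a \<le> n}"
  obtain i where "a = \<alpha> i" using surjD[OF bij_is_surj[OF bij]] by blast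
  then show "a \<in> \<alpha> ` {..<rE TYPE('d) n}"
   using a numbering_image[OF assms, of i n] by simp
 qed (auto simp: numbering_image[OF assms])
 then have "(\<Sum>i<rE TYPE('d) n. F (\<alpha> i)) = (\<Sum>a | mi_deg a \<le> n. F a)"
  using sum.reindex[of \<alpha> "{..<rE TYPE('d) n}" F] bij_is_inj[OF bij] by (simp add: inj_on_subset)
 also have "\<dots> = (\<Sum>k\<le>n. \<Sum>a\<in>{x. x \<in> {a. mi_deg a \<le> n} \<and> mi_deg x = k}. F a)"
  by (rule sum.group[symmetric]) (auto simp: finite_mi_le)
 also have "\<dots> = (\<Sum>k\<le>n. \<Sum>a | mi_deg a = k. F a)"
  by (intro sum.cong refl) auto
 finally show ?thesis .
qed

lemma rE_pos: "rE t n > 0"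
 by (simp add: rE_def)

lemma rE_mono: "m \<le> n ==> rE t m \<le> rE t n"
 by (simp add: rE_def binomial_right_mono)

subsection \<open>The dual functionals of the basis\<close>

definition sc :: "('d::finite => nat) => complex ^ 'd => real" where
 "sc a p = exp (- (norm p)\<^sup>2 / 2) / sqrt (real (mi_fact a))"

lemma sc_pos: "sc a p > 0"
 using mi_fact_pos[of a] by (simp add: sc_def)

lemma u_fun_eq: "u_fun \<alpha> p i z = of_real (sc (\<alpha> i) p) * mi_power (z - p) (\<alpha> i) * exp_fun p z"
 by (simp add: u_fun_def sc_def)

lemma hol_at_u_fun: "hol_at (u_fun \<alpha> p i) z"
 unfolding u_fun_eq[abs_def] by (intro hol_at_mult hol_at_const hol_at_mi_power hol_at_exp_fun)

lemma star_prod_add_left: "star_prod (v + w) z = star_prod v z + star_prod w z"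
 and star_prod_diff_left: "star_prod (v - w) z = star_prod v z - star_prod w z"
 and star_prod_cnj: "cnj (star_prod w z) = star_prod z w"
 by (simp_all add: star_prod_def sum.distrib sum_negf sum_subtractf algebra_simps)

lemma star_prod_self: "star_prod p p = of_real ((norm p)\<^sup>2)"
proof -
 have "(norm p)\<^sup>2 = (\<Sum>k\<in>UNIV. (cmod (p $ k))\<^sup>2)"
  by (simp add: norm_vec_def L2_set_def sum_nonneg)
 then show ?thesis
  by (simp add: star_prod_def complex_norm_square mult.commute flip: of_real_power)
qed

lemma star_prod_le: "cmod (star_prod w z) \<le> norm w * norm z"
proof -
 have "cmod (star_prod w z) \<le> (\<Sum>k\<in>UNIV. cmod (w $ k) * cmod (z $ k))"
  unfolding star_prod_def by (rule order_trans[OF norm_sum]) (simp add: norm_mult)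
 also have "\<dots> \<le> norm w * norm z"
  unfolding norm_vec_def using L2_set_mult_ineq[of "%k. cmod (w $ k)" "%k. cmod (z $ k)" UNIV] by simp
 finally show ?thesis .
qed

lemma exp_fun_le: "cmod (exp_fun w z) \<le> exp (norm w * norm z)"
 unfolding exp_fun_def norm_exp_eq_Re
 using star_prod_le[of w z] complex_Re_le_cmod[of "star_prod w z"] by simp

lemma exp_fun_mult: "exp_fun v z * exp_fun w z = exp_fun (v + w) z"
 by (simp add: exp_fun_def star_prod_add_left exp_add)

lemma exp_fun_inverse: "exp_fun p z * exp_fun (- p) z = 1" "exp_fun (- p) z * exp_fun p z = 1"
 by (simp_all add: exp_fun_mult) (simp_all add: exp_fun_def star_prod_def)

lemma exp_fun_nonzero: "exp_fun p z \<noteq> 0"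
 by (simp add: exp_fun_def)

text \<open>The function is divided by \<open>exp_fun p\<close> before its Taylor coefficients are taken, as \<open>u_fun\<close> carries this factor.\<close>

definition nu :: "(nat => ('d::finite => nat)) => complex ^ 'd => nat => (complex ^ 'd => complex) => complex" where
 "nu \<alpha> p j h = tc p (mi_deg (\<alpha> j)) (%z. h z * exp_fun (- p) z) (\<alpha> j) / of_real (sc (\<alpha> j) p)"

lemma hol_on_mult_exp: "hol_on h U ==> hol_on (%z. h z * exp_fun w z) U"
 by (simp add: hol_on_iff_hol_at hol_at_mult hol_at_exp_fun)

lemma nu_cong:
 assumes "open U" "p \<in> U" "!!x. x \<in> U ==> g x = h x"
 shows "nu \<alpha> p j g = nu \<alpha> p j h"
 unfolding nu_def by (subst tc_cong[OF assms(1,2), of _ "%z. h z * exp_fun (- p) z"]) (use assms(3) in auto)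

lemma nu_lin:
 assumes "open U" "p \<in> U" "hol_on g U" "hol_on h U"
 shows "nu \<alpha> p j (%z. c * g z + d * h z) = c * nu \<alpha> p j g + d * nu \<alpha> p j h"
proof -
 have "tc p (mi_deg (\<alpha> j)) (%z. (c * g z + d * h z) * exp_fun (- p) z) (\<alpha> j)
   = tc p (mi_deg (\<alpha> j)) (%z. c * (g z * exp_fun (- p) z) + d * (h z * exp_fun (- p) z)) (\<alpha> j)"
  by (simp add: algebra_simps)
 also have "\<dots> = c * tc p (mi_deg (\<alpha> j)) (%z. g z * exp_fun (- p) z) (\<alpha> j)
    + d * tc p (mi_deg (\<alpha> j)) (%z. h z * exp_fun (- p) z) (\<alpha> j)"
  by (rule tc_lin[OF assms(1,2)]) (intro hol_on_mult_exp assms)+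
 finally show ?thesis by (simp add: nu_def add_divide_distrib)
qed

lemma nu_diff:
 assumes "open U" "p \<in> U" "hol_on g U" "hol_on h U"
 shows "nu \<alpha> p j (%z. g z - h z) = nu \<alpha> p j g - nu \<alpha> p j h"
 using nu_lin[OF assms, of \<alpha> j 1 "-1"] by simp

lemma nu_sum:
 assumes "open U" "p \<in> U" "finite I" "!!i. i \<in> I ==> hol_on (g i) U"
 shows "nu \<alpha> p j (%z. \<Sum>i\<in>I. c i * g i z) = (\<Sum>i\<in>I. c i * nu \<alpha> p j (g i))"
 using assms(3,4)
proof (induction I rule: finite_induct)
 case empty
 show ?case
  using nu_lin[OF assms(1,2), of "%_. 0" "%_. 0" \<alpha> j 0 0] by (simp add: hol_on_iff_hol_at hol_at_const)
next
 case (insert i I)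
 have "hol_on (%z. \<Sum>i\<in>I. c i * g i z) U"
  using insert by (auto simp: hol_on_iff_hol_at intro!: conjunct1[OF hol_at_sum] hol_at_cmult)
 then have "nu \<alpha> p j (%z. c i * g i z + 1 * (\<Sum>i\<in>I. c i * g i z)) = c i * nu \<alpha> p j (g i) + 1 * nu \<alpha> p j (%z. \<Sum>i\<in>I. c i * g i z)"
  using insert by (intro nu_lin[OF assms(1,2)]) auto
 then show ?case using insert by simp
qed

text \<open>For \<open>r \<le> 1\<close> the factor \<open>exp_fun (- p)\<close> is bounded on the
  ball by a constant \<open>E\<close> free of \<open>r\<close> and \<open>h\<close>, so the estimate
  for \<open>tc\<close> carries over.\<close>

lemma nu_bound: "\<exists>c\<ge>0. \<forall>h r M. r > 0 --> r \<le> 1 --> hol_on h (ball p r) --> (\<forall>x\<in>ball p r. cmod (h x) \<le> M) -->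
  cmod (nu \<alpha> p j h) \<le> c * M / r ^ mi_deg (\<alpha> j)"
proof -
 obtain c where c: "c \<ge> 0" "!!h r M. r > 0 ==> hol_on h (ball p r) ==> (!!x. x\<in>ball p r ==> cmod (h x) \<le> M) ==>
   cmod (tc p (mi_deg (\<alpha> j)) h (\<alpha> j)) \<le> c * M / r ^ mi_deg (\<alpha> j)"
  using tc_bound[of p "mi_deg (\<alpha> j)" "\<alpha> j"] by blast
 define E where "E = exp (norm p * (norm p + 1))"
 show ?thesis
 proof (intro exI[of _ "c * E / sc (\<alpha> j) p"] conjI allI impI)
  show "0 \<le> c * E / sc (\<alpha> j) p" using c(1) sc_pos[of "\<alpha> j" p] by (simp add: E_def)
  fix h r M assume *: "r > (0::real)" "r \<le> 1" "hol_on h (ball p r)" "\<forall>x\<in>ball p r. cmod (h x) \<le> M"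
  have "cmod (h x * exp_fun (- p) x) \<le> M * E" if x: "x \<in> ball p r" for x
  proof -
   have "norm x \<le> norm p + 1"
    using norm_triangle_ineq2[of x p] x *(2) by (simp add: dist_norm norm_minus_commute)
   then have "norm p * norm x \<le> norm p * (norm p + 1)" by (rule mult_left_mono) simp
   then have "cmod (exp_fun (- p) x) \<le> E"
    using exp_fun_le[of "- p" x] unfolding E_def by (smt (verit) exp_le_cancel_iff norm_minus_cancel)
   then show ?thesis
    unfolding norm_mult using * x by (intro mult_mono) (auto intro: order_trans[OF norm_ge_zero])
  qed
  then have "cmod (tc p (mi_deg (\<alpha> j)) (%z. h z * exp_fun (- p) z) (\<alpha> j)) \<le> c * (M * E) / r ^ mi_deg (\<alpha> j)"
   by (intro c(2) hol_on_mult_exp *)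
  then show "cmod (nu \<alpha> p j h) \<le> c * E / sc (\<alpha> j) p * M / r ^ mi_deg (\<alpha> j)"
   using sc_pos[of "\<alpha> j" p] by (simp add: nu_def norm_divide field_simps)
 qed
qed

lemma nu_u_fun:
 assumes "inj \<alpha>"
 shows "nu \<alpha> p j (u_fun \<alpha> p i) = (if i = j then 1 else 0)"
proof -
 have eq: "u_fun \<alpha> p i z * exp_fun (- p) z = of_real (sc (\<alpha> i) p) * mi_power (z - p) (\<alpha> i) + 0 * mi_power (z - p) (\<alpha> i)" for z
  using exp_fun_inverse[of p z] by (simp add: u_fun_eq)
 have H: "hol_on (%z. mi_power (z - p) (\<alpha> i)) UNIV" by (simp add: hol_on_iff_hol_at hol_at_mi_power)
 have "\<alpha> i = \<alpha> j \<longleftrightarrow> i = j" using assms by (auto simp: inj_def)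
 then show ?thesis
  unfolding nu_def eq tc_lin[OF open_UNIV UNIV_I H H] using sc_pos[of "\<alpha> j" p]
  by (auto simp: tc_mi_power)
qed

text \<open>The factor \<open>exp (- (norm p)\<^sup>2)\<close> produced by
  \<open>exp_fun (w - p) p\<close>, divided by the factorial of the multi-index, is the square of
  \<open>sc\<close>. One factor \<open>sc\<close> is consumed by the division in \<open>nu\<close>,
  the other is the one in \<open>u_fun\<close>.\<close>

lemma nu_exp_fun: "nu \<alpha> p j (exp_fun w) = cnj (u_fun \<alpha> p j w)"
proof -
 have 1: "(%z. exp_fun w z * exp_fun (- p) z) = exp_fun (w - p)"
  by (simp add: fun_eq_iff exp_fun_mult)
 have 2: "exp_fun (w - p) p = cnj (exp_fun p w) * of_real (exp (- (norm p)\<^sup>2))"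
 proof -
  have "exp_fun (w - p) p = exp (star_prod w p - of_real ((norm p)\<^sup>2))"
   by (simp only: exp_fun_def star_prod_diff_left star_prod_self)
  also have "\<dots> = exp (star_prod w p) * exp (of_real (- (norm p)\<^sup>2))"
   by (subst exp_add[symmetric]) simp
  also have "exp (star_prod w p) = cnj (exp_fun p w)"
   by (simp only: exp_fun_def exp_cnj star_prod_cnj)
  finally show ?thesis by (simp only: exp_of_real)
 qed
 have "exp (- (norm p)\<^sup>2) = exp (- (norm p)\<^sup>2 / 2) * exp (- (norm p)\<^sup>2 / 2)"
  by (simp flip: exp_add)
 then have "exp (- (norm p)\<^sup>2) / real (mi_fact (\<alpha> j)) = sc (\<alpha> j) p * sc (\<alpha> j) p"
  by (simp add: sc_def)
 then have 3: "exp (- (norm p)\<^sup>2) / real (mi_fact (\<alpha> j)) / sc (\<alpha> j) p = sc (\<alpha> j) p"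
  using sc_pos[of "\<alpha> j" p] by simp
 have "nu \<alpha> p j (exp_fun w) = cnj (mi_power (w - p) (\<alpha> j)) * cnj (exp_fun p w) *
   of_real (exp (- (norm p)\<^sup>2) / real (mi_fact (\<alpha> j)) / sc (\<alpha> j) p)"
  unfolding nu_def 1 tc_exp_fun[OF refl] 2 by simp
 then show ?thesis
  unfolding 3 by (simp add: u_fun_eq mult_ac)
qed

text \<open>The expansion is that of \<open>h\<close> times \<open>exp_fun (- p)\<close>;
  multiplying back by \<open>exp_fun p\<close> turns the monomials into basis functions.\<close>

lemma nu_remainder:
 fixes h :: "complex ^ 'd => complex"
 assumes \<alpha>: "mi_numbering \<alpha>" and U: "open U" and h: "hol_on h U" and R: "R > 1"
  and M: "!!s. cmod s \<le> R ==> p + s *s v \<in> U \<and> cmod (h (p + s *s v) * exp_fun (- p) (p + s *s v)) \<le> M"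
 shows "cmod (h (p + v) - (\<Sum>i<rE TYPE('d) n. nu \<alpha> p i h * u_fun \<alpha> p i (p + v)))
   \<le> cmod (exp_fun p (p + v)) * (M / R ^ Suc n * (R / (R - 1)))"
proof -
 let ?g = "%z. h z * exp_fun (- p) z"
 have "cmod (?g (p + v) - (\<Sum>k\<le>n. \<Sum>a | mi_deg a = k. tc p k ?g a * mi_power v a)) \<le> M / R ^ Suc n * (R / (R - 1))"
  by (rule tc_remainder[OF U hol_on_mult_exp[OF h] R M])
 moreover have "(\<Sum>k\<le>n. \<Sum>a | mi_deg a = k. tc p k ?g a * mi_power v a) = (\<Sum>k\<le>n. \<Sum>a | mi_deg a = k. tc p (mi_deg a) ?g a * mi_power v a)"
  by (intro sum.cong refl) auto
 moreover have "\<dots> = (\<Sum>i<rE TYPE('d) n. tc p (mi_deg (\<alpha> i)) ?g (\<alpha> i) * mi_power v (\<alpha> i))"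
  by (rule sum_numbering[OF \<alpha>, symmetric])
 ultimately have le: "cmod (?g (p + v) - (\<Sum>i<rE TYPE('d) n. tc p (mi_deg (\<alpha> i)) ?g (\<alpha> i) * mi_power v (\<alpha> i))) \<le> M / R ^ Suc n * (R / (R - 1))"
  by (simp only:)
 have "nu \<alpha> p i h * u_fun \<alpha> p i (p + v) = exp_fun p (p + v) * (tc p (mi_deg (\<alpha> i)) ?g (\<alpha> i) * mi_power v (\<alpha> i))" for i
  using sc_pos[of "\<alpha> i" p] by (simp add: nu_def u_fun_eq)
 then have eq: "h (p + v) - (\<Sum>i<rE TYPE('d) n. nu \<alpha> p i h * u_fun \<alpha> p i (p + v))
   = exp_fun p (p + v) * (?g (p + v) - (\<Sum>i<rE TYPE('d) n. tc p (mi_deg (\<alpha> i)) ?g (\<alpha> i) * mi_power v (\<alpha> i)))"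
  using exp_fun_inverse[of p "p + v"]
  by (simp add: right_diff_distrib sum_distrib_left mult.left_commute[of _ "h (p + v)"])
 show ?thesis
  unfolding eq norm_mult by (rule mult_left_mono[OF le]) simp
qed

subsection \<open>Order of vanishing\<close>

text \<open>Order of vanishing as a growth condition. For holomorphic functions it amounts to the
  vanishing of the low-order coefficients, but products and compositions can be read off from the
  inequality at once.\<close>

definition ordge :: "complex ^ 'd => nat => (complex ^ 'd => complex) => bool" where
 "ordge p k h \<longleftrightarrow> (\<exists>C r. r > 0 \<and> (\<forall>z\<in>ball p r. cmod (h z) \<le> C * norm (z - p) ^ k))"

lemma real_0_less_1: "0 < (1::real)"
 by simp

lemma ordgeI: "r > 0 ==> (!!z. z \<in> ball p r ==> cmod (h z) \<le> C * norm (z - p) ^ k) ==> ordge p k h"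
 unfolding ordge_def by blast

lemma ordgeE:
 assumes "ordge p k h" "R > 0"
 obtains C r where "C \<ge> 0" "r > 0" "r \<le> R" "!!z. z \<in> ball p r ==> cmod (h z) \<le> C * norm (z - p) ^ k"
proof -
 obtain C r where Cr: "r > 0" "!!z. z \<in> ball p r ==> cmod (h z) \<le> C * norm (z - p) ^ k"
  using assms unfolding ordge_def by blast
 have "cmod (h z) \<le> max C 0 * norm (z - p) ^ k" if "z \<in> ball p (min r R)" for z
 proof -
  have "cmod (h z) \<le> C * norm (z - p) ^ k" using Cr(2) that by simp
  also have "\<dots> \<le> max C 0 * norm (z - p) ^ k" by (rule mult_right_mono) auto
  finally show ?thesis .
 qed
 then show ?thesis using that[of "max C 0" "min r R"] Cr(1) assms(2) by auto
qed

lemma ordge_cong: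
 assumes "open U" "p \<in> U" "!!z. z \<in> U ==> g z = h z" "ordge p k g"
 shows "ordge p k h"
proof -
 obtain R where R: "R > 0" "ball p R \<subseteq> U" using assms openE by blast
 obtain C r where Cr: "C \<ge> 0" "r > 0" "r \<le> R" "!!z. z \<in> ball p r ==> cmod (g z) \<le> C * norm (z - p) ^ k"
  using ordgeE[OF assms(4) R(1)] by blast
 show ?thesis
 proof (rule ordgeI[OF Cr(2)])
  fix z assume z: "z \<in> ball p r"
  then have "z \<in> U" using R Cr(3) by auto
  then show "cmod (h z) \<le> C * norm (z - p) ^ k" using Cr(4)[OF z] assms(3) by simp
 qed
qed

lemma ordge_add:
 assumes "ordge p k g" "ordge p k h"
 shows "ordge p k (%z. g z + h z)"
proof -
 obtain C r where Cr: "C \<ge> 0" "r > 0" "r \<le> 1" "!!z. z \<in> ball p r ==> cmod (g z) \<le> C * norm (z - p) ^ k"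
  using ordgeE[OF assms(1) real_0_less_1] by blast
 obtain D s where Ds: "D \<ge> 0" "s > 0" "s \<le> r" "!!z. z \<in> ball p s ==> cmod (h z) \<le> D * norm (z - p) ^ k"
  using ordgeE[OF assms(2) Cr(2)] by blast
 show ?thesis
 proof (rule ordgeI[OF Ds(2), of _ _ "C + D"])
  fix z assume "z \<in> ball p s"
  then have "cmod (g z) \<le> C * norm (z - p) ^ k" "cmod (h z) \<le> D * norm (z - p) ^ k"
   using Cr(4) Ds by auto
  then show "cmod (g z + h z) \<le> (C + D) * norm (z - p) ^ k"
   unfolding distrib_right by (rule norm_triangle_mono)
 qed
qed

lemma ordge_mult:
 assumes "ordge p k g" "ordge p l h"
 shows "ordge p (k + l) (%z. g z * h z)"
proof -
 obtain C r where Cr: "C \<ge> 0" "r > 0" "r \<le> 1" "!!z. z \<in> ball p r ==> cmod (g z) \<le> C * norm (z - p) ^ k"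
  using ordgeE[OF assms(1) real_0_less_1] by blast
 obtain D s where Ds: "D \<ge> 0" "s > 0" "s \<le> r" "!!z. z \<in> ball p s ==> cmod (h z) \<le> D * norm (z - p) ^ l"
  using ordgeE[OF assms(2) Cr(2)] by blast
 show ?thesis
 proof (rule ordgeI[OF Ds(2), of _ _ "C * D"])
  fix z assume "z \<in> ball p s"
  then have *: "cmod (g z) \<le> C * norm (z - p) ^ k" "cmod (h z) \<le> D * norm (z - p) ^ l"
   using Cr(4) Ds by auto
  then have "cmod (g z) * cmod (h z) \<le> (C * norm (z - p) ^ k) * (D * norm (z - p) ^ l)"
   by (intro mult_mono) (use Cr(1) in auto)
  then show "cmod (g z * h z) \<le> (C * D) * norm (z - p) ^ (k + l)"
   by (simp add: norm_mult power_add mult_ac)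
 qed
qed

lemma ordge_mono:
 assumes "ordge p l h" "k \<le> l"
 shows "ordge p k h"
proof -
 obtain C r where Cr: "C \<ge> 0" "r > 0" "r \<le> 1" "!!z. z \<in> ball p r ==> cmod (h z) \<le> C * norm (z - p) ^ l"
  using ordgeE[OF assms(1) real_0_less_1] by blast
 show ?thesis
 proof (rule ordgeI[OF Cr(2)])
  fix z assume z: "z \<in> ball p r"
  then have "norm (z - p) ^ l \<le> norm (z - p) ^ k"
   using Cr(3) assms(2) by (intro power_decreasing) (auto simp: dist_norm norm_minus_commute)
  then show "cmod (h z) \<le> C * norm (z - p) ^ k"
   using Cr(4)[OF z] Cr(1) mult_left_mono order_trans by blast
 qed
qed

lemma ordge_0_const: "ordge p 0 (%_. c)"
 by (rule ordgeI[of 1 _ _ "cmod c"]) auto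

lemma ordge_zero: "ordge p k (%_. 0)"
 by (rule ordgeI[of 1 _ _ 0]) auto

lemma ordge_cmult: "ordge p k h ==> ordge p k (%z. c * h z)"
 using ordge_mult[OF ordge_0_const, of p k h c] by simp

lemma ordge_diff: "ordge p k g ==> ordge p k h ==> ordge p k (%z. g z - h z)"
 using ordge_add[of p k g "%z. (-1) * h z"] ordge_cmult[of p k h "-1"] by simp

lemma ordge_sum: "finite I ==> (!!i. i \<in> I ==> ordge p k (h i)) ==> ordge p k (%z. \<Sum>i\<in>I. h i z)"
 by (induction I rule: finite_induct) (auto simp: ordge_zero ordge_add)

lemma ordge_0:
 assumes "isCont h p"
 shows "ordge p 0 h"
proof -
 have "\<exists>d>0. \<forall>x. dist x p < d --> dist (h x) (h p) < 1"
  using assms unfolding continuous_at_eps_delta by (rule allE[of _ 1]) simp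
 then obtain d where d: "d > 0" "!!x. dist x p < d ==> dist (h x) (h p) < 1" by blast
 show ?thesis
 proof (rule ordgeI[OF d(1), of _ _ "cmod (h p) + 1"])
  fix z assume "z \<in> ball p d"
  then have "cmod (h z - h p) < 1" using d(2)[of z] by (simp add: dist_norm dist_commute norm_minus_commute)
  then show "cmod (h z) \<le> (cmod (h p) + 1) * norm (z - p) ^ 0"
   using norm_triangle_ineq2[of "h z" "h p"] by simp
 qed
qed

lemma ordge_at: "ordge p (Suc k) h ==> h p = 0"
proof -
 assume "ordge p (Suc k) h"
 then obtain C r where "r > 0" "\<forall>z\<in>ball p r. cmod (h z) \<le> C * norm (z - p) ^ Suc k"
  unfolding ordge_def by blast
 moreover have "p \<in> ball p r" using calculation by simp
 ultimately have "cmod (h p) \<le> C * norm (p - p) ^ Suc k" by blast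
 then show ?thesis by simp
qed

text \<open>Mean value along the segment from \<open>p\<close>: the derivative in direction
  \<open>z - p\<close> has one factor \<open>norm (z - p)\<close> on top of the order
  \<open>k\<close> of the partial derivatives.\<close>

lemma ordge_Suc_from_partial:
 assumes U: "open U" "p \<in> U" and h: "hol_on h U" "h p = 0" and pd: "!!i. ordge p k (partial_deriv i h)"
 shows "ordge p (Suc k) h"
proof -
 obtain R where R: "R > 0" "ball p R \<subseteq> U" using U openE by blast
 have "\<forall>i. \<exists>C r. C \<ge> 0 \<and> r > 0 \<and> (\<forall>z\<in>ball p r. cmod (partial_deriv i h z) \<le> C * norm (z - p) ^ k)"
 proof
  fix i
  show "\<exists>C r. C \<ge> 0 \<and> r > 0 \<and> (\<forall>z\<in>ball p r. cmod (partial_deriv i h z) \<le> C * norm (z - p) ^ k)"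
   by (rule ordgeE[OF pd[of i] R(1)]) blast
 qed
 then obtain C r where Cr: "!!i. C i \<ge> 0" "!!i. r i > 0"
  "!!i z. z \<in> ball p (r i) ==> cmod (partial_deriv i h z) \<le> C i * norm (z - p) ^ k" by metis
 define \<rho> where "\<rho> = min R (Min (range r))"
 have \<rho>: "\<rho> > 0" "\<rho> \<le> R" "!!i. \<rho> \<le> r i"
  using R(1) Cr(2) by (auto simp: \<rho>_def Min_gr_iff intro: min.coboundedI2)
 show ?thesis
 proof (rule ordgeI[OF \<rho>(1), of _ _ "\<Sum>i\<in>UNIV. C i"])
  fix z assume z: "z \<in> ball p \<rho>"
  define v where "v = z - p"
  have nv: "norm v < \<rho>" using z by (simp add: v_def dist_norm norm_minus_commute)
  have "cmod (h (p + 1 *s v) - h p - 1 * 0) \<le> ((\<Sum>i\<in>UNIV. C i) * norm v ^ Suc k) * cmod 1"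
  proof (rule line_mean)
   fix s :: complex assume s: "s \<in> closed_segment 0 1"
   have "cmod s \<le> 1" using segment_bound(1)[OF s] by simp
   then have ns: "norm (s *s v) \<le> norm v" by (simp add: norm_smult_vec mult_left_le_one_le)
   then have in_ball: "p + s *s v \<in> ball p \<rho>" using nv by (simp add: dist_norm)
   then have "p + s *s v \<in> U" using R(2) \<rho>(2) by (meson order_trans subsetD subset_ball)
   then show hol: "hol_at h (p + s *s v)" using h(1) by (simp add: hol_on_iff_hol_at)
   have "cmod (dd v h (p + s *s v)) \<le> (\<Sum>i\<in>UNIV. norm v * (C i * norm v ^ k))"
    unfolding dd_eq_sum[OF hol]
   proof (rule sum_norm_le)
    fix i
    have "cmod (partial_deriv i h (p + s *s v)) \<le> C i * norm (s *s v) ^ k"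
     using Cr(3)[of "p + s *s v" i] in_ball \<rho>(3)[of i] by simp
    also have "\<dots> \<le> C i * norm v ^ k"
     using ns Cr(1) by (intro mult_left_mono power_mono) auto
    finally show "cmod (v $ i * partial_deriv i h (p + s *s v)) \<le> norm v * (C i * norm v ^ k)"
     unfolding norm_mult by (intro mult_mono) (auto simp: Finite_Cartesian_Product.norm_nth_le)
   qed
   also have "\<dots> = (\<Sum>i\<in>UNIV. C i) * norm v ^ Suc k"
    by (simp only: sum_distrib_right power_Suc) (simp add: mult_ac)
   finally show "cmod (dd v h (p + s *s v) - 0) \<le> (\<Sum>i\<in>UNIV. C i) * norm v ^ Suc k" by simp
  qed
  then show "cmod (h z) \<le> (\<Sum>i\<in>UNIV. C i) * norm (z - p) ^ Suc k"
   by (simp add: h(2) v_def)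
 qed
qed

text \<open>Cauchy's inequality on the ball around \<open>z\<close> of radius
  \<open>norm (z - p)\<close>: there \<open>h\<close> is bounded by a multiple of that radius to the
  power \<open>k + 1\<close>, and one power is lost in the division by the radius.\<close>

lemma ordge_dd:
 assumes U: "open U" "p \<in> U" and h: "hol_on h U" and o: "ordge p (Suc k) h"
 shows "ordge p k (dd v h)"
proof -
 obtain R where R: "R > 0" "ball p R \<subseteq> U" using U openE by blast
 obtain C r where Cr: "C \<ge> 0" "r > 0" "r \<le> R" "!!z. z \<in> ball p r ==> cmod (h z) \<le> C * norm (z - p) ^ Suc k"
  using ordgeE[OF o R(1)] by blast
 have b: "cmod (dd v h z) \<le> C * (norm (z - p) + \<rho>) ^ Suc k * norm v / \<rho>"
  if "z \<in> ball p (r/2)" "0 < \<rho>" "\<rho> < r/2" for z \<rho>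
 proof (rule dd_bound)
  have sub: "cball z \<rho> \<subseteq> ball p r"
  proof
   fix y assume "y \<in> cball z \<rho>"
   then show "y \<in> ball p r" using that dist_triangle[of p y z] by simp
  qed
  then show "hol_on h (cball z \<rho>)" using hol_on_subset[OF h] R Cr(3) by (meson subset_ball subset_trans)
  fix x assume x: "x \<in> cball z \<rho>"
  then have "norm (x - p) \<le> norm (z - p) + \<rho>"
   using norm_triangle_ineq[of "x - z" "z - p"] by (simp add: dist_norm norm_minus_commute)
  then have "C * norm (x - p) ^ Suc k \<le> C * (norm (z - p) + \<rho>) ^ Suc k"
   using Cr(1) by (intro mult_left_mono power_mono) auto
  then show "cmod (h x) \<le> C * (norm (z - p) + \<rho>) ^ Suc k"
   using Cr(4)[of x] sub x by force
 qed (use that in auto)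
 show ?thesis
 proof (rule ordgeI[of "r/2" _ _ "C * 2 ^ Suc k * norm v"])
  fix z assume z: "z \<in> ball p (r/2)"
  show "cmod (dd v h z) \<le> C * 2 ^ Suc k * norm v * norm (z - p) ^ k"
  proof (cases "z = p")
   case False
   define \<rho> where "\<rho> = norm (z - p)"
   have "0 < \<rho>" "\<rho> < r / 2" using False z by (auto simp: \<rho>_def dist_norm norm_minus_commute)
   then show ?thesis
    using b[OF z, of \<rho>] by (simp add: \<rho>_def[symmetric] mult_2[symmetric] power_mult_distrib mult_ac)
  next
   \<comment> \<open>At \<open>p\<close> itself there is no such radius, so the bound for small
     radii is passed to the limit; for \<open>k = 0\<close> a constant remains, as
     \<open>0 ^ 0 = 1\<close>.\<close>
   case True
   have "cmod (dd v h p) \<le> C * norm v * \<rho> ^ k" if "0 < \<rho>" "\<rho> < r/2" for \<rho>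
    using b[of p \<rho>] that Cr(2) by (simp add: mult_ac)
   then have ev: "\<forall>\<^sub>F \<rho> in at_right 0. cmod (dd v h p) \<le> C * norm v * \<rho> ^ k"
    unfolding eventually_at_right_field using Cr(2) by (intro exI[of _ "r/2"]) auto
   have "((%\<rho>. C * norm v * \<rho> ^ k) \<longlongrightarrow> C * norm v * 0 ^ k) (at_right 0)"
    by (intro tendsto_intros)
   then have "cmod (dd v h p) \<le> C * norm v * 0 ^ k"
    by (rule tendsto_lowerbound[OF _ ev]) simp
   also have "\<dots> \<le> C * 2 ^ Suc k * norm v * 0 ^ k"
   proof -
    have "C * norm v * 1 \<le> C * norm v * 2 ^ Suc k"
     using Cr(1) by (intro mult_left_mono one_le_power) auto
    then show ?thesis by (cases k) (simp_all add: mult_ac)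
   qed
   finally show ?thesis using True by simp
  qed
 qed (use Cr in auto)
qed

lemma ordge_compose:
 assumes "ordge p k h" "F p = p" "isCont F p" "!!i. ordge p 1 (%z. F z $ i - p $ i)"
 shows "ordge p k (%z. h (F z))"
proof -
 obtain C r where Cr: "C \<ge> 0" "r > 0" "r \<le> 1" "!!z. z \<in> ball p r ==> cmod (h z) \<le> C * norm (z - p) ^ k"
  using ordgeE[OF assms(1) real_0_less_1] by blast
 have "\<exists>d>0. \<forall>x. dist x p < d --> dist (F x) (F p) < r"
  using assms(3) Cr(2) unfolding continuous_at_eps_delta by simp
 then obtain d where d: "d > 0" "!!x. dist x p < d ==> dist (F x) p < r" using assms(2) by auto
 have "\<forall>i. \<exists>D s. D \<ge> 0 \<and> s > 0 \<and> (\<forall>z\<in>ball p s. cmod (F z $ i - p $ i) \<le> D * norm (z - p))"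
 proof
  fix i
  show "\<exists>D s. D \<ge> 0 \<and> s > 0 \<and> (\<forall>z\<in>ball p s. cmod (F z $ i - p $ i) \<le> D * norm (z - p))"
   by (rule ordgeE[OF assms(4)[of i] d(1)]) (unfold power_one_right, blast)
 qed
 then obtain D s where Ds: "!!i. D i \<ge> 0" "!!i. s i > 0"
  "!!i z. z \<in> ball p (s i) ==> cmod (F z $ i - p $ i) \<le> D i * norm (z - p)" by metis
 define \<rho> where "\<rho> = min d (Min (range s))"
 have \<rho>: "\<rho> > 0" "\<rho> \<le> d" "!!i. \<rho> \<le> s i"
  using d(1) Ds(2) by (auto simp: \<rho>_def Min_gr_iff intro: min.coboundedI2)
 show ?thesis
 proof (rule ordgeI[OF \<rho>(1), of _ _ "C * (\<Sum>i\<in>UNIV. D i) ^ k"])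
  fix z assume z: "z \<in> ball p \<rho>"
  have "norm (F z - p) \<le> (\<Sum>i\<in>UNIV. norm ((F z - p) $ i))"
   unfolding norm_vec_def by (rule L2_set_le_sum) simp
  also have "\<dots> \<le> (\<Sum>i\<in>UNIV. D i * norm (z - p))"
  proof (rule sum_mono)
   fix i
   have "z \<in> ball p (s i)" using z \<rho>(3)[of i] by simp
   then show "norm ((F z - p) $ i) \<le> D i * norm (z - p)" using Ds(3)[of z i] by simp
  qed
  finally have le: "norm (F z - p) \<le> (\<Sum>i\<in>UNIV. D i) * norm (z - p)" by (simp add: sum_distrib_right)
  have "F z \<in> ball p r" using d(2)[of z] z \<rho>(2) by (simp add: dist_commute)
  then have "cmod (h (F z)) \<le> C * norm (F z - p) ^ k" by (rule Cr(4))
  also have "\<dots> \<le> C * ((\<Sum>i\<in>UNIV. D i) * norm (z - p)) ^ k"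
   by (intro mult_left_mono power_mono le Cr(1)) auto
  finally show "cmod (h (F z)) \<le> C * (\<Sum>i\<in>UNIV. D i) ^ k * norm (z - p) ^ k"
   by (simp add: power_mult_distrib)
 qed
qed

lemma ordge_1:
 assumes "open U" "p \<in> U" "hol_on h U" "h p = 0"
 shows "ordge p 1 h"
 unfolding One_nat_def
proof (rule ordge_Suc_from_partial[OF assms])
 fix i
 have "hol_at (partial_deriv i h) p"
  using hol_on_partial_deriv[OF assms(1,3)] assms(2) by (simp add: hol_on_iff_hol_at)
 then show "ordge p 0 (partial_deriv i h)"
  by (intro ordge_0 hol_at_isCont)
qed

text \<open>On the ball of radius \<open>\<rho>\<close>, \<open>nu_bound\<close> yields a multiple
  of \<open>\<rho> ^ (Suc n - mi_deg (\<alpha> j))\<close>, and the exponent is positive.\<close>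

lemma nu_eq_0:
 assumes U: "open U" "p \<in> U" and h: "hol_on h U" and o: "ordge p (Suc n) h" and j: "mi_deg (\<alpha> j) \<le> n"
 shows "nu \<alpha> p j h = 0"
proof -
 obtain c where c: "c \<ge> 0" "!!h r M. r > 0 ==> r \<le> 1 ==> hol_on h (ball p r) ==> (!!x. x\<in>ball p r ==> cmod (h x) \<le> M) ==>
   cmod (nu \<alpha> p j h) \<le> c * M / r ^ mi_deg (\<alpha> j)"
  using nu_bound[of p \<alpha> j] by blast
 obtain R0 where R0: "R0 > 0" "ball p R0 \<subseteq> U" using U openE by blast
 define R where "R = min R0 1"
 have R: "R > 0" "R \<le> 1" "ball p R \<subseteq> U" using R0 by (auto simp: R_def)
 obtain C r where Cr: "C \<ge> 0" "r > 0" "r \<le> R" "!!z. z \<in> ball p r ==> cmod (h z) \<le> C * norm (z - p) ^ Suc n"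
  using ordgeE[OF o R(1)] by blast
 have le: "cmod (nu \<alpha> p j h) \<le> c * C * \<rho>" if "0 < \<rho>" "\<rho> < r" for \<rho>
 proof -
  have "cmod (nu \<alpha> p j h) \<le> c * (C * \<rho> ^ Suc n) / \<rho> ^ mi_deg (\<alpha> j)"
  proof (rule c(2))
   show "hol_on h (ball p \<rho>)"
    by (rule hol_on_subset[OF h]) (use that Cr R in \<open>meson le_less_trans less_imp_le order_trans subset_ball\<close>)
   fix x assume x: "x \<in> ball p \<rho>"
   then have "cmod (h x) \<le> C * norm (x - p) ^ Suc n" using Cr(4) that by simp
   also have "\<dots> \<le> C * \<rho> ^ Suc n"
    using x Cr(1) by (intro mult_left_mono power_mono) (auto simp: dist_norm norm_minus_commute)
   finally show "cmod (h x) \<le> C * \<rho> ^ Suc n" .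
  qed (use that Cr R in auto)
  also have "\<dots> = c * C * (\<rho> ^ Suc n / \<rho> ^ mi_deg (\<alpha> j))" by simp
  also have "\<rho> ^ Suc n / \<rho> ^ mi_deg (\<alpha> j) = \<rho> ^ (Suc n - mi_deg (\<alpha> j))"
   using that j by (simp add: power_diff)
  also have "c * C * \<rho> ^ (Suc n - mi_deg (\<alpha> j)) \<le> c * C * \<rho> ^ 1"
   using that Cr R c(1) j by (intro mult_left_mono power_decreasing) auto
  finally show ?thesis by simp
 qed
 then have ev: "\<forall>\<^sub>F \<rho> in at_right 0. cmod (nu \<alpha> p j h) \<le> c * C * \<rho>"
  unfolding eventually_at_right_field using Cr(2) by (intro exI[of _ r]) auto
 have "((%\<rho>. c * C * \<rho>) \<longlongrightarrow> c * C * 0) (at_right 0)"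
  by (intro tendsto_intros)
 then have "cmod (nu \<alpha> p j h) \<le> c * C * 0"
  by (rule tendsto_lowerbound[OF _ ev]) simp
 then show ?thesis by simp
qed

lemma exp_fun_bound_on:
 assumes "bounded S"
 obtains E where "E > 0" "!!z. z \<in> S ==> cmod (exp_fun w z) \<le> E"
proof -
 obtain B where B: "!!z. z \<in> S ==> norm z \<le> B" using assms bounded_iff by blast
 have "cmod (exp_fun w z) \<le> exp (norm w * B)" if "z \<in> S" for z
  using exp_fun_le[of w z] mult_left_mono[OF B[OF that], of "norm w"] by (smt (verit) exp_le_cancel_iff norm_ge_zero)
 then show ?thesis using that[of "exp (norm w * B)"] by simp
qed

text \<open>When the coefficients vanish, \<open>h\<close> is its own Taylor remainder. A disc
  larger than the displacement by the factor \<open>R / norm (z - p)\<close> gives the growth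
  rate.\<close>

lemma ordge_Suc_iff_nu:
 assumes \<alpha>: "mi_numbering (\<alpha> :: nat => 'd::finite => nat)" and U: "open U" "p \<in> U" and h: "hol_on h U"
  and nu0: "!!j. j < rE TYPE('d) n ==> nu \<alpha> p j h = 0"
 shows "ordge p (Suc n) h"
proof -
 have "\<exists>R>0. cball p R \<subseteq> U" using open_contains_cball_eq[OF U(1)] U(2) by simp
 then obtain R where R: "R > 0" "cball p R \<subseteq> U" by blast
 let ?g = "%z. h z * exp_fun (- p) z"
 have "continuous_on (cball p R) ?g"
  by (rule hol_on_continuous_on[OF hol_on_subset[OF hol_on_mult_exp[OF h] R(2)]])
 then have "bounded (?g ` cball p R)"
  by (intro compact_imp_bounded compact_continuous_image) auto
 then obtain M where M: "!!z. z \<in> cball p R ==> cmod (?g z) \<le> M"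
  unfolding bounded_iff by blast
 have M0: "M \<ge> 0" using M[of p] R(1) norm_ge_zero[of "?g p"] by (meson centre_in_cball less_imp_le order_trans)
 obtain E where E: "E > 0" "!!z. z \<in> cball p R ==> cmod (exp_fun p z) \<le> E"
  using exp_fun_bound_on[OF bounded_cball] by blast
 show ?thesis
 proof (rule ordgeI[of "R/2" _ _ "E * M * 2 / R ^ Suc n"])
  fix z assume z: "z \<in> ball p (R/2)"
  show "cmod (h z) \<le> E * M * 2 / R ^ Suc n * norm (z - p) ^ Suc n"
  proof (cases "z = p")
   case True
   \<comment> \<open>At the centre only the coefficient of the constant multi-index matters, and
     that one has number 0.\<close>
   have "\<alpha> 0 = (%_. 0)" using \<alpha> by (simp add: mi_numbering_def)
   moreover have "nu \<alpha> p 0 h = 0" using nu0 rE_pos by blast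
   ultimately have "h p * exp_fun (- p) p = 0"
    using sc_pos[of "%_. 0" p] by (simp add: nu_def mi_deg_def)
   then show ?thesis using True exp_fun_nonzero[of "- p" p] by simp
  next
   case False
   define v where "v = z - p"
   \<comment> \<open>The largest dilation that keeps the disc in direction \<open>v\<close> inside
     \<open>cball p R\<close>. It exceeds 2, so the factor \<open>\<rho> / (\<rho> - 1)\<close> of
     the remainder is at most 2.\<close>
   define \<rho> where "\<rho> = R / norm v"
   have v: "norm v > 0" "norm v < R/2" using False z by (auto simp: v_def dist_norm norm_minus_commute)
   then have \<rho>: "\<rho> > 2" unfolding \<rho>_def by (simp add: field_simps)
   have "cmod (h (p + v) - (\<Sum>i<rE TYPE('d) n. nu \<alpha> p i h * u_fun \<alpha> p i (p + v)))
     \<le> cmod (exp_fun p (p + v)) * (M / \<rho> ^ Suc n * (\<rho> / (\<rho> - 1)))"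
   proof (rule nu_remainder[OF \<alpha> U(1) h])
    fix s :: complex assume "cmod s \<le> \<rho>"
    then have "p + s *s v \<in> cball p R"
     using v by (simp add: \<rho>_def dist_norm norm_smult_vec field_simps)
    then show "p + s *s v \<in> U \<and> cmod (h (p + s *s v) * exp_fun (- p) (p + s *s v)) \<le> M"
     using M R by blast
   qed (use \<rho> in simp)
   also have "\<dots> \<le> E * (M / \<rho> ^ Suc n * 2)"
    using E(1) E(2)[of z] z R(1) \<rho> M0 by (intro mult_mono) (auto simp: v_def field_simps)
   also have "\<dots> = E * M * 2 / R ^ Suc n * norm v ^ Suc n"
    using v by (simp add: \<rho>_def power_divide)
   finally show ?thesis by (simp add: nu0 v_def)
  qed
 qed (use R in auto)
qed

subsection \<open>Composition operators and derivations on jets\<close>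

lemma
 fixes h :: "complex ^ 'd => complex"
 assumes \<alpha>: "mi_numbering (\<alpha> :: nat => 'd => nat)" and U: "open U" "p \<in> U" and h: "hol_on h U"
 shows hol_on_jet_remainder: "hol_on (%z. h z - (\<Sum>i<rE TYPE('d) n. nu \<alpha> p i h * u_fun \<alpha> p i z)) U"
  and ordge_jet_remainder: "ordge p (Suc n) (%z. h z - (\<Sum>i<rE TYPE('d) n. nu \<alpha> p i h * u_fun \<alpha> p i z))"
proof -
 let ?S = "%z. \<Sum>i<rE TYPE('d) n. nu \<alpha> p i h * u_fun \<alpha> p i z"
 have inj: "inj \<alpha>" using \<alpha> by (simp add: mi_numbering_def bij_is_inj)
 have hu: "hol_on (u_fun \<alpha> p i) U" for i by (simp add: hol_on_iff_hol_at hol_at_u_fun)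
 have hs: "hol_on ?S U"
  by (auto simp: hol_on_iff_hol_at intro!: conjunct1[OF hol_at_sum] hol_at_cmult hol_at_u_fun)
 show hol: "hol_on (%z. h z - ?S z) U"
  using h hs by (auto simp: hol_on_iff_hol_at intro!: hol_at_diff)
 show "ordge p (Suc n) (%z. h z - ?S z)"
 proof (rule ordge_Suc_iff_nu[OF \<alpha> U hol])
  fix j assume j: "j < rE TYPE('d) n"
  have "nu \<alpha> p j ?S = (\<Sum>i<rE TYPE('d) n. nu \<alpha> p i h * nu \<alpha> p j (u_fun \<alpha> p i))"
   by (rule nu_sum[OF U]) (use hu in auto)
  also have "\<dots> = nu \<alpha> p j h" using j by (simp add: nu_u_fun[OF inj] if_distrib cong: if_cong)
  finally show "nu \<alpha> p j (%z. h z - ?S z) = 0"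
   using nu_diff[OF U h hs] by simp
 qed
qed

lemma hol_on_compose:
 assumes "hol_on h U" "!!i. hol_on (%z. F z $ i) W" "F ` W \<subseteq> U"
 shows "hol_on (%z. h (F z)) W"
 unfolding hol_on_iff_hol_at
proof
 fix z assume z: "z \<in> W"
 show "hol_at (%z. h (F z)) z"
  by (rule hol_at_compose[where h = h and F = F]) (use assms z in \<open>auto simp: hol_on_iff_hol_at\<close>)
qed

text \<open>\<open>h\<close> differs from its jet by a function vanishing to order
  \<open>n + 1\<close>. As \<open>F\<close> fixes \<open>p\<close>, composition with
  \<open>F\<close> preserves this order, so the difference is invisible to \<open>nu\<close> in
  degrees up to \<open>n\<close>.\<close>

lemma nu_compose:
 fixes h :: "complex ^ 'd => complex" and F :: "complex ^ 'd => complex ^ 'd"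
 assumes \<alpha>: "mi_numbering (\<alpha> :: nat => 'd => nat)" and U: "open U" "p \<in> U" and h: "hol_on h U"
  and W: "open W" "p \<in> W" and F: "!!i. hol_on (%z. F z $ i) W" "F p = p" and j: "j < rE TYPE('d) n"
 shows "nu \<alpha> p j (%z. h (F z)) = (\<Sum>i<rE TYPE('d) n. nu \<alpha> p i h * nu \<alpha> p j (%z. u_fun \<alpha> p i (F z)))"
proof -
 have "continuous_on W (%z. \<chi> i. F z $ i)"
  by (rule continuous_on_vec_lambda, rule hol_on_continuous_on, rule F(1))
 then have cF: "continuous_on W F" by (simp add: vec_lambda_eta)
 define W' where "W' = W \<inter> F -` U"
 have W': "open W'" "p \<in> W'" "W' \<subseteq> W" "F ` W' \<subseteq> U"
  using continuous_open_preimage[OF cF W(1) U(1)] W U F(2) by (auto simp: W'_def)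
 have F': "hol_on (%z. F z $ i) W'" for i using hol_on_subset[OF F(1) W'(3)] .
 let ?g = "%z. h z - (\<Sum>i<rE TYPE('d) n. nu \<alpha> p i h * u_fun \<alpha> p i z)"
 note g = hol_on_jet_remainder[OF \<alpha> U h, of n] ordge_jet_remainder[OF \<alpha> U h, of n]
 have "ordge p (Suc n) (%z. ?g (F z))"
 proof (rule ordge_compose[where h = ?g and F = F, OF g(2) F(2)])
  show "isCont F p" using cF W by (simp add: continuous_on_eq_continuous_at)
  fix i
  have "hol_on (%z. F z $ i - p $ i) W"
   using F(1) by (auto simp: hol_on_iff_hol_at intro!: hol_at_diff hol_at_const)
  then show "ordge p 1 (%z. F z $ i - p $ i)"
   by (rule ordge_1[OF W]) (simp add: F(2))
 qed
 moreover have "mi_deg (\<alpha> j) \<le> n" using numbering_image[OF \<alpha>] j by blast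
 ultimately have "nu \<alpha> p j (%z. ?g (F z)) = 0"
  using nu_eq_0[OF W'(1,2) hol_on_compose[OF g(1) F' W'(4)]] by blast
 moreover have huF: "hol_on (%z. u_fun \<alpha> p i (F z)) W'" for i
  by (rule hol_on_compose[OF _ F', of _ UNIV]) (auto simp: hol_on_iff_hol_at hol_at_u_fun)
 moreover have "nu \<alpha> p j (%z. h (F z) - (\<Sum>i<rE TYPE('d) n. nu \<alpha> p i h * u_fun \<alpha> p i (F z)))
   = nu \<alpha> p j (%z. h (F z)) - nu \<alpha> p j (%z. \<Sum>i<rE TYPE('d) n. nu \<alpha> p i h * u_fun \<alpha> p i (F z))"
  by (rule nu_diff[OF W'(1,2) hol_on_compose[OF h F' W'(4)]])
    (use huF in \<open>auto simp: hol_on_iff_hol_at intro!: conjunct1[OF hol_at_sum] hol_at_cmult\<close>)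
 moreover have "nu \<alpha> p j (%z. \<Sum>i<rE TYPE('d) n. nu \<alpha> p i h * u_fun \<alpha> p i (F z))
   = (\<Sum>i<rE TYPE('d) n. nu \<alpha> p i h * nu \<alpha> p j (%z. u_fun \<alpha> p i (F z)))"
  by (rule nu_sum[OF W'(1,2)]) (use huF in auto)
 ultimately show ?thesis by simp
qed

definition Lie :: "(complex ^ 'd => complex ^ 'd) => (complex ^ 'd => complex) => complex ^ 'd => complex" where
 "Lie V h z = (\<Sum>k\<in>UNIV. V z $ k * partial_deriv k h z)"

lemma Lie_eq_dd: "hol_at h z ==> Lie V h z = dd (V z) h z"
 by (simp add: Lie_def dd_eq_sum)

lemma hol_on_Lie:
 assumes "open U" "hol_on h U" "!!i. hol_on (%z. V z $ i) U"
 shows "hol_on (Lie V h) U"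
 unfolding Lie_def[abs_def] hol_on_iff_hol_at
 using hol_on_partial_deriv[OF assms(1,2)] assms(3)
 by (auto simp: hol_on_iff_hol_at intro!: conjunct1[OF hol_at_sum] hol_at_mult)

text \<open>Differentiation loses one order of vanishing; the coefficients of \<open>V\<close>,
  which vanish at \<open>p\<close>, restore it.\<close>

lemma ordge_Lie:
 assumes U: "open U" "p \<in> U" and h: "hol_on h U" and V: "!!i. hol_on (%z. V z $ i) U" "V p = 0"
  and o: "ordge p k h"
 shows "ordge p k (Lie V h)"
 unfolding Lie_def[abs_def]
proof (rule ordge_sum)
 fix i
 have V1: "ordge p 1 (%z. V z $ i)" by (rule ordge_1[OF U V(1)]) (simp add: V(2))
 show "ordge p k (%z. V z $ i * partial_deriv i h z)"
 proof (cases k)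
  case 0
  have "hol_at (%z. V z $ i * partial_deriv i h z) p"
   using V(1) hol_on_partial_deriv[OF U(1) h] U(2) by (auto simp: hol_on_iff_hol_at intro!: hol_at_mult)
  then show ?thesis unfolding 0 by (intro ordge_0 hol_at_isCont)
 next
  case (Suc l)
  have "ordge p l (partial_deriv i h)"
   using ordge_dd[OF U h, of l "axis i 1"] o Suc by (simp add: partial_deriv_eq_dd[abs_def])
  from ordge_mult[OF V1 this] show ?thesis by (simp add: Suc)
 qed
qed simp

lemma nu_Lie:
 fixes h :: "complex ^ 'd => complex"
 assumes \<alpha>: "mi_numbering (\<alpha> :: nat => 'd => nat)" and U: "open U" "p \<in> U" and h: "hol_on h U"
  and V: "!!i. hol_on (%z. V z $ i) U" "V p = 0" and j: "j < rE TYPE('d) n"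
 shows "nu \<alpha> p j (Lie V h) = (\<Sum>i<rE TYPE('d) n. nu \<alpha> p i h * nu \<alpha> p j (Lie V (u_fun \<alpha> p i)))"
proof -
 let ?S = "%z. \<Sum>i<rE TYPE('d) n. nu \<alpha> p i h * u_fun \<alpha> p i z"
 let ?g = "%z. h z - ?S z"
 note g = hol_on_jet_remainder[OF \<alpha> U h, of n] ordge_jet_remainder[OF \<alpha> U h, of n]
 have "mi_deg (\<alpha> j) \<le> n" using numbering_image[OF \<alpha>] j by blast
 then have 0: "nu \<alpha> p j (Lie V ?g) = 0"
  using nu_eq_0[OF U hol_on_Lie[OF U(1) g(1) V(1)] ordge_Lie[OF U g(1) V g(2)]] by blast
 have hu: "hol_on (u_fun \<alpha> p i) U" for i by (simp add: hol_on_iff_hol_at hol_at_u_fun)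
 have hL: "hol_on (Lie V (u_fun \<alpha> p i)) U" for i by (rule hol_on_Lie[OF U(1) hu V(1)])
 have eq: "Lie V ?g z = Lie V h z - (\<Sum>i<rE TYPE('d) n. nu \<alpha> p i h * Lie V (u_fun \<alpha> p i) z)" if "z \<in> U" for z
 proof -
  have hz: "hol_at h z" using h that by (simp add: hol_on_iff_hol_at)
  have sz: "hol_at ?S z" "dd v ?S z = (\<Sum>i<rE TYPE('d) n. nu \<alpha> p i h * dd v (u_fun \<alpha> p i) z)" for v
   using hol_at_sum[of "{..<rE TYPE('d) n}" "%i z. nu \<alpha> p i h * u_fun \<alpha> p i z" z v]
   by (auto simp: hol_at_cmult hol_at_u_fun dd_cmult)
  have gz: "hol_at ?g z" by (rule hol_at_diff[OF hz sz(1)])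
  show ?thesis
   unfolding Lie_eq_dd[OF gz] Lie_eq_dd[OF hz] Lie_eq_dd[OF hol_at_u_fun] dd_diff[OF hz sz(1)] sz(2) ..
 qed
 have hs: "hol_on (%z. \<Sum>i<rE TYPE('d) n. nu \<alpha> p i h * Lie V (u_fun \<alpha> p i) z) U"
  using hL by (auto simp: hol_on_iff_hol_at intro!: conjunct1[OF hol_at_sum] hol_at_cmult)
 have "nu \<alpha> p j (Lie V ?g) = nu \<alpha> p j (%z. Lie V h z - (\<Sum>i<rE TYPE('d) n. nu \<alpha> p i h * Lie V (u_fun \<alpha> p i) z))"
  by (rule nu_cong[OF U eq])
 also have "\<dots> = nu \<alpha> p j (Lie V h) - nu \<alpha> p j (%z. \<Sum>i<rE TYPE('d) n. nu \<alpha> p i h * Lie V (u_fun \<alpha> p i) z)"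
  by (rule nu_diff[OF U hol_on_Lie[OF U(1) h V(1)] hs])
 also have "nu \<alpha> p j (%z. \<Sum>i<rE TYPE('d) n. nu \<alpha> p i h * Lie V (u_fun \<alpha> p i) z)
   = (\<Sum>i<rE TYPE('d) n. nu \<alpha> p i h * nu \<alpha> p j (Lie V (u_fun \<alpha> p i)))"
  by (rule nu_sum[OF U]) (use hL in auto)
 finally show ?thesis using 0 by simp
qed

section \<open>The flow\<close>

subsection \<open>Integrals depending holomorphically on parameters\<close>

text \<open>The two functions are compared after translating one of them, so that both are
  differentiated at \<open>w0\<close>. The Cauchy estimate for their difference then needs only
  uniform continuity of \<open>g\<close>.\<close>

lemma dd_joint_continuous:
 fixes g :: "'a::metric_space => complex ^ 'd => complex"
 assumes U: "open U" and K: "compact K" and c: "continuous_on (U \<times> K) (%(w, t). g t w)"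
  and h: "!!t. t \<in> K ==> hol_on (g t) U"
 shows "continuous_on (U \<times> K) (%(w, t). dd v (g t) w)"
 unfolding continuous_on_iff
proof (intro ballI allI impI)
 fix x :: "(complex ^ 'd) \<times> 'a" and e :: real
 assume x: "x \<in> U \<times> K" and e: "e > 0"
 obtain w0 t0 where x0: "x = (w0, t0)" "w0 \<in> U" "t0 \<in> K" using x by auto
 have "\<exists>R>0. cball w0 R \<subseteq> U" using open_contains_cball_eq[OF U] x0 by simp
 then obtain R0 where R0: "R0 > 0" "cball w0 R0 \<subseteq> U" by blast
 define R where "R = R0 / 2"
 have R: "R > 0" "cball w0 (2 * R) \<subseteq> U" using R0 by (auto simp: R_def)
 have "uniformly_continuous_on (cball w0 (2 * R) \<times> K) (%(w, t). g t w)"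
  by (intro compact_uniformly_continuous continuous_on_subset[OF c] compact_Times compact_cball K) (use R in auto)
 moreover define e' where "e' = e * R / (2 * (norm v + 1))"
 moreover have nv: "norm v + 1 > 0" by (simp add: add_nonneg_pos)
 then have "e' > 0" using e R by (simp add: e'_def)
 ultimately obtain \<delta> where \<delta>: "\<delta> > 0" "!!y y'. y \<in> cball w0 (2 * R) \<times> K ==> y' \<in> cball w0 (2 * R) \<times> K ==> dist y' y < \<delta> ==>
   dist ((%(w, t). g t w) y') ((%(w, t). g t w) y) < e'"
  by (elim uniformly_continuous_onE[of _ _ e']) auto
 show "\<exists>d>0. \<forall>x'\<in>U \<times> K. dist x' x < d --> dist ((%(w, t). dd v (g t) w) x') ((%(w, t). dd v (g t) w) x) < e"
 proof (intro exI[of _ "min \<delta> R"] conjI ballI impI)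
  fix x' assume x': "x' \<in> U \<times> K" "dist x' x < min \<delta> R"
  obtain w t where wt: "x' = (w, t)" "w \<in> U" "t \<in> K" using x' by auto
  have d1: "dist w w0 < R" using dist_fst_le[of x' x] x' by (simp add: wt x0)
  let ?H = "%y. g t (y + (w - w0)) - g t0 y"
  have mem: "y + (w - w0) \<in> cball w0 (2 * R)" "y \<in> cball w0 (2 * R)" if "y \<in> cball w0 R" for y
  proof -
   have "norm (w0 - (y + (w - w0))) \<le> norm (w0 - y) + norm (w0 - w)"
    using norm_triangle_ineq[of "w0 - y" "w0 - w"] by (simp add: algebra_simps)
   then show "y + (w - w0) \<in> cball w0 (2 * R)" "y \<in> cball w0 (2 * R)"
    using that d1 R by (auto simp: dist_norm norm_minus_commute)
  qed
  have hH: "hol_at (g t) (y + (w - w0))" "hol_at (g t0) y" if "y \<in> cball w0 R" for y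
   using mem[OF that] R h[OF wt(3)] h[OF x0(3)] by (auto simp: hol_on_iff_hol_at)
  have "cmod (dd v ?H w0) \<le> e' * norm v / R"
  proof (rule dd_bound)
   show "hol_on ?H (cball w0 R)"
    using hH by (auto simp: hol_on_iff_hol_at intro!: hol_at_diff hol_at_translate)
   fix y assume y: "y \<in> cball w0 R"
   have "dist (y + (w - w0), t) (y, t0) = dist x' x"
    by (simp add: wt x0 dist_Pair_Pair dist_norm)
   then show "cmod (g t (y + (w - w0)) - g t0 y) \<le> e'"
    using \<delta>(2)[of "(y, t0)" "(y + (w - w0), t)"] mem[OF y] wt x0 x' by (simp add: dist_norm)
  qed (use R in simp)
  also have "dd v ?H w0 = dd v (g t) w - dd v (g t0) w0"
   using hH[of w0] R by (subst dd_diff) (auto simp: dd_translate hol_at_translate)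
  also have "e' * norm v / R = e / 2 * (norm v / (norm v + 1))"
   using R by (simp add: e'_def)
  also have "\<dots> \<le> e / 2 * 1"
   using e nv by (intro mult_left_mono) (auto simp: divide_le_eq)
  finally show "dist ((%(w, t). dd v (g t) w) x') ((%(w, t). dd v (g t) w) x) < e"
   using e by (simp add: wt x0 dist_norm)
 qed (use \<delta> R in auto)
qed

text \<open>Osgood's lemma leaves continuity in the parameter and holomorphy in one coordinate; the
  latter is differentiation under the integral in one complex variable.\<close>

lemma hol_on_integral:
 fixes g :: "real => complex ^ 'd => complex"
 assumes U: "open U" and c: "continuous_on (U \<times> {a..b}) (%(w, t). g t w)"
  and h: "!!t. t \<in> {a..b} ==> hol_on (g t) U"
 shows "hol_on (%w. integral {a..b} (%t. g t w)) U"
proof (rule osgood[OF U])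
 show "continuous_on U (%w. integral {a..b} (%t. g t w))"
  using integral_continuous_on_param[of U a b "%w t. g t w"] c by (simp add: cbox_interval)
 fix z and k :: 'd assume z: "z \<in> U"
 let ?v = "axis k 1 :: complex ^ 'd"
 have "\<exists>R>0. ball z R \<subseteq> U" using open_contains_ball_eq[OF U] z by simp
 then obtain R where R: "R > 0" "ball z R \<subseteq> U" by blast
 have mem: "z + s *s ?v \<in> U" if "s \<in> ball 0 R" for s :: complex
  using that R by (auto simp: subset_iff dist_norm norm_smult_vec norm_axis_complex)
 have "(%s. integral (cbox a b) (%t. g t (z + s *s ?v))) holomorphic_on ball 0 R"
 proof (rule leibniz_rule_holomorphic)
  fix s :: complex and t :: real assume st: "s \<in> ball 0 R" "t \<in> cbox a b"
  then have "hol_at (g t) (z + s *s ?v)"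
   using h mem[OF st(1)] by (simp add: cbox_interval hol_on_iff_hol_at)
  from hol_at_DERIV_line[OF this]
  show "((%s. g t (z + s *s ?v)) has_field_derivative dd ?v (g t) (z + s *s ?v)) (at s within ball 0 R)"
   by (rule has_field_derivative_at_within)
 next
  fix s :: complex assume s: "s \<in> ball 0 R"
  have "continuous_on {a..b} (%t. (%(w, t). g t w) (z + s *s ?v, t))"
   by (rule continuous_on_compose2[OF c]) (use mem[OF s] in \<open>auto intro!: continuous_intros\<close>)
  then show "(%t. g t (z + s *s ?v)) integrable_on cbox a b"
   by (simp add: cbox_interval integrable_continuous_real)
 next
  have "continuous_on (ball 0 R \<times> {a..b}) (%x. (%(w, t). dd ?v (g t) w) (z + fst x *s ?v, snd x))"
  proof (rule continuous_on_compose2[OF dd_joint_continuous[OF U _ c h]])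
   have "continuous_on (fst ` (ball 0 R \<times> {a..b})) (%s. z + s *s ?v)"
    by (rule continuous_on_line)
   then have "continuous_on (ball 0 R \<times> {a..b}) (%x. z + fst x *s ?v)"
    by (rule continuous_on_compose2) (auto intro!: continuous_intros)
   then show "continuous_on (ball 0 R \<times> {a..b}) (%x. (z + fst x *s ?v, snd x))"
    by (intro continuous_on_Pair continuous_on_snd continuous_on_id)
   show "(%x. (z + fst x *s ?v, snd x)) ` (ball 0 R \<times> {a..b}) \<subseteq> U \<times> {a..b}"
    using mem by auto
  qed auto
  then show "continuous_on (ball 0 R \<times> cbox a b) (%(s, t). dd ?v (g t) (z + s *s ?v))"
   by (simp add: cbox_interval case_prod_unfold)
 qed simp
 then show "(%s. integral {a..b} (%t. g t (z + s *s ?v))) field_differentiable at 0"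
  using R(1) holomorphic_on_imp_differentiable_at[OF _ open_ball, of _ 0 R 0] by (simp add: cbox_interval)
qed

subsection \<open>Uniqueness of trajectories\<close>

lemma gronwall_real:
 fixes g :: "real => real"
 assumes c: "continuous_on {0..T} g" and g0: "g 0 = 0" and pos: "!!t. t \<in> {0..T} ==> g t \<ge> 0"
  and d: "!!t. 0 < t ==> t < T ==> \<exists>g'. (g has_real_derivative g') (at t) \<and> g' \<le> L * g t"
  and t: "t \<in> {0..T}"
 shows "g t = 0"
proof -
 \<comment> \<open>The weight turns the differential inequality into monotonicity.\<close>
 have "g t * exp (- L * t) \<le> g 0 * exp (- L * 0)"
 proof (rule DERIV_nonpos_imp_decreasing_open[of 0 t "%t. g t * exp (- L * t)"])
  fix s assume s: "0 < s" "s < t"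
  then obtain g' where g': "(g has_real_derivative g') (at s)" "g' \<le> L * g s" using d[of s] t by auto
  have "((%t. g t * exp (- L * t)) has_real_derivative (g' - L * g s) * exp (- L * s)) (at s)"
   by (rule derivative_eq_intros g' refl)+ (simp add: algebra_simps)
  moreover have "(g' - L * g s) * exp (- L * s) \<le> 0"
   using g'(2) by (simp add: mult_nonpos_nonneg)
  ultimately show "\<exists>y. ((%t. g t * exp (- L * t)) has_real_derivative y) (at s) \<and> y \<le> 0" by blast
 next
  show "continuous_on {0..t} (%t. g t * exp (- L * t))"
   using t by (intro continuous_intros continuous_on_subset[OF c]) auto
 qed (use t in auto)
 then have "g t \<le> 0" by (simp add: g0 mult_le_0_iff not_le[symmetric])
 then show ?thesis using pos[OF t] by simp
qed

text \<open>The scalar version is applied to the squared norm, which is differentiable even where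
  \<open>y\<close> vanishes; this is the source of the constant \<open>2 * L\<close>.\<close>

lemma gronwall_zero:
 fixes y :: "real => 'a::real_inner"
 assumes d: "!!t. t \<in> {0..T} ==> (y has_vector_derivative y' t) (at t within {0..T})"
  and le: "!!t. t \<in> {0..T} ==> norm (y' t) \<le> L * norm (y t)" and y0: "y 0 = 0" and t: "t \<in> {0..T}"
 shows "y t = 0"
proof -
 have cy: "continuous_on {0..T} y"
  using d has_vector_derivative_continuous continuous_on_eq_continuous_within by blast
 have "(%t. y t \<bullet> y t) t = 0"
 proof (rule gronwall_real[OF _ _ _ _ t, where L = "2 * L"])
  show "continuous_on {0..T} (%t. y t \<bullet> y t)" by (intro continuous_intros cy)
  fix s assume s: "0 < s" "s < T"
  then have ds: "(y has_vector_derivative y' s) (at s)"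
   using d[of s] at_within_interior[of s "{0..T}"] by simp
  have "((%t. y t \<bullet> y t) has_real_derivative y s \<bullet> y' s + y' s \<bullet> y s) (at s)"
   unfolding has_real_derivative_iff_has_vector_derivative
   by (rule bounded_bilinear.has_vector_derivative[OF bounded_bilinear_inner ds ds])
  moreover have "y s \<bullet> y' s + y' s \<bullet> y s \<le> 2 * L * (y s \<bullet> y s)"
  proof -
   have "y s \<bullet> y' s \<le> norm (y s) * norm (y' s)" by (rule norm_cauchy_schwarz)
   also have "\<dots> \<le> norm (y s) * (L * norm (y s))" using le[of s] s by (intro mult_left_mono) auto
   also have "\<dots> = L * (y s \<bullet> y s)" by (simp add: power2_norm_eq_inner[symmetric] power2_eq_square)
   finally show ?thesis by (simp add: inner_commute)
  qed
  ultimately show "\<exists>g'. ((%t. y t \<bullet> y t) has_real_derivative g') (at s) \<and> g' \<le> 2 * L * (y s \<bullet> y s)" by blast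
 qed (auto simp: y0)
 then show ?thesis by simp
qed

text \<open>The largest open set on which \<open>V\<close> is holomorphic. It is used in place of
  \<open>p + K0\<close>, because a trajectory may leave that set, but by the definition of
  \<open>ode_solution\<close> it never leaves this one.\<close>

definition hol_dom :: "(complex ^ 'd => complex ^ 'd) => (complex ^ 'd) set" where
 "hol_dom V = {x. analytic_map V {x}}"

lemma open_hol_dom: "open (hol_dom V)" and hol_on_hol_dom: "hol_on (%z. V z $ k) (hol_dom V)"
proof -
 show "open (hol_dom V)"
  unfolding open_subopen[of "hol_dom V"]
 proof
  fix x assume "x \<in> hol_dom V"
  then obtain U where U: "open U" "x \<in> U" "\<forall>k. hol_on (%z. V z $ k) U"
   by (auto simp: hol_dom_def analytic_map_def)
  then show "\<exists>U. open U \<and> x \<in> U \<and> U \<subseteq> hol_dom V"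
   by (intro exI[of _ U]) (auto simp: hol_dom_def analytic_map_def)
 qed
 show "hol_on (%z. V z $ k) (hol_dom V)"
  by (auto simp: hol_dom_def analytic_map_def hol_on_iff_hol_at)
qed

lemma continuous_on_hol_vec:
 assumes "!!k. hol_on (%z. F z $ k) U"
 shows "continuous_on U F"
proof -
 have "continuous_on U (%z. \<chi> k. F z $ k)"
  by (rule continuous_on_vec_lambda, rule hol_on_continuous_on, rule assms)
 then show ?thesis by (simp add: vec_lambda_eta)
qed

lemma norm_vec_le_sum: "norm (x :: complex ^ 'd) \<le> (\<Sum>k\<in>UNIV. cmod (x $ k))"
 unfolding norm_vec_def by (rule L2_set_le_sum) simp

lemma ode_solution_dom: "ode_solution V T w z ==> t \<in> {0..T} ==> z t \<in> hol_dom V"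
 by (auto simp: ode_solution_def hol_dom_def)

lemma ode_solution_continuous: "ode_solution V T w z ==> continuous_on {0..T} z"
 unfolding ode_solution_def
 using has_vector_derivative_continuous continuous_on_eq_continuous_within by blast

text \<open>By compactness the trajectory has a neighbourhood of uniform width on which
  \<open>V\<close> is holomorphic and bounded, hence Lipschitz on every ball of half that width
  centred on the trajectory.\<close>

lemma flow_tube:
 assumes T: "T \<ge> 0" and sol: "ode_solution V T w0 z0"
 obtains r L where "r > 0" "L > 0" "!!t. t \<in> {0..T} ==> cball (z0 t) r \<subseteq> hol_dom V"
  "!!t a b. t \<in> {0..T} ==> a \<in> cball (z0 t) r ==> b \<in> cball (z0 t) r ==> norm (V a - V b) \<le> L * norm (a - b)"
proof -
 let ?Z = "z0 ` {0..T}"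
 have cZ: "compact ?Z"
  by (rule compact_continuous_image[OF ode_solution_continuous[OF sol]]) simp
 obtain \<epsilon> where \<epsilon>: "\<epsilon> > 0" "(\<Union>x\<in>?Z. cball x \<epsilon>) \<subseteq> hol_dom V"
  using compact_subset_open_imp_cball_epsilon_subset[OF cZ open_hol_dom] ode_solution_dom[OF sol] by blast
 define r where "r = \<epsilon> / 2"
 have r: "r > 0" using \<epsilon> by (simp add: r_def)
 define N where "N = {x + y |x y. x \<in> ?Z \<and> y \<in> cball 0 \<epsilon>}"
 have "compact N" unfolding N_def by (rule compact_sums[OF cZ compact_cball])
 have mem: "x \<in> N" if "t \<in> {0..T}" "x \<in> cball (z0 t) \<epsilon>" for t x
 proof -
  have "x = z0 t + (x - z0 t)" "x - z0 t \<in> cball 0 \<epsilon>" using that by (auto simp: dist_norm norm_minus_commute)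
  then show ?thesis using that(1) unfolding N_def by blast
 qed
 have "N \<subseteq> hol_dom V"
 proof
  fix x assume "x \<in> N"
  then obtain t y where ty: "t \<in> {0..T}" "x = z0 t + y" "y \<in> cball 0 \<epsilon>" by (auto simp: N_def)
  then have "x \<in> cball (z0 t) \<epsilon>" by (simp add: dist_norm)
  then show "x \<in> hol_dom V" using \<epsilon>(2) ty(1) by blast
 qed
 then have "compact (V ` N)"
  using \<open>compact N\<close> continuous_on_subset[OF continuous_on_hol_vec[OF hol_on_hol_dom]] by (metis compact_continuous_image)
 then obtain M where M: "!!x. x \<in> N ==> norm (V x) \<le> M" by (metis bounded_iff compact_imp_bounded imageI)
 \<comment> \<open>One Lipschitz constant from \<open>hol_lipschitz\<close> for each component; the
   summand 1 keeps \<open>L\<close> positive.\<close>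
 define L where "L = CARD('a) * (\<bar>M\<bar> + 1) / r"
 show ?thesis
 proof (rule that[of r L])
  show "r > 0" "L > 0" using r by (auto simp: L_def)
  show sub: "cball (z0 t) r \<subseteq> hol_dom V" if "t \<in> {0..T}" for t
  proof -
   have "cball (z0 t) r \<subseteq> cball (z0 t) \<epsilon>" using r by (intro subset_cball) (simp add: r_def)
   then show ?thesis using \<epsilon>(2) that by blast
  qed
  fix t a b assume t: "t \<in> {0..T}" and ab: "a \<in> cball (z0 t) r" "b \<in> cball (z0 t) r"
  have "norm (V a - V b) \<le> (\<Sum>k\<in>UNIV. cmod ((V a - V b) $ k))" by (rule norm_vec_le_sum)
  also have "\<dots> \<le> (\<Sum>k\<in>(UNIV::'a set). (\<bar>M\<bar> + 1) / r * norm (a - b))"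
  proof (rule sum_mono)
   fix k :: 'a
   have "cmod (V a $ k - V b $ k) \<le> (\<bar>M\<bar> + 1) / r * norm (a - b)"
   proof (rule hol_lipschitz[OF _ r _ ab])
    have e: "2 * r = \<epsilon>" by (simp add: r_def)
    show "hol_on (%z. V z $ k) (cball (z0 t) (2 * r))"
     unfolding e by (rule hol_on_subset[OF hol_on_hol_dom]) (use \<epsilon> t in blast)
    fix x assume "x \<in> cball (z0 t) (2 * r)"
    then have "norm (V x) \<le> M" using M mem[OF t] e by simp
    then show "cmod (V x $ k) \<le> \<bar>M\<bar> + 1" using Finite_Cartesian_Product.norm_nth_le[of "V x" k] by linarith
   qed
   then show "cmod ((V a - V b) $ k) \<le> (\<bar>M\<bar> + 1) / r * norm (a - b)" by simp
  qed
  also have "\<dots> = L * norm (a - b)" by (simp add: L_def)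
  finally show "norm (V a - V b) \<le> L * norm (a - b)" .
 qed
qed

text \<open>The second solution is not known to stay in the tube. Outside it the distance to the
  first one exceeds \<open>r\<close>, so the velocities, whose difference is at most
  \<open>B\<close>, differ by at most \<open>B / r\<close> times the distance. Gronwall's argument
  works with the larger of the two constants.\<close>

lemma ode_solution_unique:
 assumes T: "T \<ge> 0" and s1: "ode_solution V T w z" and s2: "ode_solution V T w y" and t: "t \<in> {0..T}"
 shows "y t = z t"
proof -
 obtain r L where r: "r > 0" and L: "L > 0" and tube: "!!t. t \<in> {0..T} ==> cball (z t) r \<subseteq> hol_dom V"
  "!!t a b. t \<in> {0..T} ==> a \<in> cball (z t) r ==> b \<in> cball (z t) r ==> norm (V a - V b) \<le> L * norm (a - b)"
  using flow_tube[OF T s1] by metis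
 have cV: "continuous_on {0..T} (%t. V (x t))" if "ode_solution V T w x" for x
  by (rule continuous_on_compose2[OF continuous_on_hol_vec[OF hol_on_hol_dom] ode_solution_continuous[OF that]])
    (use ode_solution_dom[OF that] in blast)
 have "compact ((%t. V (y t) - V (z t)) ` {0..T})"
  by (intro compact_continuous_image continuous_intros cV s1 s2) simp
 then obtain B where B: "!!t. t \<in> {0..T} ==> norm (V (y t) - V (z t)) \<le> B"
  by (metis (no_types, lifting) bounded_iff compact_imp_bounded imageI)
 have "(%t. y t - z t) t = 0"
 proof (rule gronwall_zero[OF _ _ _ t, where L = "max L (B / r)"])
  fix s assume s: "s \<in> {0..T}"
  show "((%t. y t - z t) has_vector_derivative V (y s) - V (z s)) (at s within {0..T})"
   using s1 s2 s by (auto simp: ode_solution_def intro!: has_vector_derivative_diff)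
  show "norm (V (y s) - V (z s)) \<le> max L (B / r) * norm (y s - z s)"
  proof (cases "norm (y s - z s) \<le> r")
   case True
   then have "norm (V (y s) - V (z s)) \<le> L * norm (y s - z s)"
    using r by (intro tube(2)[OF s]) (auto simp: dist_norm norm_minus_commute)
   also have "\<dots> \<le> max L (B / r) * norm (y s - z s)" by (intro mult_right_mono) auto
   finally show ?thesis .
  next
   case False
   have "norm (V (y s) - V (z s)) \<le> B" by (rule B[OF s])
   also have "B = B / r * r" using r by simp
   also have "\<dots> \<le> B / r * norm (y s - z s)"
    using False r order_trans[OF norm_ge_zero B[OF s]] by (intro mult_left_mono) auto
   also have "\<dots> \<le> max L (B / r) * norm (y s - z s)" by (intro mult_right_mono) auto
   finally show ?thesis .
  qed
 qed (use s1 s2 in \<open>simp add: ode_solution_def\<close>)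
 then show ?thesis by simp
qed

lemma ode_solution_restrict:
 assumes "ode_solution V T w z" "t \<le> T"
 shows "ode_solution V t w z"
 unfolding ode_solution_def
proof (intro conjI ballI)
 show "z 0 = w" using assms(1) by (simp add: ode_solution_def)
 fix s assume s: "s \<in> {0..t}"
 then have "s \<in> {0..T}" "{0..t} \<subseteq> {0..T}" using assms(2) by auto
 then show "analytic_map V {z s}" "(z has_vector_derivative V (z s)) (at s within {0..t})"
  using assms(1) has_vector_derivative_within_subset unfolding ode_solution_def by blast+
qed

lemma flow_eq:
 assumes "ode_solution V T w z" "t \<in> {0..T}"
 shows "flow V t w = z t"
 unfolding flow_def
proof (rule the_equality)
 have s: "ode_solution V t w z" by (rule ode_solution_restrict) (use assms in auto)
 then show "\<exists>z'. ode_solution V t w z' \<and> z' t = z t" by blast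
 fix x assume "\<exists>z'. ode_solution V t w z' \<and> z' t = x"
 then show "x = z t" using ode_solution_unique[OF _ s, of _ t] assms(2) by auto
qed

subsection \<open>Picard iteration\<close>

lemma unit_interval_mult: "t \<in> {0..T} ==> u \<in> {0..1} ==> t * u \<in> {0..T}" for t T u :: real
 using mult_left_le[of u t] by (auto intro: order_trans)

lemma integral_unit_scale:
 fixes f :: "real => 'a::banach"
 assumes t: "t \<ge> 0" and c: "continuous_on {0..t} f"
 shows "integral {0..1} (%u. t *\<^sub>R f (t * u)) = integral {0..t} f"
proof (cases "t = 0")
 case False
 then have t: "t > 0" using t by simp
 have "((%u. f (t * u)) has_integral (1 / \<bar>t\<bar>) *\<^sub>R integral {0..t} f) ((%x. x / t) ` {0..t})"
  by (rule has_integral_stretch_real) (use t c in \<open>auto intro: integrable_integral integrable_continuous_real\<close>)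
 moreover have "(%x. x / t) ` {0..t} = {0..1}"
 proof -
  have "(%x. x / t) = (%x. (1/t) * x)" by auto
  then show ?thesis using t by (simp only: image_mult_atLeastAtMost) simp
 qed
 ultimately have "((%u. t *\<^sub>R f (t * u)) has_integral t *\<^sub>R ((1 / t) *\<^sub>R integral {0..t} f)) {0..1}"
  using t by (intro has_integral_cmul) simp
 then show ?thesis using t by (intro integral_unique) simp
qed simp

text \<open>Writing the Picard iteration with integrals over the fixed interval \<open>{0..1}\<close> makes continuity and holomorphy in
the parameters immediate; the weight \<open>exp (2 * L * t)\<close> makes it contract on all of \<open>{0..T}\<close> at once.\<close>

theorem local_flow:
 assumes T: "T \<ge> 0" and sol: "ode_solution V T w0 z0"
 obtains \<delta> \<Phi> where "\<delta> > 0" "!!w. w \<in> ball w0 \<delta> ==> ode_solution V T w (%t. \<Phi> t w)"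
  "continuous_on ({0..T} \<times> ball w0 \<delta>) (%(t, w). \<Phi> t w)"
  "!!t k. t \<in> {0..T} ==> hol_on (%w. \<Phi> t w $ k) (ball w0 \<delta>)"
proof -
 obtain r L where r: "r > 0" and L: "L > 0" and dom: "!!t. t \<in> {0..T} ==> cball (z0 t) r \<subseteq> hol_dom V"
  and lip: "!!t a b. t \<in> {0..T} ==> a \<in> cball (z0 t) r ==> b \<in> cball (z0 t) r ==> norm (V a - V b) \<le> L * norm (a - b)"
  using flow_tube[OF T sol] by metis
 \<comment> \<open>Chosen so that \<open>2 * \<delta> * exp (2 * L * T) = r\<close>, which bounds
   the sum of all Picard corrections.\<close>
 define \<delta> where "\<delta> = r / (2 * exp (2 * L * T))"
 have \<delta>: "\<delta> > 0" using r by (simp add: \<delta>_def)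
 let ?B = "ball w0 \<delta>"
 define x where "x = rec_nat (%t w. z0 t) (%_ f t w. w + integral {0..1} (%u. t *\<^sub>R V (f (t * u) w)))"
 have x0: "x 0 t w = z0 t" for t w by (simp add: x_def)
 have xS: "x (Suc n) t w = w + integral {0..1} (%u. t *\<^sub>R V (x n (t * u) w))" for n t w by (simp add: x_def)
 have cz0: "continuous_on {0..T} z0" by (rule ode_solution_continuous[OF sol])
 have cV: "continuous_on (hol_dom V) V" by (rule continuous_on_hol_vec[OF hol_on_hol_dom])
 have cVz0: "continuous_on {0..T} (%t. V (z0 t))"
  by (rule continuous_on_compose2[OF cV cz0]) (use ode_solution_dom[OF sol] in blast)
 have z0_eq: "z0 t = w0 + integral {0..1} (%u. t *\<^sub>R V (z0 (t * u)))" if t: "t \<in> {0..T}" for t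
 proof -
  have "((%s. V (z0 s)) has_integral (z0 t - z0 0)) {0..t}"
  proof (rule fundamental_theorem_of_calculus)
   fix s assume "s \<in> {0..t}"
   then show "(z0 has_vector_derivative V (z0 s)) (at s within {0..t})"
    using ode_solution_restrict[OF sol, of t] t by (simp add: ode_solution_def)
  qed (use t in simp)
  moreover have "integral {0..1} (%u. t *\<^sub>R V (z0 (t * u))) = integral {0..t} (%s. V (z0 s))"
   by (rule integral_unit_scale) (use t in \<open>auto intro: continuous_on_subset[OF cVz0]\<close>)
  ultimately show ?thesis
   using sol by (simp add: integral_unique ode_solution_def)
 qed
 have scale: "continuous_on ({0..T} \<times> ?B) (%(t, w). f t w) ==>
   continuous_on (({0..T} \<times> ?B) \<times> {0..1}) (%((t, w), u). f (t * u) w)" for f :: "real => _ => complex ^ 'a"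
 proof -
  assume c: "continuous_on ({0..T} \<times> ?B) (%(t, w). f t w)"
  have "continuous_on (({0..T} \<times> ?B) \<times> {0..1::real}) (%y. (%(t, w). f t w) (fst (fst y) * snd y, snd (fst y)))"
  proof (rule continuous_on_compose2[OF c])
   show "(%y. (fst (fst y) * snd y, snd (fst y))) ` (({0..T} \<times> ?B) \<times> {0..1}) \<subseteq> {0..T} \<times> ?B"
    using unit_interval_mult by auto
  qed (intro continuous_intros)
  then show ?thesis by (simp add: case_prod_unfold)
 qed
 \<comment> \<open>The clauses depend on each other: the correction bound keeps the next iterate in
   the tube, the tube gives the Lipschitz bound for the next correction, and continuity and
   holomorphy are needed to integrate.\<close>
 define Q where "Q n \<longleftrightarrow> continuous_on ({0..T} \<times> ?B) (%(t, w). x n t w) \<and>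
   (\<forall>t\<in>{0..T}. \<forall>k. hol_on (%w. x n t w $ k) ?B) \<and>
   (\<forall>t\<in>{0..T}. \<forall>w\<in>?B. norm (x n t w - z0 t) \<le> 2 * \<delta> * exp (2 * L * T) * (1 - 1 / 2 ^ n)) \<and>
   (\<forall>t\<in>{0..T}. \<forall>w\<in>?B. norm (x (Suc n) t w - x n t w) \<le> \<delta> / 2 ^ n * exp (2 * L * t))" for n
 have tube: "x n t w \<in> cball (z0 t) r" if "Q n" "t \<in> {0..T}" "w \<in> ?B" for n t w
 proof -
  have "norm (x n t w - z0 t) \<le> 2 * \<delta> * exp (2 * L * T) * (1 - 1 / 2 ^ n)"
   using that by (simp add: Q_def)
  also have "\<dots> \<le> 2 * \<delta> * exp (2 * L * T) * 1"
   using \<delta> by (intro mult_left_mono) auto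
  also have "\<dots> = r" by (simp add: \<delta>_def)
  finally show ?thesis by (simp add: dist_norm norm_minus_commute)
 qed
 have contV: "continuous_on ({0..T} \<times> ?B) (%(t, w). V (f t w))"
  if "continuous_on ({0..T} \<times> ?B) (%(t, w). f t w)" "!!t w. t \<in> {0..T} ==> w \<in> ?B ==> f t w \<in> cball (z0 t) r" for f
  using continuous_on_compose2[OF cV that(1)] that(2) dom by (simp add: case_prod_unfold) force
 have intV: "(%u. t *\<^sub>R V (f (t * u) w)) integrable_on {0..1}"
  if c: "continuous_on ({0..T} \<times> ?B) (%(t, w). f t w)" and "!!t w. t \<in> {0..T} ==> w \<in> ?B ==> f t w \<in> cball (z0 t) r"
   and tw: "t \<in> {0..T}" "w \<in> ?B" for f t w
 proof -
  have "continuous_on {0..1} (%u. (%((t, w), u). V (f (t * u) w)) ((t, w), u))"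
   by (rule continuous_on_compose2[OF scale[OF contV[OF c that(2)]]]) (use tw in \<open>auto intro!: continuous_intros\<close>)
  then show ?thesis
   by (intro integrable_continuous_real continuous_intros) simp
 qed
 have Q: "Q n" for n
 proof (induction n)
  case 0
  have "continuous_on ({0..T} \<times> ?B) (%y. z0 (fst y))"
   by (rule continuous_on_compose2[OF cz0]) (auto intro!: continuous_intros)
  moreover have "norm (x (Suc 0) t w - x 0 t w) \<le> \<delta> / 2 ^ 0 * exp (2 * L * t)"
   if "t \<in> {0..T}" "w \<in> ?B" for t w
  proof -
   \<comment> \<open>The trajectory of \<open>w0\<close> solves the integral equation, so the first
     correction is the change of the initial point alone.\<close>
   have "x (Suc 0) t w - x 0 t w = w - w0"
    using z0_eq[OF that(1)] by (simp add: xS x0 algebra_simps)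
   then have "norm (x (Suc 0) t w - x 0 t w) \<le> \<delta> * 1"
    using that(2) by (simp add: dist_norm norm_minus_commute)
   also have "\<dots> \<le> \<delta> * exp (2 * L * t)"
    using \<delta> L that(1) by (intro mult_left_mono) auto
   finally show ?thesis by simp
  qed
  ultimately show ?case
   by (auto simp: Q_def x0 case_prod_unfold hol_on_iff_hol_at hol_at_const)
 next
  case (Suc n)
  note tn = tube[OF Suc]
  have cn: "continuous_on ({0..T} \<times> ?B) (%(t, w). x n t w)" using Suc by (simp add: Q_def)
  have hn: "hol_on (%w. x n t w $ k) ?B" if "t \<in> {0..T}" for t k using Suc that by (simp add: Q_def)
  have cs: "continuous_on (({0..T} \<times> ?B) \<times> {0..1}) (%((t, w), u). t *\<^sub>R V (x n (t * u) w))"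
   using scale[OF contV[OF cn tn]] by (auto simp: case_prod_unfold intro!: continuous_intros)
  have "continuous_on ({0..T} \<times> ?B) (%y. integral (cbox 0 1) (%u. fst y *\<^sub>R V (x n (fst y * u) (snd y))))"
   by (rule integral_continuous_on_param) (use cs in \<open>simp add: case_prod_unfold cbox_interval\<close>)
  then have c: "continuous_on ({0..T} \<times> ?B) (%(t, w). x (Suc n) t w)"
   by (auto simp: xS case_prod_unfold cbox_interval intro!: continuous_intros)
  have h: "hol_on (%w. x (Suc n) t w $ k) ?B" if t: "t \<in> {0..T}" for t k
  proof -
   let ?I = "%w. integral {0..1} (%u. complex_of_real t * V (x n (t * u) w) $ k)"
   have hI: "hol_on ?I ?B"
   proof (rule hol_on_integral)
    have "continuous_on (?B \<times> {0..1}) (%y. (%((t, w), u). t *\<^sub>R V (x n (t * u) w)) ((t, fst y), snd y))"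
     by (rule continuous_on_compose2[OF cs]) (use t in \<open>auto intro!: continuous_intros\<close>)
    then have "continuous_on (?B \<times> {0..1}) (%y. (t *\<^sub>R V (x n (t * snd y) (fst y))) $ k)"
     by (intro continuous_on_component) simp
    then show "continuous_on (?B \<times> {0..1}) (%(w, u). complex_of_real t * V (x n (t * u) w) $ k)"
     by (simp add: case_prod_unfold scaleR_conv_of_real[where 'a = complex])
    fix u :: real assume "u \<in> {0..1}"
    then have tu: "t * u \<in> {0..T}" using t unit_interval_mult by blast
    have "hol_on (%w. V (x n (t * u) w) $ k) ?B"
     by (rule hol_on_compose[OF hol_on_hol_dom hn[OF tu]]) (use tn[OF tu] dom[OF tu] in blast)
    then show "hol_on (%w. complex_of_real t * V (x n (t * u) w) $ k) ?B"
     by (auto simp: hol_on_iff_hol_at intro: hol_at_cmult)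
   qed simp
   have xI: "x (Suc n) t w $ k = w $ k + ?I w"
    if w: "w \<in> ?B" for w
   proof -
    have "integral {0..1} (%u. (t *\<^sub>R V (x n (t * u) w)) $ k) = integral {0..1} (%u. t *\<^sub>R V (x n (t * u) w)) $ k"
     using integral_linear[OF intV[OF cn tn t w] bounded_linear_vec_nth[of k]] by (simp only: comp_def)
    then show ?thesis
     unfolding xS vector_add_component
     by (simp only: vector_scaleR_component scaleR_conv_of_real[where 'a = complex])
   qed
   show ?thesis
    unfolding hol_on_iff_hol_at
   proof
    fix w assume w: "w \<in> ?B"
    have "hol_at (%w. w $ k + ?I w) w"
     using hI w by (intro hol_at_add hol_at_coord) (simp add: hol_on_iff_hol_at)
    then show "hol_at (%w. x (Suc n) t w $ k) w"
     by (rule hol_at_cong[OF _ open_ball w]) (rule xI[symmetric])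
   qed
  qed
  have d: "norm (x (Suc (Suc n)) t w - x (Suc n) t w) \<le> \<delta> / 2 ^ Suc n * exp (2 * L * t)"
   and b: "norm (x (Suc n) t w - z0 t) \<le> 2 * \<delta> * exp (2 * L * T) * (1 - 1 / 2 ^ Suc n)"
   if tw: "t \<in> {0..T}" "w \<in> ?B" for t w
  proof -
   have step: "norm (x (Suc n) s w - x n s w) \<le> \<delta> / 2 ^ n * exp (2 * L * s)" if "s \<in> {0..T}" for s
    using Suc that tw by (simp add: Q_def)
   have b': "norm (x (Suc n) s w - z0 s) \<le> 2 * \<delta> * exp (2 * L * T) * (1 - 1 / 2 ^ Suc n)"
    if s: "s \<in> {0..T}" "w \<in> ?B" for s w
   proof -
    have "norm (x (Suc n) s w - z0 s) \<le> norm (x (Suc n) s w - x n s w) + norm (x n s w - z0 s)"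
     using norm_triangle_ineq[of "x (Suc n) s w - x n s w" "x n s w - z0 s"] by simp
    also have "norm (x (Suc n) s w - x n s w) \<le> \<delta> / 2 ^ n * exp (2 * L * s)"
     using Suc s by (simp add: Q_def)
    also have "\<dots> \<le> \<delta> / 2 ^ n * exp (2 * L * T)"
     using \<delta> L s by (intro mult_left_mono) auto
    also have "norm (x n s w - z0 s) \<le> 2 * \<delta> * exp (2 * L * T) * (1 - 1 / 2 ^ n)"
     using Suc s by (simp add: Q_def)
    finally show ?thesis by (simp add: field_simps)
   qed
   then show "norm (x (Suc n) t w - z0 t) \<le> 2 * \<delta> * exp (2 * L * T) * (1 - 1 / 2 ^ Suc n)"
    using tw by blast
   have tSn: "x (Suc n) s w \<in> cball (z0 s) r" if s: "s \<in> {0..T}" "w \<in> ?B" for s w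
   proof -
    have "norm (x (Suc n) s w - z0 s) \<le> 2 * \<delta> * exp (2 * L * T) * (1 - 1 / 2 ^ Suc n)"
     by (rule b'[OF s])
    also have "\<dots> \<le> 2 * \<delta> * exp (2 * L * T) * 1"
     using \<delta> by (intro mult_left_mono) auto
    also have "\<dots> = r" by (simp add: \<delta>_def)
    finally show ?thesis by (simp add: dist_norm norm_minus_commute)
   qed
   have i1: "(%u. t *\<^sub>R V (x (Suc n) (t * u) w)) integrable_on {0..1}"
    by (rule intV[OF c tSn tw])
   have i2: "(%u. t *\<^sub>R V (x n (t * u) w)) integrable_on {0..1}"
    by (rule intV[OF cn tn tw])
   \<comment> \<open>The weight is integrated exactly: the Lipschitz constant \<open>L\<close>
     against the exponent \<open>2 * L\<close> gains one half per iteration.\<close>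
   have "((%u. t * (L * (\<delta> / 2 ^ n * exp (2 * L * (t * u))))) has_integral
     (\<delta> / 2 ^ Suc n * exp (2 * L * (t * 1)) - \<delta> / 2 ^ Suc n * exp (2 * L * (t * 0)))) {0..1}"
   proof (rule fundamental_theorem_of_calculus)
    fix u :: real assume "u \<in> {0..1}"
    have "((%u. \<delta> / 2 ^ Suc n * exp (2 * L * (t * u))) has_real_derivative
      t * (L * (\<delta> / 2 ^ n * exp (2 * L * (t * u))))) (at u within {0..1})"
     by (rule derivative_eq_intros refl)+ simp
    then show "((%u. \<delta> / 2 ^ Suc n * exp (2 * L * (t * u))) has_vector_derivative
      t * (L * (\<delta> / 2 ^ n * exp (2 * L * (t * u))))) (at u within {0..1})"
     by (simp add: has_real_derivative_iff_has_vector_derivative)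
   qed simp
   note hi = this
   have "x (Suc (Suc n)) t w - x (Suc n) t w
     = integral {0..1} (%u. t *\<^sub>R V (x (Suc n) (t * u) w) - t *\<^sub>R V (x n (t * u) w))"
    by (simp add: xS[of "Suc n"] xS[of n t w] integral_diff[OF i1 i2])
   also have "norm \<dots> \<le> integral {0..1} (%u. t * (L * (\<delta> / 2 ^ n * exp (2 * L * (t * u)))))"
   proof (rule Henstock_Kurzweil_Integration.integral_norm_bound_integral)
    fix u :: real assume "u \<in> {0..1}"
    then have tu: "t * u \<in> {0..T}" using tw unit_interval_mult by blast
    have "norm (V (x (Suc n) (t * u) w) - V (x n (t * u) w)) \<le> L * norm (x (Suc n) (t * u) w - x n (t * u) w)"
     by (rule lip[OF tu tSn[OF tu tw(2)] tn[OF tu tw(2)]])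
    also have "\<dots> \<le> L * (\<delta> / 2 ^ n * exp (2 * L * (t * u)))"
     using L step[OF tu] by (intro mult_left_mono) auto
    finally have le: "norm (V (x (Suc n) (t * u) w) - V (x n (t * u) w)) \<le> L * (\<delta> / 2 ^ n * exp (2 * L * (t * u)))" .
    have "norm (t *\<^sub>R V (x (Suc n) (t * u) w) - t *\<^sub>R V (x n (t * u) w))
      = t * norm (V (x (Suc n) (t * u) w) - V (x n (t * u) w))"
     using tw by (simp flip: scaleR_diff_right)
    also have "\<dots> \<le> t * (L * (\<delta> / 2 ^ n * exp (2 * L * (t * u))))"
     by (rule mult_left_mono[OF le]) (use tw in simp)
    finally show "norm (t *\<^sub>R V (x (Suc n) (t * u) w) - t *\<^sub>R V (x n (t * u) w))
      \<le> t * (L * (\<delta> / 2 ^ n * exp (2 * L * (t * u))))" .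
   qed (use i1 i2 hi in \<open>auto intro: integrable_diff\<close>)
   also have "\<dots> = \<delta> / 2 ^ Suc n * exp (2 * L * (t * 1)) - \<delta> / 2 ^ Suc n * exp (2 * L * (t * 0))"
    by (rule integral_unique[OF hi])
   also have "\<dots> \<le> \<delta> / 2 ^ Suc n * exp (2 * L * t)"
    using \<delta> by simp
   finally show "norm (x (Suc (Suc n)) t w - x (Suc n) t w) \<le> \<delta> / 2 ^ Suc n * exp (2 * L * t)" .
  qed
  show ?case
   unfolding Q_def using c h b d by blast
 qed
 \<comment> \<open>The limit is written as a telescoping series, which puts the geometric correction
   bounds into the form of the M-test.\<close>
 define \<Phi> where "\<Phi> t w = z0 t + (\<Sum>n. x (Suc n) t w - x n t w)" for t w
 define A where "A = {0..T} \<times> ?B"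
 have ul: "uniform_limit A (%n (t, w). x n t w) (%(t, w). \<Phi> t w) sequentially"
 proof -
  have "uniform_limit A (%n y. \<Sum>i<n. x (Suc i) (fst y) (snd y) - x i (fst y) (snd y))
    (%y. \<Sum>i. x (Suc i) (fst y) (snd y) - x i (fst y) (snd y)) sequentially"
  proof (rule Weierstrass_m_test)
   show "summable (%n. \<delta> * exp (2 * L * T) * (1/2) ^ n)"
    by (intro summable_mult summable_geometric) simp
   fix n y assume y: "y \<in> A"
   then have "norm (x (Suc n) (fst y) (snd y) - x n (fst y) (snd y)) \<le> \<delta> / 2 ^ n * exp (2 * L * fst y)"
    using Q[of n] by (auto simp: Q_def A_def)
   also have "\<dots> \<le> \<delta> / 2 ^ n * exp (2 * L * T)"
    using \<delta> L y by (intro mult_left_mono) (auto simp: A_def)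
   also have "\<dots> = \<delta> * exp (2 * L * T) * (1/2) ^ n" by (simp add: power_one_over)
   finally show "norm (x (Suc n) (fst y) (snd y) - x n (fst y) (snd y)) \<le> \<delta> * exp (2 * L * T) * (1/2) ^ n" .
  qed
  then have "uniform_limit A (%n y. z0 (fst y) + (\<Sum>i<n. x (Suc i) (fst y) (snd y) - x i (fst y) (snd y)))
    (%y. z0 (fst y) + (\<Sum>i. x (Suc i) (fst y) (snd y) - x i (fst y) (snd y))) sequentially"
   by (intro uniform_limit_intros)
  moreover have "z0 t + (\<Sum>i<n. x (Suc i) t w - x i t w) = x n t w" for n t w
   using sum_lessThan_telescope[of "%n. x n t w" n] by (simp add: x0)
  ultimately show ?thesis by (simp add: \<Phi>_def case_prod_unfold)
 qed
 have lim: "(%n. x n t w) \<longlonglongrightarrow> \<Phi> t w" if "t \<in> {0..T}" "w \<in> ?B" for t w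
  using tendsto_uniform_limitI[OF ul, of "(t, w)"] that by (simp add: A_def)
 have c\<Phi>: "continuous_on ({0..T} \<times> ?B) (%(t, w). \<Phi> t w)"
  using uniform_limit_theorem[OF _ ul] Q by (simp add: Q_def A_def)
 have t\<Phi>: "\<Phi> t w \<in> cball (z0 t) r" if "t \<in> {0..T}" "w \<in> ?B" for t w
  by (rule closed_sequentially[OF closed_cball _ lim[OF that]]) (use tube[OF Q that] in auto)
 have h\<Phi>: "hol_on (%w. \<Phi> t w $ k) ?B" if t: "t \<in> {0..T}" for t k
 proof (rule hol_on_uniform_limit(1)[OF open_ball])
  show "\<forall>\<^sub>F n in sequentially. hol_on (%w. x n t w $ k) ?B"
   using Q t by (simp add: Q_def)
  have "uniform_limit ?B (%n w. x n t w $ k) (%w. \<Phi> t w $ k) sequentially"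
   unfolding uniform_limit_iff
  proof (intro allI impI)
   fix e :: real assume "e > 0"
   then have "\<forall>\<^sub>F n in sequentially. \<forall>y\<in>A. dist (case y of (t, w) => x n t w) (case y of (t, w) => \<Phi> t w) < e"
    using ul by (simp add: uniform_limit_iff)
   then show "\<forall>\<^sub>F n in sequentially. \<forall>w\<in>?B. dist (x n t w $ k) (\<Phi> t w $ k) < e"
   proof eventually_elim
    case (elim n)
    show ?case
    proof
     fix w assume "w \<in> ?B"
     then have "dist (x n t w) (\<Phi> t w) < e" using elim t by (auto simp: A_def)
     then show "dist (x n t w $ k) (\<Phi> t w $ k) < e"
      using dist_vec_nth_le[of "x n t w" k "\<Phi> t w"] by linarith
    qed
   qed
  qed
  then show "\<exists>e>0. ball z e \<subseteq> ?B \<and> uniform_limit (ball z e) (%n w. x n t w $ k) (%w. \<Phi> t w $ k) sequentially"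
   if "z \<in> ?B" for z
   using open_contains_ball_eq[OF open_ball] that uniform_limit_on_subset by meson
 qed simp
 have eq: "\<Phi> t w = w + integral {0..1} (%u. t *\<^sub>R V (\<Phi> (t * u) w))" if tw: "t \<in> {0..T}" "w \<in> ?B" for t w
 proof -
  have "(%n. x (Suc n) t w) \<longlonglongrightarrow> w + integral {0..1} (%u. t *\<^sub>R V (\<Phi> (t * u) w))"
   unfolding tendsto_iff
  proof (intro allI impI)
   fix e :: real assume e: "e > 0"
   define e' where "e' = e / (2 * (T * L + 1))"
   have TL: "T * L + 1 > 0" using T L by (simp add: add_nonneg_pos)
   then have e': "e' > 0" using e by (simp add: e'_def)
   then have "\<forall>\<^sub>F n in sequentially. \<forall>y\<in>A. dist (case y of (t, w) => x n t w) (case y of (t, w) => \<Phi> t w) < e'"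
    using ul by (simp add: uniform_limit_iff)
   then show "\<forall>\<^sub>F n in sequentially. dist (x (Suc n) t w) (w + integral {0..1} (%u. t *\<^sub>R V (\<Phi> (t * u) w))) < e"
   proof eventually_elim
    case (elim n)
    have cn: "continuous_on ({0..T} \<times> ?B) (%(t, w). x n t w)" using Q by (simp add: Q_def)
    have i1: "(%u. t *\<^sub>R V (x n (t * u) w)) integrable_on {0..1}"
     by (rule intV[OF cn tube[OF Q] tw])
    have i2: "(%u. t *\<^sub>R V (\<Phi> (t * u) w)) integrable_on {0..1}"
     by (rule intV[OF c\<Phi> t\<Phi> tw])
    have "x (Suc n) t w - (w + integral {0..1} (%u. t *\<^sub>R V (\<Phi> (t * u) w)))
      = integral {0..1} (%u. t *\<^sub>R V (x n (t * u) w) - t *\<^sub>R V (\<Phi> (t * u) w))"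
     by (simp add: xS integral_diff[OF i1 i2])
    also have "norm \<dots> \<le> integral {0..1} (%u::real. T * (L * e'))"
    proof (rule Henstock_Kurzweil_Integration.integral_norm_bound_integral)
     fix u :: real assume "u \<in> {0..1}"
     then have tu: "t * u \<in> {0..T}" using tw unit_interval_mult by blast
     have "norm (V (x n (t * u) w) - V (\<Phi> (t * u) w)) \<le> L * norm (x n (t * u) w - \<Phi> (t * u) w)"
      by (rule lip[OF tu tube[OF Q tu tw(2)] t\<Phi>[OF tu tw(2)]])
     also have "\<dots> \<le> L * e'"
      using L elim tu tw(2) by (intro mult_left_mono) (auto simp: A_def dist_norm intro: less_imp_le)
     finally have le: "norm (V (x n (t * u) w) - V (\<Phi> (t * u) w)) \<le> L * e'" .
     have "norm (t *\<^sub>R V (x n (t * u) w) - t *\<^sub>R V (\<Phi> (t * u) w)) = t * norm (V (x n (t * u) w) - V (\<Phi> (t * u) w))"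
      using tw by (simp flip: scaleR_diff_right)
     also have "\<dots> \<le> T * (L * e')"
      using tw le by (intro mult_mono) auto
     finally show "norm (t *\<^sub>R V (x n (t * u) w) - t *\<^sub>R V (\<Phi> (t * u) w)) \<le> T * (L * e')" .
    qed (use i1 i2 in \<open>auto intro: integrable_diff\<close>)
    also have "integral {0..1} (%u::real. T * (L * e')) = T * L * e'" by simp
    also have "\<dots> \<le> (T * L + 1) * e'" using e' by (intro mult_right_mono) auto
    also have "\<dots> = e / 2"
    proof -
     have "K * (e / (2 * K)) = e / 2" if "K > 0" for K using that by simp
     from this[OF TL] show ?thesis by (simp only: e'_def)
    qed
    finally show ?case using e by (simp add: dist_norm)
   qed
  qed
  moreover have "(%n. x (Suc n) t w) \<longlonglongrightarrow> \<Phi> t w" by (rule LIMSEQ_Suc[OF lim[OF tw]])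
  ultimately show ?thesis using LIMSEQ_unique by blast
 qed
 have sol': "ode_solution V T w (%t. \<Phi> t w)" if w: "w \<in> ?B" for w
  unfolding ode_solution_def
 proof (intro conjI ballI)
  show "\<Phi> 0 w = w" using eq[of 0 w] T w by simp
  fix t assume t: "t \<in> {0..T}"
  show "analytic_map V {\<Phi> t w}" using dom[OF t] t\<Phi>[OF t w] by (auto simp: hol_dom_def)
  have "continuous_on {0..T} (%t. (%(t, w). V (\<Phi> t w)) (t, w))"
   by (rule continuous_on_compose2[OF contV[OF c\<Phi> t\<Phi>]]) (use w in \<open>auto intro!: continuous_intros\<close>)
  then have c: "continuous_on {0..T} (%t. V (\<Phi> t w))" by simp
  have "((%t. w + integral {0..t} (%s. V (\<Phi> s w))) has_vector_derivative 0 + V (\<Phi> t w)) (at t within {0..T})"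
   by (intro has_vector_derivative_add has_vector_derivative_const integral_has_vector_derivative c t)
  moreover have "\<Phi> s w = w + integral {0..s} (%s. V (\<Phi> s w))" if "s \<in> {0..T}" for s
  proof -
   have "integral {0..1} (%u. s *\<^sub>R V (\<Phi> (s * u) w)) = integral {0..s} (%s. V (\<Phi> s w))"
    by (rule integral_unit_scale) (use that in \<open>auto intro: continuous_on_subset[OF c]\<close>)
   then show ?thesis using eq[OF that w] by simp
  qed
  ultimately show "((%t. \<Phi> t w) has_vector_derivative V (\<Phi> t w)) (at t within {0..T})"
   using has_vector_derivative_transform[OF t, of "%t. \<Phi> t w" "%t. w + integral {0..t} (%s. V (\<Phi> s w))"] by simp
 qed
 show ?thesis
  by (rule that[OF \<delta> sol' c\<Phi> h\<Phi>])
qed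

lemma flow_local:
 assumes T: "T \<ge> 0" and sol: "ode_solution V T w0 z0"
 obtains \<delta> where "\<delta> > 0" "!!w. w \<in> ball w0 \<delta> ==> ode_solution V T w (%t. flow V t w)"
  "continuous_on ({0..T} \<times> ball w0 \<delta>) (%(t, w). flow V t w)"
  "!!t k. t \<in> {0..T} ==> hol_on (%w. flow V t w $ k) (ball w0 \<delta>)"
proof -
 obtain \<delta> \<Phi> where *: "\<delta> > 0" "!!w. w \<in> ball w0 \<delta> ==> ode_solution V T w (%t. \<Phi> t w)"
  "continuous_on ({0..T} \<times> ball w0 \<delta>) (%(t, w). \<Phi> t w)"
  "!!t k. t \<in> {0..T} ==> hol_on (%w. \<Phi> t w $ k) (ball w0 \<delta>)"
  using local_flow[OF T sol] by metis
 have eq: "flow V t w = \<Phi> t w" if "t \<in> {0..T}" "w \<in> ball w0 \<delta>" for t w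
  by (rule flow_eq[OF *(2)[OF that(2)] that(1)])
 show ?thesis
 proof (rule that[OF *(1)])
  fix w assume w: "w \<in> ball w0 \<delta>"
  show "ode_solution V T w (%t. flow V t w)"
   unfolding ode_solution_def
  proof (intro conjI ballI)
   show "flow V 0 w = w" using *(2)[OF w] eq[of 0 w] w T by (simp add: ode_solution_def)
   fix t assume t: "t \<in> {0..T}"
   show "analytic_map V {flow V t w}"
    using *(2)[OF w] eq[OF t w] t by (simp add: ode_solution_def)
   have "((%t. \<Phi> t w) has_vector_derivative V (flow V t w)) (at t within {0..T})"
    using *(2)[OF w] eq[OF t w] t by (simp add: ode_solution_def)
   then show "((%t. flow V t w) has_vector_derivative V (flow V t w)) (at t within {0..T})"
    by (rule has_vector_derivative_transform[OF t eq[OF _ w], rotated])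
  qed
 next
  show "continuous_on ({0..T} \<times> ball w0 \<delta>) (%(t, w). flow V t w)"
   using *(3) by (rule continuous_on_eq) (auto simp: eq)
  fix t and k :: 'a assume t: "t \<in> {0..T}"
  show "hol_on (%w. flow V t w $ k) (ball w0 \<delta>)"
   unfolding hol_on_iff_hol_at
  proof
   fix w assume w: "w \<in> ball w0 \<delta>"
   show "hol_at (%w. flow V t w $ k) w"
    by (rule hol_at_cong[of "%w. \<Phi> t w $ k" w "ball w0 \<delta>"])
      (use *(4)[OF t] w eq[OF t] in \<open>auto simp: hol_on_iff_hol_at\<close>)
  qed
 qed
qed

text \<open>\<open>flow\<close> is a single function singled out by uniqueness, so the local
  statements on balls need no gluing.\<close>

lemma flow_analytic:
 assumes T: "T \<ge> 0" and S: "!!w. w \<in> S ==> \<exists>z. ode_solution V T w z"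
 shows "analytic_map (flow V T) S"
proof -
 have "\<exists>\<delta>. \<delta> > 0 \<and> (\<forall>k. hol_on (%w. flow V T w $ k) (ball w0 \<delta>))" if w0: "w0 \<in> S" for w0
 proof -
  obtain z where z: "ode_solution V T w0 z" using S[OF w0] by blast
  obtain \<delta> where \<delta>: "\<delta> > 0" "!!t k. t \<in> {0..T} ==> hol_on (%w. flow V t w $ k) (ball w0 \<delta>)"
   using flow_local[OF T z] by metis
  then show ?thesis using T by (intro exI[of _ \<delta>]) auto
 qed
 then obtain \<delta> where \<delta>: "!!w0. w0 \<in> S ==> \<delta> w0 > 0" "!!w0 k. w0 \<in> S ==> hol_on (%w. flow V T w $ k) (ball w0 (\<delta> w0))"
  by metis
 show ?thesis
  unfolding analytic_map_def
  by (intro exI[of _ "\<Union>w0\<in>S. ball w0 (\<delta> w0)"]) (use \<delta> in \<open>auto simp: hol_on_iff_hol_at intro: open_UN\<close>)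
qed

lemma flow_fixed_point:
 assumes "T \<ge> 0" "analytic_map V {p}" "V p = 0" "t \<in> {0..T}"
 shows "ode_solution V T p (%_. p)" "flow V t p = p"
proof -
 show s: "ode_solution V T p (%_. p)"
  using assms by (auto simp: ode_solution_def intro!: derivative_eq_intros)
 show "flow V t p = p" using flow_eq[OF s assms(4)] .
qed

section \<open>The matrices of the push-forward\<close>

lemma analytic_fun_linear:
 assumes "analytic_fun g S" "analytic_fun h S"
 shows "analytic_fun (%z. a * g z + b * h z) S"
proof -
 obtain U W where "open U" "S \<subseteq> U" "hol_on g U" "open W" "S \<subseteq> W" "hol_on h W"
  using assms by (auto simp: analytic_fun_def)
 then show ?thesis
  unfolding analytic_fun_def
  by (intro exI[of _ "U \<inter> W"]) (auto simp: hol_on_iff_hol_at intro!: hol_at_add hol_at_cmult)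
qed

lemma analytic_fun_entire: "(!!z. hol_at h z) ==> analytic_fun h S"
 unfolding analytic_fun_def by (intro exI[of _ UNIV]) (auto simp: hol_on_iff_hol_at)

section \<open>Dilations of an absolutely convex neighbourhood\<close>

context
 fixes K0 :: "(complex ^ 'd) set"
 assumes K0: "compact K0" "absolutely_convex K0" "0 \<in> interior K0"
begin

lemma K0_scale: "x \<in> K0 ==> cmod c \<le> 1 ==> c *s x \<in> K0"
proof -
 assume x: "x \<in> K0" "cmod c \<le> 1"
 have "\<forall>a b. cmod a + cmod b \<le> 1 --> a *s x + b *s x \<in> K0"
  using K0(2) x(1) unfolding absolutely_convex_def by blast
 from this[rule_format, of c 0] show ?thesis using x(2) by simp
qed

lemma K0_scaleR: "x \<in> K0 ==> \<bar>c\<bar> \<le> 1 ==> c *\<^sub>R x \<in> K0"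
 unfolding scaleR_eq_smult by (rule K0_scale) auto

lemma convex_K0: "convex K0"
 unfolding convex_def
proof (intro ballI allI impI)
 fix x y and u v :: real assume "x \<in> K0" "y \<in> K0" "0 \<le> u" "0 \<le> v" "u + v = 1"
 then show "u *\<^sub>R x + v *\<^sub>R y \<in> K0"
  unfolding scaleR_eq_smult using K0(2) unfolding absolutely_convex_def by simp
qed

lemma zero_in_K0: "0 \<in> K0"
 using K0(3) interior_subset by blast

lemma K0_shrink: "x \<in> K0 ==> \<rho> > 1 ==> (1 / \<rho>) *\<^sub>R x \<in> interior K0"
 using mem_interior_convex_shrink[OF convex_K0 K0(3), of x "1 - 1 / \<rho>"]
 by (simp add: scaleR_left_diff_distrib)

lemma compact_dilate:
 assumes C: "compact C" and O: "open (O' :: (complex ^ 'd) set)" and sub: "C \<subseteq> O'"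
 obtains \<rho> where "\<rho> > 1" "!!x. x \<in> C ==> \<rho> *\<^sub>R x \<in> O'"
proof -
 obtain \<epsilon> where \<epsilon>: "\<epsilon> > 0" "(\<Union>x\<in>C. cball x \<epsilon>) \<subseteq> O'"
  using compact_subset_open_imp_cball_epsilon_subset[OF C O sub] by blast
 obtain B where B: "B > 0" "!!x. x \<in> C ==> norm x \<le> B"
  using compact_imp_bounded[OF C] by (auto simp: bounded_pos)
 show ?thesis
 proof (rule that[of "1 + \<epsilon> / B"])
  fix x assume x: "x \<in> C"
  have "dist x ((1 + \<epsilon> / B) *\<^sub>R x) = norm ((\<epsilon> / B) *\<^sub>R x)"
   by (simp add: dist_norm algebra_simps)
  also have "\<dots> \<le> \<epsilon>"
   using B(1) B(2)[OF x] \<epsilon>(1) by (simp add: field_simps)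
  finally show "(1 + \<epsilon> / B) *\<^sub>R x \<in> O'" using \<epsilon>(2) x by force
 qed (use \<epsilon> B in simp)
qed

lemma nbhd_dilate:
 assumes U: "open U" "(+) p ` K0 \<subseteq> U"
 obtains \<rho> where "\<rho> > 1" "!!x. x \<in> K0 ==> p + \<rho> *\<^sub>R x \<in> U"
proof -
 have "open ((+) (- p) ` U)" by (rule open_translation[OF U(1)])
 moreover have "K0 \<subseteq> (+) (- p) ` U" using U(2) by force
 ultimately obtain \<rho> where "\<rho> > 1" "!!x. x \<in> K0 ==> \<rho> *\<^sub>R x \<in> (+) (- p) ` U"
  using compact_dilate[OF K0(1)] by blast
 then show ?thesis using that[of \<rho>] by force
qed

text \<open>The remainder along the line through \<open>v\<close> requires a whole complex disc of
  points. Stability of \<open>K0\<close> under complex scalars of modulus at most 1 places this disc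
  in the dilate by \<open>\<rho>\<close>; \<open>\<sigma>\<close> is the room left beyond
  \<open>v\<close>.\<close>

lemma taylor_dilate:
 fixes h :: "complex ^ 'd => complex"
 assumes \<alpha>: "mi_numbering \<alpha>" and U: "open U" and h: "hol_on h U" and \<rho>: "!!x. x \<in> K0 ==> p + \<rho> *\<^sub>R x \<in> U"
  and M: "!!x. x \<in> K0 ==> cmod (h (p + \<rho> *\<^sub>R x) * exp_fun (- p) (p + \<rho> *\<^sub>R x)) \<le> M"
  and v: "v = (\<rho> / \<sigma>) *\<^sub>R x" "x \<in> K0" "\<sigma> > 1" "\<rho> > 0"
 shows "cmod (h (p + v) - (\<Sum>i<rE TYPE('d) n. nu \<alpha> p i h * u_fun \<alpha> p i (p + v)))
   \<le> cmod (exp_fun p (p + v)) * (M / \<sigma> ^ Suc n * (\<sigma> / (\<sigma> - 1)))"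
proof (rule nu_remainder[OF \<alpha> U h v(3)])
 fix s :: complex assume s: "cmod s \<le> \<sigma>"
 have "s *s v = \<rho> *\<^sub>R ((s / of_real \<sigma>) *s x)"
  unfolding v(1) by (simp add: scaleR_eq_smult vec.scale_scale)
 moreover have "(s / of_real \<sigma>) *s x \<in> K0"
  by (rule K0_scale[OF v(2)]) (use s v(3) in \<open>simp add: norm_divide\<close>)
 ultimately show "p + s *s v \<in> U \<and> cmod (h (p + s *s v) * exp_fun (- p) (p + s *s v)) \<le> M"
  using \<rho> M by metis
qed

lemma mult_exp_bound_dilate:
 assumes U: "open U" and h: "hol_on h U" and \<rho>: "!!x. x \<in> K0 ==> p + \<rho> *\<^sub>R x \<in> U"
 obtains M where "M \<ge> 0" "!!x. x \<in> K0 ==> cmod (h (p + \<rho> *\<^sub>R x) * exp_fun (- p) (p + \<rho> *\<^sub>R x)) \<le> M"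
proof -
 have "compact ((%x. h (p + \<rho> *\<^sub>R x) * exp_fun (- p) (p + \<rho> *\<^sub>R x)) ` K0)"
 proof (rule compact_continuous_image[OF _ K0(1)])
  show "continuous_on K0 (%x. h (p + \<rho> *\<^sub>R x) * exp_fun (- p) (p + \<rho> *\<^sub>R x))"
   by (rule continuous_on_compose2[OF hol_on_continuous_on[OF hol_on_mult_exp[OF h, of "- p"]]])
     (use \<rho> in \<open>auto intro!: continuous_intros\<close>)
 qed
 then have "bounded ((%x. h (p + \<rho> *\<^sub>R x) * exp_fun (- p) (p + \<rho> *\<^sub>R x)) ` K0)"
  by (rule compact_imp_bounded)
 then obtain M where "\<forall>y\<in>(%x. h (p + \<rho> *\<^sub>R x) * exp_fun (- p) (p + \<rho> *\<^sub>R x)) ` K0. cmod y \<le> M"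
  unfolding bounded_iff by blast
 then show ?thesis using that[of "max M 0"] by force
qed

subsection \<open>Analytic functionals are determined by their values on exponentials\<close>

lemma germ_dualD:
 assumes "\<nu> \<in> germ_dual S"
 shows "\<not> analytic_fun h S ==> \<nu> h = 0"
  and "analytic_fun g S ==> analytic_fun h S ==> \<nu> (%z. a * g z + b * h z) = a * \<nu> g + b * \<nu> h"
  and "open U ==> S \<subseteq> U ==> \<exists>L c. compact L \<and> L \<noteq> {} \<and> L \<subseteq> U \<and> (\<forall>h. hol_on h U --> cmod (\<nu> h) \<le> c * (SUP z\<in>L. cmod (h z)))"
 using assms unfolding germ_dual_def by blast+

lemma germ_dual_bound:
 assumes \<nu>: "\<nu> \<in> germ_dual S" and U: "open U" "S \<subseteq> U"
 obtains L c where "compact L" "L \<subseteq> U" "c \<ge> 0" "!!h M. hol_on h U ==> (!!z. z \<in> L ==> cmod (h z) \<le> M) ==> cmod (\<nu> h) \<le> c * M"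
proof -
 obtain L c where L: "compact L" "L \<noteq> {}" "L \<subseteq> U" "!!h. hol_on h U ==> cmod (\<nu> h) \<le> c * (SUP z\<in>L. cmod (h z))"
  using germ_dualD(3)[OF \<nu> U] by blast
 show ?thesis
 \<comment> \<open>\<open>germ_dual\<close> prescribes no sign for its constant.\<close>
 proof (rule that[of L "max c 0"])
  fix h M assume h: "hol_on h U" "!!z. z \<in> L ==> cmod (h z) \<le> M"
  obtain z0 where z0: "z0 \<in> L" using L(2) by blast
  have "cmod (h z0) \<le> (SUP z\<in>L. cmod (h z))"
   by (rule cSUP_upper[OF z0]) (use h(2) in \<open>auto intro!: bdd_aboveI2\<close>)
  then have pos: "0 \<le> (SUP z\<in>L. cmod (h z))" by (rule order_trans[OF norm_ge_zero])
  have "cmod (\<nu> h) \<le> c * (SUP z\<in>L. cmod (h z))" by (rule L(4)[OF h(1)])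
  also have "\<dots> \<le> max c 0 * (SUP z\<in>L. cmod (h z))" using pos by (intro mult_right_mono) auto
  also have "\<dots> \<le> max c 0 * M" using L(2) h(2) by (intro mult_left_mono cSUP_least) auto
  finally show "cmod (\<nu> h) \<le> max c 0 * M" .
 qed (use L in auto)
qed

lemma exp_quotient_bound:
 assumes "cmod x \<le> B" "0 < cmod s" "cmod s \<le> 1"
 shows "cmod ((exp (s * x) - 1) / s - x) \<le> exp B * B\<^sup>2 * cmod s"
proof -
 have B: "B \<ge> 0" using assms(1) norm_ge_zero order_trans by blast
 have sx: "cmod (s * x) \<le> B"
  using mult_mono[of "cmod s" 1 "cmod x" B] assms by (simp add: norm_mult)
 have "cmod (exp (s * x) - (\<Sum>k\<le>1. (s * x) ^ k / fact k)) \<le> exp (cmod (s * x)) * cmod (s * x) ^ Suc 1 / fact 1"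
  by (rule Taylor_exp_field)
 also have "\<dots> \<le> exp B * (cmod s * B)\<^sup>2"
  using sx assms B by (auto simp: norm_mult numeral_2_eq_2[symmetric] intro!: mult_mono power_mono mult_left_mono)
 finally have "cmod (exp (s * x) - 1 - s * x) \<le> exp B * B\<^sup>2 * (cmod s)\<^sup>2"
  by (simp add: power_mult_distrib algebra_simps)
 moreover have "(exp (s * x) - 1) / s - x = (exp (s * x) - 1 - s * x) / s"
  using assms(2) by (simp add: field_simps)
 ultimately show ?thesis
  using assms(2) by (simp add: norm_divide divide_le_eq power2_eq_square mult_ac)
qed

lemma star_prod_axis: "star_prod (axis k c) z = cnj c * z $ k"
proof -
 have "star_prod (axis k c) z = (\<Sum>j\<in>UNIV. if j = k then cnj c * z $ k else 0)"
  unfolding star_prod_def by (intro sum.cong refl) (auto simp: axis_def)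
 then show ?thesis by simp
qed

lemma exp_fun_add_axis: "exp_fun (w + axis k (cnj s)) z = exp_fun w z * exp (s * z $ k)"
 unfolding exp_fun_def star_prod_add_left star_prod_axis exp_add by simp

text \<open>Differentiating in the parameter of the exponential inserts coordinate functions, so the values on exponentials
determine those on polynomial multiples of exponentials.\<close>

lemma germ_dual_exp_derivative:
 fixes P :: "complex ^ 'd => complex"
 assumes \<nu>: "\<nu> \<in> germ_dual S" and P: "!!z. hol_at P z"
 shows "((%s. (\<nu> (%z. P z * exp_fun (w + axis k (cnj s)) z) - \<nu> (%z. P z * exp_fun w z)) / s)
   \<longlongrightarrow> \<nu> (%z. z $ k * P z * exp_fun w z)) (at 0)"
proof -
 obtain L c where L: "compact L" "c \<ge> 0" "!!h M. hol_on h UNIV ==> (!!z. z \<in> L ==> cmod (h z) \<le> M) ==> cmod (\<nu> h) \<le> c * M"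
  using germ_dual_bound[OF \<nu> open_UNIV subset_UNIV] by metis
 have hPe: "hol_at (%z. P z * exp_fun w z) z" for z w by (intro hol_at_mult P hol_at_exp_fun)
 have hz: "hol_at (%z. z $ k * P z * exp_fun w z) z" for z by (intro hol_at_mult P hol_at_exp_fun hol_at_coord)
 have "compact ((%z. P z * exp_fun w z) ` L)"
  by (intro compact_continuous_image L continuous_at_imp_continuous_on ballI hol_at_isCont hPe)
 then have "bounded ((%z. P z * exp_fun w z) ` L)"
  by (rule compact_imp_bounded)
 then obtain D where D: "!!z. z \<in> L ==> cmod (P z * exp_fun w z) \<le> D"
  unfolding bounded_iff by blast
 obtain B where B: "!!z. z \<in> L ==> norm z \<le> B"
  using compact_imp_bounded[OF L(1)] by (auto simp: bounded_iff)
 define C where "C = c * (\<bar>D\<bar> * (exp B * B\<^sup>2))"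
 have le: "cmod ((\<nu> (%z. P z * exp_fun (w + axis k (cnj s)) z) - \<nu> (%z. P z * exp_fun w z)) / s
   - \<nu> (%z. z $ k * P z * exp_fun w z)) \<le> C * cmod s" if s: "0 < cmod s" "cmod s \<le> 1" for s
 proof -
  \<comment> \<open>The error is the value of the functional at one entire function, which is
    bounded on \<open>L\<close> by a multiple of \<open>cmod s\<close>.\<close>
  let ?q = "%z. P z * exp_fun w z * ((exp (s * z $ k) - 1) / s - z $ k)"
  have eq: "?q = (%z. 1 * ((1 / s) * (P z * exp_fun (w + axis k (cnj s)) z) + (- 1 / s) * (P z * exp_fun w z))
    + (- 1) * (z $ k * P z * exp_fun w z))"
   using s by (auto simp: exp_fun_add_axis field_simps)
  have "\<nu> ?q = (\<nu> (%z. P z * exp_fun (w + axis k (cnj s)) z) - \<nu> (%z. P z * exp_fun w z)) / s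
   - \<nu> (%z. z $ k * P z * exp_fun w z)"
   unfolding eq
   by (subst germ_dualD(2)[OF \<nu>], (intro analytic_fun_linear analytic_fun_entire hPe hz)+,
     subst germ_dualD(2)[OF \<nu>], (intro analytic_fun_entire hPe)+) (simp add: diff_divide_distrib)
  moreover have "cmod (\<nu> ?q) \<le> c * (\<bar>D\<bar> * (exp B * B\<^sup>2) * cmod s)"
  proof (rule L(3))
   show "hol_on ?q UNIV"
    unfolding hol_on_iff_hol_at eq
    by (intro ballI hol_at_add hol_at_cmult hPe hz)
   fix z assume z: "z \<in> L"
   have "cmod (z $ k) \<le> B" using B[OF z] Finite_Cartesian_Product.norm_nth_le[of z k] by linarith
   then have "cmod ((exp (s * z $ k) - 1) / s - z $ k) \<le> exp B * B\<^sup>2 * cmod s"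
    by (rule exp_quotient_bound[OF _ s])
   moreover have "cmod (P z * exp_fun w z) \<le> \<bar>D\<bar>" using D[OF z] by linarith
   ultimately have "cmod (?q z) \<le> \<bar>D\<bar> * (exp B * B\<^sup>2 * cmod s)"
    unfolding norm_mult[of "P z * exp_fun w z"] by (intro mult_mono) auto
   then show "cmod (?q z) \<le> \<bar>D\<bar> * (exp B * B\<^sup>2) * cmod s" by (simp only: mult.assoc)
  qed
  ultimately show ?thesis by (simp add: C_def mult_ac)
 qed
 show ?thesis
 proof (rule Lim_null[THEN iffD2], rule Lim_null_comparison)
  show "\<forall>\<^sub>F s in at 0. cmod ((\<nu> (%z. P z * exp_fun (w + axis k (cnj s)) z) - \<nu> (%z. P z * exp_fun w z)) / s
   - \<nu> (%z. z $ k * P z * exp_fun w z)) \<le> C * cmod s"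
   unfolding eventually_at by (intro exI[of _ 1]) (use le in \<open>auto simp: dist_norm\<close>)
  have "((%s. C * cmod s) \<longlongrightarrow> C * cmod 0) (at (0::complex))" by (intro tendsto_intros)
  then show "((%s. C * cmod s) \<longlongrightarrow> 0) (at (0::complex))" by simp
 qed
qed

text \<open>The induction on the degree runs over all \<open>w\<close> at once, because
  differentiating at \<open>w\<close> uses the case of lower degree at parameters near
  \<open>w\<close>.\<close>

lemma germ_dual_eq_on_polynomials:
 fixes p :: "complex ^ 'd"
 assumes \<nu>: "\<nu> \<in> germ_dual S" "\<nu>' \<in> germ_dual S" and eq: "!!w. \<nu> (exp_fun w) = \<nu>' (exp_fun w)"
 shows "\<nu> (%z. mi_power (z - p) a * exp_fun w z) = \<nu>' (%z. mi_power (z - p) a * exp_fun w z)"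
proof (induction "mi_deg a" arbitrary: a w)
 case 0
 then have "a = (%_. 0)" using mi_deg_0_iff by metis
 then have "(%z. mi_power (z - p) a * exp_fun w z) = exp_fun w" by (simp add: mi_power_def)
 then show ?case using eq by simp
next
 case (Suc n)
 then obtain k where k: "a k > 0"
  by (metis gr0I mi_deg_0_iff Zero_not_Suc ext)
 define b where "b = a(k := a k - 1)"
 define P where "P z = mi_power (z - p) b" for z
 have n: "n = mi_deg b" using mi_deg_decr[of a k, OF k] Suc(2) by (simp add: b_def)
 have P: "hol_at P z" for z unfolding P_def[abs_def] by (rule hol_at_mi_power)
 have IH: "\<nu> (%z. P z * exp_fun w z) = \<nu>' (%z. P z * exp_fun w z)" for w
  unfolding P_def by (rule Suc(1)[OF n])
 have 1: "\<nu> (%z. z $ k * P z * exp_fun w z) = \<nu>' (%z. z $ k * P z * exp_fun w z)"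
  using germ_dual_exp_derivative[OF \<nu>(1) P, of w k] germ_dual_exp_derivative[OF \<nu>(2) P, of w k]
  unfolding IH by (rule tendsto_unique[OF at_neq_bot])
 have 2: "(%z. mi_power (z - p) a * exp_fun w z) = (%z. 1 * (z $ k * P z * exp_fun w z) + (- p $ k) * (P z * exp_fun w z))"
  unfolding P_def mi_power_decr[of a k, OF k] b_def[symmetric] by (simp add: algebra_simps)
 have A: "analytic_fun (%z. z $ k * P z * exp_fun w z) S" "analytic_fun (%z. P z * exp_fun w z) S"
  by (intro analytic_fun_entire hol_at_mult hol_at_coord P hol_at_exp_fun)+
 show ?case
  unfolding 2 germ_dualD(2)[OF \<nu>(1) A] germ_dualD(2)[OF \<nu>(2) A] 1 IH ..
qed

lemma germ_dual_sum:
 assumes \<nu>: "\<nu> \<in> germ_dual S" and I: "finite I" and g: "!!i z. i \<in> I ==> hol_at (g i) z"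
 shows "\<nu> (%z. \<Sum>i\<in>I. c i * g i z) = (\<Sum>i\<in>I. c i * \<nu> (g i))"
 using I g
proof (induction I rule: finite_induct)
 case empty
 have A: "analytic_fun (%z. 0) S" by (intro analytic_fun_entire hol_at_const)
 show ?case using germ_dualD(2)[OF \<nu> A A, of 0 0] by simp
next
 case (insert i I)
 have A: "analytic_fun (g i) S" "analytic_fun (%z. \<Sum>i\<in>I. c i * g i z) S"
  using insert by (auto intro!: analytic_fun_entire conjunct1[OF hol_at_sum] hol_at_cmult)
 show ?case
  using germ_dualD(2)[OF \<nu> A, of "c i" 1] insert by simp
qed

text \<open>On a compact subset of a slightly larger dilate of the interior of \<open>K0\<close> the
  Taylor series converges uniformly, and by continuity the functional sees only such a set.\<close>

lemma germ_dual_taylor: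
 assumes \<alpha>: "mi_numbering \<alpha>" and \<nu>: "\<nu> \<in> germ_dual ((+) p ` K0)" and h: "analytic_fun h ((+) p ` K0)"
 shows "(%n. \<Sum>i<rE TYPE('d) n. nu \<alpha> p i h * \<nu> (u_fun \<alpha> p i)) \<longlonglongrightarrow> \<nu> h"
proof -
 obtain U where U: "open U" "(+) p ` K0 \<subseteq> U" "hol_on h U" using h by (auto simp: analytic_fun_def)
 obtain \<rho> where \<rho>: "\<rho> > 1" "!!x. x \<in> K0 ==> p + \<rho> *\<^sub>R x \<in> U" using nbhd_dilate[OF U(1,2)] by blast
 obtain M where M: "M \<ge> 0" "!!x. x \<in> K0 ==> cmod (h (p + \<rho> *\<^sub>R x) * exp_fun (- p) (p + \<rho> *\<^sub>R x)) \<le> M"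
  using mult_exp_bound_dilate[OF U(1,3) \<rho>(2)] by blast
 \<comment> \<open>Continuity is invoked for this dilate and not for \<open>U\<close>, since the
   series is controlled only inside the dilate.\<close>
 define W where "W = (+) p ` ((*\<^sub>R) \<rho> ` interior K0)"
 have W: "open W" "(+) p ` K0 \<subseteq> W" "W \<subseteq> U"
 proof -
  show "open W" unfolding W_def using \<rho>(1) by (intro open_translation open_scaling) auto
  show "(+) p ` K0 \<subseteq> W"
  proof
   fix y assume "y \<in> (+) p ` K0"
   then obtain x where x: "x \<in> K0" "y = p + x" by blast
   then show "y \<in> W"
    unfolding W_def using K0_shrink[OF x(1) \<rho>(1)] \<rho>(1) by (intro image_eqI[of _ _ x] image_eqI[of _ _ "(1/\<rho>) *\<^sub>R x"]) auto
  qed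
  show "W \<subseteq> U" unfolding W_def using \<rho>(2) interior_subset by blast
 qed
 obtain L c where L: "compact L" "L \<subseteq> W" "c \<ge> 0" "!!h M. hol_on h W ==> (!!z. z \<in> L ==> cmod (h z) \<le> M) ==> cmod (\<nu> h) \<le> c * M"
  using germ_dual_bound[OF \<nu> W(1,2)] by metis
 define L' where "L' = (%z. (1/\<rho>) *\<^sub>R (z - p)) ` L"
 have "compact L'" unfolding L'_def by (intro compact_continuous_image continuous_intros L(1))
 moreover have "L' \<subseteq> interior K0" using L(2) \<rho>(1) by (auto simp: L'_def W_def)
 \<comment> \<open>Compactness leaves a margin \<open>\<sigma>\<close>, whose inverse becomes the
   ratio of the geometric convergence.\<close>
 ultimately obtain \<sigma> where \<sigma>: "\<sigma> > 1" "!!x. x \<in> L' ==> \<sigma> *\<^sub>R x \<in> interior K0"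
  using compact_dilate[of L' "interior K0"] by blast
 obtain E where E: "E > 0" "!!z. z \<in> L ==> cmod (exp_fun p z) \<le> E"
  using exp_fun_bound_on[OF compact_imp_bounded[OF L(1)]] by blast
 let ?S = "%n z. \<Sum>i<rE TYPE('d) n. nu \<alpha> p i h * u_fun \<alpha> p i z"
 have hS: "hol_at (?S n) z" for n z
  by (auto intro!: conjunct1[OF hol_at_sum] hol_at_cmult hol_at_u_fun)
 have hW: "hol_on h W" by (rule hol_on_subset[OF U(3) W(3)])
 have Ah: "analytic_fun h ((+) p ` K0)" "analytic_fun (?S n) ((+) p ` K0)" for n
  using h by (auto intro!: analytic_fun_entire hS)
 define D where "D = c * (E * M * (\<sigma> / (\<sigma> - 1)))"
 have le: "cmod (\<nu> (?S n) - \<nu> h) \<le> D * (1/\<sigma>) ^ Suc n" for n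
 proof -
  have "cmod (\<nu> (%z. 1 * h z + (- 1) * ?S n z)) \<le> c * (E * (M / \<sigma> ^ Suc n * (\<sigma> / (\<sigma> - 1))))"
  proof (rule L(4))
   show "hol_on (%z. 1 * h z + - 1 * ?S n z) W"
    using hW hS by (auto simp: hol_on_iff_hol_at intro!: hol_at_diff)
   fix z assume z: "z \<in> L"
   define x where "x = \<sigma> *\<^sub>R ((1/\<rho>) *\<^sub>R (z - p))"
   have "(1/\<rho>) *\<^sub>R (z - p) \<in> L'" unfolding L'_def by (rule imageI[OF z])
   then have x: "x \<in> K0" unfolding x_def using \<sigma>(2) interior_subset by blast
   have v: "z - p = (\<rho> / \<sigma>) *\<^sub>R x" using \<rho>(1) \<sigma>(1) by (simp add: x_def)
   have "cmod (h (p + (z - p)) - ?S n (p + (z - p))) \<le> cmod (exp_fun p (p + (z - p))) * (M / \<sigma> ^ Suc n * (\<sigma> / (\<sigma> - 1)))"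
    by (rule taylor_dilate[OF \<alpha> U(1,3) \<rho>(2) M(2) v x \<sigma>(1)]) (use \<rho>(1) in auto)
   also have "\<dots> \<le> E * (M / \<sigma> ^ Suc n * (\<sigma> / (\<sigma> - 1)))"
    using E(2)[OF z] M(1) \<sigma>(1) by (intro mult_right_mono) auto
   finally show "cmod (1 * h z + - 1 * ?S n z) \<le> E * (M / \<sigma> ^ Suc n * (\<sigma> / (\<sigma> - 1)))" by simp
  qed
  also have "\<dots> = D * (1/\<sigma>) ^ Suc n" by (simp add: D_def power_one_over)
  finally show ?thesis
   using germ_dualD(2)[OF \<nu> Ah, of 1 "- 1" n] by (simp add: norm_minus_commute)
 qed
 have "(%n. \<nu> (?S n)) \<longlonglongrightarrow> \<nu> h"
 proof (rule Lim_null[THEN iffD2], rule Lim_null_comparison)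
  show "\<forall>\<^sub>F n in sequentially. cmod (\<nu> (?S n) - \<nu> h) \<le> D * (1/\<sigma>) ^ Suc n" using le by simp
  have "(%n. (1/\<sigma>) ^ Suc n) \<longlonglongrightarrow> 0" by (rule LIMSEQ_Suc[OF LIMSEQ_power_zero]) (use \<sigma>(1) in auto)
  then show "(%n. D * (1/\<sigma>) ^ Suc n) \<longlonglongrightarrow> 0" by (rule tendsto_mult_right_zero)
 qed
 moreover have "\<nu> (?S n) = (\<Sum>i<rE TYPE('d) n. nu \<alpha> p i h * \<nu> (u_fun \<alpha> p i))" for n
  by (rule germ_dual_sum[OF \<nu>]) (auto intro: hol_at_u_fun)
 ultimately show ?thesis by simp
qed

text \<open>Injectivity of the transform. It removes the dependence on the preimage picked by
  \<open>inv_into\<close> in \<open>push_forward_tilde\<close>.\<close>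

lemma germ_dual_eqI:
 assumes \<alpha>: "mi_numbering (\<alpha> :: nat => 'd => nat)"
  and \<nu>: "\<nu> \<in> germ_dual ((+) p ` K0)" "\<nu>' \<in> germ_dual ((+) p ` K0)" and eq: "FB_conj \<nu> = FB_conj \<nu>'"
  and h: "analytic_fun h ((+) p ` K0)"
 shows "\<nu> h = \<nu>' h"
proof -
 have "\<nu> (exp_fun w) = \<nu>' (exp_fun w)" for w
  using fun_cong[OF eq, of w] by (simp add: FB_conj_def)
 note poly = germ_dual_eq_on_polynomials[OF \<nu> this]
 have "\<nu> (u_fun \<alpha> p i) = \<nu>' (u_fun \<alpha> p i)" for i
 proof -
  let ?G = "%z. mi_power (z - p) (\<alpha> i) * exp_fun p z"
  have u: "u_fun \<alpha> p i = (%z. of_real (sc (\<alpha> i) p) * ?G z + 0 * ?G z)"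
   by (auto simp: u_fun_eq)
  have A: "analytic_fun ?G ((+) p ` K0)"
   by (intro analytic_fun_entire hol_at_mult hol_at_mi_power hol_at_exp_fun)
  show ?thesis
   unfolding u germ_dualD(2)[OF \<nu>(1) A A] germ_dualD(2)[OF \<nu>(2) A A] poly ..
 qed
 then show ?thesis
  using germ_dual_taylor[OF \<alpha> \<nu>(1) h] germ_dual_taylor[OF \<alpha> \<nu>(2) h] LIMSEQ_unique by simp
qed

text \<open>Members of \<open>germ_dual\<close> have to vanish on functions that are not analytic, a
  clause which \<open>nu\<close> itself need not meet.\<close>

definition nu_germ :: "(nat => 'd => nat) => complex ^ 'd => nat => (complex ^ 'd => complex) => complex" where
 "nu_germ \<alpha> p j h = (if analytic_fun h ((+) p ` K0) then nu \<alpha> p j h else 0)"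

lemma p_in: "p \<in> (+) p ` K0"
 using zero_in_K0 by force

lemma nu_germ_in_germ_dual: "nu_germ \<alpha> p j \<in> germ_dual ((+) p ` K0)"
 unfolding germ_dual_def
proof (intro CollectI conjI allI impI)
 fix h assume "\<not> analytic_fun h ((+) p ` K0)"
 then show "nu_germ \<alpha> p j h = 0" by (simp add: nu_germ_def)
next
 fix g h assume *: "analytic_fun g ((+) p ` K0) \<and> analytic_fun h ((+) p ` K0) \<and>
  (\<exists>U. open U \<and> (+) p ` K0 \<subseteq> U \<and> (\<forall>z\<in>U. g z = h z))"
 then obtain U where U: "open U" "(+) p ` K0 \<subseteq> U" "\<forall>z\<in>U. g z = h z" by blast
 have "nu \<alpha> p j g = nu \<alpha> p j h"
  by (rule nu_cong[OF U(1)]) (use U p_in in auto)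
 then show "nu_germ \<alpha> p j g = nu_germ \<alpha> p j h" using * by (simp add: nu_germ_def)
next
 fix g h and a b :: complex assume *: "analytic_fun g ((+) p ` K0) \<and> analytic_fun h ((+) p ` K0)"
 then obtain U W where UW: "open U" "(+) p ` K0 \<subseteq> U" "hol_on g U" "open W" "(+) p ` K0 \<subseteq> W" "hol_on h W"
  by (auto simp: analytic_fun_def)
 have "nu \<alpha> p j (%z. a * g z + b * h z) = a * nu \<alpha> p j g + b * nu \<alpha> p j h"
  by (rule nu_lin[of "U \<inter> W"]) (use UW p_in in \<open>auto intro: hol_on_subset\<close>)
 then show "nu_germ \<alpha> p j (%z. a * g z + b * h z) = a * nu_germ \<alpha> p j g + b * nu_germ \<alpha> p j h"
  using * analytic_fun_linear[of g "(+) p ` K0" h a b] by (simp add: nu_germ_def)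
next
 fix U assume U: "open U \<and> (+) p ` K0 \<subseteq> U"
 then have "p \<in> U" using p_in by blast
 then have "\<exists>r>0. cball p r \<subseteq> U" using open_contains_cball_eq U by blast
 then obtain r0 where r0: "r0 > 0" "cball p r0 \<subseteq> U" by blast
 define r where "r = min r0 1"
 have r: "r > 0" "r \<le> 1" "cball p r \<subseteq> U" using r0 by (auto simp: r_def)
 obtain c where c: "c \<ge> 0" "!!h r M. r > 0 ==> r \<le> 1 ==> hol_on h (ball p r) ==> (!!x. x\<in>ball p r ==> cmod (h x) \<le> M) ==>
   cmod (nu \<alpha> p j h) \<le> c * M / r ^ mi_deg (\<alpha> j)"
  using nu_bound[of p \<alpha> j] by blast
 show "\<exists>L c. compact L \<and> L \<noteq> {} \<and> L \<subseteq> U \<and> (\<forall>h. hol_on h U --> cmod (nu_germ \<alpha> p j h) \<le> c * (SUP z\<in>L. cmod (h z)))"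
 proof (intro exI[of _ "cball p r"] exI[of _ "c / r ^ mi_deg (\<alpha> j)"] conjI allI impI)
  fix h assume h: "hol_on h U"
  then have "analytic_fun h ((+) p ` K0)" using U by (auto simp: analytic_fun_def)
  then have 1: "nu_germ \<alpha> p j h = nu \<alpha> p j h" by (simp add: nu_germ_def)
  have "compact ((%z. cmod (h z)) ` cball p r)"
   by (intro compact_continuous_image continuous_on_norm hol_on_continuous_on hol_on_subset[OF h] r) simp
  then have "bdd_above ((%z. cmod (h z)) ` cball p r)"
   by (simp add: bounded_imp_bdd_above compact_imp_bounded)
  then have "cmod (h x) \<le> (SUP z\<in>cball p r. cmod (h z))" if "x \<in> ball p r" for x
   using that by (intro cSUP_upper) auto
  then have "cmod (nu \<alpha> p j h) \<le> c * (SUP z\<in>cball p r. cmod (h z)) / r ^ mi_deg (\<alpha> j)"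
   by (intro c(2) r hol_on_subset[OF h]) (use r(3) ball_subset_cball in auto)
  then show "cmod (nu_germ \<alpha> p j h) \<le> c / r ^ mi_deg (\<alpha> j) * (SUP z\<in>cball p r. cmod (h z))"
   by (simp add: 1)
 qed (use r in auto)
qed

section \<open>The push-forward in the dual basis\<close>

lemma FB_conj_nu_germ: "FB_conj (nu_germ \<alpha> p j) = u_fun \<alpha> p j"
 by (rule ext) (simp add: FB_conj_def nu_germ_def nu_exp_fun analytic_fun_entire hol_at_exp_fun)

text \<open>By injectivity the chosen preimage of \<open>u_fun \<alpha> p j\<close> agrees with
  \<open>nu \<alpha> p j\<close> on analytic functions, and \<open>nu_compose\<close> applied to an
  exponential expands the image in the basis.\<close>

lemma push_forward_tilde_u_fun:
 assumes \<alpha>: "mi_numbering (\<alpha> :: nat => 'd => nat)"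
  and f: "analytic_map f ((+) p ` K0)" "f p = p" and j: "j < rE TYPE('d) n"
 shows "push_forward_tilde ((+) p ` K0) f (u_fun \<alpha> p j)
   = (%w. \<Sum>i<rE TYPE('d) n. cnj (nu \<alpha> p j (%z. u_fun \<alpha> p i (f z))) * u_fun \<alpha> p i w)"
proof
 fix w :: "complex ^ 'd"
 let ?K = "(+) p ` K0"
 define \<nu> where "\<nu> = inv_into (germ_dual ?K) FB_conj (u_fun \<alpha> p j)"
 have im: "u_fun \<alpha> p j \<in> FB_conj ` germ_dual ?K"
  using FB_conj_nu_germ nu_germ_in_germ_dual by (metis image_eqI)
 have \<nu>: "\<nu> \<in> germ_dual ?K" "FB_conj \<nu> = FB_conj (nu_germ \<alpha> p j)"
  unfolding \<nu>_def FB_conj_nu_germ by (rule inv_into_into[OF im], rule f_inv_into_f[OF im])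
 obtain U where U: "open U" "?K \<subseteq> U" "!!k. hol_on (%z. f z $ k) U"
  using f(1) by (auto simp: analytic_map_def)
 have he: "hol_on (exp_fun w) UNIV" by (simp add: hol_on_iff_hol_at hol_at_exp_fun)
 have "hol_on (%z. exp_fun w (f z)) U" by (rule hol_on_compose[OF he U(3)]) simp
 then have A: "analytic_fun (%z. exp_fun w (f z)) ?K" using U by (auto simp: analytic_fun_def)
 have "push_forward_tilde ?K f (u_fun \<alpha> p j) w = cnj (\<nu> (%z. exp_fun w (f z)))"
  by (simp add: push_forward_tilde_def \<nu>_def[symmetric] FB_conj_def push_forward_def comp_def
    analytic_fun_entire hol_at_exp_fun)
 also have "\<nu> (%z. exp_fun w (f z)) = nu \<alpha> p j (%z. exp_fun w (f z))"
  using germ_dual_eqI[OF \<alpha> \<nu>(1) nu_germ_in_germ_dual \<nu>(2) A] A by (simp add: nu_germ_def)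
 also have "\<dots> = (\<Sum>i<rE TYPE('d) n. nu \<alpha> p i (exp_fun w) * nu \<alpha> p j (%z. u_fun \<alpha> p i (f z)))"
  by (rule nu_compose[OF \<alpha> open_UNIV UNIV_I he U(1) _ U(3) f(2) j]) (use U(2) p_in in auto)
 finally show "push_forward_tilde ?K f (u_fun \<alpha> p j) w
   = (\<Sum>i<rE TYPE('d) n. cnj (nu \<alpha> p j (%z. u_fun \<alpha> p i (f z))) * u_fun \<alpha> p i w)"
  by (simp add: nu_exp_fun mult.commute)
qed

text \<open>The functionals \<open>nu\<close> read off the coefficients of a combination of the
  \<open>u_fun\<close>, so the defining description has only one solution.\<close>

lemma push_forward_mat_eq:
 assumes \<alpha>: "mi_numbering (\<alpha> :: nat => 'd => nat)"
  and f: "analytic_map f ((+) p ` K0)" "f p = p"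
 shows "push_forward_mat \<alpha> p ((+) p ` K0) f n
   = Matrix.mat (rE TYPE('d) n) (rE TYPE('d) n) (%(i, j). cnj (nu \<alpha> p j (%z. u_fun \<alpha> p i (f z))))"
 unfolding push_forward_mat_def
proof (rule the_equality)
 let ?r = "rE TYPE('d) n" and ?K = "(+) p ` K0"
 let ?C = "Matrix.mat ?r ?r (%(i, j). cnj (nu \<alpha> p j (%z. u_fun \<alpha> p i (f z))))"
 show "?C \<in> carrier_mat ?r ?r \<and> (\<forall>j<?r. push_forward_tilde ?K f (u_fun \<alpha> p j) = (%z. \<Sum>i<?r. ?C $$ (i, j) * u_fun \<alpha> p i z))"
  by (auto simp: push_forward_tilde_u_fun[OF \<alpha> f])
 fix C assume C: "C \<in> carrier_mat ?r ?r \<and> (\<forall>j<?r. push_forward_tilde ?K f (u_fun \<alpha> p j) = (%z. \<Sum>i<?r. C $$ (i, j) * u_fun \<alpha> p i z))"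
 have inj: "inj \<alpha>" using \<alpha> by (simp add: mi_numbering_def bij_is_inj)
 have nus: "nu \<alpha> p i (%z. \<Sum>i<?r. c i * u_fun \<alpha> p i z) = c i" if "i < ?r" for c i
 proof -
  have "nu \<alpha> p i (%z. \<Sum>i<?r. c i * u_fun \<alpha> p i z) = (\<Sum>l<?r. c l * nu \<alpha> p i (u_fun \<alpha> p l))"
   by (rule nu_sum[OF open_UNIV UNIV_I]) (auto simp: hol_on_iff_hol_at hol_at_u_fun)
  then show ?thesis using that by (simp add: nu_u_fun[OF inj] if_distrib cong: if_cong)
 qed
 show "C = ?C"
 proof (rule eq_matI)
  fix i j assume ij: "i < dim_row ?C" "j < dim_col ?C"
  then have "(%z. \<Sum>i<?r. C $$ (i, j) * u_fun \<alpha> p i z) = (%z. \<Sum>i<?r. cnj (nu \<alpha> p j (%z. u_fun \<alpha> p i (f z))) * u_fun \<alpha> p i z)"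
   using C push_forward_tilde_u_fun[OF \<alpha> f] by simp
  then show "C $$ (i, j) = ?C $$ (i, j)"
   using nus[of i "%i. C $$ (i, j)"] nus[of i "%i. cnj (nu \<alpha> p j (%z. u_fun \<alpha> p i (f z)))"] ij by simp
 qed (use C in auto)
qed

text \<open>The coordinate function is the derivative of the exponentials in their parameter at
  \<open>w = 0\<close>. By \<open>germ_dual_exp_derivative\<close> the functional may be exchanged
  with this derivative, and \<open>nu_exp_fun\<close> identifies the result; the conjugates come
  from the antilinear dependence on \<open>w\<close>.\<close>

lemma nu_coord_aux:
 fixes p :: "complex ^ 'd"
 shows "nu \<alpha> p j (%z. z $ k) = cnj (partial_deriv k (u_fun \<alpha> p j) 0)"
proof -
 have A: "analytic_fun (%z. exp_fun w z) S" "analytic_fun (%z. z $ k) S" for w :: "complex ^ 'd" and S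
  by (intro analytic_fun_entire hol_at_exp_fun hol_at_coord)+
 have e0: "exp_fun (0 :: complex ^ 'd) z = 1" for z by (simp add: exp_fun_def star_prod_def)
 have A1: "analytic_fun (%z :: complex ^ 'd. 1) S" for S
  by (intro analytic_fun_entire hol_at_const)
 have "exp_fun (0 :: complex ^ 'd) = (%z. 1)" by (rule ext) (rule e0)
 then have N: "nu \<alpha> p j (%z. 1) = cnj (u_fun \<alpha> p j 0)" using nu_exp_fun[of \<alpha> p j 0] by simp
 have "((%s. (nu_germ \<alpha> p j (%z. 1 * exp_fun (0 + axis k (cnj s)) z) - nu_germ \<alpha> p j (%z. 1 * exp_fun 0 z)) / s)
   \<longlongrightarrow> nu_germ \<alpha> p j (%z. z $ k * 1 * exp_fun 0 z)) (at 0)"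
  by (rule germ_dual_exp_derivative[OF nu_germ_in_germ_dual hol_at_const])
 then have "((%s. cnj ((u_fun \<alpha> p j (axis k (cnj s)) - u_fun \<alpha> p j 0) / cnj s)) \<longlongrightarrow> nu \<alpha> p j (%z. z $ k)) (at 0)"
  using A A1 N by (simp add: nu_germ_def nu_exp_fun e0)
 moreover have "((%s. cnj ((u_fun \<alpha> p j (axis k (cnj s)) - u_fun \<alpha> p j 0) / cnj s)) \<longlongrightarrow> cnj (partial_deriv k (u_fun \<alpha> p j) 0)) (at 0)"
 proof -
  have "hol_at (u_fun \<alpha> p j) (0 + 0 *s axis k 1)" by (rule hol_at_u_fun)
  from hol_at_DERIV_line[OF this]
  have "((%s. u_fun \<alpha> p j (0 + s *s axis k 1)) has_field_derivative dd (axis k 1) (u_fun \<alpha> p j) 0) (at 0)"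
   by simp
  moreover have "s *s axis k 1 = axis k s" for s :: complex by (simp add: Finite_Cartesian_Product.vec_eq_iff axis_def)
  ultimately have "((%s. (u_fun \<alpha> p j (axis k s) - u_fun \<alpha> p j 0) / s) \<longlongrightarrow> partial_deriv k (u_fun \<alpha> p j) 0) (at 0)"
   by (simp add: DERIV_def partial_deriv_eq_dd axis_def)
  moreover have "filterlim cnj (at 0) (at 0)"
   by (rule filterlim_atI) (auto intro!: tendsto_eq_intros simp: eventually_at_filter)
  ultimately have "((%s. (u_fun \<alpha> p j (axis k (cnj s)) - u_fun \<alpha> p j 0) / cnj s) \<longlongrightarrow> partial_deriv k (u_fun \<alpha> p j) 0) (at 0)"
   by (rule filterlim_compose[rotated, rotated]) 
  then show ?thesis by (rule tendsto_cnj)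
 qed
 ultimately show ?thesis by (rule tendsto_unique[OF at_neq_bot])
qed

end

section \<open>The generator on jets\<close>

text \<open>\<open>nu\<close> is continuous for uniform convergence on a small ball, so it commutes
  with differentiation in \<open>s\<close> once the difference quotients converge uniformly in
  \<open>w\<close>. Uniform continuity of \<open>H\<close> provides this.\<close>

lemma nu_has_vector_derivative:
 fixes G H :: "real => complex ^ 'd => complex"
 assumes \<delta>: "\<delta> > 0" and t: "t \<in> {0..T}"
  and G: "!!s. s \<in> {0..T} ==> hol_on (G s) (ball p \<delta>)" and H: "!!s. s \<in> {0..T} ==> hol_on (H s) (ball p \<delta>)"
  and c: "continuous_on ({0..T} \<times> ball p \<delta>) (%(s, w). H s w)"
  and d: "!!s w. s \<in> {0..T} ==> w \<in> ball p \<delta> ==> ((%s. G s w) has_vector_derivative H s w) (at s within {0..T})"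
 shows "((%s. nu \<alpha> p j (G s)) has_vector_derivative nu \<alpha> p j (H t)) (at t within {0..T})"
 unfolding has_vector_derivative_def has_derivative_within_alt
proof (intro conjI allI impI)
 show "bounded_linear (%x. x *\<^sub>R nu \<alpha> p j (H t))" by (rule bounded_linear_scaleR_left)
 fix e :: real assume e: "e > 0"
 define r where "r = min (\<delta> / 2) 1"
 have r: "r > 0" "r \<le> 1" "cball p r \<subseteq> ball p \<delta>" using \<delta> by (auto simp: r_def)
 obtain C where C: "C \<ge> 0" "!!h r M. r > 0 ==> r \<le> 1 ==> hol_on h (ball p r) ==> (!!x. x\<in>ball p r ==> cmod (h x) \<le> M) ==>
   cmod (nu \<alpha> p j h) \<le> C * M / r ^ mi_deg (\<alpha> j)"
  using nu_bound[of p \<alpha> j] by blast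
 define R where "R = r ^ mi_deg (\<alpha> j)"
 have R: "R > 0" using r by (simp add: R_def)
 \<comment> \<open>Scaled so that \<open>C * \<epsilon> / R \<le> e\<close>; the summand 1 covers
   \<open>C = 0\<close>.\<close>
 define \<epsilon> where "\<epsilon> = e * R / (C + 1)"
 have \<epsilon>: "\<epsilon> > 0" using e R C by (simp add: \<epsilon>_def)
 have "uniformly_continuous_on ({0..T} \<times> cball p r) (%(s, w). H s w)"
  by (intro compact_uniformly_continuous continuous_on_subset[OF c] compact_Times compact_cball) (use r in auto)
 then obtain \<eta> where \<eta>: "\<eta> > 0" "!!y y'. y \<in> {0..T} \<times> cball p r ==> y' \<in> {0..T} \<times> cball p r ==> dist y' y < \<eta> ==>
   dist ((%(s, w). H s w) y') ((%(s, w). H s w) y) < \<epsilon>"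
  using \<epsilon> by (elim uniformly_continuous_onE[of _ _ \<epsilon>]) auto
 show "\<exists>d>0. \<forall>y\<in>{0..T}. norm (y - t) < d -->
   norm (nu \<alpha> p j (G y) - nu \<alpha> p j (G t) - (y - t) *\<^sub>R nu \<alpha> p j (H t)) \<le> e * norm (y - t)"
 proof (intro exI[of _ \<eta>] conjI ballI impI)
  fix y assume y: "y \<in> {0..T}" "norm (y - t) < \<eta>"
  have seg: "closed_segment t y \<subseteq> {0..T}"
   using t y(1) closed_segment_subset[of t "{0..T}" y] by simp
  have b: "cmod (G y w - G t w - (y - t) *\<^sub>R H t w) \<le> \<epsilon> * norm (y - t)" if w: "w \<in> ball p r" for w
  proof -
   have "norm (G y w - G t w - (y - t) *\<^sub>R H t w) \<le> norm (y - t) * \<epsilon>"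
   proof (rule vector_differentiable_bound_linearization[where S = "closed_segment t y"])
    fix s assume s: "s \<in> closed_segment t y"
    then have s': "s \<in> {0..T}" using seg by blast
    show "((%s. G s w) has_vector_derivative H s w) (at s within closed_segment t y)"
     by (rule has_vector_derivative_within_subset[OF d[OF s' subsetD[OF r(3)]] seg]) (use w in simp)
    have "dist (s, w) (t, w) < \<eta>"
     using segment_bound(1)[OF s] y(2) by (simp add: dist_Pair_Pair dist_norm norm_minus_commute)
    then show "norm (H s w - H t w) \<le> \<epsilon>"
     using \<eta>(2)[of "(t, w)" "(s, w)"] s' t w by (simp add: dist_norm)
   qed auto
   then show ?thesis by (simp add: mult.commute)
  qed
  let ?D = "%w. 1 * (1 * G y w + (- 1) * G t w) + (- of_real (y - t)) * H t w"
  have U: "open (ball p r)" "p \<in> ball p r" using r by auto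
  have sub: "ball p r \<subseteq> ball p \<delta>" using r(3) ball_subset_cball by blast
  have hol: "hol_on (G y) (ball p r)" "hol_on (G t) (ball p r)" "hol_on (H t) (ball p r)"
   using hol_on_subset[OF G sub] hol_on_subset[OF H sub] y t by auto
  have hol2: "hol_on (%w. 1 * G y w + (- 1) * G t w) (ball p r)"
   using hol by (auto simp: hol_on_iff_hol_at intro!: hol_at_diff)
  have "nu \<alpha> p j ?D = nu \<alpha> p j (G y) - nu \<alpha> p j (G t) - (y - t) *\<^sub>R nu \<alpha> p j (H t)"
   unfolding nu_lin[OF U hol2 hol(3)] nu_lin[OF U hol(1,2)] by (simp add: scaleR_conv_of_real algebra_simps)
  moreover have "cmod (nu \<alpha> p j ?D) \<le> C * (\<epsilon> * norm (y - t)) / r ^ mi_deg (\<alpha> j)"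
  proof (rule C(2)[OF r(1,2)])
   show "hol_on ?D (ball p r)"
    using hol by (auto simp: hol_on_iff_hol_at intro!: hol_at_add hol_at_diff hol_at_cmult)
   fix w assume "w \<in> ball p r"
   from b[OF this] show "cmod (?D w) \<le> \<epsilon> * norm (y - t)"
    by (simp add: scaleR_conv_of_real algebra_simps)
  qed
  moreover have "C * (\<epsilon> * norm (y - t)) / R \<le> e * norm (y - t)"
  proof -
   have "C * \<epsilon> / R = e * (C / (C + 1))" using R by (simp add: \<epsilon>_def)
   also have "\<dots> \<le> e * 1" using C(1) e by (intro mult_left_mono) (auto simp: divide_le_eq)
   finally have "C * \<epsilon> / R * norm (y - t) \<le> e * norm (y - t)" by (intro mult_right_mono) auto
   then show ?thesis by simp
  qed
  ultimately show "norm (nu \<alpha> p j (G y) - nu \<alpha> p j (G t) - (y - t) *\<^sub>R nu \<alpha> p j (H t)) \<le> e * norm (y - t)"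
   by (simp add: R_def)
 qed (use \<eta> in simp)
qed

text \<open>The time derivative of a basis function along the flow is its Lie derivative at the
  moved point. Expanding this composition by \<open>nu_compose\<close> puts the generator to the
  left of the flow matrix.\<close>

lemma nu_flow_ode:
 fixes V :: "complex ^ 'd => complex ^ 'd"
 assumes \<alpha>: "mi_numbering (\<alpha> :: nat => 'd => nat)" and T: "T \<ge> 0" and V: "analytic_map V {p}" "V p = 0"
  and t: "t \<in> {0..T}" and j: "j < rE TYPE('d) n"
 shows "((%t. nu \<alpha> p j (%z. u_fun \<alpha> p i (flow V t z))) has_vector_derivative
   (\<Sum>k<rE TYPE('d) n. nu \<alpha> p k (Lie V (u_fun \<alpha> p i)) * nu \<alpha> p j (%z. u_fun \<alpha> p k (flow V t z)))) (at t within {0..T})"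
proof -
 have T0: "0 \<in> {0..T}" using T by simp
 obtain \<delta> where \<delta>: "\<delta> > 0" and sol: "!!w. w \<in> ball p \<delta> ==> ode_solution V T w (%t. flow V t w)"
  and c: "continuous_on ({0..T} \<times> ball p \<delta>) (%(t, w). flow V t w)"
  and h: "!!t k. t \<in> {0..T} ==> hol_on (%w. flow V t w $ k) (ball p \<delta>)"
  using flow_local[OF T flow_fixed_point(1)[OF T V T0]] by metis
 let ?u = "u_fun \<alpha> p i"
 have hu: "hol_on ?u UNIV" "hol_on ?u (hol_dom V)" by (simp_all add: hol_on_iff_hol_at hol_at_u_fun)
 have hL: "hol_on (Lie V ?u) (hol_dom V)" by (rule hol_on_Lie[OF open_hol_dom hu(2) hol_on_hol_dom])
 have img: "flow V s ` ball p \<delta> \<subseteq> hol_dom V" if "s \<in> {0..T}" for s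
  using ode_solution_dom[OF sol] that by blast
 have "((%t. nu \<alpha> p j (%z. ?u (flow V t z))) has_vector_derivative nu \<alpha> p j (%z. Lie V ?u (flow V t z))) (at t within {0..T})"
 proof (rule nu_has_vector_derivative[OF \<delta> t])
  fix s assume s: "s \<in> {0..T}"
  show "hol_on (%z. ?u (flow V s z)) (ball p \<delta>)" by (rule hol_on_compose[OF hu(1) h[OF s]]) simp
  show "hol_on (%z. Lie V ?u (flow V s z)) (ball p \<delta>)" by (rule hol_on_compose[OF hL h[OF s] img[OF s]])
  fix w assume w: "w \<in> ball p \<delta>"
  have d: "((%t. flow V t w) has_vector_derivative V (flow V s w)) (at s within {0..T})"
   using sol[OF w] s by (simp add: ode_solution_def)
  have "((?u \<circ> (%t. flow V t w)) has_vector_derivative dd (V (flow V s w)) ?u (flow V s w)) (at s within {0..T})"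
   by (rule vector_derivative_diff_chain_within[OF d])
     (rule has_derivative_at_withinI[OF hol_at_has_derivative(1)[OF hol_at_u_fun]])
  then show "((%t. ?u (flow V t w)) has_vector_derivative Lie V ?u (flow V s w)) (at s within {0..T})"
   by (simp add: comp_def Lie_eq_dd hol_at_u_fun)
 next
  have "continuous_on ({0..T} \<times> ball p \<delta>) (%y. Lie V ?u ((%(t, w). flow V t w) y))"
   by (rule continuous_on_compose2[OF hol_on_continuous_on[OF hL] c]) (use img in \<open>auto simp: image_subset_iff\<close>)
  then show "continuous_on ({0..T} \<times> ball p \<delta>) (%(s, w). Lie V ?u (flow V s w))"
   by (simp add: case_prod_unfold)
 qed
 moreover have "nu \<alpha> p j (%z. Lie V ?u (flow V t z))
   = (\<Sum>k<rE TYPE('d) n. nu \<alpha> p k (Lie V ?u) * nu \<alpha> p j (%z. u_fun \<alpha> p k (flow V t z)))"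
  by (rule nu_compose[OF \<alpha> open_hol_dom _ hL open_ball _ h[OF t] flow_fixed_point(2)[OF T V t] j])
    (use V \<delta> in \<open>auto simp: hol_dom_def\<close>)
 ultimately show ?thesis by simp
qed

lemma nu_flow_0:
 assumes \<alpha>: "mi_numbering \<alpha>" and V: "analytic_map V {p}" "V p = 0"
 shows "nu \<alpha> p j (%z. u_fun \<alpha> p i (flow V 0 z)) = (if i = j then 1 else 0)"
proof -
 have T0: "0 \<in> {0..0::real}" by simp
 obtain \<delta> where \<delta>: "\<delta> > 0" and sol: "!!w. w \<in> ball p \<delta> ==> ode_solution V 0 w (%t. flow V t w)"
  using flow_local[OF order_refl flow_fixed_point(1)[OF order_refl V T0]] by metis
 have "flow V 0 w = w" if "w \<in> ball p \<delta>" for w using sol[OF that] by (simp add: ode_solution_def)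
 then have "nu \<alpha> p j (%z. u_fun \<alpha> p i (flow V 0 z)) = nu \<alpha> p j (u_fun \<alpha> p i)"
  by (intro nu_cong[OF open_ball[of p \<delta>]]) (use \<delta> in auto)
 then show ?thesis using nu_u_fun[of \<alpha> p j i] \<alpha> by (simp add: mi_numbering_def bij_is_inj)
qed

subsection \<open>A chain of eigenvalues annihilating a vector\<close>

text \<open>The product of the commuting factors \<open>M - l\<close>, for \<open>l\<close> in the
  list, applied to \<open>v\<close>.\<close>

primrec kill :: "complex ^ 'd ^ 'd => complex list => complex ^ 'd => complex ^ 'd" where
 "kill M [] v = v"
| "kill M (l # ls) v = kill M ls (M *v v - l *s v)"

lemma kill_diff: "kill M ls (v - w) = kill M ls v - kill M ls w"
proof (induction ls arbitrary: v w)
 case (Cons l ls)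
 have "M *v (v - w) - l *s (v - w) = (M *v v - l *s v) - (M *v w - l *s w)"
  by (simp add: matrix_vector_mult_diff_distrib vec.scale_right_diff_distrib)
 then show ?case by (simp only: kill.simps Cons)
qed simp

lemma kill_smult: "kill M ls (c *s v) = c *s kill M ls v"
proof (induction ls arbitrary: v)
 case (Cons l ls)
 have "M *v (c *s v) - l *s (c *s v) = c *s (M *v v - l *s v)"
  by (simp add: vector_scalar_commute vec.scale_right_diff_distrib vec.scale_scale mult.commute)
 then show ?case by (simp only: kill.simps Cons)
qed simp

lemma kill_mult: "kill M ls (M *v v) = M *v kill M ls v"
proof (induction ls arbitrary: v)
 case (Cons l ls)
 have "M *v (M *v v) - l *s (M *v v) = M *v (M *v v - l *s v)"
  by (simp add: matrix_vector_mult_diff_distrib vector_scalar_commute)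
 then show ?case by (simp only: kill.simps Cons)
qed simp

lemma kill_eigenvalues:
 assumes "kill M ls v = 0"
 shows "\<exists>ls'. (\<forall>l\<in>set ls'. \<exists>w. w \<noteq> 0 \<and> M *v w = l *s w) \<and> kill M ls' v = 0"
 using assms
proof (induction ls arbitrary: v)
 case Nil
 then show ?case by (intro exI[of _ "[]"]) simp
next
 case (Cons l ls)
 then obtain ls' where ls': "\<forall>l\<in>set ls'. \<exists>w. w \<noteq> 0 \<and> M *v w = l *s w" "kill M ls' (M *v v - l *s v) = 0"
  by force
 show ?case
 proof (cases "\<exists>w. w \<noteq> 0 \<and> M *v w = l *s w")
  case True
  then show ?thesis using ls' by (intro exI[of _ "l # ls'"]) simp
 next
  case False
  have "M *v kill M ls' v - l *s kill M ls' v = 0"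
   using ls'(2) by (simp add: kill_diff kill_smult kill_mult)
  then have "kill M ls' v = 0" using False by auto
  then show ?thesis using ls'(1) by blast
 qed
qed

text \<open>The value of the polynomial at the matrix, applied to \<open>v\<close>, by Horner's
  scheme.\<close>

definition pm :: "complex ^ 'd ^ 'd => complex poly => complex ^ 'd => complex ^ 'd" where
 "pm M P v = fold_coeffs (%a w. a *s v + M *v w) P 0"

lemma pm_0: "pm M 0 v = 0"
 by (simp add: pm_def)

lemma pm_pCons: "pm M (pCons a P) v = a *s v + M *v pm M P v"
 by (cases "a = 0 \<and> P = 0") (auto simp: pm_def fold_coeffs_pCons_not_0_0_eq fold_coeffs_pCons_coeff_not_0_eq)

lemma pm_add: "pm M (P + Q) v = pm M P v + pm M Q v"
 by (induction P Q rule: poly_induct2)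
   (simp_all add: pm_0 pm_pCons matrix_vector_right_distrib vec.scale_left_distrib)

lemma pm_smult: "pm M (Polynomial.smult c P) v = c *s pm M P v"
 by (induction P) (simp_all add: pm_0 pm_pCons vector_scalar_commute vec.scale_right_distrib)

lemma pm_factor: "pm M ([:- l, 1:] * Q) v = pm M Q (M *v v - l *s v)"
proof -
 have 1: "pm M Q (M *v v) = M *v pm M Q v" for v
  by (induction Q) (simp_all add: pm_0 pm_pCons matrix_vector_right_distrib vector_scalar_commute)
 have 2: "pm M Q (v - w) = pm M Q v - pm M Q w" for v w
  by (induction Q) (simp_all add: pm_0 pm_pCons matrix_vector_mult_diff_distrib vec.scale_right_diff_distrib)
 have 3: "pm M Q (c *s v) = c *s pm M Q v" for c v
  by (induction Q) (simp_all add: pm_0 pm_pCons vector_scalar_commute vec.scale_right_distrib mult.commute)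
 have "[:- l, 1:] * Q = Polynomial.smult (- l) Q + pCons 0 Q" by simp
 then show ?thesis
  unfolding pm_add pm_smult pm_pCons 1 2 3 by (simp only: pm_add pm_smult pm_pCons) simp
qed

lemma pm_imp_kill: "P \<noteq> 0 ==> pm M P v = 0 ==> \<exists>ls. kill M ls v = 0"
proof (induction "Polynomial.degree P" arbitrary: P v)
 case 0
 then obtain a where a: "P = [:a:]" by (metis degree_eq_zeroE)
 then have "a \<noteq> 0" "a *s v = 0" using 0 by (auto simp: pm_pCons pm_0)
 then have "v = 0" by (simp add: vector_mul_eq_0)
 then show ?case by (intro exI[of _ "[]"]) simp
next
 case (Suc n)
 have "\<not> constant (poly P)" using Suc(2) by (simp add: constant_degree)
 from Fundamental_Theorem_Algebra.fundamental_theorem_of_algebra[OF this] obtain l where "poly P l = 0" by blast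
 then obtain Q where Q: "P = [:- l, 1:] * Q" unfolding poly_eq_0_iff_dvd by (elim dvdE)
 have Q0: "Q \<noteq> 0" using Suc(3) Q by auto
 have "Polynomial.degree P = Polynomial.degree [:- l, 1:] + Polynomial.degree Q" unfolding Q by (rule degree_mult_eq) (use Q0 in auto)
 then have n: "n = Polynomial.degree Q" using Suc(2) by simp
 have "pm M Q (M *v v - l *s v) = 0" using Suc(4) unfolding Q pm_factor .
 from Suc(1)[OF n Q0 this] obtain ls where "kill M ls (M *v v - l *s v) = 0" by blast
 then show ?case by (intro exI[of _ "l # ls"]) simp
qed

text \<open>The family is indexed, so repetitions have to be treated separately; a repetition is
  itself a relation.\<close>

lemma ex_linear_relation:
 fixes f :: "nat => 'a::euclidean_space"
 shows "\<exists>c :: nat => real. (\<exists>i\<le>DIM('a). c i \<noteq> 0) \<and> (\<Sum>i\<le>DIM('a). c i *\<^sub>R f i) = 0"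
proof (cases "inj_on f {..DIM('a)}")
 case False
 then obtain i j where ij: "i \<le> DIM('a)" "j \<le> DIM('a)" "i \<noteq> j" "f i = f j" by (auto simp: inj_on_def)
 define c where "c k = (if k = i then 1 else 0) - (if k = j then 1 else 0 :: real)" for k
 have "(\<Sum>k\<le>DIM('a). c k *\<^sub>R f k) = (\<Sum>k\<le>DIM('a). (if k = i then f k else 0) - (if k = j then f k else 0))"
  by (intro sum.cong refl) (auto simp: c_def)
 also have "\<dots> = 0" using ij by (simp add: sum_subtractf)
 finally show ?thesis using ij by (intro exI[of _ c]) (auto simp: c_def)
next
 case True
 let ?S = "f ` {..DIM('a)}"
 have "dependent ?S"
  by (rule dependent_biggerset) (simp add: card_image[OF True])
 then obtain u where u: "\<exists>v\<in>?S. u v \<noteq> 0" "(\<Sum>v\<in>?S. u v *\<^sub>R v) = 0"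
  unfolding dependent_finite[OF finite_imageI[OF finite_atMost]] by blast
 have "(\<Sum>i\<le>DIM('a). u (f i) *\<^sub>R f i) = 0"
  using u(2) by (simp add: sum.reindex[OF True])
 then show ?thesis using u(1) by (intro exI[of _ "%i. u (f i)"]) auto
qed

text \<open>The vectors \<open>v\<close>, \<open>M v\<close>, ... satisfy a linear relation, that
  is, a nonzero polynomial in \<open>M\<close> annihilates \<open>v\<close>. It splits into linear
  factors over the complex numbers, and \<open>kill_eigenvalues\<close> keeps those that belong to
  eigenvalues.\<close>

lemma ex_kill: "\<exists>ls. (\<forall>l\<in>set ls. \<exists>w. w \<noteq> 0 \<and> M *v w = l *s w) \<and> kill M ls v = 0"
proof -
 let ?N = "DIM(complex ^ 'a)"
 obtain c where c: "\<exists>i\<le>?N. c i \<noteq> 0" "(\<Sum>i\<le>?N. c i *\<^sub>R ((%x. M *v x) ^^ i) v) = 0"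
  using ex_linear_relation[of "%i. ((%x. M *v x) ^^ i) v"] by blast
 define P where "P = (\<Sum>i\<le>?N. Polynomial.monom (complex_of_real (c i)) i)"
 have monom: "pm M (Polynomial.monom a i) v = a *s ((%x. M *v x) ^^ i) v" for a i
  by (induction i) (simp_all add: monom_0 monom_Suc pm_pCons pm_0 vector_scalar_commute)
 have "pm M (\<Sum>i\<le>n. Polynomial.monom (complex_of_real (c i)) i) v = (\<Sum>i\<le>n. complex_of_real (c i) *s ((%x. M *v x) ^^ i) v)" for n
  by (induction n) (simp_all add: pm_add monom)
 then have "pm M P v = 0" using c(2) by (simp add: P_def scaleR_eq_smult)
 moreover have "P \<noteq> 0"
 proof
  assume "P = 0"
  obtain i where i: "i \<le> ?N" "c i \<noteq> 0" using c(1) by blast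
  have "Polynomial.coeff P i = complex_of_real (c i)"
   using i(1) by (simp add: P_def coeff_sum if_distrib cong: if_cong)
  then show False using i(2) \<open>P = 0\<close> by simp
 qed
 ultimately show ?thesis using pm_imp_kill kill_eigenvalues by blast
qed

subsection \<open>Eigenvalues of the generator\<close>

text \<open>The second derivatives of \<open>h\<close> cancel by symmetry; only the derivative of
  the coefficients of \<open>V\<close> remains.\<close>

lemma Lie_dd_commutator:
 assumes U: "open U" "z \<in> U" and V: "!!i. hol_on (%z. V z $ i) U" and h: "hol_on h U"
 shows "Lie V (dd u h) z = dd u (Lie V h) z - (\<Sum>i\<in>UNIV. dd u (%z. V z $ i) z * partial_deriv i h z)"
proof -
 have Vz: "hol_at (%z. V z $ i) z" for i using V U(2) by (simp add: hol_on_iff_hol_at)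
 have pz: "hol_at (partial_deriv i h) z" for i
  using hol_on_partial_deriv[OF U(1) h] U(2) by (simp add: hol_on_iff_hol_at)
 have "dd u (Lie V h) z = (\<Sum>i\<in>UNIV. dd u (%z. V z $ i * partial_deriv i h z) z)"
  unfolding Lie_def[abs_def] by (rule conjunct2[OF hol_at_sum]) (auto intro: hol_at_mult Vz pz)
 also have "\<dots> = (\<Sum>i\<in>UNIV. dd u (%z. V z $ i) z * partial_deriv i h z + V z $ i * partial_deriv i (dd u h) z)"
 proof (intro sum.cong refl)
  fix i
  have "dd u (partial_deriv i h) z = partial_deriv i (dd u h) z"
   using dd_commute[OF U(1) h U(2), of u "axis i 1"] by (simp add: partial_deriv_eq_dd[abs_def])
  then show "dd u (%z. V z $ i * partial_deriv i h z) z
    = dd u (%z. V z $ i) z * partial_deriv i h z + V z $ i * partial_deriv i (dd u h) z"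
   by (simp add: dd_mult[OF Vz pz])
 qed
 finally show ?thesis by (simp add: Lie_def sum.distrib)
qed

lemma jacobian_mult:
 assumes "!!i. hol_at (%z. V z $ i) p"
 shows "(complex_jacobian V p *v u) $ i = dd u (%z. V z $ i) p"
 by (simp add: complex_jacobian_def matrix_vector_mult_def dd_eq_sum[OF assms] mult.commute)

text \<open>The chain started at \<open>v\<close> ends at 0, where the derivative vanishes
  identically. The last vector before the order of vanishing rises is \<open>u\<close>.\<close>

lemma chain_step:
 assumes h: "hol_at h p" and not: "\<not> ordge p k (dd v h)" and 0: "kill M ls v = 0"
 shows "\<exists>u l. l \<in> set ls \<and> \<not> ordge p k (dd u h) \<and> ordge p k (dd (M *v u - l *s u) h)"
 using not 0
proof (induction ls arbitrary: v)
 case Nil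
 then have "dd v h = (%z. 0)" by (auto simp: dd_def)
 then show ?case using Nil(1) ordge_zero by metis
next
 case (Cons l ls)
 show ?case
 proof (cases "ordge p k (dd (M *v v - l *s v) h)")
  case True
  then show ?thesis using Cons.prems by auto
 next
  case False
  then show ?thesis using Cons.IH[OF False] Cons.prems(2) by auto
 qed
qed

text \<open>If \<open>h\<close> is to leading order an eigenfunction of the Lie derivative, then so is its derivative along a suitable
generalized eigenvector of the Jacobian, with the eigenvalue lowered by an eigenvalue of the Jacobian.\<close>

theorem generator_eigenvalue_real:
 fixes V :: "complex ^ 'd => complex ^ 'd"
 assumes U: "open U" "p \<in> U" and V: "!!i. hol_on (%z. V z $ i) U" "V p = 0"
  and J: "\<forall>l v. v \<noteq> 0 \<and> complex_jacobian V p *v v = l *s v --> l \<in> \<real>"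
  and h: "hol_on h U" "ordge p k h" "\<not> ordge p (Suc k) h"
  and eig: "ordge p (Suc k) (%z. Lie V h z - l * h z)"
 shows "l \<in> \<real>"
 using h eig
proof (induction k arbitrary: h l)
 case 0
 \<comment> \<open>At order 0 the function does not vanish at \<open>p\<close>, but its Lie
   derivative does, so \<open>l = 0\<close>.\<close>
 have "h p \<noteq> 0" using ordge_1[OF U 0(1)] 0(3) by auto
 moreover have "Lie V h p = 0" by (simp add: Lie_def V(2))
 ultimately show ?case using ordge_at[OF 0(4)] by simp
next
 case (Suc k)
 let ?J = "complex_jacobian V p"
 have hp: "h p = 0" by (rule ordge_at[OF Suc.prems(2)])
 obtain i where i: "\<not> ordge p (Suc k) (partial_deriv i h)"
  using ordge_Suc_from_partial[OF U Suc.prems(1) hp, of "Suc k"] Suc.prems(3) by blast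
 obtain ls where ls: "\<forall>l\<in>set ls. \<exists>w. w \<noteq> 0 \<and> ?J *v w = l *s w" "kill ?J ls (axis i 1) = 0"
  using ex_kill by blast
 have hp': "hol_at h p" using Suc.prems(1) U(2) by (simp add: hol_on_iff_hol_at)
 obtain u \<mu> where u: "\<mu> \<in> set ls" "\<not> ordge p (Suc k) (dd u h)" "ordge p (Suc k) (dd (?J *v u - \<mu> *s u) h)"
  using chain_step[OF hp' _ ls(2), of "Suc k"] i by (auto simp: partial_deriv_eq_dd[abs_def])
 have \<mu>: "\<mu> \<in> \<real>" using ls(1) u(1) J by blast
 have hL: "hol_on (%z. Lie V h z - l * h z) U"
  using hol_on_Lie[OF U(1) Suc.prems(1) V(1)] Suc.prems(1)
  by (auto simp: hol_on_iff_hol_at intro!: hol_at_diff hol_at_cmult)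
 \<comment> \<open>Three terms of order \<open>Suc k\<close>: the derivative of the assumed
   relation; the deviation of the first derivatives of \<open>V\<close> from their values at
   \<open>p\<close>, of order 1, times partial derivatives of order \<open>k\<close>; and the defect
   of \<open>u\<close> as an eigenvector.\<close>
 let ?R = "%z. dd u (%z. Lie V h z - l * h z) z - (\<Sum>i\<in>UNIV. (dd u (%z. V z $ i) z - (?J *v u) $ i) * partial_deriv i h z)
   - dd (?J *v u - \<mu> *s u) h z"
 have "ordge p (Suc k) ?R"
 proof (intro ordge_diff u(3) ordge_sum)
  show "ordge p (Suc k) (dd u (%z. Lie V h z - l * h z))"
   by (rule ordge_dd[OF U hL Suc.prems(4)])
  fix i :: 'd
  have Vp: "hol_at (%z. V z $ i) p" for i using V(1) U(2) by (simp add: hol_on_iff_hol_at)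
  have "hol_on (%z. dd u (%z. V z $ i) z - (?J *v u) $ i) U"
   using hol_on_dd[OF U(1) V(1)] by (auto simp: hol_on_iff_hol_at intro!: hol_at_diff hol_at_const)
  then have 1: "ordge p 1 (%z. dd u (%z. V z $ i) z - (?J *v u) $ i)"
   by (rule ordge_1[OF U]) (simp add: jacobian_mult[OF Vp])
  have "ordge p k (partial_deriv i h)"
   using ordge_dd[OF U Suc.prems(1,2), of "axis i 1"] by (simp add: partial_deriv_eq_dd[abs_def])
  from ordge_mult[OF 1 this] show "ordge p (Suc k) (%z. (dd u (%z. V z $ i) z - (?J *v u) $ i) * partial_deriv i h z)"
   by simp
 qed simp
 then have "ordge p (Suc k) (%z. Lie V (dd u h) z - (l - \<mu>) * dd u h z)"
 proof (rule ordge_cong[OF U, rotated])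
  fix z assume z: "z \<in> U"
  have hz: "hol_at h z" "hol_at (Lie V h) z"
   using Suc.prems(1) hol_on_Lie[OF U(1) Suc.prems(1) V(1)] z by (auto simp: hol_on_iff_hol_at)
  have 1: "dd (?J *v u - \<mu> *s u) h z = (\<Sum>i\<in>UNIV. (?J *v u) $ i * partial_deriv i h z) - \<mu> * dd u h z"
   unfolding dd_eq_sum[OF hz(1)] by (simp add: sum_subtractf sum_distrib_left algebra_simps)
  have 2: "dd u (%z. Lie V h z - l * h z) z = dd u (Lie V h) z - l * dd u h z"
   using hz by (simp add: dd_diff dd_cmult hol_at_cmult)
  show "?R z = Lie V (dd u h) z - (l - \<mu>) * dd u h z"
   unfolding Lie_dd_commutator[OF U(1) z V(1) Suc.prems(1)] 1 2
   by (simp add: sum_subtractf left_diff_distrib)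
 qed
 then have "l - \<mu> \<in> \<real>"
  by (rule Suc.IH[OF hol_on_dd[OF U(1) Suc.prems(1)] ordge_dd[OF U Suc.prems(1,2)] u(2)])
 then show ?case using Reals_add[OF _ \<mu>] by fastforce
qed

text \<open>The coefficients \<open>x\<close> define a function \<open>h\<close> on which the Lie
  derivative acts as multiplication by \<open>l\<close> up to order \<open>n + 1\<close>. Some
  coefficient of degree at most \<open>n\<close> is nonzero, so \<open>h\<close> has an exact order
  of vanishing at most \<open>n\<close>, and \<open>generator_eigenvalue_real\<close> applies at
  this order.\<close>

lemma generator_matrix_eigenvalue_real:
 fixes V :: "complex ^ 'd => complex ^ 'd"
 assumes \<alpha>: "mi_numbering (\<alpha> :: nat => 'd => nat)" and U: "open U" "p \<in> U"
  and V: "!!i. hol_on (%z. V z $ i) U" "V p = 0"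
  and J: "\<forall>l v. v \<noteq> 0 \<and> complex_jacobian V p *v v = l *s v --> l \<in> \<real>"
  and x: "\<exists>i<rE TYPE('d) n. x i \<noteq> 0"
  and eig: "!!k. k < rE TYPE('d) n ==> (\<Sum>i<rE TYPE('d) n. x i * nu \<alpha> p k (Lie V (u_fun \<alpha> p i))) = l * x k"
 shows "l \<in> \<real>"
proof -
 let ?r = "rE TYPE('d) n"
 have inj: "inj \<alpha>" using \<alpha> by (simp add: mi_numbering_def bij_is_inj)
 define h where "h = (%z. \<Sum>i<?r. x i * u_fun \<alpha> p i z)"
 have hol: "hol_on h U"
  unfolding h_def by (auto simp: hol_on_iff_hol_at intro!: conjunct1[OF hol_at_sum] hol_at_cmult hol_at_u_fun)
 have hu: "hol_on (u_fun \<alpha> p i) U" for i by (simp add: hol_on_iff_hol_at hol_at_u_fun)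
 have nuh: "nu \<alpha> p k h = x k" if "k < ?r" for k
 proof -
  have "nu \<alpha> p k h = (\<Sum>i<?r. x i * nu \<alpha> p k (u_fun \<alpha> p i))"
   unfolding h_def by (rule nu_sum[OF U]) (use hu in auto)
  then show ?thesis using that by (simp add: nu_u_fun[OF inj] if_distrib cong: if_cong)
 qed
 have hL: "hol_on (Lie V h) U" by (rule hol_on_Lie[OF U(1) hol V(1)])
 have "nu \<alpha> p k (%z. Lie V h z - l * h z) = 0" if k: "k < ?r" for k
 proof -
  have "nu \<alpha> p k (%z. 1 * Lie V h z + (- l) * h z) = 1 * nu \<alpha> p k (Lie V h) + (- l) * nu \<alpha> p k h"
   by (rule nu_lin[OF U hL hol])
  moreover have "nu \<alpha> p k (Lie V h) = l * x k"
   using nu_Lie[OF \<alpha> U hol V k] nuh eig[OF k] by simp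
  ultimately show ?thesis using nuh[OF k] by simp
 qed
 then have big: "ordge p (Suc n) (%z. Lie V h z - l * h z)"
  by (intro ordge_Suc_iff_nu[OF \<alpha> U])
    (use hL hol in \<open>auto simp: hol_on_iff_hol_at intro!: hol_at_diff hol_at_cmult\<close>)
 have not: "\<not> ordge p (Suc n) h"
 proof
  assume o: "ordge p (Suc n) h"
  obtain i where i: "i < ?r" "x i \<noteq> 0" using x by blast
  have "mi_deg (\<alpha> i) \<le> n" using numbering_image[OF \<alpha>] i(1) by blast
  then have "nu \<alpha> p i h = 0" by (rule nu_eq_0[OF U hol o])
  then show False using nuh[OF i(1)] i(2) by simp
 qed
 define k where "k = (LEAST k. \<not> ordge p (Suc k) h)"
 have k: "\<not> ordge p (Suc k) h" "k \<le> n"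
  unfolding k_def using LeastI[of "%k. \<not> ordge p (Suc k) h", OF not] Least_le[of "%k. \<not> ordge p (Suc k) h", OF not] by auto
 have "ordge p k h"
 proof (cases k)
  case 0
  have "hol_at h p" using hol U(2) by (simp add: hol_on_iff_hol_at)
  then show ?thesis unfolding 0 by (intro ordge_0 hol_at_isCont)
 next
  case (Suc k')
  then show ?thesis using not_less_Least[of k' "%k. \<not> ordge p (Suc k) h"] by (simp add: k_def)
 qed
 then show ?thesis
  using generator_eigenvalue_real[OF U V J hol _ k(1)] ordge_mono[OF big, of "Suc k"] k(2) by simp
qed

section \<open>Complex matrices\<close>

subsection \<open>The Euclidean norm and the operator norm\<close>

definition hip :: "complex Matrix.vec => complex Matrix.vec => complex" where
 "hip v w = (\<Sum>i<dim_vec w. cnj (vec_index v i) * vec_index w i)"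

lemma vec_l2_L2_set: "vec_l2 v = L2_set (%i. cmod (vec_index v i)) {..<dim_vec v}"
 by (simp add: vec_l2_def L2_set_def)

lemma vec_l2_nonneg: "vec_l2 v \<ge> 0"
 by (simp add: vec_l2_L2_set L2_set_nonneg)

lemma vec_l2_power2: "(vec_l2 v)\<^sup>2 = (\<Sum>i<dim_vec v. (cmod (vec_index v i))\<^sup>2)"
 by (simp add: vec_l2_def sum_nonneg)

lemma vec_l2_eq_0: "v \<in> carrier_vec n ==> vec_l2 v = 0 \<longleftrightarrow> v = 0\<^sub>v n"
 by (auto simp: vec_l2_L2_set L2_set_eq_0_iff intro!: eq_vecI)

lemma vec_l2_zero: "vec_l2 (0\<^sub>v n) = 0"
 by (simp add: vec_l2_def)

lemma vec_l2_add:
 assumes "v \<in> carrier_vec n" "w \<in> carrier_vec n"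
 shows "vec_l2 (v + w) \<le> vec_l2 v + vec_l2 w"
proof -
 have "vec_l2 (v + w) \<le> L2_set (%i. cmod (vec_index v i) + cmod (vec_index w i)) {..<n}"
  unfolding vec_l2_L2_set using assms by (auto intro!: L2_set_mono simp: norm_triangle_ineq)
 also have "\<dots> \<le> vec_l2 v + vec_l2 w"
  unfolding vec_l2_L2_set using assms L2_set_triangle_ineq[of "%i. cmod (vec_index v i)" "%i. cmod (vec_index w i)" "{..<n}"]
  by simp
 finally show ?thesis .
qed

lemma vec_l2_smult: "vec_l2 (c \<cdot>\<^sub>v v) = cmod c * vec_l2 v"
proof -
 have "vec_l2 (c \<cdot>\<^sub>v v) = L2_set (%i. cmod c * cmod (vec_index v i)) {..<dim_vec v}"
  unfolding vec_l2_L2_set by (intro L2_set_cong) (auto simp: norm_mult)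
 then show ?thesis unfolding vec_l2_L2_set by (simp add: L2_set_right_distrib)
qed

lemma hip_self: "hip v v = of_real ((vec_l2 v)\<^sup>2)"
 by (simp add: hip_def vec_l2_power2 complex_norm_square mult.commute flip: of_real_power)

lemma hip_le:
 assumes "v \<in> carrier_vec n" "w \<in> carrier_vec n"
 shows "cmod (hip v w) \<le> vec_l2 v * vec_l2 w"
proof -
 have "cmod (hip v w) \<le> (\<Sum>i<n. \<bar>cmod (vec_index v i)\<bar> * \<bar>cmod (vec_index w i)\<bar>)"
  unfolding hip_def using assms by (intro order_trans[OF norm_sum]) (simp add: norm_mult)
 also have "\<dots> \<le> vec_l2 v * vec_l2 w"
  using L2_set_mult_ineq[of "%i. cmod (vec_index v i)" "%i. cmod (vec_index w i)" "{..<n}"] assms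
  by (simp add: vec_l2_L2_set)
 finally show ?thesis .
qed

lemma hip_add_right: "w \<in> carrier_vec n ==> w' \<in> carrier_vec n ==> hip v (w + w') = hip v w + hip v w'"
 and hip_diff_right: "w \<in> carrier_vec n ==> w' \<in> carrier_vec n ==> hip v (w - w') = hip v w - hip v w'"
 and hip_smult_right: "hip v (c \<cdot>\<^sub>v w) = c * hip v w"
 by (auto simp: hip_def sum.distrib sum_subtractf sum_distrib_left algebra_simps intro!: sum.cong)

lemma hip_scalar_prod: "w \<in> carrier_vec n ==> v \<in> carrier_vec n ==> scalar_prod (conjugate v) w = hip v w"
 by (auto simp: hip_def scalar_prod_def atLeast0LessThan)

lemma mult_mat_vec_index: "A \<in> carrier_mat n m ==> v \<in> carrier_vec m ==> i < n ==>
  vec_index (A *\<^sub>v v) i = (\<Sum>j<m. A $$ (i, j) * vec_index v j)"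
 by (simp add: scalar_prod_def atLeast0LessThan)

lemma mult_mat_index: "A \<in> carrier_mat n m ==> B \<in> carrier_mat m k ==> i < n ==> j < k ==>
  (A * B) $$ (i, j) = (\<Sum>l<m. A $$ (i, l) * B $$ (l, j))"
 by (simp add: scalar_prod_def atLeast0LessThan)

lemma mat_adjoint_carrier: "A \<in> carrier_mat n m ==> mat_adjoint A \<in> carrier_mat m n"
 unfolding mat_adjoint_def mat_of_rows_def by auto

lemma mat_adjoint_index: "A \<in> carrier_mat n m ==> i < m ==> j < n ==> mat_adjoint A $$ (i, j) = cnj (A $$ (j, i))"
 unfolding mat_adjoint_def by (auto simp: mat_of_rows_def)

lemma mat_adjoint_adjoint:
 fixes A :: "complex Matrix.mat"
 assumes A: "A \<in> carrier_mat n m"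
 shows "mat_adjoint (mat_adjoint A) = A"
proof (rule eq_matI)
 note c = mat_adjoint_carrier[OF A]
 fix i j assume "i < dim_row A" "j < dim_col A"
 then have ij: "i < n" "j < m" using A by auto
 show "mat_adjoint (mat_adjoint A) $$ (i, j) = A $$ (i, j)"
  unfolding mat_adjoint_index[OF c ij] mat_adjoint_index[OF A ij(2,1)] by simp
qed (use A mat_adjoint_carrier[OF mat_adjoint_carrier[OF A]] in auto)

lemma mat_adjoint_mult:
 fixes A B :: "complex Matrix.mat"
 assumes A: "A \<in> carrier_mat n m" and B: "B \<in> carrier_mat m k"
 shows "mat_adjoint (A * B) = mat_adjoint B * mat_adjoint A"
proof (rule eq_matI)
 note c = mat_adjoint_carrier[OF A] mat_adjoint_carrier[OF B] mat_adjoint_carrier[OF mult_carrier_mat[OF A B]]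
 show "dim_row (mat_adjoint (A * B)) = dim_row (mat_adjoint B * mat_adjoint A)"
  "dim_col (mat_adjoint (A * B)) = dim_col (mat_adjoint B * mat_adjoint A)" using c by auto
 fix i j assume "i < dim_row (mat_adjoint B * mat_adjoint A)" "j < dim_col (mat_adjoint B * mat_adjoint A)"
 then have ij: "i < k" "j < n" using c by auto
 have "mat_adjoint (A * B) $$ (i, j) = cnj ((A * B) $$ (j, i))"
  by (rule mat_adjoint_index[OF mult_carrier_mat[OF A B] ij])
 also have "\<dots> = (\<Sum>l<m. mat_adjoint B $$ (i, l) * mat_adjoint A $$ (l, j))"
  unfolding mult_mat_index[OF A B ij(2,1)]
  by (auto simp: mat_adjoint_index[OF A] mat_adjoint_index[OF B] ij mult.commute intro!: sum.cong)
 also have "\<dots> = (mat_adjoint B * mat_adjoint A) $$ (i, j)"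
  by (rule mult_mat_index[OF c(2,1) ij, symmetric])
 finally show "mat_adjoint (A * B) $$ (i, j) = (mat_adjoint B * mat_adjoint A) $$ (i, j)" .
qed

lemma mat_adjoint_one: "mat_adjoint (1\<^sub>m n) = (1\<^sub>m n :: complex Matrix.mat)"
proof (rule eq_matI)
 note c = mat_adjoint_carrier[OF one_carrier_mat, of n, where ?'a = complex]
 fix i j assume "i < dim_row (1\<^sub>m n :: complex Matrix.mat)" "j < dim_col (1\<^sub>m n :: complex Matrix.mat)"
 then show "mat_adjoint (1\<^sub>m n) $$ (i, j) = (1\<^sub>m n :: complex Matrix.mat) $$ (i, j)"
  by (simp add: mat_adjoint_index[OF one_carrier_mat])
qed (use mat_adjoint_carrier[OF one_carrier_mat, of n, where ?'a = complex] in auto)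

lemma hip_adjoint:
 assumes A: "A \<in> carrier_mat n m" and v: "v \<in> carrier_vec n" and w: "w \<in> carrier_vec m"
 shows "hip v (A *\<^sub>v w) = hip (mat_adjoint A *\<^sub>v v) w"
proof -
 have Aw: "dim_vec (A *\<^sub>v w) = n" using A by simp
 have "hip v (A *\<^sub>v w) = (\<Sum>i<n. \<Sum>j<m. cnj (vec_index v i) * (A $$ (i, j) * vec_index w j))"
  unfolding hip_def Aw by (auto simp: mult_mat_vec_index[OF A w] sum_distrib_left simp del: index_mult_mat_vec intro!: sum.cong)
 also have "\<dots> = (\<Sum>j<m. \<Sum>i<n. cnj (vec_index v i) * (A $$ (i, j) * vec_index w j))"
  by (rule sum.swap)
 also have "\<dots> = hip (mat_adjoint A *\<^sub>v v) w"
  unfolding hip_def using w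
  by (auto simp: mult_mat_vec_index[OF mat_adjoint_carrier[OF A] v] mat_adjoint_index[OF A] sum_distrib_right
    simp del: index_mult_mat_vec intro!: sum.cong)
 finally show ?thesis .
qed

text \<open>A crude bound, by which the suprema in \<open>op_norm\<close> and \<open>B_const\<close>
  are seen to be finite.\<close>

lemma mult_mat_vec_bounded:
 fixes A :: "complex Matrix.mat"
 assumes A: "A \<in> carrier_mat n m" and v: "v \<in> carrier_vec m"
 shows "vec_l2 (A *\<^sub>v v) \<le> (\<Sum>i<n. \<Sum>j<m. cmod (A $$ (i, j))) * vec_l2 v"
proof -
 have "vec_l2 (A *\<^sub>v v) \<le> (\<Sum>i<n. cmod (vec_index (A *\<^sub>v v) i))"
  unfolding vec_l2_L2_set using A by (simp add: L2_set_le_sum del: index_mult_mat_vec)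
 also have "\<dots> \<le> (\<Sum>i<n. (\<Sum>j<m. cmod (A $$ (i, j))) * vec_l2 v)"
 proof (rule sum_mono)
  fix i assume "i \<in> {..<n}"
  then have "cmod (vec_index (A *\<^sub>v v) i) \<le> (\<Sum>j<m. cmod (A $$ (i, j)) * cmod (vec_index v j))"
   by (subst mult_mat_vec_index[OF A v]) (auto intro!: order_trans[OF norm_sum] simp: norm_mult)
  also have "\<dots> \<le> (\<Sum>j<m. cmod (A $$ (i, j)) * vec_l2 v)"
   unfolding vec_l2_L2_set using v by (intro sum_mono mult_left_mono member_le_L2_set) auto
  finally show "cmod (vec_index (A *\<^sub>v v) i) \<le> (\<Sum>j<m. cmod (A $$ (i, j))) * vec_l2 v"
   by (simp add: sum_distrib_right)
 qed
 finally show ?thesis by (simp add: sum_distrib_right)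
qed

lemma op_norm_bdd:
 assumes A: "A \<in> carrier_mat n m"
 shows "bdd_above ((%v. vec_l2 (A *\<^sub>v v)) ` {v \<in> carrier_vec (dim_col A). vec_l2 v \<le> 1})"
proof (rule bdd_aboveI2)
 fix v assume v: "v \<in> {v \<in> carrier_vec (dim_col A). vec_l2 v \<le> 1}"
 then have "vec_l2 (A *\<^sub>v v) \<le> (\<Sum>i<n. \<Sum>j<m. cmod (A $$ (i, j))) * vec_l2 v"
  using A by (intro mult_mat_vec_bounded[OF A]) auto
 also have "\<dots> \<le> (\<Sum>i<n. \<Sum>j<m. cmod (A $$ (i, j))) * 1"
  using v by (intro mult_left_mono sum_nonneg) auto
 finally show "vec_l2 (A *\<^sub>v v) \<le> (\<Sum>i<n. \<Sum>j<m. cmod (A $$ (i, j))) * 1" .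
qed

lemma op_norm_nonneg: "A \<in> carrier_mat n m ==> op_norm A \<ge> 0"
 unfolding op_norm_def
 by (rule order_trans[OF vec_l2_nonneg cSUP_upper[OF _ op_norm_bdd, of "0\<^sub>v (dim_col A)"]]) (auto simp: vec_l2_zero)

lemma op_norm_le:
 assumes A: "A \<in> carrier_mat n m" and v: "v \<in> carrier_vec m"
 shows "vec_l2 (A *\<^sub>v v) \<le> op_norm A * vec_l2 v"
proof (cases "vec_l2 v = 0")
 case True
 then have "A *\<^sub>v v = 0\<^sub>v n" using A v by (simp add: vec_l2_eq_0) (auto intro!: eq_vecI simp: scalar_prod_def)
 then show ?thesis using True by (simp add: vec_l2_zero)
next
 case False
 define c where "c = complex_of_real (1 / vec_l2 v)"
 have pos: "vec_l2 v > 0" using False vec_l2_nonneg[of v] by simp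
 have cv: "c \<cdot>\<^sub>v v \<in> {v \<in> carrier_vec (dim_col A). vec_l2 v \<le> 1}"
  using A v pos by (auto simp: vec_l2_smult c_def norm_divide)
 have "vec_l2 (A *\<^sub>v (c \<cdot>\<^sub>v v)) \<le> op_norm A"
  unfolding op_norm_def by (rule cSUP_upper[OF cv op_norm_bdd[OF A]])
 also have "A *\<^sub>v (c \<cdot>\<^sub>v v) = c \<cdot>\<^sub>v (A *\<^sub>v v)" using A v by (simp add: mult_mat_vec)
 finally show ?thesis using pos by (simp add: vec_l2_smult c_def norm_divide field_simps)
qed

lemma op_norm_leI:
 assumes A: "A \<in> carrier_mat n m" and c: "c \<ge> 0" and le: "!!v. v \<in> carrier_vec m ==> vec_l2 (A *\<^sub>v v) \<le> c * vec_l2 v"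
 shows "op_norm A \<le> c"
 unfolding op_norm_def
proof (rule cSUP_least)
 have "0\<^sub>v (dim_col A) \<in> {v \<in> carrier_vec (dim_col A). vec_l2 v \<le> 1}" by (simp add: vec_l2_zero)
 then show "{v \<in> carrier_vec (dim_col A). vec_l2 v \<le> 1} \<noteq> {}" by blast
 fix v assume v: "v \<in> {v \<in> carrier_vec (dim_col A). vec_l2 v \<le> 1}"
 then have "vec_l2 (A *\<^sub>v v) \<le> c * vec_l2 v" using le A by auto
 also have "\<dots> \<le> c * 1" using v c by (intro mult_left_mono) auto
 finally show "vec_l2 (A *\<^sub>v v) \<le> c" by simp
qed

subsection \<open>Inverse and pseudo-inverse\<close>

lemma minv:
 assumes A: "A \<in> carrier_mat n n" and d: "Determinant.det A \<noteq> 0"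
 shows "minv A \<in> carrier_mat n n" "A * minv A = 1\<^sub>m n" "minv A * A = 1\<^sub>m n"
proof -
 have "mat_inverse A \<noteq> None"
  using mat_inverse(1)[OF A, where b = "()"] det_non_zero_imp_unit[OF A d, where b = "()"] by blast
 then obtain B where "mat_inverse A = Some B" by blast
 then show "minv A \<in> carrier_mat n n" "A * minv A = 1\<^sub>m n" "minv A * A = 1\<^sub>m n"
  using mat_inverse(2)[OF A] by (auto simp: minv_def)
qed

lemma minv_unique:
 assumes A: "A \<in> carrier_mat n n" and d: "Determinant.det A \<noteq> 0" and B: "B \<in> carrier_mat n n" "A * B = 1\<^sub>m n"
 shows "minv A = B"
proof -
 have "minv A = minv A * (A * B)" using minv[OF A d] B by simp
 also have "\<dots> = minv A * A * B" using minv(1)[OF A d] A B by (simp add: assoc_mult_mat)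
 also have "\<dots> = B" using minv(3)[OF A d] B by simp
 finally show ?thesis .
qed

lemma det_nonzeroI:
 assumes A: "(A :: complex Matrix.mat) \<in> carrier_mat n n"
  and inj: "!!v. v \<in> carrier_vec n ==> A *\<^sub>v v = 0\<^sub>v n ==> v = 0\<^sub>v n"
 shows "Determinant.det A \<noteq> 0"
 using inj by (auto simp: det_0_iff_vec_prod_zero_field[OF A])

lemma det_nonzero_inj:
 assumes A: "(A :: complex Matrix.mat) \<in> carrier_mat n n" and "Determinant.det A \<noteq> 0"
  and v: "v \<in> carrier_vec n" "A *\<^sub>v v = 0\<^sub>v n"
 shows "v = 0\<^sub>v n"
 using assms det_0_iff_vec_prod_zero_field[OF A] by blast

lemma det_nonzero_of_inverse:
 assumes A: "(A :: complex Matrix.mat) \<in> carrier_mat n n" and B: "B \<in> carrier_mat n n" "A * B = 1\<^sub>m n"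
 shows "Determinant.det A \<noteq> 0"
 using det_mult[OF A B(1)] B(2) by auto

text \<open>\<open>A * mat_adjoint A\<close> is invertible, so \<open>mat_adjoint A\<close> times
  its inverse is a right inverse of \<open>A\<close> that satisfies the Penrose equations.\<close>

lemma pinv_full_row_rank:
 assumes A: "A \<in> carrier_mat r N" and d: "Determinant.det (A * mat_adjoint A) \<noteq> 0"
 shows "pinv A = mat_adjoint A * minv (A * mat_adjoint A)" and "A * pinv A = 1\<^sub>m r"
proof -
 let ?A' = "mat_adjoint A"
 define G where "G = A * ?A'"
 have A': "?A' \<in> carrier_mat N r" by (rule mat_adjoint_carrier[OF A])
 have G: "G \<in> carrier_mat r r" using A A' by (simp add: G_def)
 note I = minv[OF G d[folded G_def]]
 define X where "X = ?A' * minv G"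
 have X: "X \<in> carrier_mat N r" using A' I by (simp add: X_def)
 have AX: "A * X = 1\<^sub>m r"
  unfolding X_def using assoc_mult_mat[OF A A' I(1)] I(2) by (simp add: G_def)
 have Gadj: "mat_adjoint G = G"
  unfolding G_def mat_adjoint_mult[OF A A'] mat_adjoint_adjoint[OF A] ..
 have Iadj: "mat_adjoint (minv G) = minv G"
 proof (rule minv_unique[OF G d[folded G_def] mat_adjoint_carrier[OF I(1)], symmetric])
  have "mat_adjoint (minv G * G) = mat_adjoint G * mat_adjoint (minv G)"
   by (rule mat_adjoint_mult[OF I(1) G])
  then show "G * mat_adjoint (minv G) = 1\<^sub>m r" by (simp add: I(3) Gadj mat_adjoint_one)
 qed
 have XA_adj: "mat_adjoint (X * A) = X * A"
 proof -
  have "mat_adjoint (X * A) = ?A' * mat_adjoint X" by (rule mat_adjoint_mult[OF X A])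
  also have "mat_adjoint X = minv G * A"
   unfolding X_def mat_adjoint_mult[OF A' I(1)] mat_adjoint_adjoint[OF A] Iadj ..
  also have "?A' * (minv G * A) = X * A"
   unfolding X_def by (rule assoc_mult_mat[OF A' I(1) A, symmetric])
  finally show ?thesis .
 qed
 have "pinv A = X"
  unfolding pinv_def
 proof (rule the_equality)
  show "X \<in> carrier_mat (dim_col A) (dim_row A) \<and> A * X * A = A \<and> X * A * X = X \<and>
    mat_adjoint (A * X) = A * X \<and> mat_adjoint (X * A) = X * A"
   using A X AX XA_adj assoc_mult_mat[OF X A X] by (simp add: mat_adjoint_one)
  fix Y assume Y': "Y \<in> carrier_mat (dim_col A) (dim_row A) \<and> A * Y * A = A \<and> Y * A * Y = Y \<and>
    mat_adjoint (A * Y) = A * Y \<and> mat_adjoint (Y * A) = Y * A"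
  then have Y: "Y \<in> carrier_mat N r" using A by auto
  have AY: "A * Y = 1\<^sub>m r"
  proof -
   have "A * Y = A * Y * (A * X)" using A Y by (simp add: AX)
   also have "\<dots> = (A * Y * A) * X" by (rule assoc_mult_mat[OF mult_carrier_mat[OF A Y] A X, symmetric])
   also have "\<dots> = 1\<^sub>m r" using Y' AX by simp
   finally show ?thesis .
  qed
  \<comment> \<open>Uniqueness: self-adjointness of \<open>Y * A\<close> moves it across the
    adjoint, so \<open>Y * G\<close> is \<open>?A'\<close> for every Penrose inverse
    \<open>Y\<close>.\<close>
  have "Y * G = (Y * A) * ?A'" unfolding G_def by (rule assoc_mult_mat[OF Y A A', symmetric])
  also have "\<dots> = mat_adjoint (Y * A) * ?A'" using Y' by simp
  also have "\<dots> = mat_adjoint (A * (Y * A))"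
   by (rule mat_adjoint_mult[symmetric, OF A]) (use A Y in auto)
  also have "A * (Y * A) = A" using assoc_mult_mat[OF A Y A] Y' by simp
  finally have "Y * G = ?A'" .
  then have "X = (Y * G) * minv G" by (simp add: X_def)
  also have "\<dots> = Y" using assoc_mult_mat[OF Y G I(1)] I(2) Y by simp
  finally show "Y = X" by simp
 qed
 then show "pinv A = mat_adjoint A * minv (A * mat_adjoint A)" "A * pinv A = 1\<^sub>m r"
  using AX by (simp_all add: X_def G_def)
qed

subsection \<open>The spectral theorem for Hermitian matrices\<close>

text \<open>One eigenvector is completed to a unitary matrix \<open>W\<close>. In this basis the
  first column is \<open>e\<close> times the unit vector, self-adjointness clears the rest of the
  first row, and the remaining block is Hermitian of smaller size.\<close>

lemma hermitian_eigenbasis: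
 assumes "H \<in> carrier_mat n n" "mat_adjoint H = H"
 shows "\<exists>E d. (\<forall>i<n. E i \<in> carrier_vec n \<and> H *\<^sub>v E i = complex_of_real (d i) \<cdot>\<^sub>v E i) \<and>
   (\<forall>i<n. \<forall>j<n. hip (E i) (E j) = (if i = j then 1 else 0))"
 using assms
proof (induction n arbitrary: H)
 case 0
 then show ?case by auto
next
 case (Suc n)
 note H = Suc.prems(1) and Hadj = Suc.prems(2)
 have "\<not> constant (poly (char_poly H))"
  using degree_monic_char_poly[OF H] by (simp add: constant_degree)
 from Fundamental_Theorem_Algebra.fundamental_theorem_of_algebra[OF this]
 obtain e where "poly (char_poly H) e = 0" by blast
 then obtain v where v: "v \<in> carrier_vec (Suc n)" "v \<noteq> 0\<^sub>v (Suc n)" "H *\<^sub>v v = e \<cdot>\<^sub>v v"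
  using eigenvalue_root_char_poly[OF H] H by (auto simp: eigenvalue_def eigenvector_def)
 interpret cof_vec_space "Suc n" "TYPE(complex)" .
 define b where "b = basis_completion v"
 define ws where "ws = gram_schmidt (Suc n) b"
 from basis_completion[OF v(1,2), folded b_def]
 have dist_b: "distinct b" and indep: "\<not> lin_dep (set b)" and b: "set b \<subseteq> carrier_vec (Suc n)"
  and hdb: "hd b = v" and len_b: "length b = Suc n" by auto
 obtain vs where bv: "b = v # vs" using hdb len_b by (cases b) auto
 from gram_schmidt_result[OF b dist_b indep refl, folded ws_def]
 have ws: "set ws \<subseteq> carrier_vec (Suc n)" "corthogonal ws" "length ws = Suc n"
  by (auto simp: len_b)
 have "hd ws = v"
  using gram_schmidt_hd[OF v(1), of vs, folded bv] by (simp only: ws_def)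
 then have hdws: "ws ! 0 = v" using ws(3) by (cases ws) auto
 have wsc: "ws ! i \<in> carrier_vec (Suc n)" if "i < Suc n" for i using ws that by auto
 have orth: "hip (ws ! i) (ws ! j) = 0 \<longleftrightarrow> i \<noteq> j" if "i < Suc n" "j < Suc n" for i j
 proof -
  have "scalar_prod (ws ! j) (conjugate (ws ! i)) = 0 \<longleftrightarrow> j \<noteq> i"
   using ws that unfolding corthogonal_def by auto
  moreover have "scalar_prod (ws ! j) (conjugate (ws ! i)) = hip (ws ! i) (ws ! j)"
   using carrier_vecD[OF wsc[OF that(1)]] carrier_vecD[OF wsc[OF that(2)]]
   by (simp add: hip_def scalar_prod_def atLeast0LessThan mult.commute)
  ultimately show ?thesis by auto
 qed
 define w where "w i = complex_of_real (1 / vec_l2 (ws ! i)) \<cdot>\<^sub>v ws ! i" for i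
 have wc: "w i \<in> carrier_vec (Suc n)" if "i < Suc n" for i using wsc that by (simp add: w_def)
 have hip_smult_left: "hip (c \<cdot>\<^sub>v x) y = cnj c * hip x y" if "x \<in> carrier_vec k" "y \<in> carrier_vec k" for c x y k
  using that by (auto simp: hip_def sum_distrib_left mult.assoc intro!: sum.cong)
 have worth: "hip (w i) (w j) = (if i = j then 1 else 0)" if ij: "i < Suc n" "j < Suc n" for i j
 proof -
  have "hip (w i) (w j) = of_real (1 / vec_l2 (ws ! i)) * (of_real (1 / vec_l2 (ws ! j)) * hip (ws ! i) (ws ! j))"
   unfolding w_def using wsc ij by (simp add: hip_smult_left[of _ "Suc n"] hip_smult_right)
  moreover have "hip (ws ! i) (ws ! i) = of_real ((vec_l2 (ws ! i))\<^sup>2)" by (rule hip_self)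
  ultimately show ?thesis using orth[OF ij] orth[OF ij(1) ij(1)] by (auto simp: power2_eq_square)
 qed
 define W where "W = Matrix.mat (Suc n) (Suc n) (%(i, j). vec_index (w j) i)"
 have W: "W \<in> carrier_mat (Suc n) (Suc n)" by (simp add: W_def)
 have Wadj: "mat_adjoint W \<in> carrier_mat (Suc n) (Suc n)" by (rule mat_adjoint_carrier[OF W])
 have WW: "mat_adjoint W * W = 1\<^sub>m (Suc n)"
 proof (rule eq_matI)
  fix i j assume "i < dim_row (1\<^sub>m (Suc n))" "j < dim_col (1\<^sub>m (Suc n))"
  then have ij: "i < Suc n" "j < Suc n" by auto
  have "(mat_adjoint W * W) $$ (i, j) = (\<Sum>l<Suc n. cnj (vec_index (w i) l) * vec_index (w j) l)"
   unfolding mult_mat_index[OF Wadj W ij]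
  proof (rule sum.cong[OF refl])
   fix l assume "l \<in> {..<Suc n}"
   then have l: "l < Suc n" by simp
   show "mat_adjoint W $$ (i, l) * W $$ (l, j) = cnj (vec_index (w i) l) * vec_index (w j) l"
    unfolding mat_adjoint_index[OF W ij(1) l] using l ij by (simp add: W_def)
  qed
  also have "\<dots> = hip (w i) (w j)" using carrier_vecD[OF wc[OF ij(2)]] by (simp only: hip_def)
  finally show "(mat_adjoint W * W) $$ (i, j) = 1\<^sub>m (Suc n) $$ (i, j)" using worth[OF ij] ij by simp
 qed (use W Wadj in auto)
 have WW': "W * mat_adjoint W = 1\<^sub>m (Suc n)" by (rule mat_mult_left_right_inverse[OF Wadj W WW])
 define A where "A = mat_adjoint W * (H * W)"
 have HW: "H * W \<in> carrier_mat (Suc n) (Suc n)" using H W by simp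
 have A: "A \<in> carrier_mat (Suc n) (Suc n)" using HW Wadj by (simp add: A_def)
 have Aadj: "mat_adjoint A = A"
  unfolding A_def mat_adjoint_mult[OF Wadj HW] mat_adjoint_mult[OF H W] mat_adjoint_adjoint[OF W] Hadj
  by (rule assoc_mult_mat[OF Wadj H W])
 have Asym: "A $$ (i, j) = cnj (A $$ (j, i))" if "i < Suc n" "j < Suc n" for i j
  using mat_adjoint_index[OF A that] Aadj by simp
 have Hw0: "H *\<^sub>v w 0 = e \<cdot>\<^sub>v w 0"
  unfolding w_def hdws using H v by (simp add: mult_mat_vec smult_smult_assoc mult.commute)
 have unit_col: "vec_index (M *\<^sub>v unit_vec (Suc n) 0) i = M $$ (i, 0)"
  if "M \<in> carrier_mat (Suc n) (Suc n)" "i < Suc n" for M :: "complex Matrix.mat" and i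
  using that scalar_prod_right_unit[of 0 "Suc n" "row M i"] by auto
 have Wcol: "W *\<^sub>v unit_vec (Suc n) 0 = w 0"
 proof (rule eq_vecI)
  fix i assume "i < dim_vec (w 0)"
  then have i: "i < Suc n" using wc[of 0] by simp
  have u: "unit_vec (Suc n) 0 \<in> carrier_vec (Suc n)" by simp
  have "vec_index (W *\<^sub>v unit_vec (Suc n) 0) i = (\<Sum>j<Suc n. if j = 0 then vec_index (w 0) i else 0)"
   unfolding mult_mat_vec_index[OF W u i]
  proof (rule sum.cong[OF refl])
   fix j assume "j \<in> {..<Suc n}"
   then show "W $$ (i, j) * vec_index (unit_vec (Suc n) 0) j = (if j = 0 then vec_index (w 0) i else 0)"
    using i by (simp add: W_def)
  qed
  then show "vec_index (W *\<^sub>v unit_vec (Suc n) 0) i = vec_index (w 0) i" by (simp add: sum.delta)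
 qed (use W wc[of 0] in simp)
 have A0: "A $$ (i, 0) = (if i = 0 then e else 0)" if "i < Suc n" for i
 proof -
  have u: "unit_vec (Suc n) 0 \<in> carrier_vec (Suc n)" by simp
  have "A *\<^sub>v unit_vec (Suc n) 0 = mat_adjoint W *\<^sub>v (H *\<^sub>v (W *\<^sub>v unit_vec (Suc n) 0))"
   unfolding A_def using assoc_mult_mat_vec[OF Wadj HW u] assoc_mult_mat_vec[OF H W u] by simp
  also have "\<dots> = e \<cdot>\<^sub>v (mat_adjoint W *\<^sub>v w 0)"
   unfolding Wcol Hw0 using Wadj wc[of 0] by (simp add: mult_mat_vec)
  also have "mat_adjoint W *\<^sub>v w 0 = mat_adjoint W *\<^sub>v (W *\<^sub>v unit_vec (Suc n) 0)" by (simp add: Wcol)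
  also have "\<dots> = unit_vec (Suc n) 0"
   using assoc_mult_mat_vec[OF Wadj W u] WW by simp
  finally have "vec_index (A *\<^sub>v unit_vec (Suc n) 0) i = vec_index (e \<cdot>\<^sub>v unit_vec (Suc n) 0) i" by simp
  moreover have "vec_index (A *\<^sub>v unit_vec (Suc n) 0) i = A $$ (i, 0)" by (rule unit_col[OF A]) (use that in auto)
  ultimately show ?thesis using that by (auto split: if_splits)
 qed
 have e_real: "e = of_real (Re e)"
  using Asym[of 0 0] A0[of 0] by (simp add: complex_eq_iff)
 have A0': "A $$ (0, j) = 0" if "0 < j" "j < Suc n" for j
  using Asym[of 0 j] A0[of j] that by simp
 define B where "B = Matrix.mat n n (%(i, j). A $$ (Suc i, Suc j))"
 have B: "B \<in> carrier_mat n n" by (simp add: B_def)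
 have Badj: "mat_adjoint B = B"
 proof (rule eq_matI)
  fix i j assume "i < dim_row B" "j < dim_col B"
  then have ij: "i < n" "j < n" using B by auto
  have "mat_adjoint B $$ (i, j) = cnj (A $$ (Suc j, Suc i))"
   using mat_adjoint_index[OF B ij] ij by (simp add: B_def)
  also have "\<dots> = B $$ (i, j)" using Asym[of "Suc i" "Suc j"] ij by (simp add: B_def)
  finally show "mat_adjoint B $$ (i, j) = B $$ (i, j)" .
 qed (use B mat_adjoint_carrier[OF B] in auto)
 obtain E d where E: "\<forall>i<n. E i \<in> carrier_vec n \<and> B *\<^sub>v E i = complex_of_real (d i) \<cdot>\<^sub>v E i"
  and Eorth: "\<forall>i<n. \<forall>j<n. hip (E i) (E j) = (if i = j then 1 else 0)"
  using Suc.IH[OF B Badj] by blast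
 \<comment> \<open>Eigenvectors of the block are carried over by a leading zero.\<close>
 define up where "up x = Matrix.vec (Suc n) (%i. if i = 0 then 0 else vec_index x (i - 1))" for x :: "complex Matrix.vec"
 define F where "F i = (if i = 0 then unit_vec (Suc n) 0 else up (E (i - 1)))" for i
 define d' where "d' i = (if i = 0 then Re e else d (i - 1))" for i
 have upc: "up x \<in> carrier_vec (Suc n)" for x by (simp add: up_def)
 have Fc: "F i \<in> carrier_vec (Suc n)" for i by (simp add: F_def upc)
 have hip_up: "hip (up x) (up y) = hip x y" if "y \<in> carrier_vec n" for x y
  using that unfolding hip_def up_def by (simp add: sum.lessThan_Suc_shift del: sum.lessThan_Suc)
 have hip_0: "hip (unit_vec (Suc n) 0) (up y) = 0" for y
  unfolding hip_def up_def by (simp add: sum.lessThan_Suc_shift del: sum.lessThan_Suc)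
 have hip_0': "hip (up y) (unit_vec (Suc n) 0) = 0" for y
  unfolding hip_def up_def by (simp add: sum.lessThan_Suc_shift del: sum.lessThan_Suc)
 have hip_00: "hip (unit_vec (Suc n) 0) (unit_vec (Suc n) 0) = 1"
  unfolding hip_def by (simp add: sum.lessThan_Suc_shift del: sum.lessThan_Suc)
 have Forth: "hip (F i) (F j) = (if i = j then 1 else 0)" if ij: "i < Suc n" "j < Suc n" for i j
 proof (cases i)
  case 0
  then show ?thesis by (cases j) (auto simp: F_def hip_0 hip_00)
 next
  case (Suc i')
  then show ?thesis using ij E Eorth by (cases j) (auto simp: F_def hip_0' hip_up)
 qed
 have AF: "A *\<^sub>v F i = complex_of_real (d' i) \<cdot>\<^sub>v F i" if i: "i < Suc n" for i
 proof (cases i)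
  case 0
  show ?thesis
  proof (rule eq_vecI)
   fix k assume "k < dim_vec (complex_of_real (d' i) \<cdot>\<^sub>v F i)"
   then have k: "k < Suc n" by (simp add: F_def 0)
   show "vec_index (A *\<^sub>v F i) k = vec_index (complex_of_real (d' i) \<cdot>\<^sub>v F i) k"
    unfolding F_def d'_def 0 using unit_col[OF A k] A0[OF k] e_real k by auto
  qed (use A in \<open>simp add: F_def 0\<close>)
 next
  case (Suc i')
  then have i': "i' < n" using i by simp
  have Ei: "E i' \<in> carrier_vec n" "B *\<^sub>v E i' = complex_of_real (d i') \<cdot>\<^sub>v E i'" using E i' by auto
  have "A *\<^sub>v up (E i') = complex_of_real (d i') \<cdot>\<^sub>v up (E i')"
  proof (rule eq_vecI)
   fix k assume "k < dim_vec (complex_of_real (d i') \<cdot>\<^sub>v up (E i'))"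
   then have k: "k < Suc n" by (simp add: up_def)
   have "vec_index (A *\<^sub>v up (E i')) k = (\<Sum>j<n. A $$ (k, Suc j) * vec_index (E i') j)"
    unfolding mult_mat_vec_index[OF A upc k] by (simp add: up_def sum.lessThan_Suc_shift del: sum.lessThan_Suc)
   also have "\<dots> = vec_index (complex_of_real (d i') \<cdot>\<^sub>v up (E i')) k"
   proof (cases k)
    case 0
    then show ?thesis by (simp add: A0' up_def)
   next
    case (Suc k')
    then have k': "k' < n" using k by simp
    have "(\<Sum>j<n. A $$ (k, Suc j) * vec_index (E i') j) = vec_index (B *\<^sub>v E i') k'"
     unfolding mult_mat_vec_index[OF B Ei(1) k'] using k' by (auto simp: B_def Suc intro!: sum.cong)
    then show ?thesis unfolding Ei(2) using k' Ei(1) by (simp add: up_def Suc)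
   qed
   finally show "vec_index (A *\<^sub>v up (E i')) k = vec_index (complex_of_real (d i') \<cdot>\<^sub>v up (E i')) k" .
  qed (use A in \<open>simp add: up_def\<close>)
  then show ?thesis by (simp add: F_def d'_def Suc)
 qed
 have HWF: "H *\<^sub>v (W *\<^sub>v F i) = complex_of_real (d' i) \<cdot>\<^sub>v (W *\<^sub>v F i)" if i: "i < Suc n" for i
 proof -
  have "W *\<^sub>v (A *\<^sub>v F i) = (W * A) *\<^sub>v F i" using assoc_mult_mat_vec[OF W A Fc] by simp
  also have "W * A = H * W"
   unfolding A_def using assoc_mult_mat[OF W Wadj HW] WW' left_mult_one_mat[OF HW] by simp
  also have "(H * W) *\<^sub>v F i = H *\<^sub>v (W *\<^sub>v F i)" by (rule assoc_mult_mat_vec[OF H W Fc])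
  finally show ?thesis unfolding AF[OF i] using W Fc by (simp add: mult_mat_vec)
 qed
 have WForth: "hip (W *\<^sub>v F i) (W *\<^sub>v F j) = (if i = j then 1 else 0)" if ij: "i < Suc n" "j < Suc n" for i j
 proof -
  have WFi: "W *\<^sub>v F i \<in> carrier_vec (Suc n)" using W Fc by auto
  have "hip (W *\<^sub>v F i) (W *\<^sub>v F j) = hip (mat_adjoint W *\<^sub>v (W *\<^sub>v F i)) (F j)"
   by (rule hip_adjoint[OF W WFi Fc])
  also have "mat_adjoint W *\<^sub>v (W *\<^sub>v F i) = F i"
   using assoc_mult_mat_vec[OF Wadj W Fc] WW Fc by simp
  finally show ?thesis using Forth[OF ij] by simp
 qed
 show ?case
  by (intro exI[of _ "%i. W *\<^sub>v F i"] exI[of _ d']) (use HWF WForth W Fc in auto)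
qed

definition diagm :: "nat => (nat => real) => complex Matrix.mat" where
 "diagm n d = Matrix.mat n n (%(i, j). if i = j then of_real (d i) else 0)"

lemma diagm_carrier: "diagm n d \<in> carrier_mat n n"
 by (simp add: diagm_def)

lemma diagm_mult_vec:
 assumes "y \<in> carrier_vec n"
 shows "diagm n d *\<^sub>v y = Matrix.vec n (%i. of_real (d i) * vec_index y i)"
proof (rule eq_vecI)
 fix i assume "i < dim_vec (Matrix.vec n (%i. of_real (d i) * vec_index y i))"
 then have i: "i < n" by simp
 have "vec_index (diagm n d *\<^sub>v y) i = (\<Sum>j<n. if j = i then of_real (d i) * vec_index y i else 0)"
  unfolding mult_mat_vec_index[OF diagm_carrier assms i]
  by (rule sum.cong[OF refl]) (use i in \<open>auto simp: diagm_def\<close>)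
 then show "vec_index (diagm n d *\<^sub>v y) i = vec_index (Matrix.vec n (%i. of_real (d i) * vec_index y i)) i"
  using i by simp
qed (simp add: diagm_def)

lemma hip_diagm:
 assumes "y \<in> carrier_vec n"
 shows "hip y (diagm n d *\<^sub>v y) = of_real (\<Sum>i<n. d i * (cmod (vec_index y i))\<^sup>2)"
 unfolding diagm_mult_vec[OF assms] hip_def
 by (auto simp: complex_norm_square mult_ac simp flip: of_real_power intro!: sum.cong)

lemma hermitian_spectral:
 assumes H: "H \<in> carrier_mat n n" "mat_adjoint H = H"
 obtains U d where "U \<in> carrier_mat n n" "mat_adjoint U * U = 1\<^sub>m n" "U * mat_adjoint U = 1\<^sub>m n"
  "H = U * (diagm n d * mat_adjoint U)" "!!i. i < n ==> eigenvalue H (of_real (d i))"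
proof -
 obtain E d where E: "\<forall>i<n. E i \<in> carrier_vec n \<and> H *\<^sub>v E i = complex_of_real (d i) \<cdot>\<^sub>v E i"
  and orth: "\<forall>i<n. \<forall>j<n. hip (E i) (E j) = (if i = j then 1 else 0)"
  using hermitian_eigenbasis[OF H] by blast
 define U where "U = Matrix.mat n n (%(i, j). vec_index (E j) i)"
 have U: "U \<in> carrier_mat n n" by (simp add: U_def)
 have Ua: "mat_adjoint U \<in> carrier_mat n n" by (rule mat_adjoint_carrier[OF U])
 have entry: "(mat_adjoint U * M) $$ (i, j) = hip (E i) (col M j)"
  if "M \<in> carrier_mat n n" "i < n" "j < n" for M i j
  unfolding mult_mat_index[OF Ua that] hip_def
  using that by (auto simp: mat_adjoint_index[OF U] U_def[THEN arg_cong[of _ _ "%A. A $$ _"]] intro!: sum.cong)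
 have colU: "col U j = E j" if "j < n" for j
  using E that by (intro eq_vecI) (auto simp: U_def)
 have UU: "mat_adjoint U * U = 1\<^sub>m n"
 proof (rule eq_matI)
  fix i j assume "i < dim_row (1\<^sub>m n)" "j < dim_col (1\<^sub>m n)"
  then have ij: "i < n" "j < n" by auto
  show "(mat_adjoint U * U) $$ (i, j) = 1\<^sub>m n $$ (i, j)"
   unfolding entry[OF U ij] colU[OF ij(2)] using orth ij by simp
 qed (use U Ua in auto)
 have UU': "U * mat_adjoint U = 1\<^sub>m n" by (rule mat_mult_left_right_inverse[OF Ua U UU])
 have HU: "H * U \<in> carrier_mat n n" using H U by simp
 have D: "mat_adjoint U * (H * U) = diagm n d"
 proof (rule eq_matI)
  fix i j assume "i < dim_row (diagm n d)" "j < dim_col (diagm n d)"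
  then have ij: "i < n" "j < n" by (auto simp: diagm_def)
  have "col (H * U) j = of_real (d j) \<cdot>\<^sub>v E j"
   using col_mult2[OF H(1) U ij(2)] colU[OF ij(2)] E ij by simp
  then show "(mat_adjoint U * (H * U)) $$ (i, j) = diagm n d $$ (i, j)"
   unfolding entry[OF HU ij] using orth ij by (simp add: hip_smult_right diagm_def)
 qed (use HU Ua in \<open>auto simp: diagm_def\<close>)
 have "U * (diagm n d * mat_adjoint U) = U * diagm n d * mat_adjoint U"
  by (rule assoc_mult_mat[OF U diagm_carrier Ua, symmetric])
 also have "U * diagm n d = H * U"
  unfolding D[symmetric] assoc_mult_mat[OF U Ua HU, symmetric] UU' by (rule left_mult_one_mat[OF HU])
 also have "H * U * mat_adjoint U = H"
  unfolding assoc_mult_mat[OF H(1) U Ua] UU' using H by simp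
 finally have HD: "H = U * (diagm n d * mat_adjoint U)" by simp
 have "eigenvalue H (of_real (d i))" if i: "i < n" for i
 proof -
  have "E i \<noteq> 0\<^sub>v n"
  proof
   assume "E i = 0\<^sub>v n"
   then have "hip (E i) (E i) = 0" by (simp add: hip_def)
   then show False using orth i by simp
  qed
  then show ?thesis using E i H by (auto simp: eigenvalue_def eigenvector_def)
 qed
 then show ?thesis using that[OF U UU UU' HD] by blast
qed

lemma hip_spectral:
 assumes U: "U \<in> carrier_mat n n" and v: "v \<in> carrier_vec n"
 shows "hip v ((U * (diagm n d * mat_adjoint U)) *\<^sub>v v)
   = of_real (\<Sum>i<n. d i * (cmod (vec_index (mat_adjoint U *\<^sub>v v) i))\<^sup>2)"
proof -
 have Ua: "mat_adjoint U \<in> carrier_mat n n" by (rule mat_adjoint_carrier[OF U])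
 have y: "mat_adjoint U *\<^sub>v v \<in> carrier_vec n" using Ua v by simp
 have "(U * (diagm n d * mat_adjoint U)) *\<^sub>v v = U *\<^sub>v (diagm n d *\<^sub>v (mat_adjoint U *\<^sub>v v))"
  using assoc_mult_mat_vec[OF U _ v, of "diagm n d * mat_adjoint U"] assoc_mult_mat_vec[OF diagm_carrier Ua v]
   mult_carrier_mat[OF diagm_carrier Ua] by simp
 then show ?thesis
  using hip_adjoint[OF U v, of "diagm n d *\<^sub>v (mat_adjoint U *\<^sub>v v)"] hip_diagm[OF y] y diagm_carrier[of n d] by simp
qed

lemma vec_l2_unitary:
 assumes U: "U \<in> carrier_mat n n" "U * mat_adjoint U = 1\<^sub>m n" and v: "v \<in> carrier_vec n"
 shows "vec_l2 (mat_adjoint U *\<^sub>v v) = vec_l2 v"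
proof -
 have Ua: "mat_adjoint U \<in> carrier_mat n n" by (rule mat_adjoint_carrier[OF U(1)])
 have y: "mat_adjoint U *\<^sub>v v \<in> carrier_vec n" using Ua v by simp
 have "hip (mat_adjoint U *\<^sub>v v) (mat_adjoint U *\<^sub>v v) = hip v (U *\<^sub>v (mat_adjoint U *\<^sub>v v))"
  by (rule hip_adjoint[OF U(1) v y, symmetric])
 also have "U *\<^sub>v (mat_adjoint U *\<^sub>v v) = v"
  using assoc_mult_mat_vec[OF U(1) Ua v] U(2) v by simp
 finally have "(vec_l2 (mat_adjoint U *\<^sub>v v))\<^sup>2 = (vec_l2 v)\<^sup>2"
  unfolding hip_self by (simp only: of_real_eq_iff)
 then show ?thesis using vec_l2_nonneg by (simp add: power2_eq_iff_nonneg)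
qed

lemma finite_real_eigenvalues:
 assumes H: "(H :: complex Matrix.mat) \<in> carrier_mat n n"
 shows "finite {l. eigenvalue H (complex_of_real l)}"
proof -
 have "char_poly H \<noteq> 0" using degree_monic_char_poly[OF H] by auto
 then have "finite {z. poly (char_poly H) z = 0}" by (rule poly_roots_finite)
 then have "finite (complex_of_real -` {z. poly (char_poly H) z = 0})"
  by (rule finite_vimageI) (simp add: inj_on_def)
 then show ?thesis using eigenvalue_root_char_poly[OF H] by (simp add: vimage_def)
qed

lemma rayleigh_min_eigenvalue:
 assumes H: "H \<in> carrier_mat n n" "mat_adjoint H = H" and v: "v \<in> carrier_vec n"
 shows "min_eigenvalue H * (vec_l2 v)\<^sup>2 \<le> Re (hip v (H *\<^sub>v v))"
proof -
 obtain U d where U: "U \<in> carrier_mat n n" "mat_adjoint U * U = 1\<^sub>m n" "U * mat_adjoint U = 1\<^sub>m n"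
  "H = U * (diagm n d * mat_adjoint U)" "!!i. i < n ==> eigenvalue H (of_real (d i))"
  using hermitian_spectral[OF H] by metis
 have le: "min_eigenvalue H \<le> d i" if "i < n" for i
  unfolding min_eigenvalue_def using U(5)[OF that] finite_real_eigenvalues[OF H(1)] by (intro Min_le) auto
 have y: "mat_adjoint U *\<^sub>v v \<in> carrier_vec n" using mat_adjoint_carrier[OF U(1)] v by simp
 have "min_eigenvalue H * (vec_l2 v)\<^sup>2 = min_eigenvalue H * (\<Sum>i<n. (cmod (vec_index (mat_adjoint U *\<^sub>v v) i))\<^sup>2)"
  unfolding vec_l2_unitary[OF U(1,3) v, symmetric] vec_l2_power2 using carrier_vecD[OF y] by simp
 also have "\<dots> \<le> (\<Sum>i<n. d i * (cmod (vec_index (mat_adjoint U *\<^sub>v v) i))\<^sup>2)"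
  unfolding sum_distrib_left by (intro sum_mono mult_right_mono le) auto
 also have "\<dots> = Re (hip v (H *\<^sub>v v))"
  by (subst U(4)) (simp add: hip_spectral[OF U(1) v] del: index_mult_mat_vec)
 finally show ?thesis .
qed

lemma mat_psdD:
 assumes "mat_psd H" "H \<in> carrier_mat n n"
 shows "mat_adjoint H = H" "v \<in> carrier_vec n ==> 0 \<le> Re (hip v (H *\<^sub>v v))"
 using assms hip_scalar_prod[of "H *\<^sub>v v" n v] by (auto simp: mat_psd_def)

lemma mat_psdI:
 assumes "H \<in> carrier_mat n n" "mat_adjoint H = H" "!!v. v \<in> carrier_vec n ==> 0 \<le> Re (hip v (H *\<^sub>v v))"
 shows "mat_psd H"
 unfolding mat_psd_def using assms hip_scalar_prod[of "H *\<^sub>v _" n] by auto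

lemma psd_eigenvalue_pos:
 assumes H: "H \<in> carrier_mat n n" "mat_psd H" and l: "eigenvalue H (of_real l)"
 shows "l \<ge> 0" and "Determinant.det H \<noteq> 0 ==> l > 0"
proof -
 obtain v where v: "v \<in> carrier_vec n" "v \<noteq> 0\<^sub>v n" "H *\<^sub>v v = of_real l \<cdot>\<^sub>v v"
  using l H by (auto simp: eigenvalue_def eigenvector_def)
 have pos: "(vec_l2 v)\<^sup>2 > 0" using v vec_l2_eq_0[OF v(1)] by simp
 have "hip v (H *\<^sub>v v) = of_real (l * (vec_l2 v)\<^sup>2)"
  unfolding v(3) hip_smult_right hip_self by simp
 then have "0 \<le> l * (vec_l2 v)\<^sup>2" using mat_psdD(2)[OF H(2,1) v(1)] by simp
 then show l0: "l \<ge> 0" using pos by (simp add: zero_le_mult_iff)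
 assume d: "Determinant.det H \<noteq> 0"
 have "l \<noteq> 0"
 proof
  assume "l = 0"
  then have "H *\<^sub>v v = 0\<^sub>v n" using v by (simp add: v(3)) (auto intro!: eq_vecI)
  then show False using det_nonzero_inj[OF H(1) d v(1)] v(2) by blast
 qed
 then show "l > 0" using l0 by simp
qed

lemma min_eigenvalue_pos:
 assumes H: "H \<in> carrier_mat n n" "mat_psd H" "Determinant.det H \<noteq> 0" and n: "n > 0"
 shows "min_eigenvalue H > 0"
proof -
 obtain U d where U: "!!i. i < n ==> eigenvalue H (of_real (d i))"
  using hermitian_spectral[OF H(1) mat_psdD(1)[OF H(2,1)]] by metis
 have "{l. eigenvalue H (complex_of_real l)} \<noteq> {}" using U[OF n] by auto
 then have "min_eigenvalue H \<in> {l. eigenvalue H (complex_of_real l)}"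
  unfolding min_eigenvalue_def by (rule Min_in[OF finite_real_eigenvalues[OF H(1)]])
 then show ?thesis using psd_eigenvalue_pos(2)[OF H(1,2) _ H(3)] by simp
qed

lemma psd_spectral_sqrt:
 assumes D: "D \<in> carrier_mat n n" "mat_psd D"
 shows "\<exists>R. R \<in> carrier_mat n n \<and> mat_psd R \<and> R * R = D"
proof -
 obtain U d where U: "U \<in> carrier_mat n n" "mat_adjoint U * U = 1\<^sub>m n" "U * mat_adjoint U = 1\<^sub>m n"
  "D = U * (diagm n d * mat_adjoint U)" "!!i. i < n ==> eigenvalue D (of_real (d i))"
  using hermitian_spectral[OF D(1) mat_psdD(1)[OF D(2,1)]] by metis
 have d: "d i \<ge> 0" if "i < n" for i using psd_eigenvalue_pos(1)[OF D U(5)[OF that]] .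
 note Ua = mat_adjoint_carrier[OF U(1)]
 let ?S = "diagm n (%i. sqrt (d i))"
 note Sc = diagm_carrier[of n "%i. sqrt (d i)"]
 have SU: "?S * mat_adjoint U \<in> carrier_mat n n" by (rule mult_carrier_mat[OF Sc Ua])
 define R where "R = U * (?S * mat_adjoint U)"
 have R: "R \<in> carrier_mat n n" unfolding R_def by (rule mult_carrier_mat[OF U(1) SU])
 have Sadj: "mat_adjoint ?S = ?S"
 proof (rule eq_matI)
  fix i j assume "i < dim_row ?S" "j < dim_col ?S"
  then have ij: "i < n" "j < n" by (auto simp: diagm_def)
  show "mat_adjoint ?S $$ (i, j) = ?S $$ (i, j)"
   unfolding mat_adjoint_index[OF Sc ij] using ij by (simp add: diagm_def)
 qed (use Sc mat_adjoint_carrier[OF Sc] in auto)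
 have "mat_adjoint R = R"
  unfolding R_def mat_adjoint_mult[OF U(1) SU] mat_adjoint_mult[OF Sc Ua] mat_adjoint_adjoint[OF U(1)] Sadj
  by (rule assoc_mult_mat[OF U(1) Sc Ua])
 then have "mat_psd R"
 proof (rule mat_psdI[OF R])
  fix v :: "complex Matrix.vec" assume v: "v \<in> carrier_vec n"
  show "0 \<le> Re (hip v (R *\<^sub>v v))"
   unfolding R_def hip_spectral[OF U(1) v] Re_complex_of_real using d by (auto intro!: sum_nonneg mult_nonneg_nonneg)
 qed
 moreover have "R * R = D"
 proof -
  have "R * R = U * ((?S * mat_adjoint U) * R)"
   unfolding R_def by (rule assoc_mult_mat[OF U(1) SU R[unfolded R_def]])
  also have "(?S * mat_adjoint U) * R = ?S * (mat_adjoint U * R)" by (rule assoc_mult_mat[OF Sc Ua R])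
  also have "mat_adjoint U * R = ?S * mat_adjoint U"
   unfolding R_def assoc_mult_mat[OF Ua U(1) SU, symmetric] U(2) by (rule left_mult_one_mat[OF SU])
  also have "?S * (?S * mat_adjoint U) = (?S * ?S) * mat_adjoint U"
   by (rule assoc_mult_mat[OF Sc Sc Ua, symmetric])
  also have "?S * ?S = diagm n d"
  proof (rule eq_matI)
   fix i j assume "i < dim_row (diagm n d)" "j < dim_col (diagm n d)"
   then have ij: "i < n" "j < n" by (auto simp: diagm_def)
   have "(?S * ?S) $$ (i, j) = (\<Sum>l<n. if l = i then of_real (sqrt (d i)) * ?S $$ (i, j) else 0)"
    unfolding mult_mat_index[OF Sc Sc ij] by (rule sum.cong[OF refl]) (use ij in \<open>auto simp: diagm_def\<close>)
   also have "\<dots> = diagm n d $$ (i, j)"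
    using ij d[OF ij(1)] by (cases "i = j") (simp_all add: diagm_def flip: of_real_mult)
   finally show "(?S * ?S) $$ (i, j) = diagm n d $$ (i, j)" .
  qed (simp_all add: diagm_def)
  finally show ?thesis using U(4) by simp
 qed
 ultimately show ?thesis using R by blast
qed

text \<open>The difference \<open>X = S - R\<close> satisfies \<open>S X + X R = 0\<close>, so the form \<open>S + R\<close> vanishes on every eigenvector of \<open>X\<close> with
nonzero eigenvalue.\<close>

lemma psd_sqrt_unique:
 assumes D: "D \<in> carrier_mat n n" "Determinant.det D \<noteq> 0"
  and S: "S \<in> carrier_mat n n" "mat_psd S" "S * S = D"
  and R: "R \<in> carrier_mat n n" "mat_psd R" "R * R = D"
 shows "S = R"
proof (cases "n = 0")
 case True
 then show ?thesis using S R by (intro eq_matI) auto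
next
 case False
 have dS: "Determinant.det S \<noteq> 0" using det_mult[OF S(1) S(1)] S(3) D(2) by auto
 define X where "X = S - R"
 have X: "X \<in> carrier_mat n n" unfolding X_def by (rule minus_carrier_mat[OF R(1)])
 note Sa = mat_psdD(1)[OF S(2,1)] and Ra = mat_psdD(1)[OF R(2,1)]
 have Xa: "mat_adjoint X = X"
 proof (rule eq_matI)
  fix i j assume "i < dim_row X" "j < dim_col X"
  then have ij: "i < n" "j < n" using X by auto
  have "S $$ (i, j) = cnj (S $$ (j, i))" "R $$ (i, j) = cnj (R $$ (j, i))"
   using mat_adjoint_index[OF S(1) ij] mat_adjoint_index[OF R(1) ij] Sa Ra by simp_all
  then show "mat_adjoint X $$ (i, j) = X $$ (i, j)"
   unfolding mat_adjoint_index[OF X ij] using ij S R by (simp add: X_def)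
 qed (use X mat_adjoint_carrier[OF X] in auto)
 have key: "S *\<^sub>v (X *\<^sub>v v) + X *\<^sub>v (R *\<^sub>v v) = 0\<^sub>v n" if v: "v \<in> carrier_vec n" for v
 proof -
  have Sv: "S *\<^sub>v v \<in> carrier_vec n" "R *\<^sub>v v \<in> carrier_vec n" using S R v by auto
  have 1: "X *\<^sub>v w = S *\<^sub>v w - R *\<^sub>v w" if "w \<in> carrier_vec n" for w
   unfolding X_def by (rule minus_mult_distrib_mat_vec[OF S(1) R(1) that])
  have "S *\<^sub>v (X *\<^sub>v v) = S *\<^sub>v (S *\<^sub>v v) - S *\<^sub>v (R *\<^sub>v v)"
   unfolding 1[OF v] by (rule mult_minus_distrib_mat_vec[OF S(1) Sv])
  moreover have "S *\<^sub>v (S *\<^sub>v v) = R *\<^sub>v (R *\<^sub>v v)"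
   using assoc_mult_mat_vec[OF S(1) S(1) v] assoc_mult_mat_vec[OF R(1) R(1) v] S(3) R(3) by simp
  moreover have "R *\<^sub>v (R *\<^sub>v v) \<in> carrier_vec n" "S *\<^sub>v (R *\<^sub>v v) \<in> carrier_vec n" using S R Sv by auto
  moreover have "a - b + (b - a) = 0\<^sub>v n" if "a \<in> carrier_vec n" "b \<in> carrier_vec n" for a b :: "complex Matrix.vec"
   using that by (intro eq_vecI) auto
  ultimately show ?thesis unfolding 1[OF Sv(2)] by simp
 qed
 obtain U d where U: "U \<in> carrier_mat n n" "X = U * (diagm n d * mat_adjoint U)"
   "!!i. i < n ==> eigenvalue X (of_real (d i))"
  using hermitian_spectral[OF X Xa] by metis
 have d: "d i = 0" if i: "i < n" for i
 proof (rule ccontr)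
  assume di: "d i \<noteq> 0"
  obtain v where v: "v \<in> carrier_vec n" "v \<noteq> 0\<^sub>v n" "X *\<^sub>v v = of_real (d i) \<cdot>\<^sub>v v"
   using U(3)[OF i] X by (auto simp: eigenvalue_def eigenvector_def)
  have Sv: "S *\<^sub>v v \<in> carrier_vec n" "R *\<^sub>v v \<in> carrier_vec n" using S R v by auto
  have XR: "X *\<^sub>v (R *\<^sub>v v) \<in> carrier_vec n" "S *\<^sub>v (X *\<^sub>v v) \<in> carrier_vec n" using S X Sv v by auto
  have "hip v (S *\<^sub>v (X *\<^sub>v v) + X *\<^sub>v (R *\<^sub>v v)) = 0"
   unfolding key[OF v(1)] by (simp add: hip_def)
  then have "hip v (S *\<^sub>v (X *\<^sub>v v)) + hip v (X *\<^sub>v (R *\<^sub>v v)) = 0"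
   by (simp add: hip_add_right[OF XR(2,1)])
  moreover have "hip v (S *\<^sub>v (X *\<^sub>v v)) = of_real (d i) * hip v (S *\<^sub>v v)"
   unfolding v(3) using S v by (simp add: mult_mat_vec hip_smult_right)
  moreover have "hip v (X *\<^sub>v (R *\<^sub>v v)) = of_real (d i) * hip v (R *\<^sub>v v)"
  proof -
   have "hip (c \<cdot>\<^sub>v v) y = cnj c * hip v y" if "y \<in> carrier_vec n" for c y
    using that v(1) by (auto simp: hip_def sum_distrib_left mult.assoc intro!: sum.cong)
   then show ?thesis
    using hip_adjoint[OF X v(1) Sv(2)] unfolding Xa v(3) using Sv(2) by simp
  qed
  ultimately have "of_real (d i) * (hip v (S *\<^sub>v v) + hip v (R *\<^sub>v v)) = 0"
   by (simp add: distrib_left)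
  then have "Re (hip v (S *\<^sub>v v)) + Re (hip v (R *\<^sub>v v)) = 0"
   using di by (simp flip: plus_complex.simps(1))
  then have "Re (hip v (S *\<^sub>v v)) = 0"
   using mat_psdD(2)[OF S(2,1) v(1)] mat_psdD(2)[OF R(2,1) v(1)] by linarith
  then have "min_eigenvalue S * (vec_l2 v)\<^sup>2 \<le> 0"
   using rayleigh_min_eigenvalue[OF S(1) Sa v(1)] by simp
  then have "vec_l2 v = 0"
   using min_eigenvalue_pos[OF S(1,2) dS] False by (simp add: mult_le_0_iff)
  then show False using vec_l2_eq_0[OF v(1)] v(2) by simp
 qed
 have "diagm n d = 0\<^sub>m n n" by (rule eq_matI) (auto simp: diagm_def d)
 then have "X = 0\<^sub>m n n" using U mat_adjoint_carrier[OF U(1)] by simp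
 show ?thesis
 proof (rule eq_matI)
  fix i j assume "i < dim_row R" "j < dim_col R"
  then have ij: "i < n" "j < n" using R by auto
  have "S $$ (i, j) - R $$ (i, j) = X $$ (i, j)" using ij S R by (simp add: X_def)
  then show "S $$ (i, j) = R $$ (i, j)" using \<open>X = 0\<^sub>m n n\<close> ij by simp
 qed (use S R in auto)
qed

lemma mat_sqrt_psd:
 assumes D: "D \<in> carrier_mat n n" "mat_psd D" "Determinant.det D \<noteq> 0"
 shows "mat_sqrt D \<in> carrier_mat n n" "mat_psd (mat_sqrt D)" "mat_sqrt D * mat_sqrt D = D"
proof -
 obtain R where R: "R \<in> carrier_mat n n" "mat_psd R" "R * R = D"
  using psd_spectral_sqrt[OF D(1,2)] by blast
 have "mat_sqrt D = R"
  unfolding mat_sqrt_def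
 proof (rule the_equality)
  show "R \<in> carrier_mat (dim_row D) (dim_row D) \<and> mat_psd R \<and> R * R = D" using R D(1) by simp
  fix S assume "S \<in> carrier_mat (dim_row D) (dim_row D) \<and> mat_psd S \<and> S * S = D"
  then show "S = R" using psd_sqrt_unique[OF D(1,3) _ _ _ R, of S] carrier_matD(1)[OF D(1)] by simp
 qed
 then show "mat_sqrt D \<in> carrier_mat n n" "mat_psd (mat_sqrt D)" "mat_sqrt D * mat_sqrt D = D"
  using R by simp_all
qed

text \<open>With \<open>R\<close> the square root of \<open>D\<close>, the substitution
  \<open>v = R w\<close> turns the squared norm of \<open>v\<close> into the form of
  \<open>D\<close> at \<open>w\<close>, and the form of the whitened matrix at \<open>v\<close> into
  the form of \<open>M\<close> at \<open>w\<close>.\<close>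

lemma whitened_lower_bound:
 assumes D: "D \<in> carrier_mat n n" "mat_psd D" "Determinant.det D \<noteq> 0" and M: "M \<in> carrier_mat n n"
  and S: "S = minv (mat_sqrt D)" and le: "op_norm (1\<^sub>m n - S * M * S) \<le> 1 - \<gamma>"
  and w: "w \<in> carrier_vec n"
 shows "\<gamma> * Re (hip w (D *\<^sub>v w)) \<le> Re (hip w (M *\<^sub>v w))"
proof -
 define R where "R = mat_sqrt D"
 note R = mat_sqrt_psd[OF D, folded R_def]
 have Ra: "mat_adjoint R = R" by (rule mat_psdD(1)[OF R(2,1)])
 have dR: "Determinant.det R \<noteq> 0" using det_mult[OF R(1) R(1)] R(3) D(3) by auto
 note Sm = minv[OF R(1) dR, folded S[folded R_def]]
 have Sa: "mat_adjoint S = S"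
 proof -
  have "mat_adjoint (S * R) = mat_adjoint R * mat_adjoint S" by (rule mat_adjoint_mult[OF Sm(1) R(1)])
  then have "R * mat_adjoint S = 1\<^sub>m n" by (simp add: Sm(3) Ra mat_adjoint_one)
  then show ?thesis using minv_unique[OF R(1) dR mat_adjoint_carrier[OF Sm(1)]] S by (simp add: R_def)
 qed
 define v where "v = R *\<^sub>v w"
 have v: "v \<in> carrier_vec n" using R w by (simp add: v_def)
 have Sv: "S *\<^sub>v v = w" unfolding v_def using assoc_mult_mat_vec[OF Sm(1) R(1) w] Sm(3) w by simp
 have SM: "S * M \<in> carrier_mat n n" "S * M * S \<in> carrier_mat n n" using Sm M by auto
 have Mw: "M *\<^sub>v w \<in> carrier_vec n" using M w by simp
 have SMS: "(S * M * S) *\<^sub>v v = S *\<^sub>v (M *\<^sub>v w)"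
  using assoc_mult_mat_vec[OF SM(1) Sm(1) v] assoc_mult_mat_vec[OF Sm(1) M w] Sv by simp
 have "hip v ((1\<^sub>m n - S * M * S) *\<^sub>v v) = hip v v - hip v (S *\<^sub>v (M *\<^sub>v w))"
  using minus_mult_distrib_mat_vec[OF one_carrier_mat SM(2) v] SMS v Sm(1) Mw
  by (simp add: hip_diff_right[of _ n])
 also have "hip v (S *\<^sub>v (M *\<^sub>v w)) = hip w (M *\<^sub>v w)"
  using hip_adjoint[OF Sm(1) v Mw] Sa Sv by simp
 finally have eq: "Re (hip v ((1\<^sub>m n - S * M * S) *\<^sub>v v)) = (vec_l2 v)\<^sup>2 - Re (hip w (M *\<^sub>v w))"
  by (simp add: hip_self)
 have c: "1\<^sub>m n - S * M * S \<in> carrier_mat n n" by (rule minus_carrier_mat[OF SM(2)])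
 have "Re (hip v ((1\<^sub>m n - S * M * S) *\<^sub>v v)) \<le> cmod (hip v ((1\<^sub>m n - S * M * S) *\<^sub>v v))"
  by (rule complex_Re_le_cmod)
 also have "\<dots> \<le> vec_l2 v * vec_l2 ((1\<^sub>m n - S * M * S) *\<^sub>v v)"
  by (rule hip_le[OF v]) (use c v in auto)
 also have "\<dots> \<le> vec_l2 v * (op_norm (1\<^sub>m n - S * M * S) * vec_l2 v)"
  by (intro mult_left_mono op_norm_le[OF c v] vec_l2_nonneg)
 also have "\<dots> \<le> vec_l2 v * ((1 - \<gamma>) * vec_l2 v)"
  using le by (intro mult_left_mono mult_right_mono vec_l2_nonneg)
 finally have "\<gamma> * (vec_l2 v)\<^sup>2 \<le> Re (hip w (M *\<^sub>v w))"
  unfolding eq by (simp add: power2_eq_square algebra_simps)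
 moreover have "hip v v = hip w (D *\<^sub>v w)"
 proof -
  have "hip v v = hip w (R *\<^sub>v v)" using hip_adjoint[OF R(1) w v] Ra by (simp add: v_def)
  also have "R *\<^sub>v v = D *\<^sub>v w" unfolding v_def using assoc_mult_mat_vec[OF R(1) R(1) w] R(3) by simp
  finally show ?thesis .
 qed
 ultimately show ?thesis using arg_cong[OF hip_self[of v], of Re] by (simp only: Re_complex_of_real)
qed

section \<open>The matrix logarithm\<close>

subsection \<open>Continuous and differentiable families of matrices\<close>

definition mat_cont :: "'x::topological_space set => nat => ('x => complex Matrix.mat) => bool" where
 "mat_cont S n M \<longleftrightarrow> (\<forall>x\<in>S. M x \<in> carrier_mat n n) \<and> (\<forall>i<n. \<forall>j<n. continuous_on S (%x. M x $$ (i, j)))"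

lemma mat_contD:
 "mat_cont S n M ==> x \<in> S ==> M x \<in> carrier_mat n n"
 "mat_cont S n M ==> i < n ==> j < n ==> continuous_on S (%x. M x $$ (i, j))"
 by (auto simp: mat_cont_def)

lemma mat_contI:
 assumes "!!x. x \<in> S ==> M x \<in> carrier_mat n n"
  and "!!i j. i < n ==> j < n ==> continuous_on S (f i j)"
  and "!!i j x. i < n ==> j < n ==> x \<in> S ==> M x $$ (i, j) = f i j x"
 shows "mat_cont S n M"
 unfolding mat_cont_def
proof (intro conjI allI impI ballI)
 fix i j assume ij: "i < n" "j < n"
 have "continuous_on S (%x. M x $$ (i, j)) \<longleftrightarrow> continuous_on S (f i j)"
  by (rule continuous_on_cong) (use assms(3) ij in auto)
 then show "continuous_on S (%x. M x $$ (i, j))" using assms(2)[OF ij] by simp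
qed (rule assms(1))

lemma mat_cont_const: "M \<in> carrier_mat n n ==> mat_cont S n (%_. M)"
 by (simp add: mat_cont_def)

lemma mat_cont_subset: "mat_cont S n M ==> S' \<subseteq> S ==> mat_cont S' n M"
 unfolding mat_cont_def by (blast intro: continuous_on_subset)

lemma mat_cont_compose:
 assumes M: "mat_cont S n M" and g: "continuous_on S' g" "g ` S' \<subseteq> S"
 shows "mat_cont S' n (%x. M (g x))"
 by (rule mat_contI[where f = "%i j x. M (g x) $$ (i, j)"])
  (use mat_contD(1)[OF M] continuous_on_compose2[OF mat_contD(2)[OF M] g] g in auto)

lemma mat_cont_mult:
 assumes M: "mat_cont S n M" and N: "mat_cont S n N"
 shows "mat_cont S n (%x. M x * N x)"
proof (rule mat_contI[where f = "%i j x. \<Sum>l<n. M x $$ (i, l) * N x $$ (l, j)"])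
 fix i j assume "i < n" "j < n"
 then show "continuous_on S (%x. \<Sum>l<n. M x $$ (i, l) * N x $$ (l, j))"
  by (intro continuous_intros mat_contD(2)[OF M] mat_contD(2)[OF N]) auto
next
 fix i j x assume "i < n" "j < n" "x \<in> S"
 then show "(M x * N x) $$ (i, j) = (\<Sum>l<n. M x $$ (i, l) * N x $$ (l, j))"
  by (intro mult_mat_index[OF mat_contD(1)[OF M] mat_contD(1)[OF N]])
qed (rule mult_carrier_mat[OF mat_contD(1)[OF M] mat_contD(1)[OF N]])

lemma mat_cont_minus:
 assumes M: "mat_cont S n M" and N: "mat_cont S n N"
 shows "mat_cont S n (%x. M x - N x)"
proof (rule mat_contI[where f = "%i j x. M x $$ (i, j) - N x $$ (i, j)"])
 fix i j assume "i < n" "j < n"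
 then show "continuous_on S (%x. M x $$ (i, j) - N x $$ (i, j))"
  by (intro continuous_intros mat_contD(2)[OF M] mat_contD(2)[OF N]) auto
next
 fix i j x assume "i < n" "j < n" "x \<in> S"
 then show "(M x - N x) $$ (i, j) = M x $$ (i, j) - N x $$ (i, j)"
  using mat_contD(1)[OF M, of x] mat_contD(1)[OF N, of x] by auto
qed (use mat_contD(1)[OF N] in \<open>auto intro!: minus_carrier_mat\<close>)

lemma continuous_on_det:
 assumes M: "mat_cont S n M"
 shows "continuous_on S (%x. Determinant.det (M x))"
proof -
 have "continuous_on S (%x. Determinant.det (M x)) \<longleftrightarrow>
   continuous_on S (%x. \<Sum>p\<in>{p. p permutes {0..<n}}. signof p * (\<Prod>i=0..<n. M x $$ (i, p i)))"
  by (rule continuous_on_cong[OF refl]) (rule det_def'[OF mat_contD(1)[OF M]])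
 moreover have "continuous_on S (%x. \<Sum>p\<in>{p. p permutes {0..<n}}. signof p * (\<Prod>i=0..<n. M x $$ (i, p i)))"
  by (intro continuous_intros mat_contD(2)[OF M]) (auto simp: permutes_def[symmetric] dest: permutes_in_image)
 ultimately show ?thesis by simp
qed

text \<open>By Cramer's rule the entries of the inverse are quotients of determinants, hence
  continuous.\<close>

lemma mat_cont_minv:
 assumes M: "mat_cont S n M" and d: "!!x. x \<in> S ==> Determinant.det (M x) \<noteq> 0"
 shows "mat_cont S n (%x. minv (M x))"
proof (rule mat_contI[where f = "%i j x. 1 / Determinant.det (M x) * ((-1) ^ (j + i) * Determinant.det (mat_delete (M x) j i))"])
 fix i j assume ij: "i < n" "j < n"
 have "mat_cont S (n - 1) (%x. mat_delete (M x) j i)"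
 proof (rule mat_contI[where f = "%i' j' x. M x $$ (if i' < j then i' else Suc i', if j' < i then j' else Suc j')"])
  fix i' j' assume "i' < n - 1" "j' < n - 1"
  then show "continuous_on S (%x. M x $$ (if i' < j then i' else Suc i', if j' < i then j' else Suc j'))"
   by (intro mat_contD(2)[OF M]) auto
 next
  fix i' j' x assume "i' < n - 1" "j' < n - 1" "x \<in> S"
  then show "mat_delete (M x) j i $$ (i', j') = M x $$ (if i' < j then i' else Suc i', if j' < i then j' else Suc j')"
   using mat_contD(1)[OF M, of x] unfolding mat_delete_def by auto
 qed (rule mat_delete_carrier[OF mat_contD(1)[OF M]])
 note delete = continuous_on_det[OF this]
 show "continuous_on S (%x. 1 / Determinant.det (M x) * ((-1) ^ (j + i) * Determinant.det (mat_delete (M x) j i)))"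
  by (intro continuous_intros delete continuous_on_det[OF M]) (use d in auto)
next
 fix i j x assume ij: "i < n" "j < n" and x: "x \<in> S"
 note Mx = mat_contD(1)[OF M x] and adj = adj_mat[OF mat_contD(1)[OF M x]]
 let ?c = "1 / Determinant.det (M x)"
 have c: "?c \<cdot>\<^sub>m adj_mat (M x) \<in> carrier_mat n n" using adj(1) by simp
 have "M x * (?c \<cdot>\<^sub>m adj_mat (M x)) = ?c \<cdot>\<^sub>m (M x * adj_mat (M x))" by (rule mult_smult_distrib[OF Mx adj(1)])
 also have "\<dots> = 1\<^sub>m n" unfolding adj(2) by (rule eq_matI) (use d[OF x] in auto)
 finally have "minv (M x) = ?c \<cdot>\<^sub>m adj_mat (M x)" by (rule minv_unique[OF Mx d[OF x] c])
 then show "minv (M x) $$ (i, j) = ?c * ((-1) ^ (j + i) * Determinant.det (mat_delete (M x) j i))"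
  using ij Mx by (simp add: adj_mat_def cofactor_def)
qed (use minv(1)[OF mat_contD(1)[OF M] d] in auto)

definition mat_der :: "real set => nat => (real => complex Matrix.mat) => complex Matrix.mat => real => bool" where
 "mat_der S n M M' t \<longleftrightarrow> (\<forall>x\<in>S. M x \<in> carrier_mat n n) \<and> M' \<in> carrier_mat n n \<and>
   (\<forall>i<n. \<forall>j<n. ((%x. M x $$ (i, j)) has_vector_derivative M' $$ (i, j)) (at t within S))"

lemma mat_derD:
 "mat_der S n M M' t ==> x \<in> S ==> M x \<in> carrier_mat n n" "mat_der S n M M' t ==> M' \<in> carrier_mat n n"
 "mat_der S n M M' t ==> i < n ==> j < n ==> ((%x. M x $$ (i, j)) has_vector_derivative M' $$ (i, j)) (at t within S)"
 by (auto simp: mat_der_def)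

lemma mat_derI:
 assumes "!!x. x \<in> S ==> M x \<in> carrier_mat n n" "M' \<in> carrier_mat n n" and t: "t \<in> S"
  and "!!i j. i < n ==> j < n ==> (f i j has_vector_derivative M' $$ (i, j)) (at t within S)"
  and "!!i j x. i < n ==> j < n ==> x \<in> S ==> M x $$ (i, j) = f i j x"
 shows "mat_der S n M M' t"
 unfolding mat_der_def
proof (intro conjI allI impI ballI)
 fix i j assume ij: "i < n" "j < n"
 show "((%x. M x $$ (i, j)) has_vector_derivative M' $$ (i, j)) (at t within S)"
  by (rule has_vector_derivative_transform[OF t _ assms(4)[OF ij]]) (use assms(5) ij in auto)
qed (use assms in auto)

lemma mat_der_const: "M \<in> carrier_mat n n ==> mat_der S n (%_. M) (0\<^sub>m n n) t"
 by (auto simp: mat_der_def)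

lemma mat_der_minus:
 assumes M: "mat_der S n M M' t" and N: "mat_der S n N N' t" and t: "t \<in> S"
 shows "mat_der S n (%x. M x - N x) (M' - N') t"
proof (rule mat_derI[where f = "%i j x. M x $$ (i, j) - N x $$ (i, j)", OF _ _ t])
 fix i j assume ij: "i < n" "j < n"
 then have "(M' - N') $$ (i, j) = M' $$ (i, j) - N' $$ (i, j)" using mat_derD(2)[OF M] mat_derD(2)[OF N] by auto
 then show "((%x. M x $$ (i, j) - N x $$ (i, j)) has_vector_derivative (M' - N') $$ (i, j)) (at t within S)"
  by (simp only:) (intro has_vector_derivative_diff mat_derD(3)[OF M] mat_derD(3)[OF N] ij)
next
 fix i j x assume "i < n" "j < n" "x \<in> S"
 then show "(M x - N x) $$ (i, j) = M x $$ (i, j) - N x $$ (i, j)"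
  using mat_derD(1)[OF M, of x] mat_derD(1)[OF N, of x] by auto
qed (use mat_derD[OF M] mat_derD[OF N] in \<open>auto intro!: minus_carrier_mat\<close>)

lemma mat_der_mult:
 assumes M: "mat_der S n M M' t" and N: "mat_der S n N N' t" and t: "t \<in> S"
 shows "mat_der S n (%x. M x * N x) (M' * N t + M t * N') t"
proof (rule mat_derI[where f = "%i j x. \<Sum>l<n. M x $$ (i, l) * N x $$ (l, j)", OF _ _ t])
 note c = mat_derD(1)[OF M t] mat_derD(2)[OF M] mat_derD(1)[OF N t] mat_derD(2)[OF N]
 show "M' * N t + M t * N' \<in> carrier_mat n n" using c by auto
 fix i j assume ij: "i < n" "j < n"
 have "(M' * N t + M t * N') $$ (i, j) = (M' * N t) $$ (i, j) + (M t * N') $$ (i, j)" using c ij by auto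
 also have "\<dots> = (\<Sum>l<n. M t $$ (i, l) * N' $$ (l, j) + M' $$ (i, l) * N t $$ (l, j))"
  unfolding mult_mat_index[OF c(2,3) ij] mult_mat_index[OF c(1,4) ij] sum.distrib by (rule add.commute)
 finally have eq: "(M' * N t + M t * N') $$ (i, j) = (\<Sum>l<n. M t $$ (i, l) * N' $$ (l, j) + M' $$ (i, l) * N t $$ (l, j))" .
 show "((%x. \<Sum>l<n. M x $$ (i, l) * N x $$ (l, j)) has_vector_derivative (M' * N t + M t * N') $$ (i, j)) (at t within S)"
  unfolding eq
  by (intro has_vector_derivative_sum has_vector_derivative_mult mat_derD(3)[OF M] mat_derD(3)[OF N] ij) auto
next
 fix i j x assume "i < n" "j < n" "x \<in> S"
 then show "(M x * N x) $$ (i, j) = (\<Sum>l<n. M x $$ (i, l) * N x $$ (l, j))"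
  by (intro mult_mat_index[OF mat_derD(1)[OF M] mat_derD(1)[OF N]])
qed (rule mult_carrier_mat[OF mat_derD(1)[OF M] mat_derD(1)[OF N]])

lemma mat_der_smult:
 assumes M: "mat_der S n M M' t" and c: "(c has_vector_derivative c') (at t within S)" and t: "t \<in> S"
 shows "mat_der S n (%x. c x \<cdot>\<^sub>m M x) (c' \<cdot>\<^sub>m M t + c t \<cdot>\<^sub>m M') t"
proof (rule mat_derI[where f = "%i j x. c x * M x $$ (i, j)", OF _ _ t])
 note m = mat_derD(1)[OF M t] mat_derD(2)[OF M]
 show "c' \<cdot>\<^sub>m M t + c t \<cdot>\<^sub>m M' \<in> carrier_mat n n" using m by auto
 fix i j assume ij: "i < n" "j < n"
 have "(c' \<cdot>\<^sub>m M t + c t \<cdot>\<^sub>m M') $$ (i, j) = c t * M' $$ (i, j) + c' * M t $$ (i, j)" using m ij by auto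
 then show "((%x. c x * M x $$ (i, j)) has_vector_derivative (c' \<cdot>\<^sub>m M t + c t \<cdot>\<^sub>m M') $$ (i, j)) (at t within S)"
  by (simp only:) (intro has_vector_derivative_mult mat_derD(3)[OF M] ij c)
next
 fix i j x assume "i < n" "j < n" "x \<in> S"
 then show "(c x \<cdot>\<^sub>m M x) $$ (i, j) = c x * M x $$ (i, j)"
  using mat_derD(1)[OF M, of x] by auto
qed (use mat_derD(1)[OF M] in auto)

lemma mat_der_imp_cont:
 assumes "!!t. t \<in> S ==> mat_der S n M (M' t) t"
 shows "mat_cont S n M"
 using assms unfolding mat_der_def mat_cont_def continuous_on_eq_continuous_within
 by (auto intro: has_vector_derivative_continuous)

lemma minv_diff:
 assumes A: "A \<in> carrier_mat n n" "Determinant.det A \<noteq> 0" and B: "B \<in> carrier_mat n n" "Determinant.det B \<noteq> 0"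
 shows "minv B - minv A = minv B * (A - B) * minv A"
proof -
 note a = minv[OF A] and b = minv[OF B]
 have "minv B * (A - B) = minv B * A - 1\<^sub>m n"
  using mult_minus_distrib_mat[OF b(1) A(1) B(1)] b(3) by simp
 then have "minv B * (A - B) * minv A = minv B * A * minv A - 1\<^sub>m n * minv A"
  using minus_mult_distrib_mat[OF mult_carrier_mat[OF b(1) A(1)] one_carrier_mat a(1)] by simp
 also have "minv B * A * minv A = minv B"
  using assoc_mult_mat[OF b(1) A(1) a(1)] a(2) b(1) by simp
 finally show ?thesis using a(1) by simp
qed

lemma has_vector_derivative_at_within_iff:
 "(f has_vector_derivative D) (at t within S) \<longleftrightarrow> ((%x. (f x - f t) /\<^sub>R (x - t)) \<longlongrightarrow> D) (at t within S)"
proof -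
 have eq: "norm ((1 / norm (x - t)) *\<^sub>R (f x - (f t + (x - t) *\<^sub>R D))) = norm ((f x - f t) /\<^sub>R (x - t) - D)"
  if "x \<noteq> t" for x
 proof -
  have "f x - (f t + (x - t) *\<^sub>R D) = (x - t) *\<^sub>R ((f x - f t) /\<^sub>R (x - t) - D)"
   using that by (simp add: scaleR_diff_right)
  then show ?thesis using that by simp
 qed
 have "(f has_vector_derivative D) (at t within S) \<longleftrightarrow>
   ((%x. norm ((1 / norm (x - t)) *\<^sub>R (f x - (f t + (x - t) *\<^sub>R D)))) \<longlongrightarrow> 0) (at t within S)"
  unfolding has_vector_derivative_def has_derivative_within tendsto_norm_zero_iff
  by (simp add: bounded_linear_scaleR_left)
 also have "\<dots> \<longleftrightarrow> ((%x. norm ((f x - f t) /\<^sub>R (x - t) - D)) \<longlongrightarrow> 0) (at t within S)"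
  by (rule tendsto_cong, unfold eventually_at_filter, rule always_eventually) (use eq in blast)
 also have "\<dots> \<longleftrightarrow> ((%x. (f x - f t) /\<^sub>R (x - t)) \<longlongrightarrow> D) (at t within S)"
  unfolding tendsto_norm_zero_iff by (rule Lim_null[symmetric])
 finally show ?thesis .
qed

text \<open>\<open>minv_diff\<close> writes the difference quotient as a product of the inverse at
  \<open>x\<close>, the difference quotient of \<open>M\<close> and the inverse at \<open>t\<close>;
  the first factor converges by continuity.\<close>

lemma mat_der_minv:
 assumes M: "mat_der S n M M' t" and c: "mat_cont S n M" and t: "t \<in> S"
  and d: "!!x. x \<in> S ==> Determinant.det (M x) \<noteq> 0"
 shows "mat_der S n (%x. minv (M x)) (0\<^sub>m n n - minv (M t) * M' * minv (M t)) t"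
proof (rule mat_derI[where f = "%i j x. minv (M x) $$ (i, j)", OF _ _ t])
 let ?R = "%x. minv (M x)"
 note Mc = mat_contD(1)[OF c] and M' = mat_derD(2)[OF M]
 note R = minv(1)[OF Mc d] and Rt = minv(1)[OF Mc[OF t] d[OF t]]
 note Rcont = mat_cont_minv[OF c d]
 show "?R x \<in> carrier_mat n n" if "x \<in> S" for x using R that by blast
 have RM: "?R t * M' \<in> carrier_mat n n" using Rt M' by auto
 have RMR: "?R t * M' * ?R t \<in> carrier_mat n n" using RM Rt by auto
 show "0\<^sub>m n n - ?R t * M' * ?R t \<in> carrier_mat n n" using RMR by (intro minus_carrier_mat)
 fix i j assume ij: "i < n" "j < n"
 have entry: "(X * Y * Z) $$ (i, j) = (\<Sum>l<n. (\<Sum>k<n. X $$ (i, k) * Y $$ (k, l)) * Z $$ (l, j))"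
  if "X \<in> carrier_mat n n" "Y \<in> carrier_mat n n" "Z \<in> carrier_mat n n" for X Y Z :: "complex Matrix.mat"
  unfolding mult_mat_index[OF mult_carrier_mat[OF that(1,2)] that(3) ij]
  by (rule sum.cong[OF refl]) (simp add: mult_mat_index[OF that(1,2) ij(1)])
 have lim: "((%x. - (\<Sum>l<n. (\<Sum>k<n. ?R x $$ (i, k) * ((M x $$ (k, l) - M t $$ (k, l)) /\<^sub>R (x - t))) * ?R t $$ (l, j)))
   \<longlongrightarrow> - (\<Sum>l<n. (\<Sum>k<n. ?R t $$ (i, k) * M' $$ (k, l)) * ?R t $$ (l, j))) (at t within S)"
 proof (intro tendsto_intros)
  fix k l assume k: "k \<in> {..<n}" and l: "l \<in> {..<n}"
  show "((%x. ?R x $$ (i, k)) \<longlongrightarrow> ?R t $$ (i, k)) (at t within S)"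
   using mat_contD(2)[OF Rcont ij(1), of k] k t by (auto simp: continuous_on_def)
  show "((%x. (M x $$ (k, l) - M t $$ (k, l)) /\<^sub>R (x - t)) \<longlongrightarrow> M' $$ (k, l)) (at t within S)"
   using mat_derD(3)[OF M, of k l] k l by (simp add: has_vector_derivative_at_within_iff)
 qed
 have eq: "(0\<^sub>m n n - ?R t * M' * ?R t) $$ (i, j) = - (\<Sum>l<n. (\<Sum>k<n. ?R t $$ (i, k) * M' $$ (k, l)) * ?R t $$ (l, j))"
  unfolding entry[OF Rt M' Rt, symmetric] using RMR ij by (simp del: index_mult_mat)
 show "((%x. ?R x $$ (i, j)) has_vector_derivative (0\<^sub>m n n - ?R t * M' * ?R t) $$ (i, j)) (at t within S)"
  unfolding has_vector_derivative_at_within_iff eq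
 proof (rule Lim_transform_eventually[OF lim])
  have "- (\<Sum>l<n. (\<Sum>k<n. ?R x $$ (i, k) * ((M x $$ (k, l) - M t $$ (k, l)) /\<^sub>R (x - t))) * ?R t $$ (l, j))
    = (?R x $$ (i, j) - ?R t $$ (i, j)) /\<^sub>R (x - t)" if x: "x \<in> S" for x
  proof -
   have "?R x $$ (i, j) - ?R t $$ (i, j) = (?R x - ?R t) $$ (i, j)" using R[OF x x] Rt ij by auto
   also have "\<dots> = (\<Sum>l<n. (\<Sum>k<n. ?R x $$ (i, k) * (M t - M x) $$ (k, l)) * ?R t $$ (l, j))"
    unfolding minv_diff[OF Mc[OF t] d[OF t] Mc[OF x] d[OF x]]
    by (rule entry[OF R[OF x x] minus_carrier_mat[OF Mc[OF x]] Rt])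
   also have "\<dots> = (\<Sum>l<n. (\<Sum>k<n. - (?R x $$ (i, k) * (M x $$ (k, l) - M t $$ (k, l)))) * ?R t $$ (l, j))"
    using Mc[OF x] Mc[OF t] by (intro sum.cong refl arg_cong2[where f = "(*)"]) (auto simp: algebra_simps)
   finally show ?thesis
    by (simp add: scaleR_sum_right sum_negf scaleR_conv_of_real sum_distrib_left sum_distrib_right mult_ac)
  qed
  then show "\<forall>\<^sub>F x in at t within S.
    - (\<Sum>l<n. (\<Sum>k<n. ?R x $$ (i, k) * ((M x $$ (k, l) - M t $$ (k, l)) /\<^sub>R (x - t))) * ?R t $$ (l, j))
    = (?R x $$ (i, j) - ?R t $$ (i, j)) /\<^sub>R (x - t)"
   by (auto simp: eventually_at_filter)
 qed
qed auto

text \<open>The matrix inverted in \<open>segment_inv\<close>: the point with parameter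
  \<open>s\<close> on the segment from the identity to \<open>M\<close>.\<close>

definition seg :: "complex Matrix.mat => real => complex Matrix.mat" where
 "seg M s = 1\<^sub>m (dim_row M) + complex_of_real s \<cdot>\<^sub>m (M - 1\<^sub>m (dim_row M))"

lemma seg_carrier: "M \<in> carrier_mat n n ==> seg M s \<in> carrier_mat n n"
 unfolding seg_def by (auto intro!: minus_carrier_mat)

lemma seg_index:
 "M \<in> carrier_mat n n ==> i < n ==> j < n ==>
  seg M s $$ (i, j) = (if i = j then 1 else 0) + complex_of_real s * (M $$ (i, j) - (if i = j then 1 else 0))"
 unfolding seg_def by (auto simp: minus_carrier_mat[OF one_carrier_mat])

lemma segment_inv_seg: "segment_inv M s = minv (seg M s)"
 by (simp add: segment_inv_def seg_def)

lemma seg_0: "M \<in> carrier_mat n n ==> seg M 0 = 1\<^sub>m n"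
 by (rule eq_matI) (use seg_carrier[of M n 0] in \<open>auto simp: seg_index\<close>)

lemma seg_1: "M \<in> carrier_mat n n ==> seg M 1 = M"
 by (rule eq_matI) (use seg_carrier[of M n 1] in \<open>auto simp: seg_index\<close>)

lemma mat_cont_seg:
 assumes M: "mat_cont S n M"
 shows "mat_cont (S \<times> UNIV) n (%(t, s). seg (M t) s)"
proof (rule mat_contI[where f = "%i j (t, s). (if i = j then 1 else 0) + complex_of_real s * (M t $$ (i, j) - (if i = j then 1 else 0))"])
 fix i j assume ij: "i < n" "j < n"
 have "continuous_on (S \<times> UNIV) (%x. M (fst x) $$ (i, j))"
  by (rule continuous_on_compose2[OF mat_contD(2)[OF M ij]]) (auto intro: continuous_intros)
 then show "continuous_on (S \<times> UNIV) (%(t, s). (if i = j then 1 else 0) + complex_of_real s * (M t $$ (i, j) - (if i = j then 1 else 0)))"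
  unfolding case_prod_unfold by (intro continuous_intros)
qed (use mat_contD(1)[OF M] in \<open>auto simp: seg_carrier seg_index[of _ n]\<close>)

lemma mat_der_seg_param:
 assumes M: "mat_der S n M M' t" and t: "t \<in> S"
 shows "mat_der S n (%t. seg (M t) s) (complex_of_real s \<cdot>\<^sub>m M') t"
proof (rule mat_derI[where f = "%i j t. (if i = j then 1 else 0) + complex_of_real s * (M t $$ (i, j) - (if i = j then 1 else 0))", OF _ _ t])
 fix i j assume ij: "i < n" "j < n"
 show "((%t. (if i = j then 1 else 0) + complex_of_real s * (M t $$ (i, j) - (if i = j then 1 else 0)))
   has_vector_derivative (complex_of_real s \<cdot>\<^sub>m M') $$ (i, j)) (at t within S)"
  by (rule has_vector_derivative_eq_rhs, (rule derivative_intros mat_derD(3)[OF M] ij)+)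
   (use ij mat_derD(2)[OF M] in auto)
qed (use mat_derD(1,2)[OF M] in \<open>auto simp: seg_carrier seg_index[of _ n]\<close>)

lemma mat_der_seg:
 assumes M: "M \<in> carrier_mat n n" and t: "t \<in> S"
 shows "mat_der S n (%s. seg M s) (M - 1\<^sub>m n) t"
proof (rule mat_derI[where f = "%i j s. (if i = j then 1 else 0) + complex_of_real s * (M $$ (i, j) - (if i = j then 1 else 0))", OF _ _ t])
 fix i j assume ij: "i < n" "j < n"
 show "((%s. (if i = j then 1 else 0) + complex_of_real s * (M $$ (i, j) - (if i = j then 1 else 0)))
   has_vector_derivative (M - 1\<^sub>m n) $$ (i, j)) (at t within S)"
  by (rule has_vector_derivative_eq_rhs, (rule derivative_intros)+) (use ij M in auto)
qed (use M in \<open>auto simp: seg_carrier seg_index[of _ n] intro!: minus_carrier_mat\<close>)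

text \<open>The last two equations are the inverse property expanded in \<open>s\<close>; they serve
  to trade a term with the factor \<open>s\<close> for one without it.\<close>

lemma seg_resolvent:
 assumes M: "M \<in> carrier_mat n n" and d: "Determinant.det (seg M s) \<noteq> 0"
 shows "segment_inv M s \<in> carrier_mat n n" "seg M s * segment_inv M s = 1\<^sub>m n" "segment_inv M s * seg M s = 1\<^sub>m n"
  and "segment_inv M s + complex_of_real s \<cdot>\<^sub>m ((M - 1\<^sub>m n) * segment_inv M s) = 1\<^sub>m n"
  and "segment_inv M s + complex_of_real s \<cdot>\<^sub>m (segment_inv M s * (M - 1\<^sub>m n)) = 1\<^sub>m n"
proof -
 show R: "segment_inv M s \<in> carrier_mat n n" "seg M s * segment_inv M s = 1\<^sub>m n" "segment_inv M s * seg M s = 1\<^sub>m n"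
  unfolding segment_inv_seg using minv[OF seg_carrier[OF M] d] by auto
 have X: "M - 1\<^sub>m n \<in> carrier_mat n n" by (rule minus_carrier_mat[OF one_carrier_mat])
 have seg: "seg M s = 1\<^sub>m n + complex_of_real s \<cdot>\<^sub>m (M - 1\<^sub>m n)" unfolding seg_def using M by simp
 show "segment_inv M s + complex_of_real s \<cdot>\<^sub>m ((M - 1\<^sub>m n) * segment_inv M s) = 1\<^sub>m n"
  using R(2) unfolding seg add_mult_distrib_mat[OF one_carrier_mat smult_carrier_mat[OF X] R(1)]
   mult_smult_assoc_mat[OF X R(1)] using R(1) by simp
 show "segment_inv M s + complex_of_real s \<cdot>\<^sub>m (segment_inv M s * (M - 1\<^sub>m n)) = 1\<^sub>m n"
  using R(3) unfolding seg mult_add_distrib_mat[OF R(1) one_carrier_mat smult_carrier_mat[OF X]]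
   mult_smult_distrib[OF R(1) X] using R(1) by simp
qed

lemma mat_log_index:
 assumes M: "M \<in> carrier_mat n n" and d: "!!s. s \<in> {0..1} ==> Determinant.det (seg M s) \<noteq> 0" and ij: "i < n" "j < n"
 shows "mat_log M $$ (i, j) = integral {0..1} (%s. ((M - 1\<^sub>m n) * segment_inv M s) $$ (i, j))"
proof -
 have X: "M - 1\<^sub>m n \<in> carrier_mat n n" by (rule minus_carrier_mat[OF one_carrier_mat])
 have "mat_cont {0..1} n (%s. seg M s)"
  by (rule mat_der_imp_cont[OF mat_der_seg[OF M]])
 from mat_cont_minv[OF this d] have c: "mat_cont {0..1} n (%s. segment_inv M s)" by (simp add: segment_inv_seg)
 have "mat_log M $$ (i, j) = (\<Sum>l<n. (M - 1\<^sub>m n) $$ (i, l) * integral {0..1} (%s. segment_inv M s $$ (l, j)))"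
  unfolding mat_log_def using M ij X by (subst mult_mat_index[of _ n n _ n]) auto
 also have "\<dots> = integral {0..1} (%s. \<Sum>l<n. (M - 1\<^sub>m n) $$ (i, l) * segment_inv M s $$ (l, j))"
  by (subst integral_sum) (use mat_contD(2)[OF c] ij in \<open>auto intro!: integrable_continuous_interval continuous_intros\<close>)
 also have "\<dots> = integral {0..1} (%s. ((M - 1\<^sub>m n) * segment_inv M s) $$ (i, j))"
  by (rule integral_cong) (simp only: mult_mat_index[OF X mat_contD(1)[OF c] ij])
 finally show ?thesis .
qed

text \<open>Back substitution: the last component solves a scalar equation with zero initial value,
  and once all components of larger index vanish, equation \<open>k\<close> is scalar as
  well.\<close>

lemma upper_triangular_ode:
 fixes y :: "nat => real => complex"
 assumes der: "!!k t. k < r ==> t \<in> {0..T} ==> (y k has_vector_derivative (\<Sum>l<r. B k l * y l t)) (at t within {0..T})"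
  and tri: "!!k l. l < k ==> k < r ==> B k l = 0"
  and y0: "!!k. i \<le> k ==> k < r ==> y k 0 = 0" and t: "t \<in> {0..T}" and k: "i \<le> k" "k < r"
 shows "y k t = 0"
 using t k
proof (induction "r - k" arbitrary: k t rule: less_induct)
 case less
 have sum: "(\<Sum>l<r. B k l * y l s) = B k k * y k s" if s: "s \<in> {0..T}" for s
 proof -
  have "(\<Sum>l<r. B k l * y l s) = (\<Sum>l<r. if l = k then B k k * y k s else 0)"
  proof (rule sum.cong[OF refl])
   fix l assume l: "l \<in> {..<r}"
   consider "l < k" | "l = k" | "l > k" by linarith
   then show "B k l * y l s = (if l = k then B k k * y k s else 0)"
   proof cases
    case 1 then show ?thesis using tri less.prems by simp
   next
    case 2 then show ?thesis by simp
   next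
    case 3 then show ?thesis using less.hyps[of l s] less.prems l s by simp
   qed
  qed
  then show ?thesis using less.prems by simp
 qed
 show ?case
  by (rule gronwall_zero[OF der[OF less.prems(3)], where L = "cmod (B k k)"])
   (use less.prems y0 sum in \<open>auto simp: norm_mult\<close>)
qed

lemma mat_der_mult_left:
 assumes M: "M \<in> carrier_mat n n" and N: "mat_der S n N N' t" and t: "t \<in> S"
 shows "mat_der S n (%x. M * N x) (M * N') t"
 using mat_der_mult[OF mat_der_const[OF M] N t] mat_derD(1)[OF N t] mat_derD(2)[OF N] M
 by (simp add: mult_carrier_mat[OF M])

lemma mat_der_mult_right:
 assumes M: "M \<in> carrier_mat n n" and N: "mat_der S n N N' t" and t: "t \<in> S"
 shows "mat_der S n (%x. N x * M) (N' * M) t"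
 using mat_der_mult[OF N mat_der_const[OF M] t] mat_derD(1)[OF N t] mat_derD(2)[OF N] M
 by (simp add: mult_carrier_mat[OF _ M])

section \<open>The logarithm of a solution of a linear system with real spectrum\<close>

context
 fixes r :: nat and A :: "complex Matrix.mat" and C :: "real => complex Matrix.mat" and T :: real
 assumes A: "A \<in> carrier_mat r r" and spec: "!!a. eigenvalue A a ==> a \<in> \<real>"
  and der: "!!t. t \<in> {0..T} ==> mat_der {0..T} r C (A * C t) t" and C0: "C 0 = 1\<^sub>m r" and T: "T \<ge> 0"
begin

lemma C_carrier: "t \<in> {0..T} ==> C t \<in> carrier_mat r r"
 using mat_derD(1)[OF der] by blast

lemma triangularization:
 obtains B P Q where "B \<in> carrier_mat r r" "P \<in> carrier_mat r r" "Q \<in> carrier_mat r r"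
  "P * Q = 1\<^sub>m r" "Q * P = 1\<^sub>m r" "A = P * B * Q" "upper_triangular B" "!!i. i < r ==> B $$ (i, i) \<in> \<real>"
proof -
 obtain es where es: "char_poly A = (\<Prod>a\<leftarrow>es. [:- a, 1:])" "length es = r"
  using char_poly_factorized[OF A] by blast
 obtain B P Q where BPQ: "schur_decomposition A es = (B, P, Q)" by (cases "schur_decomposition A es")
 note s = schur_decomposition[OF A es(1) BPQ]
 have sim: "similar_mat_wit A B P Q" using s by blast
 note w = similar_mat_witD2[OF A sim]
 have real: "B $$ (i, i) \<in> \<real>" if i: "i < r" for i
 proof -
  have "diag_mat B ! i = B $$ (i, i)" using i w(5) by (simp add: diag_mat_def)
  then have "B $$ (i, i) = es ! i" using s by simp
  then have "B $$ (i, i) \<in> set es" using i es(2) by simp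
  then have "poly (char_poly A) (B $$ (i, i)) = 0" unfolding es(1) by (rule linear_poly_root)
  then show ?thesis using spec eigenvalue_root_char_poly[OF A] by blast
 qed
 show ?thesis by (rule that[OF w(5,6,7) w(1,2) w(3)]) (use s real in auto)
qed

lemma conj_ode:
 assumes B: "B \<in> carrier_mat r r" "P \<in> carrier_mat r r" "Q \<in> carrier_mat r r" "Q * P = 1\<^sub>m r" "A = P * B * Q"
  and Y: "!!t. t \<in> {0..T} ==> mat_der {0..T} r Y (A * Y t) t" and t: "t \<in> {0..T}" and k: "k < r" "j < r"
 shows "((%t. (Q * Y t * P) $$ (k, j)) has_vector_derivative (\<Sum>l<r. B $$ (k, l) * (Q * Y t * P) $$ (l, j))) (at t within {0..T})"
proof -
 note Yt = mat_derD(1)[OF Y[OF t] t]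
 note as = assoc_mult_mat[of _ r r _ r _ r] mult_carrier_mat[of _ r r _ r]
 have QP: "Q * (P * X) = X" if "X \<in> carrier_mat r r" for X
  using assoc_mult_mat[OF B(3,2) that] B(4) that by simp
 have "Q * (A * Y t) * P = B * (Q * Y t * P)"
  unfolding B(5) using B Yt by (simp add: as QP)
 then have "mat_der {0..T} r (%t. Q * Y t * P) (B * (Q * Y t * P)) t"
  using mat_der_mult_right[OF B(2) mat_der_mult_left[OF B(3) Y[OF t] t] t] by simp
 from mat_derD(3)[OF this k] show ?thesis
  by (subst (asm) mult_mat_index[OF B(1) _ k]) (use B Yt in \<open>auto simp: as\<close>)
qed

text \<open>The commutator \<open>A * C t - C t * A\<close> solves the same linear equation with
  initial value 0. In a Schur basis the system is triangular, so \<open>upper_triangular_ode\<close>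
  makes it vanish.\<close>

lemma commutes:
 assumes t: "t \<in> {0..T}"
 shows "A * C t = C t * A"
proof -
 note as = assoc_mult_mat[of _ r r _ r _ r] mult_carrier_mat[of _ r r _ r]
 define E where "E t = A * C t - C t * A" for t
 have E: "mat_der {0..T} r E (A * E t) t" if t: "t \<in> {0..T}" for t
 proof -
  note Ct = C_carrier[OF t]
  have "mat_der {0..T} r E (A * (A * C t) - A * C t * A) t"
   unfolding E_def
   by (rule mat_der_minus[OF mat_der_mult_left[OF A der[OF t] t] mat_der_mult_right[OF A der[OF t] t] t])
  also have "A * (A * C t) - A * C t * A = A * E t"
   unfolding E_def mult_minus_distrib_mat[OF A mult_carrier_mat[OF A Ct] mult_carrier_mat[OF Ct A]]
   using assoc_mult_mat[OF A Ct A] by simp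
  finally show ?thesis .
 qed
 obtain B P Q where B: "B \<in> carrier_mat r r" "P \<in> carrier_mat r r" "Q \<in> carrier_mat r r"
  "P * Q = 1\<^sub>m r" "Q * P = 1\<^sub>m r" "A = P * B * Q" "upper_triangular B"
  using triangularization by metis
 have Et: "E t \<in> carrier_mat r r" using mat_derD(1)[OF E[OF t] t] .
 have "0 \<in> {0..T}" using T by simp
 have E0: "E 0 = 0\<^sub>m r r" unfolding E_def C0 using A by auto
 have "Q * E t * P = 0\<^sub>m r r"
 proof (rule eq_matI)
  fix k j assume "k < dim_row (0\<^sub>m r r :: complex Matrix.mat)" "j < dim_col (0\<^sub>m r r :: complex Matrix.mat)"
  then have k: "k < r" "j < r" by auto
  have "(Q * E t * P) $$ (k, j) = 0"
  proof (rule upper_triangular_ode[where y = "%k t. (Q * E t * P) $$ (k, j)" and i = 0 and B = "%k l. B $$ (k, l)", OF _ _ _ t _ k(1)])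
   show "(Q * E 0 * P) $$ (k, j) = 0" if "k < r" for k
    unfolding E0 using B that k by simp
  qed (use conj_ode[OF B(1,2,3,5,6) E _ _ k(2)] upper_triangularD[OF B(7)] B(1) in auto)
  then show "(Q * E t * P) $$ (k, j) = 0\<^sub>m r r $$ (k, j)" using k by simp
 qed (use B Et in auto)
 moreover have "P * (Q * X) = X" if "X \<in> carrier_mat r r" for X
  using assoc_mult_mat[OF B(2,3) that] B(4) that by simp
 then have "P * (Q * E t * P) * Q = E t" using B Et by (simp add: as)
 ultimately have 0: "E t = 0\<^sub>m r r" using B by simp
 show ?thesis
 proof (rule eq_matI)
  fix i j assume "i < dim_row (C t * A)" "j < dim_col (C t * A)"
  then have ij: "i < r" "j < r" using C_carrier[OF t] A by auto
  have "(A * C t) $$ (i, j) - (C t * A) $$ (i, j) = E t $$ (i, j)"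
   unfolding E_def using ij C_carrier[OF t] A by (simp del: index_mult_mat(1))
  then show "(A * C t) $$ (i, j) = (C t * A) $$ (i, j)" unfolding 0 using ij by simp
 qed (use C_carrier[OF t] A in auto)
qed

text \<open>In a Schur basis of \<open>A\<close> the matrix \<open>C t\<close> is upper triangular
  with diagonal entries \<open>exp (t * b)\<close>, \<open>b\<close> real. The segment then has the
  diagonal entries \<open>1 - s + s * exp (t * b)\<close>, which are positive.\<close>

lemma det_segment:
 assumes t: "t \<in> {0..T}" and s: "s \<in> {0..1}"
 shows "Determinant.det (seg (C t) s) \<noteq> 0"
proof -
 obtain B P Q where B: "B \<in> carrier_mat r r" "P \<in> carrier_mat r r" "Q \<in> carrier_mat r r"
  "P * Q = 1\<^sub>m r" "Q * P = 1\<^sub>m r" "A = P * B * Q" "upper_triangular B" and Breal: "!!i. i < r ==> B $$ (i, i) \<in> \<real>"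
  using triangularization by metis
 note as = assoc_mult_mat[of _ r r _ r _ r] mult_carrier_mat[of _ r r _ r]
 define Z where "Z t = Q * C t * P" for t
 have Zc: "Z t \<in> carrier_mat r r" if "t \<in> {0..T}" for t unfolding Z_def using B C_carrier[OF that] by simp
 have Z0: "Z 0 $$ (i, j) = (if i = j then 1 else 0)" if "i < r" "j < r" for i j
  unfolding Z_def C0 using B that by simp
 have Zder: "((%t. Z t $$ (k, j)) has_vector_derivative (\<Sum>l<r. B $$ (k, l) * Z t $$ (l, j))) (at t within {0..T})"
  if "t \<in> {0..T}" "k < r" "j < r" for t k j
  unfolding Z_def by (rule conj_ode[OF B(1,2,3,5,6) der that])
 have tri: "B $$ (k, l) = 0" if "l < k" "k < r" for k l using upper_triangularD[OF B(7) that(1)] that B(1) by simp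
 \<comment> \<open>Initially column \<open>j\<close> is zero below the diagonal, and the triangular
   system keeps it so; hence the start index \<open>Suc j\<close>.\<close>
 have low: "Z t $$ (k, j) = 0" if t: "t \<in> {0..T}" and k: "j < k" "k < r" for t k j
  by (rule upper_triangular_ode[where y = "%k t. Z t $$ (k, j)" and i = "Suc j" and B = "%k l. B $$ (k, l)" and r = r, OF _ _ _ t])
   (use Zder tri Z0 k in auto)
 have diag: "Z t $$ (k, k) = exp (of_real t * B $$ (k, k))" if t: "t \<in> {0..T}" and k: "k < r" for t k
 proof -
  have sum: "(\<Sum>l<r. B $$ (k, l) * Z s $$ (l, k)) = B $$ (k, k) * Z s $$ (k, k)" if s: "s \<in> {0..T}" for s
  proof -
   have "(\<Sum>l<r. B $$ (k, l) * Z s $$ (l, k)) = (\<Sum>l<r. if l = k then B $$ (k, k) * Z s $$ (k, k) else 0)"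
   proof (rule sum.cong[OF refl])
    fix l assume "l \<in> {..<r}"
    then show "B $$ (k, l) * Z s $$ (l, k) = (if l = k then B $$ (k, k) * Z s $$ (k, k) else 0)"
     using tri[of l k] low[OF s, of k l] k by (cases l k rule: linorder_cases) auto
   qed
   then show ?thesis using k by simp
  qed
  have "Z t $$ (k, k) - exp (of_real t * B $$ (k, k)) = 0"
  proof (rule gronwall_zero[where y = "%s. Z s $$ (k, k) - exp (of_real s * B $$ (k, k))" and L = "cmod (B $$ (k, k))", OF _ _ _ t])
   fix s assume s: "s \<in> {0..T}"
   have e: "((%s. exp (of_real s * B $$ (k, k))) has_vector_derivative B $$ (k, k) * exp (of_real s * B $$ (k, k))) (at s within {0..T})"
    by (rule has_vector_derivative_real_field) (auto intro!: derivative_eq_intros)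
   show "((%s. Z s $$ (k, k) - exp (of_real s * B $$ (k, k))) has_vector_derivative
     B $$ (k, k) * Z s $$ (k, k) - B $$ (k, k) * exp (of_real s * B $$ (k, k))) (at s within {0..T})"
    using has_vector_derivative_diff[OF Zder[OF s k k] e] unfolding sum[OF s] .
   show "cmod (B $$ (k, k) * Z s $$ (k, k) - B $$ (k, k) * exp (of_real s * B $$ (k, k)))
     \<le> cmod (B $$ (k, k)) * cmod (Z s $$ (k, k) - exp (of_real s * B $$ (k, k)))"
    by (simp add: norm_mult flip: right_diff_distrib)
  qed (use Z0 k in auto)
  then show ?thesis by simp
 qed
 note Ct = C_carrier[OF t]
 let ?s = "complex_of_real s"
 define M where "M = 1\<^sub>m r + ?s \<cdot>\<^sub>m (Z t - 1\<^sub>m r)"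
 have Mc: "M \<in> carrier_mat r r" unfolding M_def by (intro add_carrier_mat smult_carrier_mat minus_carrier_mat one_carrier_mat)
 have X: "C t - 1\<^sub>m r \<in> carrier_mat r r" by (rule minus_carrier_mat[OF one_carrier_mat])
 have seg: "seg (C t) s = 1\<^sub>m r + ?s \<cdot>\<^sub>m (C t - 1\<^sub>m r)" unfolding seg_def using Ct by simp
 have "Q * seg (C t) s = Q + ?s \<cdot>\<^sub>m (Q * C t - Q)"
  unfolding seg using B X Ct
  by (simp add: mult_add_distrib_mat[of _ r r _ r] mult_smult_distrib[of _ r r _ r] mult_minus_distrib_mat[of _ r r _ r])
 also have "\<dots> * P = Q * P + ?s \<cdot>\<^sub>m (Q * C t * P - Q * P)"
  using B X Ct minus_carrier_mat[of Q r r "Q * C t"]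
  by (simp add: add_mult_distrib_mat[of _ r r _ _ r] mult_smult_assoc_mat[of _ r r _ r] minus_mult_distrib_mat[of _ r r _ _ r] as(2))
 finally have QMP: "Q * seg (C t) s * P = M" unfolding M_def Z_def using B by simp
 have "upper_triangular M"
 proof (rule upper_triangularI)
  fix i j assume ij: "j < i" "i < dim_row M"
  then have "i < r" "j < r" using Mc by auto
  then show "M $$ (i, j) = 0" unfolding M_def using low[OF t ij(1)] Zc[OF t] ij by simp
 qed
 then have "Determinant.det M = prod_list (diag_mat M)" using Mc by (rule det_upper_triangular)
 moreover have "0 \<notin> set (diag_mat M)"
 proof
  assume "0 \<in> set (diag_mat M)"
  then obtain k where k: "k < r" "M $$ (k, k) = 0" using Mc by (auto simp: diag_mat_def)
  obtain b where b: "B $$ (k, k) = of_real b" using Breal[OF k(1)] by (auto elim: Reals_cases)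
  have "M $$ (k, k) = 1 + ?s * (exp (of_real t * of_real b) - 1)"
   unfolding M_def using k Zc[OF t] diag[OF t k(1)] b by simp
  also have "\<dots> = of_real (1 + s * (exp (t * b) - 1))" unfolding of_real_mult[symmetric] exp_of_real by simp
  finally have z: "(1 - s) + s * exp (t * b) = 0" using k(2) by (simp add: algebra_simps del: of_real_add of_real_mult of_real_diff)
  moreover have "0 \<le> s * exp (t * b)" "0 \<le> 1 - s" using s by auto
  ultimately have "s = 1" by linarith
  then show False using z by simp
 qed
 ultimately have "Determinant.det M \<noteq> 0" by simp
 then show ?thesis
  unfolding QMP[symmetric] using det_mult[of "Q * seg (C t) s" r P] det_mult[of Q r "seg (C t) s"] B X seg by auto
qed

lemma segment_inv_commute:
 assumes t: "t \<in> {0..T}" and s: "s \<in> {0..1}"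
 shows "segment_inv (C t) s * (A * C t) = A * C t * segment_inv (C t) s"
proof -
 note Ct = C_carrier[OF t] and R = seg_resolvent[OF C_carrier[OF t] det_segment[OF t s]]
 note as = assoc_mult_mat[of _ r r _ r _ r] mult_carrier_mat[of _ r r _ r]
 define N where "N = A * C t"
 have N: "N \<in> carrier_mat r r" using A Ct by (simp add: N_def)
 have X: "C t - 1\<^sub>m r \<in> carrier_mat r r" by (rule minus_carrier_mat[OF one_carrier_mat])
 have seg: "seg (C t) s = 1\<^sub>m r + complex_of_real s \<cdot>\<^sub>m (C t - 1\<^sub>m r)" unfolding seg_def using Ct by simp
 have CN: "C t * N = N * C t" unfolding N_def using commutes[OF t] assoc_mult_mat[OF Ct A Ct] by simp
 have "N * seg (C t) s = seg (C t) s * N"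
  unfolding seg using N X Ct CN
  by (simp add: mult_add_distrib_mat[of _ r r _ r] add_mult_distrib_mat[of _ r r _ _ r] mult_smult_distrib[of _ r r _ r]
   mult_smult_assoc_mat[of _ r r _ r] mult_minus_distrib_mat[of _ r r _ r] minus_mult_distrib_mat[of _ r r _ _ r])
 then have "segment_inv (C t) s * (N * seg (C t) s) * segment_inv (C t) s
   = segment_inv (C t) s * (seg (C t) s * N) * segment_inv (C t) s" by simp
 moreover have "segment_inv (C t) s * (N * seg (C t) s) * segment_inv (C t) s = segment_inv (C t) s * N"
  using N R(1,2) seg_carrier[OF Ct] by (simp add: as)
 moreover have "segment_inv (C t) s * (seg (C t) s * N) * segment_inv (C t) s = N * segment_inv (C t) s"
  using assoc_mult_mat[OF R(1) seg_carrier[OF Ct] N, of s] R(3) N by simp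
 ultimately show ?thesis unfolding N_def by simp
qed

text \<open>An antiderivative is \<open>A * C t\<close> times \<open>s\<close> times the resolvent.
  It vanishes at \<open>s = 0\<close>, and at \<open>s = 1\<close> the resolvent is the inverse of
  \<open>C t\<close>, which leaves \<open>A\<close>.\<close>

lemma integral_resolvent_square:
 assumes t: "t \<in> {0..T}" and ij: "i < r" "j < r"
 shows "((%s. (segment_inv (C t) s * (A * C t) * segment_inv (C t) s) $$ (i, j)) has_integral A $$ (i, j)) {0..1}"
proof -
 note Ct = C_carrier[OF t] and R = seg_resolvent[OF C_carrier[OF t] det_segment[OF t]]
 note as = assoc_mult_mat[of _ r r _ r _ r] mult_carrier_mat[of _ r r _ r]
 let ?R = "segment_inv (C t)" and ?X = "C t - 1\<^sub>m r"
 have N: "A * C t \<in> carrier_mat r r" using A Ct by simp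
 have X: "?X \<in> carrier_mat r r" by (rule minus_carrier_mat[OF one_carrier_mat])
 have cont: "mat_cont {0..1} r (%s. seg (C t) s)" by (rule mat_der_imp_cont[OF mat_der_seg[OF Ct]])
 define G where "G s = A * C t * (complex_of_real s \<cdot>\<^sub>m ?R s)" for s
 have G: "mat_der {0..1} r G (?R s * (A * C t) * ?R s) s" if s: "s \<in> {0..1}" for s
 proof -
  note Rs = R[OF s]
  have RXR: "?R s * ?X * ?R s \<in> carrier_mat r r" using Rs(1) X by simp
  have "mat_der {0..1} r ?R (0\<^sub>m r r - ?R s * ?X * ?R s) s"
   using mat_der_minv[OF mat_der_seg[OF Ct s] cont s det_segment[OF t]] by (simp add: segment_inv_seg[abs_def])
  from mat_der_mult_left[OF N mat_der_smult[OF this has_vector_derivative_of_real[OF DERIV_ident] s] s]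
  have "mat_der {0..1} r G (A * C t * (1 \<cdot>\<^sub>m ?R s + complex_of_real s \<cdot>\<^sub>m (0\<^sub>m r r - ?R s * ?X * ?R s))) s"
   by (simp only: G_def[abs_def] of_real_1)
  also have "1 \<cdot>\<^sub>m ?R s + complex_of_real s \<cdot>\<^sub>m (0\<^sub>m r r - ?R s * ?X * ?R s) = ?R s * ?R s"
  proof (rule eq_matI)
   fix i j assume "i < dim_row (?R s * ?R s)" "j < dim_col (?R s * ?R s)"
   then have ij: "i < r" "j < r" using Rs(1) by auto
   \<comment> \<open>The equation \<open>R + s R X = 1\<close>, multiplied by \<open>R\<close>,
     identifies the derivative of \<open>s R\<close> with the square of \<open>R\<close>.\<close>
   have "(?R s + complex_of_real s \<cdot>\<^sub>m (?R s * ?X)) * ?R s = ?R s" using Rs(5,1) by simp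
   moreover have "(?R s + complex_of_real s \<cdot>\<^sub>m (?R s * ?X)) * ?R s = ?R s * ?R s + complex_of_real s \<cdot>\<^sub>m (?R s * ?X * ?R s)"
    using Rs(1) X by (simp add: add_mult_distrib_mat[of _ r r _ _ r] mult_smult_assoc_mat[of _ r r _ r] as(2))
   ultimately have "(?R s * ?R s + complex_of_real s \<cdot>\<^sub>m (?R s * ?X * ?R s)) $$ (i, j) = ?R s $$ (i, j)" by simp
   then show "(1 \<cdot>\<^sub>m ?R s + complex_of_real s \<cdot>\<^sub>m (0\<^sub>m r r - ?R s * ?X * ?R s)) $$ (i, j) = (?R s * ?R s) $$ (i, j)"
    using ij Rs(1) RXR by (auto simp: algebra_simps simp del: index_mult_mat(1))
  qed (use Rs(1) RXR in auto)
  also have "A * C t * (?R s * ?R s) = ?R s * (A * C t) * ?R s"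
   unfolding segment_inv_commute[OF t s] using assoc_mult_mat[OF N Rs(1) Rs(1)] by simp
  finally show ?thesis .
 qed
 have "((%s. (?R s * (A * C t) * ?R s) $$ (i, j)) has_integral G 1 $$ (i, j) - G 0 $$ (i, j)) {0..1}"
  by (rule fundamental_theorem_of_calculus) (use mat_derD(3)[OF G ij] in auto)
 moreover have "G 0 = 0\<^sub>m r r"
  unfolding G_def using N R(1)[of 0] by (auto intro!: eq_matI simp: scalar_prod_def)
 moreover have "G 1 = A"
 proof -
  have "1 \<cdot>\<^sub>m ?R 1 = ?R 1" by (rule eq_matI) auto
  then show ?thesis unfolding G_def using R(1,2)[of 1] A Ct by (simp add: seg_1 as)
 qed
 ultimately show ?thesis using ij by simp
qed

text \<open>With \<open>R\<^sub>s\<close> the resolvent on the segment, the derivative of \<open>log (C t)\<close> is the integral of \<open>R\<^sub>s A C R\<^sub>s\<close>; this is \<open>A\<close>,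
since \<open>A C\<close> commutes with \<open>R\<^sub>s\<close> and \<open>s R\<^sub>s\<close> has derivative \<open>R\<^sub>s\<^sup>2\<close>.\<close>

lemma mat_log_flow: "mat_log (C T) = complex_of_real T \<cdot>\<^sub>m A"
proof (rule eq_matI)
 have TT: "T \<in> {0..T}" "0 \<in> {0..T}" using T by auto
 show "dim_row (mat_log (C T)) = dim_row (complex_of_real T \<cdot>\<^sub>m A)" "dim_col (mat_log (C T)) = dim_col (complex_of_real T \<cdot>\<^sub>m A)"
  using C_carrier[OF TT(1)] A by (auto simp: mat_log_def)
 fix i j assume "i < dim_row (complex_of_real T \<cdot>\<^sub>m A)" "j < dim_col (complex_of_real T \<cdot>\<^sub>m A)"
 then have ij: "i < r" "j < r" using A by auto
 have X: "C t - 1\<^sub>m r \<in> carrier_mat r r" for t by (rule minus_carrier_mat[OF one_carrier_mat])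
 have Ccont: "mat_cont {0..T} r C" by (rule mat_der_imp_cont[OF der])
 have segcont: "mat_cont ({0..T} \<times> {0..1}) r (%(t, s). seg (C t) s)"
  by (rule mat_cont_subset[OF mat_cont_seg[OF Ccont]]) auto
 have Rcont: "mat_cont ({0..T} \<times> {0..1}) r (%x. segment_inv (C (fst x)) (snd x))"
  using mat_cont_minv[OF segcont] det_segment by (auto simp: segment_inv_seg case_prod_unfold)
 have Ncont: "mat_cont ({0..T} \<times> {0..1}) r (%x. A * C (fst x))"
  by (rule mat_cont_mult[OF mat_cont_const[OF A] mat_cont_compose[OF Ccont]]) (auto intro: continuous_intros)
 have Xcont: "mat_cont ({0..T} \<times> {0..1}) r (%x. C (fst x) - 1\<^sub>m r)"
  by (rule mat_cont_minus[OF mat_cont_compose[OF Ccont] mat_cont_const]) (auto intro: continuous_intros)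
 define F where "F t s = (C t - 1\<^sub>m r) * segment_inv (C t) s" for t s
 define F' where "F' t s = segment_inv (C t) s * (A * C t) * segment_inv (C t) s" for t s
 have F: "mat_der {0..T} r (%t. F t s) (F' t s) t" if t: "t \<in> {0..T}" and s: "s \<in> {0..1}" for t s
 proof -
  note Ct = C_carrier[OF t] and R = seg_resolvent[OF C_carrier[OF t] det_segment[OF t s]]
  let ?R = "segment_inv (C t) s" and ?N = "A * C t" and ?s = "complex_of_real s"
  have N: "?N \<in> carrier_mat r r" using A Ct by simp
  have NR: "?N * ?R \<in> carrier_mat r r" using N R(1) by auto
  have "mat_cont {0..T} r (%t. seg (C t) s)"
   by (rule mat_der_imp_cont[OF mat_der_seg_param[OF der]])
  from mat_der_minv[OF mat_der_seg_param[OF der[OF t] t] this t det_segment[OF _ s]]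
  have "mat_der {0..T} r (%t. segment_inv (C t) s) (0\<^sub>m r r - ?R * (?s \<cdot>\<^sub>m ?N) * ?R) t"
   by (simp add: segment_inv_seg)
  moreover have "mat_der {0..T} r (%t. C t - 1\<^sub>m r) ?N t"
  proof -
   have "?N - 0\<^sub>m r r = ?N" by (rule eq_matI) (use N A Ct in \<open>auto simp del: index_mult_mat(1)\<close>)
   then show ?thesis using mat_der_minus[OF der[OF t] mat_der_const[OF one_carrier_mat] t] by simp
  qed
  ultimately have "mat_der {0..T} r (%t. F t s) (?N * ?R + (C t - 1\<^sub>m r) * (0\<^sub>m r r - ?R * (?s \<cdot>\<^sub>m ?N) * ?R)) t"
   unfolding F_def by (intro mat_der_mult[OF _ _ t])
  also have "?N * ?R + (C t - 1\<^sub>m r) * (0\<^sub>m r r - ?R * (?s \<cdot>\<^sub>m ?N) * ?R) = F' t s"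
  proof (rule eq_matI)
   have RNR: "?R * ?N * ?R \<in> carrier_mat r r" "?R * (?s \<cdot>\<^sub>m ?N) * ?R \<in> carrier_mat r r" using R(1) N by auto
   have XRNR: "(C t - 1\<^sub>m r) * (?R * ?N * ?R) \<in> carrier_mat r r" by (rule mult_carrier_mat[OF X RNR(1)])
   fix i j assume "i < dim_row (F' t s)" "j < dim_col (F' t s)"
   then have ij: "i < r" "j < r" using R(1) by (auto simp: F'_def)
   have "?R * (?s \<cdot>\<^sub>m ?N) * ?R = ?s \<cdot>\<^sub>m (?R * ?N * ?R)"
    using R(1) N by (simp add: mult_smult_distrib[of _ r r _ r] mult_smult_assoc_mat[of _ r r _ r])
   then have "(C t - 1\<^sub>m r) * (0\<^sub>m r r - ?R * (?s \<cdot>\<^sub>m ?N) * ?R) = (C t - 1\<^sub>m r) * (0\<^sub>m r r - ?s \<cdot>\<^sub>m (?R * ?N * ?R))" by simp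
   also have "\<dots> = 0\<^sub>m r r - ?s \<cdot>\<^sub>m ((C t - 1\<^sub>m r) * (?R * ?N * ?R))"
    using RNR X[of t] mult_minus_distrib_mat[OF X[of t] zero_carrier_mat[of r r] smult_carrier_mat[OF RNR(1)]]
    by (simp add: mult_smult_distrib[of _ r r _ r])
   finally have 1: "(?N * ?R + (C t - 1\<^sub>m r) * (0\<^sub>m r r - ?R * (?s \<cdot>\<^sub>m ?N) * ?R)) $$ (i, j)
     = (?N * ?R) $$ (i, j) - ?s * ((C t - 1\<^sub>m r) * (?R * ?N * ?R)) $$ (i, j)"
    using ij NR XRNR X[of t] by (auto simp del: index_mult_mat(1))
   \<comment> \<open>The two terms of the product rule combine because
     \<open>R + s (C - 1) R\<close> is the identity.\<close>
   have "(?R + ?s \<cdot>\<^sub>m ((C t - 1\<^sub>m r) * ?R)) * (?N * ?R) = ?N * ?R"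
    unfolding R(4) by (rule left_mult_one_mat[OF NR])
   moreover have "(?R + ?s \<cdot>\<^sub>m ((C t - 1\<^sub>m r) * ?R)) * (?N * ?R) = ?R * ?N * ?R + ?s \<cdot>\<^sub>m ((C t - 1\<^sub>m r) * (?R * ?N * ?R))"
    using R(1) N X[of t]
    by (simp add: add_mult_distrib_mat[of _ r r _ _ r] mult_smult_assoc_mat[of _ r r _ r] assoc_mult_mat[of _ r r _ r _ r])
   ultimately have "(?R * ?N * ?R + ?s \<cdot>\<^sub>m ((C t - 1\<^sub>m r) * (?R * ?N * ?R))) $$ (i, j) = (?N * ?R) $$ (i, j)" by simp
   then show "(?N * ?R + (C t - 1\<^sub>m r) * (0\<^sub>m r r - ?R * (?s \<cdot>\<^sub>m ?N) * ?R)) $$ (i, j) = F' t s $$ (i, j)"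
    unfolding 1 F'_def using ij RNR XRNR by (auto simp: algebra_simps simp del: index_mult_mat(1))
  qed (use R(1) N X[of t] in \<open>auto simp: F'_def\<close>)
  finally show ?thesis .
 qed
 have F'cont: "mat_cont ({0..T} \<times> {0..1}) r (%x. F' (fst x) (snd x))"
  unfolding F'_def by (intro mat_cont_mult Rcont Ncont)
 have Fcont: "mat_cont ({0..T} \<times> {0..1}) r (%x. F (fst x) (snd x))"
  unfolding F_def by (intro mat_cont_mult Rcont Xcont)
 define L where "L t = integral {0..1} (%s. F t s $$ (i, j))" for t
 have Ld: "(L has_vector_derivative A $$ (i, j)) (at t within {0..T})" if t: "t \<in> {0..T}" for t
 proof -
  have "(L has_vector_derivative integral (cbox 0 1) (%s. F' t s $$ (i, j))) (at t within {0..T})"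
   unfolding L_def box_real(2)[symmetric]
  proof (rule leibniz_rule_vector_derivative)
   fix t s assume "t \<in> cbox 0 T" "s \<in> cbox (0::real) 1"
   then show "((%t. F t s $$ (i, j)) has_vector_derivative F' t s $$ (i, j)) (at t within cbox 0 T)"
    using mat_derD(3)[OF F ij] by simp
  next
   fix t assume t: "t \<in> cbox 0 T"
   have "continuous_on {0..1} (%s. F (fst (t, s)) (snd (t, s)) $$ (i, j))"
    by (rule continuous_on_compose2[OF mat_contD(2)[OF Fcont ij], of _ "%s. (t, s)"]) (use t in \<open>auto intro!: continuous_intros\<close>)
   then show "(%s. F t s $$ (i, j)) integrable_on cbox 0 1" by (simp add: integrable_continuous_interval)
  qed (use mat_contD(2)[OF F'cont ij] t in \<open>auto simp: case_prod_unfold\<close>)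
  moreover have "integral (cbox 0 1) (%s. F' t s $$ (i, j)) = A $$ (i, j)"
   unfolding F'_def box_real using integral_resolvent_square[OF t ij] by (rule integral_unique)
  ultimately show ?thesis by simp
 qed
 \<comment> \<open>The difference has zero derivative and zero initial value: Gronwall's lemma with
   constant 0.\<close>
 have "L T - of_real T * A $$ (i, j) = 0"
 proof (rule gronwall_zero[where y = "%t. L t - of_real t * A $$ (i, j)" and L = 0, OF _ _ _ TT(1)])
  fix t assume t: "t \<in> {0..T}"
  show "((%t. L t - of_real t * A $$ (i, j)) has_vector_derivative 0) (at t within {0..T})"
   by (rule has_vector_derivative_eq_rhs, (rule derivative_intros Ld[OF t])+) simp
  show "norm (0::complex) \<le> 0 * norm (L t - of_real t * A $$ (i, j))" by simp
 next
  have "F 0 s $$ (i, j) = 0" if s: "s \<in> {0..1}" for s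
  proof -
   have "F 0 s = 0\<^sub>m r r * segment_inv (C 0) s"
    unfolding F_def C0 by (rule arg_cong2[where f = "(*)"]) (auto intro!: eq_matI)
   also have "\<dots> = 0\<^sub>m r r" using seg_resolvent(1)[OF C_carrier[OF TT(2)] det_segment[OF TT(2) s]] by simp
   finally show ?thesis using ij by simp
  qed
  then have "L 0 = integral {0..1::real} (%s. 0)" unfolding L_def by (intro integral_cong) auto
  then show "L 0 - of_real 0 * A $$ (i, j) = 0" by simp
 qed
 moreover have "mat_log (C T) $$ (i, j) = L T"
  unfolding L_def F_def by (rule mat_log_index[OF C_carrier[OF TT(1)] det_segment[OF TT(1)] ij])
 ultimately show "mat_log (C T) $$ (i, j) = (complex_of_real T \<cdot>\<^sub>m A) $$ (i, j)" using ij A by simp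
qed

end

subsection \<open>Perturbation of the logarithm\<close>

lemma mat_minus_index:
 "(M :: complex Matrix.mat) \<in> carrier_mat n n ==> N \<in> carrier_mat n n ==> i < n ==> j < n ==>
  (M - N) $$ (i, j) = M $$ (i, j) - N $$ (i, j)"
 by auto

lemma mat_add_smult_index:
 "(M :: complex Matrix.mat) \<in> carrier_mat n n ==> N \<in> carrier_mat n n ==> i < n ==> j < n ==>
  (M + c \<cdot>\<^sub>m N) $$ (i, j) = M $$ (i, j) + c * N $$ (i, j)"
 by auto

text \<open>The supremum in \<open>B_const\<close> bounds its members only if they form a bounded
  set; here the entries of the resolvent are continuous on a compact interval.\<close>

lemma op_norm_segment_inv_le_B_const:
 assumes C: "C \<in> carrier_mat r r" and d: "!!s. s \<in> {0..1} ==> Determinant.det (seg C s) \<noteq> 0" and s: "s \<in> {0..1}"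
 shows "op_norm (segment_inv C s) \<le> B_const C"
proof -
 have "mat_cont {0..1} r (%s. seg C s)" by (rule mat_der_imp_cont[OF mat_der_seg[OF C]])
 from mat_cont_minv[OF this d] have c: "mat_cont {0..1} r (segment_inv C)" by (simp add: segment_inv_seg[abs_def])
 have "continuous_on {0..1} (%s. \<Sum>i<r. \<Sum>j<r. cmod (segment_inv C s $$ (i, j)))"
  by (intro continuous_intros mat_contD(2)[OF c]) auto
 then have "\<exists>x\<in>{0..1}. \<forall>s\<in>{0..1}. (\<Sum>i<r. \<Sum>j<r. cmod (segment_inv C s $$ (i, j)))
   \<le> (\<Sum>i<r. \<Sum>j<r. cmod (segment_inv C x $$ (i, j)))"
  by (rule continuous_attains_sup[OF compact_Icc, rotated]) simp
 then obtain b where b: "!!s. s \<in> {0..1} ==> (\<Sum>i<r. \<Sum>j<r. cmod (segment_inv C s $$ (i, j))) \<le> b"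
  by blast
 have "op_norm (segment_inv C t) \<le> b" if t: "t \<in> {0..1}" for t
 proof (rule op_norm_leI[OF mat_contD(1)[OF c t]])
  show "b \<ge> 0" by (rule order_trans[OF _ b[OF t]]) (simp add: sum_nonneg)
  fix v :: "complex Matrix.vec" assume v: "v \<in> carrier_vec r"
  have "vec_l2 (segment_inv C t *\<^sub>v v) \<le> (\<Sum>i<r. \<Sum>j<r. cmod (segment_inv C t $$ (i, j))) * vec_l2 v"
   by (rule mult_mat_vec_bounded[OF mat_contD(1)[OF c t] v])
  also have "\<dots> \<le> b * vec_l2 v" by (intro mult_right_mono b t vec_l2_nonneg)
  finally show "vec_l2 (segment_inv C t *\<^sub>v v) \<le> b * vec_l2 v" .
 qed
 then have "bdd_above ((%t. op_norm (segment_inv C t)) ` {0..1})" by (intro bdd_aboveI2)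
 then show ?thesis unfolding B_const_def by (rule cSUP_upper2[OF _ s order_refl])
qed

text \<open>At \<open>s = 0\<close> the resolvent is the identity. The bound is there to make
  \<open>B_const\<close> positive in later divisions.\<close>

lemma B_const_ge_1:
 assumes C: "C \<in> carrier_mat r r" and d: "!!s. s \<in> {0..1} ==> Determinant.det (seg C s) \<noteq> 0" and r: "r > 0"
 shows "B_const C \<ge> 1"
proof -
 have z: "(0::real) \<in> {0..1}" by simp
 note R = seg_resolvent[OF C d[OF z]]
 have "segment_inv C 0 = 1\<^sub>m r" using R(2) R(1) by (simp add: seg_0[OF C])
 moreover have u: "unit_vec r 0 \<in> carrier_vec r" by simp
 have "vec_l2 (unit_vec r 0) = 1"
  unfolding vec_l2_def using r by (simp add: unit_vec_def if_distrib[of cmod] if_distrib[of "%x. x\<^sup>2"] cong: if_cong)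
 then have "1 \<le> op_norm (1\<^sub>m r)" using op_norm_le[OF one_carrier_mat u] u by simp
 ultimately show ?thesis using op_norm_segment_inv_le_B_const[OF C d z] by simp
qed

lemma segment_inv_bound:
 assumes C: "C \<in> carrier_mat r r" and d: "!!s. s \<in> {0..1} ==> Determinant.det (seg C s) \<noteq> 0" and s: "s \<in> {0..1}"
  and v: "v \<in> carrier_vec r"
 shows "vec_l2 (segment_inv C s *\<^sub>v v) \<le> B_const C * vec_l2 v"
 using op_norm_le[OF seg_resolvent(1)[OF C d[OF s]] v]
  mult_right_mono[OF op_norm_segment_inv_le_B_const[OF C d s] vec_l2_nonneg, of v] by simp

text \<open>At parameter \<open>s\<close> the segments to \<open>C\<close> and \<open>H\<close>
  differ by \<open>s * (C - H)\<close>. The lower bound \<open>1 / B_const C\<close> for the first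
  loses at most \<open>(1 - \<gamma>) / B_const C\<close>.\<close>

lemma seg_lower_bound:
 assumes C: "C \<in> carrier_mat r r" and d: "!!s. s \<in> {0..1} ==> Determinant.det (seg C s) \<noteq> 0" and r: "r > 0"
  and H: "H \<in> carrier_mat r r" and le: "op_norm (C - H) < (1 - \<gamma>) * inverse (B_const C)"
  and s: "s \<in> {0..1}" and v: "v \<in> carrier_vec r"
 shows "\<gamma> / B_const C * vec_l2 v \<le> vec_l2 (seg H s *\<^sub>v v)"
proof -
 define B where "B = B_const C"
 have B: "B > 0" using B_const_ge_1[OF C d r] by (simp add: B_def)
 note R = seg_resolvent[OF C d[OF s]] and segc = seg_carrier[OF C, of s] seg_carrier[OF H, of s]
 have D: "C - H \<in> carrier_mat r r" by (rule minus_carrier_mat[OF H])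
 have "segment_inv C s *\<^sub>v (seg C s *\<^sub>v v) = v"
  using assoc_mult_mat_vec[OF R(1) segc(1) v] R(3) v by simp
 then have "vec_l2 v \<le> B * vec_l2 (seg C s *\<^sub>v v)"
  using segment_inv_bound[OF C d s, of "seg C s *\<^sub>v v"] segc v by (simp add: B_def)
 then have 1: "vec_l2 v / B \<le> vec_l2 (seg C s *\<^sub>v v)" using B by (simp add: field_simps)
 have "seg C s *\<^sub>v v = seg H s *\<^sub>v v + complex_of_real s \<cdot>\<^sub>v ((C - H) *\<^sub>v v)"
 proof (rule eq_vecI)
  fix i assume "i < dim_vec (seg H s *\<^sub>v v + complex_of_real s \<cdot>\<^sub>v ((C - H) *\<^sub>v v))"
  then have i: "i < r" using carrier_matD(1)[OF D] by simp
  have "(\<Sum>j<r. seg C s $$ (i, j) * vec_index v j)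
    = (\<Sum>j<r. seg H s $$ (i, j) * vec_index v j) + complex_of_real s * (\<Sum>j<r. (C - H) $$ (i, j) * vec_index v j)"
   unfolding sum_distrib_left sum.distrib[symmetric]
  proof (rule sum.cong[OF refl])
   fix j assume "j \<in> {..<r}"
   then have "seg C s $$ (i, j) = seg H s $$ (i, j) + complex_of_real s * (C - H) $$ (i, j)"
    using i C H by (simp add: seg_index[of _ r] algebra_simps)
   then show "seg C s $$ (i, j) * vec_index v j
     = seg H s $$ (i, j) * vec_index v j + complex_of_real s * ((C - H) $$ (i, j) * vec_index v j)"
    by (simp add: algebra_simps)
  qed
  then show "vec_index (seg C s *\<^sub>v v) i = vec_index (seg H s *\<^sub>v v + complex_of_real s \<cdot>\<^sub>v ((C - H) *\<^sub>v v)) i"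
   unfolding mult_mat_vec_index[OF segc(1) v i, symmetric] mult_mat_vec_index[OF segc(2) v i, symmetric]
    mult_mat_vec_index[OF D v i, symmetric]
   using i carrier_matD(1)[OF D] by (simp del: index_mult_mat_vec index_minus_mat)
 qed (use segc D in auto)
 then have "vec_l2 (seg C s *\<^sub>v v) \<le> vec_l2 (seg H s *\<^sub>v v) + s * vec_l2 ((C - H) *\<^sub>v v)"
  using vec_l2_add[of "seg H s *\<^sub>v v" r "complex_of_real s \<cdot>\<^sub>v ((C - H) *\<^sub>v v)"] segc D v s by (simp add: vec_l2_smult)
 also have "s * vec_l2 ((C - H) *\<^sub>v v) \<le> 1 * (op_norm (C - H) * vec_l2 v)"
  using s by (intro mult_mono op_norm_le[OF D v] vec_l2_nonneg) auto
 also have "\<dots> \<le> (1 - \<gamma>) / B * vec_l2 v"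
  using le by (auto simp: B_def divide_inverse intro!: mult_right_mono vec_l2_nonneg)
 finally have "vec_l2 v / B - (1 - \<gamma>) / B * vec_l2 v \<le> vec_l2 (seg H s *\<^sub>v v)" using 1 by linarith
 then show ?thesis by (simp add: B_def[symmetric] diff_divide_distrib algebra_simps)
qed

text \<open>So the integrand of \<open>mat_log H\<close> consists of genuine inverses, and the
  logarithm of the perturbed matrix is defined.\<close>

lemma det_seg_perturb:
 assumes C: "C \<in> carrier_mat r r" and d: "!!s. s \<in> {0..1} ==> Determinant.det (seg C s) \<noteq> 0" and r: "r > 0"
  and H: "H \<in> carrier_mat r r" and le: "op_norm (C - H) < (1 - \<gamma>) * inverse (B_const C)" and \<gamma>: "\<gamma> > 0"
  and s: "s \<in> {0..1}"
 shows "Determinant.det (seg H s) \<noteq> 0"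
proof (rule det_nonzeroI[OF seg_carrier[OF H]])
 have B: "B_const C > 0" using B_const_ge_1[OF C d r] by simp
 fix v assume v: "v \<in> carrier_vec r" and z: "seg H s *\<^sub>v v = 0\<^sub>v r"
 have "\<gamma> / B_const C * vec_l2 v \<le> 0"
  using seg_lower_bound[OF C d r H le s v] by (simp add: z vec_l2_zero)
 then have "vec_l2 v \<le> 0" using B \<gamma> by (simp add: mult_le_0_iff divide_le_0_iff)
 then show "v = 0\<^sub>v r" using vec_l2_nonneg[of v] vec_l2_eq_0[OF v] by simp
qed

text \<open>A resolvent identity: each resolvent satisfies \<open>R + s X R = 1\<close>, and
  inserting the identity for one matrix next to the resolvent of the other leaves only
  \<open>H - C\<close> between the two resolvents.\<close>

lemma resolvent_difference:
 assumes C: "C \<in> carrier_mat r r" "Determinant.det (seg C s) \<noteq> 0" and H: "H \<in> carrier_mat r r" "Determinant.det (seg H s) \<noteq> 0"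
  and ij: "i < r" "j < r"
 shows "((H - 1\<^sub>m r) * segment_inv H s) $$ (i, j) - ((C - 1\<^sub>m r) * segment_inv C s) $$ (i, j)
   = (segment_inv C s * (H - C) * segment_inv H s) $$ (i, j)"
proof -
 note R = seg_resolvent[OF C] and Q = seg_resolvent[OF H]
 have X: "C - 1\<^sub>m r \<in> carrier_mat r r" and Y: "H - 1\<^sub>m r \<in> carrier_mat r r"
  by (rule minus_carrier_mat[OF one_carrier_mat])+
 have D: "H - C \<in> carrier_mat r r" by (rule minus_carrier_mat[OF C(1)])
 have YQ: "(H - 1\<^sub>m r) * segment_inv H s \<in> carrier_mat r r" and RX: "segment_inv C s * (C - 1\<^sub>m r) \<in> carrier_mat r r"
  using X Y R(1) Q(1) by auto
 have RYQ: "segment_inv C s * ((H - 1\<^sub>m r) * segment_inv H s) \<in> carrier_mat r r"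
  "segment_inv C s * (C - 1\<^sub>m r) * segment_inv H s \<in> carrier_mat r r"
  "segment_inv C s * (C - 1\<^sub>m r) * ((H - 1\<^sub>m r) * segment_inv H s) \<in> carrier_mat r r"
  using YQ RX R(1) Q(1) by auto
 let ?s = "complex_of_real s"
 have HC: "H - C = (H - 1\<^sub>m r) - (C - 1\<^sub>m r)" by (rule eq_matI) (use H C X in auto)
 \<comment> \<open>Commutation is read off from the two expansions of the identity by cancelling
   \<open>s\<close>. At \<open>s = 0\<close> this is impossible, but there the resolvent is the
   identity.\<close>
 have XR: "(C - 1\<^sub>m r) * segment_inv C s = segment_inv C s * (C - 1\<^sub>m r)"
 proof (cases "s = 0")
  case True
  then have "segment_inv C s = 1\<^sub>m r" using R(2) R(1) by (simp add: seg_0[OF C(1)])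
  then show ?thesis using X by simp
 next
  case False
  show ?thesis
  proof (rule eq_matI)
   fix i j assume "i < dim_row (segment_inv C s * (C - 1\<^sub>m r))" "j < dim_col (segment_inv C s * (C - 1\<^sub>m r))"
   then have ij: "i < r" "j < r" using R(1) X by auto
   have XR: "(C - 1\<^sub>m r) * segment_inv C s \<in> carrier_mat r r" using X R(1) by auto
   have "(segment_inv C s + ?s \<cdot>\<^sub>m ((C - 1\<^sub>m r) * segment_inv C s)) $$ (i, j)
     = (segment_inv C s + ?s \<cdot>\<^sub>m (segment_inv C s * (C - 1\<^sub>m r))) $$ (i, j)" unfolding R(4,5) ..
   then show "((C - 1\<^sub>m r) * segment_inv C s) $$ (i, j) = (segment_inv C s * (C - 1\<^sub>m r)) $$ (i, j)"
    unfolding mat_add_smult_index[OF R(1) XR ij] mat_add_smult_index[OF R(1) RX ij] using False by simp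
  qed (use R(1) X in auto)
 qed
 have 1: "(segment_inv C s * (H - C) * segment_inv H s) $$ (i, j)
   = (segment_inv C s * ((H - 1\<^sub>m r) * segment_inv H s)) $$ (i, j) - (segment_inv C s * (C - 1\<^sub>m r) * segment_inv H s) $$ (i, j)"
  unfolding HC mult_minus_distrib_mat[OF R(1) Y X] minus_mult_distrib_mat[OF mult_carrier_mat[OF R(1) Y] RX Q(1)]
   assoc_mult_mat[OF R(1) Y Q(1)]
  by (rule mat_minus_index[OF RYQ(1,2) ij])
 have "(segment_inv C s + ?s \<cdot>\<^sub>m (segment_inv C s * (C - 1\<^sub>m r))) * ((H - 1\<^sub>m r) * segment_inv H s) = (H - 1\<^sub>m r) * segment_inv H s"
  unfolding R(5) by (rule left_mult_one_mat[OF YQ])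
 moreover have "(segment_inv C s + ?s \<cdot>\<^sub>m (segment_inv C s * (C - 1\<^sub>m r))) * ((H - 1\<^sub>m r) * segment_inv H s)
   = segment_inv C s * ((H - 1\<^sub>m r) * segment_inv H s) + ?s \<cdot>\<^sub>m (segment_inv C s * (C - 1\<^sub>m r) * ((H - 1\<^sub>m r) * segment_inv H s))"
  unfolding add_mult_distrib_mat[OF R(1) smult_carrier_mat[OF RX] YQ] mult_smult_assoc_mat[OF RX YQ] ..
 ultimately have 2: "((H - 1\<^sub>m r) * segment_inv H s) $$ (i, j) = (segment_inv C s * ((H - 1\<^sub>m r) * segment_inv H s)) $$ (i, j)
   + ?s * (segment_inv C s * (C - 1\<^sub>m r) * ((H - 1\<^sub>m r) * segment_inv H s)) $$ (i, j)"
  using mat_add_smult_index[OF RYQ(1,3) ij, of ?s] by simp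
 have "segment_inv C s * (C - 1\<^sub>m r) * (segment_inv H s + ?s \<cdot>\<^sub>m ((H - 1\<^sub>m r) * segment_inv H s)) = segment_inv C s * (C - 1\<^sub>m r)"
  unfolding Q(4) by (rule right_mult_one_mat[OF RX])
 moreover have "segment_inv C s * (C - 1\<^sub>m r) * (segment_inv H s + ?s \<cdot>\<^sub>m ((H - 1\<^sub>m r) * segment_inv H s))
   = segment_inv C s * (C - 1\<^sub>m r) * segment_inv H s + ?s \<cdot>\<^sub>m (segment_inv C s * (C - 1\<^sub>m r) * ((H - 1\<^sub>m r) * segment_inv H s))"
  unfolding mult_add_distrib_mat[OF RX Q(1) smult_carrier_mat[OF YQ]] mult_smult_distrib[OF RX YQ] ..
 ultimately have 3: "(segment_inv C s * (C - 1\<^sub>m r)) $$ (i, j) = (segment_inv C s * (C - 1\<^sub>m r) * segment_inv H s) $$ (i, j)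
   + ?s * (segment_inv C s * (C - 1\<^sub>m r) * ((H - 1\<^sub>m r) * segment_inv H s)) $$ (i, j)"
  using mat_add_smult_index[OF RYQ(2,3) ij, of ?s] by simp
 show ?thesis unfolding 1 2 XR 3 by simp
qed

text \<open>Pairing with \<open>y\<close> makes the integral scalar, so that the integrand can be
  estimated by norms. The resolvent of \<open>C\<close> contributes \<open>B_const C\<close>, that
  of \<open>H\<close> contributes \<open>B_const C / \<gamma>\<close> by
  \<open>seg_lower_bound\<close>.\<close>

lemma mat_log_perturb:
 assumes C: "C \<in> carrier_mat r r" and d: "!!s. s \<in> {0..1} ==> Determinant.det (seg C s) \<noteq> 0" and r: "r > 0"
  and H: "H \<in> carrier_mat r r" and le: "op_norm (C - H) < (1 - \<gamma>) * inverse (B_const C)" and \<gamma>: "\<gamma> > 0"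
  and x: "x \<in> carrier_vec r" and y: "y \<in> carrier_vec r"
 shows "cmod (hip y ((mat_log H - mat_log C) *\<^sub>v x)) \<le> (B_const C)\<^sup>2 / \<gamma> * op_norm (C - H) * vec_l2 x * vec_l2 y"
proof -
 have dH: "Determinant.det (seg H s) \<noteq> 0" if "s \<in> {0..1}" for s by (rule det_seg_perturb[OF C d r H le \<gamma> that])
 define B where "B = B_const C"
 have B: "B > 0" using B_const_ge_1[OF C d r] by (simp add: B_def)
 have D: "C - H \<in> carrier_mat r r" "H - C \<in> carrier_mat r r"
  by (rule minus_carrier_mat[OF H], rule minus_carrier_mat[OF C])
 define G where "G s = segment_inv C s * (H - C) * segment_inv H s" for s
 have G: "G s \<in> carrier_mat r r" if "s \<in> {0..1}" for s
  unfolding G_def using seg_resolvent(1)[OF C d[OF that]] seg_resolvent(1)[OF H dH[OF that]] D by auto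
 have cont: "mat_cont {0..1} r (segment_inv M)" if "M \<in> carrier_mat r r" "!!s. s \<in> {0..1} ==> Determinant.det (seg M s) \<noteq> 0" for M
  unfolding segment_inv_seg[abs_def] by (rule mat_cont_minv[OF mat_der_imp_cont[OF mat_der_seg[OF that(1)]] that(2)])
 have Gc: "mat_cont {0..1} r G"
  unfolding G_def[abs_def] by (intro mat_cont_mult cont mat_cont_const C H d dH D)
 have L: "mat_log M \<in> carrier_mat r r" if "M \<in> carrier_mat r r" for M
  using that minus_carrier_mat[OF one_carrier_mat, of M r] by (auto simp: mat_log_def)
 have Xc: "mat_cont {0..1} r (%s. (M - 1\<^sub>m r) * segment_inv M s)"
  if "M \<in> carrier_mat r r" "!!s. s \<in> {0..1} ==> Determinant.det (seg M s) \<noteq> 0" for M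
  by (intro mat_cont_mult cont mat_cont_const minus_carrier_mat one_carrier_mat that)
 have entry: "(mat_log H - mat_log C) $$ (i, j) = integral {0..1} (%s. G s $$ (i, j))" if ij: "i < r" "j < r" for i j
 proof -
  have logs: "mat_log H $$ (i, j) = integral {0..1} (%s. ((H - 1\<^sub>m r) * segment_inv H s) $$ (i, j))"
   "mat_log C $$ (i, j) = integral {0..1} (%s. ((C - 1\<^sub>m r) * segment_inv C s) $$ (i, j))"
   by (rule mat_log_index[OF H _ ij], erule dH, rule mat_log_index[OF C _ ij], erule d)
  have "(mat_log H - mat_log C) $$ (i, j) = mat_log H $$ (i, j) - mat_log C $$ (i, j)" using L[OF H] L[OF C] ij by simp
  also have "\<dots> = integral {0..1} (%s. ((H - 1\<^sub>m r) * segment_inv H s) $$ (i, j) - ((C - 1\<^sub>m r) * segment_inv C s) $$ (i, j))"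
   unfolding logs by (rule Henstock_Kurzweil_Integration.integral_diff[symmetric]; rule integrable_continuous_interval; rule mat_contD(2)[OF Xc])
    (use C H d dH ij in auto)
  also have "\<dots> = integral {0..1} (%s. G s $$ (i, j))"
   unfolding G_def by (rule integral_cong) (rule resolvent_difference[OF C d H dH ij])
  finally show ?thesis .
 qed
 have int: "(%s. G s $$ (i, j)) integrable_on {0..1}" if "i < r" "j < r" for i j
  by (rule integrable_continuous_interval[OF mat_contD(2)[OF Gc that]])
 have LL: "mat_log H - mat_log C \<in> carrier_mat r r" by (rule minus_carrier_mat[OF L[OF C]])
 have hip: "hip y (M *\<^sub>v x) = (\<Sum>i<r. \<Sum>j<r. cnj (vec_index y i) * (M $$ (i, j) * vec_index x j))" if M: "M \<in> carrier_mat r r" for M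
 proof -
  have "dim_vec (M *\<^sub>v x) = r" using M by simp
  then show ?thesis
   unfolding hip_def by (auto simp: mult_mat_vec_index[OF M x] sum_distrib_left simp del: index_mult_mat_vec intro!: sum.cong)
 qed
 have "((%s. \<Sum>i<r. \<Sum>j<r. cnj (vec_index y i) * (G s $$ (i, j) * vec_index x j)) has_integral
   (\<Sum>i<r. \<Sum>j<r. cnj (vec_index y i) * (integral {0..1} (%s. G s $$ (i, j)) * vec_index x j))) {0..1}"
  by (intro has_integral_sum finite_lessThan has_integral_mult_right has_integral_mult_left integrable_integral int) auto
 moreover have "hip y ((mat_log H - mat_log C) *\<^sub>v x)
   = (\<Sum>i<r. \<Sum>j<r. cnj (vec_index y i) * (integral {0..1} (%s. G s $$ (i, j)) * vec_index x j))"
  unfolding hip[OF LL] by (intro sum.cong refl) (simp add: entry)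
 ultimately have "hip y ((mat_log H - mat_log C) *\<^sub>v x)
   = integral {0..1} (%s. \<Sum>i<r. \<Sum>j<r. cnj (vec_index y i) * (G s $$ (i, j) * vec_index x j))"
  by (simp only: integral_unique)
 also have "\<dots> = integral {0..1} (%s. hip y (G s *\<^sub>v x))"
  by (rule integral_cong) (simp only: hip[OF G])
 finally have eq: "hip y ((mat_log H - mat_log C) *\<^sub>v x) = integral {0..1} (%s. hip y (G s *\<^sub>v x))" .
 have ci: "continuous_on {0..1} (%s. hip y (G s *\<^sub>v x))"
 proof -
  have "continuous_on {0..1} (%s. \<Sum>i<r. \<Sum>j<r. cnj (vec_index y i) * (G s $$ (i, j) * vec_index x j))"
   by (intro continuous_intros mat_contD(2)[OF Gc]) auto
  then show ?thesis by (rule continuous_on_eq) (simp only: hip[OF G])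
 qed
 have bound: "cmod (hip y (G s *\<^sub>v x)) \<le> B\<^sup>2 / \<gamma> * op_norm (C - H) * vec_l2 x * vec_l2 y" if s: "s \<in> {0..1}" for s
 proof -
  note R = seg_resolvent[OF C d[OF s]] and Q = seg_resolvent[OF H dH[OF s]]
  define w where "w = segment_inv H s *\<^sub>v x"
  have w: "w \<in> carrier_vec r" unfolding w_def using Q(1) x by auto
  have "seg H s *\<^sub>v w = x" unfolding w_def
   using assoc_mult_mat_vec[OF seg_carrier[OF H] Q(1) x, of s] Q(2) x by simp
  then have "\<gamma> / B * vec_l2 w \<le> vec_l2 x" using seg_lower_bound[OF C d r H le s w] by (simp add: B_def)
  then have wle: "vec_l2 w \<le> B / \<gamma> * vec_l2 x" using B \<gamma> by (simp add: field_simps)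
  have Dw: "(H - C) *\<^sub>v w = - 1 \<cdot>\<^sub>v ((C - H) *\<^sub>v w)"
   unfolding minus_mult_distrib_mat_vec[OF C H w] minus_mult_distrib_mat_vec[OF H C w]
   by (rule eq_vecI) (use C H in \<open>auto simp del: index_mult_mat_vec\<close>)
  have "vec_l2 ((H - C) *\<^sub>v w) \<le> op_norm (C - H) * (B / \<gamma> * vec_l2 x)"
   unfolding Dw vec_l2_smult using op_norm_le[OF D(1) w] mult_left_mono[OF wle op_norm_nonneg[OF D(1)]] by simp
  moreover have "vec_l2 (G s *\<^sub>v x) \<le> B * vec_l2 ((H - C) *\<^sub>v w)"
  proof -
   have "G s *\<^sub>v x = segment_inv C s *\<^sub>v ((H - C) *\<^sub>v w)"
    unfolding G_def w_def using R(1) Q(1) D x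
    by (simp add: assoc_mult_mat_vec[of _ r r _ r])
   then show ?thesis using segment_inv_bound[OF C d s, of "(H - C) *\<^sub>v w"] D w by (simp add: B_def)
  qed
  ultimately have "vec_l2 (G s *\<^sub>v x) \<le> B * (op_norm (C - H) * (B / \<gamma> * vec_l2 x))"
   using B by (meson mult_left_mono order_trans less_imp_le)
  then have "vec_l2 y * vec_l2 (G s *\<^sub>v x) \<le> vec_l2 y * (B * (op_norm (C - H) * (B / \<gamma> * vec_l2 x)))"
   by (rule mult_left_mono[OF _ vec_l2_nonneg])
  then show ?thesis
   using hip_le[OF y, of "G s *\<^sub>v x"] G[OF s] x by (simp add: power2_eq_square mult_ac)
 qed
 have "cmod (integral {0..1} (%s. hip y (G s *\<^sub>v x))) \<le> integral {0..1::real} (%s. B\<^sup>2 / \<gamma> * op_norm (C - H) * vec_l2 x * vec_l2 y)"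
  by (rule Henstock_Kurzweil_Integration.integral_norm_bound_integral)
   (use ci bound in \<open>auto intro!: integrable_continuous_interval\<close>)
 then show ?thesis unfolding eq by (simp add: B_def)
qed

section \<open>Estimates\<close>

subsection \<open>The gauge and truncated Taylor expansions\<close>

context
 fixes K0 :: "(complex ^ 'd) set"
 assumes K0: "compact K0" "absolutely_convex K0" "0 \<in> interior K0"
begin

lemma gauge_set_one: "v \<in> K0 ==> 1 \<in> {t. t > 0 \<and> v \<in> (*\<^sub>R) t ` K0}"
 by force

lemma gauge_norm_nonneg: "v \<in> K0 ==> 0 \<le> gauge_norm K0 v"
 unfolding gauge_norm_def by (rule cInf_greatest) (use gauge_set_one in \<open>blast, auto\<close>)

lemma gauge_norm_le_1: "v \<in> K0 ==> gauge_norm K0 v \<le> 1"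
 unfolding gauge_norm_def using gauge_set_one by (intro cInf_lower bdd_belowI[of _ 0]) auto

lemma gauge_norm_lessE:
 assumes v: "v \<in> K0" and t: "gauge_norm K0 v < t"
 obtains x where "x \<in> K0" "v = t *\<^sub>R x"
proof -
 have "{t. t > 0 \<and> v \<in> (*\<^sub>R) t ` K0} \<noteq> {}" using gauge_set_one[OF v] by blast
 from cInf_lessD[OF this t[unfolded gauge_norm_def]] obtain s x where
  s: "0 < s" "s < t" "x \<in> K0" "v = s *\<^sub>R x" by auto
 show ?thesis
 proof (rule that[of "(s / t) *\<^sub>R x"])
  show "(s / t) *\<^sub>R x \<in> K0" using s by (intro K0_scaleR[OF K0]) auto
  show "v = t *\<^sub>R (s / t) *\<^sub>R x" using s by simp
 qed
qed

lemma SUP_gauge_norm: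
 assumes S: "S \<subseteq> K0" "S \<noteq> {}"
 shows "0 \<le> (SUP v\<in>S. gauge_norm K0 v)" "(SUP v\<in>S. gauge_norm K0 v) \<le> 1"
  "v \<in> S ==> gauge_norm K0 v \<le> (SUP v\<in>S. gauge_norm K0 v)"
proof -
 have bdd: "bdd_above (gauge_norm K0 ` S)" using gauge_norm_le_1 S by (intro bdd_aboveI2[of _ _ 1]) auto
 show up: "gauge_norm K0 v \<le> (SUP v\<in>S. gauge_norm K0 v)" if "v \<in> S" for v by (rule cSUP_upper[OF that bdd])
 obtain v where v: "v \<in> S" using S by blast
 show "0 \<le> (SUP v\<in>S. gauge_norm K0 v)" using order_trans[OF gauge_norm_nonneg up[OF v]] v S by auto
 show "(SUP v\<in>S. gauge_norm K0 v) \<le> 1" using gauge_norm_le_1 S by (intro cSUP_least) auto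
qed

text \<open>The infimum in the gauge is approached by parameters \<open>t > R\<close>, for which the
  bound is proved before \<open>t\<close> tends to \<open>R\<close>. Analyticity on the dilate by
  \<open>\<rho> > 1\<close> keeps the geometric factor bounded even for
  \<open>R = 1\<close>.\<close>

lemma taylor_gauge:
 fixes h :: "complex ^ 'd => complex"
 assumes \<alpha>: "mi_numbering \<alpha>" and U: "open U" and h: "hol_on h U" and \<rho>: "\<rho> > 1" "!!x. x \<in> K0 ==> p + \<rho> *\<^sub>R x \<in> U"
  and M: "M \<ge> 0" "!!x. x \<in> K0 ==> cmod (h (p + \<rho> *\<^sub>R x) * exp_fun (- p) (p + \<rho> *\<^sub>R x)) \<le> M"
  and E: "!!z. z \<in> (+) p ` K0 ==> cmod (exp_fun p z) \<le> E"
  and v: "v \<in> K0" "gauge_norm K0 v \<le> R" and R: "R \<le> 1"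
 shows "cmod (h (p + v) - (\<Sum>i<rE TYPE('d) n. nu \<alpha> p i h * u_fun \<alpha> p i (p + v)))
   \<le> E * (M * ((1 + \<rho>) / (\<rho> - 1))) * R ^ n"
proof -
 let ?X = "cmod (h (p + v) - (\<Sum>i<rE TYPE('d) n. nu \<alpha> p i h * u_fun \<alpha> p i (p + v)))"
 have R0: "R \<ge> 0" using gauge_norm_nonneg[OF v(1)] v(2) by linarith
 have Ev: "cmod (exp_fun p (p + v)) \<le> E" using E v(1) by blast
 then have E0: "E \<ge> 0" by (rule order_trans[OF norm_ge_zero])
 \<comment> \<open>The cap \<open>(1 + \<rho>) / 2\<close> on \<open>t\<close> gives
   \<open>\<sigma> - 1 > (\<rho> - 1) / (1 + \<rho>)\<close>, the origin of the constant in the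
   statement.\<close>
 have le: "?X \<le> E * (M * ((1 + \<rho>) / (\<rho> - 1))) * t ^ n" if t: "R < t" "t < (1 + \<rho>) / 2" for t
 proof -
  obtain x where x: "x \<in> K0" "v = t *\<^sub>R x" using gauge_norm_lessE[OF v(1), of t] v(2) t by auto
  define \<sigma> where "\<sigma> = \<rho> / t"
  have t0: "t > 0" using R0 t by simp
  have \<sigma>: "\<sigma> > 2 * \<rho> / (1 + \<rho>)" unfolding \<sigma>_def using mult_strict_left_mono[OF t(2), of \<rho>] t0 \<rho>(1) by (simp add: field_simps)
  have "2 * \<rho> / (1 + \<rho>) > 1" using \<rho>(1) by (simp add: field_simps)
  then have \<sigma>1: "\<sigma> > 1" using \<sigma> by simp
  have \<sigma>2: "\<sigma> - 1 > (\<rho> - 1) / (1 + \<rho>)" using \<sigma> \<rho>(1) by (simp add: field_simps)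
  have vx: "v = (\<rho> / \<sigma>) *\<^sub>R x" using x(2) \<rho>(1) t0 by (simp add: \<sigma>_def)
  have "?X \<le> cmod (exp_fun p (p + v)) * (M / \<sigma> ^ Suc n * (\<sigma> / (\<sigma> - 1)))"
   by (rule taylor_dilate[OF K0 \<alpha> U h \<rho>(2) M(2) vx x(1) \<sigma>1]) (use \<rho> in auto)
  \<comment> \<open>The numerator of the geometric factor lowers the exponent from
    \<open>n + 1\<close> to \<open>n\<close>.\<close>
  also have "M / \<sigma> ^ Suc n * (\<sigma> / (\<sigma> - 1)) = M * (1 / \<sigma>) ^ n * (1 / (\<sigma> - 1))"
   using \<sigma>1 by (simp add: power_one_over field_simps)
  also have "cmod (exp_fun p (p + v)) * (M * (1 / \<sigma>) ^ n * (1 / (\<sigma> - 1))) \<le> E * (M * t ^ n * ((1 + \<rho>) / (\<rho> - 1)))"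
  proof (intro mult_mono Ev power_mono order_refl M E0)
   show "1 / \<sigma> \<le> t" unfolding \<sigma>_def using \<rho>(1) t0 by (simp add: field_simps)
   show "1 / (\<sigma> - 1) \<le> (1 + \<rho>) / (\<rho> - 1)"
    using \<sigma>2 \<sigma>1 \<rho>(1) by (simp add: field_simps)
  qed (use M t0 \<sigma>1 in auto)
  finally show ?thesis by (simp add: mult_ac)
 qed
 have lt: "R < (1 + \<rho>) / 2" using R \<rho> by simp
 have "((%t. E * (M * ((1 + \<rho>) / (\<rho> - 1))) * t ^ n) \<longlongrightarrow> E * (M * ((1 + \<rho>) / (\<rho> - 1))) * R ^ n) (at_right R)"
  by (intro tendsto_intros)
 moreover have "eventually (%t. ?X \<le> E * (M * ((1 + \<rho>) / (\<rho> - 1))) * t ^ n) (at_right R)"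
  unfolding eventually_at_right[OF lt] using lt le by blast
 ultimately show ?thesis by (rule tendsto_lowerbound) simp
qed

end

subsection \<open>Bounds for the basis functions\<close>

text \<open>The last factor is the square root of the exponential series in the squared norm of
  \<open>z - p\<close>, summed over all multi-indices. Hence the norm of the vector of basis
  functions is bounded independently of the degree.\<close>

definition u_bound :: "complex ^ 'd => complex ^ 'd => real" where
 "u_bound p z = exp (- (norm p)\<^sup>2 / 2) * cmod (exp_fun p z) * exp ((norm (z - p))\<^sup>2 / 2)"

lemma u_bound_nonneg: "u_bound p z \<ge> 0"
 by (simp add: u_bound_def)

lemma continuous_on_u_bound: "continuous_on S (u_bound p)"
proof -
 have "continuous_on S (exp_fun p)" by (rule hol_on_continuous_on) (simp add: hol_on_iff_hol_at hol_at_exp_fun)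
 then show ?thesis unfolding u_bound_def[abs_def] by (intro continuous_intros) auto
qed

lemma u_bound_compact:
 assumes "compact S"
 obtains B where "B \<ge> 0" "!!z. z \<in> S ==> u_bound p z \<le> B"
proof -
 have "bounded (u_bound p ` S)"
  by (rule compact_imp_bounded[OF compact_continuous_image[OF continuous_on_u_bound assms]])
 then obtain B where "!!z. z \<in> S ==> norm (u_bound p z) \<le> B" unfolding bounded_iff by blast
 then show ?thesis by (intro that[of "max B 0"]) (auto intro: max.coboundedI1 abs_le_D1)
qed

text \<open>Extending the sum from multi-indices of bounded degree to a box makes it a product of
  truncated exponential series, one for each coordinate.\<close>

lemma u_fun_sum_le:
 fixes p :: "complex ^ 'd"
 assumes \<alpha>: "mi_numbering (\<alpha> :: nat => 'd => nat)"
 shows "(\<Sum>i<rE TYPE('d) m. (cmod (u_fun \<alpha> p i z))\<^sup>2) \<le> (u_bound p z)\<^sup>2"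
proof -
 let ?I = "{..<rE TYPE('d) m}"
 define x where "x k = (cmod ((z - p) $ k))\<^sup>2" for k
 define F where "F a = (\<Prod>k\<in>UNIV. x k ^ a k / fact (a k))" for a :: "'d => nat"
 define c where "c = (exp (- (norm p)\<^sup>2 / 2) * cmod (exp_fun p z))\<^sup>2"
 have x0: "x k \<ge> 0" for k by (simp add: x_def)
 have F0: "F a \<ge> 0" for a unfolding F_def by (intro prod_nonneg) (auto simp: x0)
 have u: "(cmod (u_fun \<alpha> p i z))\<^sup>2 = c * F (\<alpha> i)" for i
 proof -
  have "(cmod (mi_power (z - p) (\<alpha> i)))\<^sup>2 = (\<Prod>k\<in>UNIV. x k ^ \<alpha> i k)"
   unfolding mi_power_def x_def by (simp add: norm_mult norm_power prod_norm[symmetric] prod_power_distrib mult.commute flip: power_mult)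
  moreover have "F (\<alpha> i) = (\<Prod>k\<in>UNIV. x k ^ \<alpha> i k) / real (mi_fact (\<alpha> i))"
   unfolding F_def mi_fact_def by (simp add: prod_dividef)
  ultimately show ?thesis
   unfolding u_fun_def c_def using mi_fact_pos[of "\<alpha> i"]
   by (simp add: norm_mult norm_divide power_mult_distrib power_divide)
 qed
 have inj: "inj_on \<alpha> ?I" using \<alpha> unfolding mi_numbering_def bij_def by (blast intro: inj_on_subset)
 have "(\<Sum>i\<in>?I. F (\<alpha> i)) = (\<Sum>a\<in>\<alpha> ` ?I. F a)" by (simp add: sum.reindex[OF inj])
 also have "\<dots> \<le> (\<Sum>a\<in>PiE UNIV (%_. {..m}). F a)"
 proof (rule sum_mono2)
  show "finite (PiE UNIV (%_::'d. {..m}))" by (rule finite_PiE) auto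
  show "\<alpha> ` ?I \<subseteq> PiE UNIV (%_. {..m})"
  proof
   fix a assume "a \<in> \<alpha> ` ?I"
   then have "mi_deg a \<le> m" using numbering_image[OF \<alpha>] by auto
   moreover have "a k \<le> mi_deg a" for k unfolding mi_deg_def by (rule member_le_sum) auto
   ultimately show "a \<in> PiE UNIV (%_. {..m})" by (auto intro: order_trans)
  qed
 qed (rule F0)
 also have "\<dots> = (\<Prod>k\<in>UNIV. \<Sum>j\<le>m. x k ^ j / fact j)" unfolding F_def by (rule prod_sum_PiE[symmetric]) auto
 also have "\<dots> \<le> (\<Prod>k\<in>UNIV. exp (x k))"
 proof (rule prod_mono)
  fix k
  have "(\<Sum>j\<le>m. x k ^ j / fact j) \<le> exp (x k)"
   unfolding exp_def using summable_exp_generic[of "x k"] x0[of k]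
   by (simp add: divide_inverse mult.commute, intro sum_le_suminf) auto
  then show "0 \<le> (\<Sum>j\<le>m. x k ^ j / fact j) \<and> (\<Sum>j\<le>m. x k ^ j / fact j) \<le> exp (x k)"
   by (simp add: sum_nonneg x0)
 qed
 also have "\<dots> = exp ((norm (z - p))\<^sup>2)"
  by (simp add: exp_sum[symmetric] norm_vec_def L2_set_def sum_nonneg x_def)
 also have "\<dots> = (exp ((norm (z - p))\<^sup>2 / 2))\<^sup>2" by (simp add: exp_double[symmetric])
 finally have "c * (\<Sum>i\<in>?I. F (\<alpha> i)) \<le> c * (exp ((norm (z - p))\<^sup>2 / 2))\<^sup>2"
  by (intro mult_left_mono) (auto simp: c_def)
 then show ?thesis unfolding u sum_distrib_left[symmetric] by (simp add: c_def u_bound_def power_mult_distrib)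
qed

lemma vec_l2_u_fun_le:
 fixes p :: "complex ^ 'd"
 assumes "mi_numbering (\<alpha> :: nat => 'd => nat)"
 shows "vec_l2 (Matrix.vec (rE TYPE('d) m) (%i. cnj (u_fun \<alpha> p i z))) \<le> u_bound p z"
 unfolding vec_l2_def using real_sqrt_le_mono[OF u_fun_sum_le[OF assms, of p z m]] u_bound_nonneg[of p z] by simp

lemma u_fun_combination_le:
 fixes p :: "complex ^ 'd"
 assumes \<alpha>: "mi_numbering (\<alpha> :: nat => 'd => nat)" and w: "w \<in> carrier_vec (rE TYPE('d) m)"
 shows "cmod (\<Sum>i<rE TYPE('d) m. vec_index w i * u_fun \<alpha> p i z) \<le> vec_l2 w * u_bound p z"
proof -
 let ?u = "Matrix.vec (rE TYPE('d) m) (%i. cnj (u_fun \<alpha> p i z))"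
 have "(\<Sum>i<rE TYPE('d) m. vec_index w i * u_fun \<alpha> p i z) = hip ?u w"
  using carrier_vecD[OF w] by (auto simp: hip_def mult.commute intro!: sum.cong)
 also have "cmod \<dots> \<le> vec_l2 ?u * vec_l2 w" by (rule hip_le[OF _ w]) simp
 also have "\<dots> \<le> u_bound p z * vec_l2 w" by (intro mult_right_mono vec_l2_u_fun_le[OF \<alpha>] vec_l2_nonneg)
 finally show ?thesis by (simp add: mult.commute)
qed

text \<open>Duality: the combination of the \<open>u_fun\<close> with these very coefficients has
  derivative \<open>(vec_l2 c)\<^sup>2\<close> at 0, while its values on the unit ball are at most
  \<open>vec_l2 c * S\<close>. Cauchy's inequality lets one factor cancel.\<close>

lemma vec_l2_partial_deriv_u_fun_le:
 fixes p :: "complex ^ 'd"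
 assumes \<alpha>: "mi_numbering (\<alpha> :: nat => 'd => nat)" and S: "!!z. z \<in> cball 0 1 ==> u_bound p z \<le> S"
 shows "vec_l2 (Matrix.vec (rE TYPE('d) m) (%i. cnj (partial_deriv k (u_fun \<alpha> p i) 0))) \<le> S"
proof -
 let ?r = "rE TYPE('d) m"
 define c where "c = Matrix.vec ?r (%i. cnj (partial_deriv k (u_fun \<alpha> p i) 0))"
 have c: "c \<in> carrier_vec ?r" by (simp add: c_def)
 define h where "h z = (\<Sum>i<?r. vec_index c i * u_fun \<alpha> p i z)" for z
 have hs: "hol_at h z \<and> dd v h z = (\<Sum>i<?r. dd v (%z. vec_index c i * u_fun \<alpha> p i z) z)" for z v
  unfolding h_def[abs_def] by (rule hol_at_sum) (auto intro: hol_at_cmult hol_at_u_fun)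
 have "dd (axis k 1) h 0 = (\<Sum>i<?r. cnj (vec_index c i) * vec_index c i)"
 proof -
  have "dd (axis k 1) h 0 = (\<Sum>i<?r. vec_index c i * dd (axis k 1) (u_fun \<alpha> p i) 0)"
   using hs[of 0 "axis k 1"] by (simp only: dd_cmult[OF hol_at_u_fun])
  also have "\<dots> = (\<Sum>i<?r. cnj (vec_index c i) * vec_index c i)"
   by (rule sum.cong) (simp_all add: c_def partial_deriv_eq_dd mult.commute)
  finally show ?thesis .
 qed
 also have "\<dots> = of_real ((vec_l2 c)\<^sup>2)" using hip_self[of c] carrier_vecD[OF c] by (simp add: hip_def)
 finally have eq: "dd (axis k 1) h 0 = of_real ((vec_l2 c)\<^sup>2)" .
 have "cmod (dd (axis k 1) h 0) \<le> (vec_l2 c * S) * norm (axis k (1::complex) :: complex ^ 'd) / 1"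
 proof (rule dd_bound)
  show "hol_on h (cball 0 1)" using hs by (simp add: hol_on_iff_hol_at)
  fix x :: "complex ^ 'd" assume "x \<in> cball 0 1"
  then show "cmod (h x) \<le> vec_l2 c * S"
   unfolding h_def using u_fun_combination_le[OF \<alpha> c, of p x] mult_left_mono[OF S vec_l2_nonneg, of x c] by linarith
 qed simp
 then have "vec_l2 c * vec_l2 c \<le> vec_l2 c * S" unfolding eq norm_of_real by (simp add: norm_axis_complex power2_eq_square)
 then have "vec_l2 c \<le> S \<or> vec_l2 c = 0" using vec_l2_nonneg[of c] by (auto simp: mult_le_cancel_left)
 moreover have "S \<ge> 0" using order_trans[OF u_bound_nonneg S, of 0] by simp
 ultimately show ?thesis unfolding c_def by auto
qed

subsection \<open>Moment matrices\<close>

lemma quadratic_form_index: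
 assumes M: "M \<in> carrier_mat r r" and w: "w \<in> carrier_vec r"
 shows "hip w (M *\<^sub>v w) = (\<Sum>i<r. \<Sum>j<r. cnj (vec_index w i) * (M $$ (i, j) * vec_index w j))"
proof -
 have "dim_vec (M *\<^sub>v w) = r" using M by simp
 then show ?thesis
  unfolding hip_def by (auto simp: mult_mat_vec_index[OF M w] sum_distrib_left simp del: index_mult_mat_vec intro!: sum.cong)
qed

lemma square_of_sum:
 "(\<Sum>i<r. \<Sum>j<r. cnj (w i) * (cnj (x i) * x j * w j)) = of_real ((cmod (\<Sum>j<r. x j * w j))\<^sup>2)"
proof -
 have "(\<Sum>i<r. \<Sum>j<r. cnj (w i) * (cnj (x i) * x j * w j)) = cnj (\<Sum>j<r. x j * w j) * (\<Sum>j<r. x j * w j)"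
  unfolding cnj_sum sum_product by (intro sum.cong refl) (simp add: mult_ac)
 also have "\<dots> = of_real ((cmod (\<Sum>j<r. x j * w j))\<^sup>2)"
  by (rule trans[OF mult.commute complex_norm_square[symmetric]])
 finally show ?thesis .
qed

lemma continuous_on_mi_power: "continuous_on S (%z. mi_power z a)"
 unfolding mi_power_def by (intro continuous_intros)

lemma
 fixes \<mu> :: "(complex ^ 'd) measure"
 assumes \<mu>: "prob_space \<mu>" "sets \<mu> = sets borel" and K: "compact K" "emeasure \<mu> (K \<inter> S) = 1"
 shows moment_mat_psd: "mat_psd (moment_mat \<alpha> n \<mu>)"
proof -
 interpret prob_space \<mu> by (rule \<mu>(1))
 let ?r = "rE TYPE('d) n"
 let ?g = "%a b z. cnj (mi_power z a) * mi_power z b"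
 have M: "moment_mat \<alpha> n \<mu> \<in> carrier_mat ?r ?r" by (simp add: moment_mat_def)
 \<comment> \<open>A set outside the sigma-algebra would have measure 0.\<close>
 have "K \<inter> S \<in> sets \<mu>" using K(2) emeasure_notin_sets by fastforce
 then have AE: "AE z in \<mu>. z \<in> K \<inter> S" using AE_in_set_eq_1[of "K \<inter> S"] K(2) by (simp only: measure_def enn2real_1)
 have int: "integrable \<mu> (?g a b)" for a b
 proof -
  have c: "continuous_on A (?g a b)" for A by (intro continuous_intros continuous_on_mi_power)
  have "bounded (?g a b ` K)" by (rule compact_imp_bounded[OF compact_continuous_image[OF c K(1)]])
  then obtain B where B: "!!z. z \<in> K ==> norm (?g a b z) \<le> B" unfolding bounded_iff by blast
  have meas: "?g a b \<in> borel_measurable \<mu>"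
   using borel_measurable_continuous_onI[OF c] by (simp add: measurable_cong_sets[OF \<mu>(2) refl])
  show ?thesis by (rule integrable_const_bound[OF _ meas, of B]) (use AE B in \<open>auto elim!: eventually_mono\<close>)
 qed
 show ?thesis
 proof (rule mat_psdI[OF M])
  show "mat_adjoint (moment_mat \<alpha> n \<mu>) = moment_mat \<alpha> n \<mu>"
  proof (rule eq_matI)
   fix i j assume "i < dim_row (moment_mat \<alpha> n \<mu>)" "j < dim_col (moment_mat \<alpha> n \<mu>)"
   then have ij: "i < ?r" "j < ?r" using M by auto
   have "mat_adjoint (moment_mat \<alpha> n \<mu>) $$ (i, j) = cnj (integral\<^sup>L \<mu> (?g (\<alpha> j) (\<alpha> i)))"
    unfolding mat_adjoint_index[OF M ij] using ij by (simp add: moment_mat_def)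
   also have "\<dots> = integral\<^sup>L \<mu> (%z. cnj (?g (\<alpha> j) (\<alpha> i) z))" by (rule Bochner_Integration.integral_cnj[symmetric])
   also have "(%z. cnj (?g (\<alpha> j) (\<alpha> i) z)) = ?g (\<alpha> i) (\<alpha> j)" by (auto simp: mult.commute)
   finally show "mat_adjoint (moment_mat \<alpha> n \<mu>) $$ (i, j) = moment_mat \<alpha> n \<mu> $$ (i, j)"
    using ij by (simp add: moment_mat_def)
  qed (use M mat_adjoint_carrier[OF M] in auto)
  fix w :: "complex Matrix.vec" assume w: "w \<in> carrier_vec ?r"
  have "hip w (moment_mat \<alpha> n \<mu> *\<^sub>v w)
    = (\<Sum>i<?r. \<Sum>j<?r. cnj (vec_index w i) * (integral\<^sup>L \<mu> (?g (\<alpha> i) (\<alpha> j)) * vec_index w j))"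
   unfolding quadratic_form_index[OF M w] by (auto simp: moment_mat_def intro!: sum.cong)
  also have "\<dots> = (\<Sum>i<?r. \<Sum>j<?r. integral\<^sup>L \<mu> (%z. cnj (vec_index w i) * (?g (\<alpha> i) (\<alpha> j) z * vec_index w j)))"
   by (intro sum.cong refl) simp
  also have "\<dots> = integral\<^sup>L \<mu> (%z. \<Sum>i<?r. \<Sum>j<?r. cnj (vec_index w i) * (?g (\<alpha> i) (\<alpha> j) z * vec_index w j))"
   by (subst Bochner_Integration.integral_sum, intro Bochner_Integration.integrable_sum integrable_mult_right integrable_mult_left int)
    (intro sum.cong refl Bochner_Integration.integral_sum[symmetric] integrable_mult_right integrable_mult_left int)
  also have "\<dots> = integral\<^sup>L \<mu> (%z. of_real ((cmod (\<Sum>j<?r. mi_power z (\<alpha> j) * vec_index w j))\<^sup>2))"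
   by (simp only: square_of_sum)
  also have "\<dots> = of_real (integral\<^sup>L \<mu> (%z. (cmod (\<Sum>j<?r. mi_power z (\<alpha> j) * vec_index w j))\<^sup>2))"
   by (rule integral_complex_of_real)
  finally show "0 \<le> Re (hip w (moment_mat \<alpha> n \<mu> *\<^sub>v w))" by simp
 qed
qed

lemma hip_moment_mat_empirical:
 fixes z :: "nat => complex ^ 'd"
 assumes w: "w \<in> carrier_vec (rE TYPE('d) n)"
 shows "hip w (moment_mat \<alpha> n (empirical_measure N z) *\<^sub>v w)
  = of_real ((\<Sum>k<N. (cmod (\<Sum>j<rE TYPE('d) n. mi_power (z k) (\<alpha> j) * vec_index w j))\<^sup>2) / real N)"
proof -
 let ?r = "rE TYPE('d) n" and ?D = "moment_mat \<alpha> n (empirical_measure N z)"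
 let ?g = "%a b z. cnj (mi_power z a) * mi_power z b"
 have M: "?D \<in> carrier_mat ?r ?r" by (simp add: moment_mat_def)
 have int: "integral\<^sup>L (empirical_measure N z) (?g a b) = (\<Sum>k<N. ?g a b (z k)) / of_nat N" for a b
 proof -
  have c: "continuous_on UNIV (?g a b)" by (intro continuous_intros continuous_on_mi_power)
  have m: "z \<in> measurable (uniform_count_measure {..<N}) borel"
   by (simp add: measurable_def sets_uniform_count_measure space_uniform_count_measure)
  have "integral\<^sup>L (empirical_measure N z) (?g a b) = integral\<^sup>L (uniform_count_measure {..<N}) (%k. ?g a b (z k))"
   unfolding empirical_measure_def by (rule integral_distr[OF m borel_measurable_continuous_onI[OF c]])
  then show ?thesis
   by (simp add: uniform_count_measure_def lebesgue_integral_point_measure_finite sum_divide_distrib scaleR_conv_of_real)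
 qed
 have "hip w (?D *\<^sub>v w) = (\<Sum>i<?r. \<Sum>j<?r. cnj (vec_index w i) * ((\<Sum>k<N. ?g (\<alpha> i) (\<alpha> j) (z k)) / of_nat N * vec_index w j))"
  unfolding quadratic_form_index[OF M w] by (auto simp: moment_mat_def int intro!: sum.cong)
 also have "\<dots> = (\<Sum>i<?r. \<Sum>j<?r. \<Sum>k<N. cnj (vec_index w i) * (?g (\<alpha> i) (\<alpha> j) (z k) * vec_index w j)) / of_nat N"
  by (simp add: sum_divide_distrib sum_distrib_left sum_distrib_right mult_ac)
 also have "(\<Sum>i<?r. \<Sum>j<?r. \<Sum>k<N. cnj (vec_index w i) * (?g (\<alpha> i) (\<alpha> j) (z k) * vec_index w j))
   = (\<Sum>k<N. \<Sum>i<?r. \<Sum>j<?r. cnj (vec_index w i) * (?g (\<alpha> i) (\<alpha> j) (z k) * vec_index w j))"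
  by (subst sum.swap, subst (2) sum.swap, subst sum.swap) (intro sum.cong refl sum.swap)
 also have "\<dots> = (\<Sum>k<N. of_real ((cmod (\<Sum>j<?r. mi_power (z k) (\<alpha> j) * vec_index w j))\<^sup>2))"
  by (simp only: square_of_sum)
 finally show ?thesis by simp
qed

lemma det_nonzero_of_invertible:
 assumes A: "(A :: complex Matrix.mat) \<in> carrier_mat n n" and "invertible_mat A"
 shows "Determinant.det A \<noteq> 0"
proof -
 obtain B where B: "A * B = 1\<^sub>m n" "B * A = 1\<^sub>m (dim_row B)"
  using assms unfolding invertible_mat_def inverts_mat_def by auto
 have "dim_col B = n" using arg_cong[OF B(1), of dim_col] by simp
 moreover have "dim_row B = n" using arg_cong[OF B(2), of dim_col] A by simp
 ultimately show ?thesis by (intro det_nonzero_of_inverse[OF A _ B(1)]) auto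
qed

subsection \<open>The estimator of the push-forward\<close>

lemma mi_fact_le: "mi_fact a \<le> fact (mi_deg a)"
proof -
 have "(\<Prod>k\<in>I. fact (a k)) \<le> (fact (\<Sum>k\<in>I. a k) :: nat)" if "finite I" for I
  using that
 proof (induction I rule: finite_induct)
  case (insert k I)
  then have "(\<Prod>k\<in>insert k I. fact (a k)) \<le> (fact (a k) * fact (\<Sum>k\<in>I. a k) :: nat)" by simp
  also have "\<dots> \<le> fact (a k + (\<Sum>k\<in>I. a k))" by (rule dvd_imp_le[OF fact_fact_dvd_fact]) simp
  finally show ?case using insert by simp
 qed simp
 then show ?thesis by (simp add: mi_fact_def mi_deg_def)
qed

text \<open>Only the first \<open>rE m\<close> entries of \<open>e\<close> are nonzero; this is why the bound contains \<open>m!\<close> and not \<open>n!\<close>.\<close>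

lemma
 fixes p :: "complex ^ 'd"
 assumes \<alpha>: "mi_numbering (\<alpha> :: nat => 'd => nat)" and mn: "m \<le> n" and N: "N > 0"
  and D: "mat_psd (moment_mat \<alpha> n \<mu>)" "Determinant.det (moment_mat \<alpha> n \<mu>) \<noteq> 0"
  and le: "op_norm (1\<^sub>m (rE TYPE('d) n) - minv (mat_sqrt (moment_mat \<alpha> n \<mu>)) *
   moment_mat \<alpha> n (empirical_measure N z0) * minv (mat_sqrt (moment_mat \<alpha> n \<mu>))) \<le> 1 - \<gamma>"
  and \<gamma>: "\<gamma> > 0" and \<kappa>: "\<kappa> > 0" "!!k. k < N ==> \<kappa> \<le> cmod (exp_fun p (p + z0 k))"
  and x: "x \<in> carrier_vec (rE TYPE('d) m)"
 defines "b \<equiv> exp (- (norm p)\<^sup>2) * \<kappa>\<^sup>2 * real N * \<gamma> * min_eigenvalue (moment_mat \<alpha> n \<mu>)"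
  and "A \<equiv> mat_adjoint (U_mat \<alpha> p n N (%i. p + z0 i))"
  and "e \<equiv> Matrix.vec (rE TYPE('d) n) (%i. if i < rE TYPE('d) m then vec_index x i else 0)"
 shows U_mat_pinv: "A * pinv A = 1\<^sub>m (rE TYPE('d) n)" "pinv A \<in> carrier_mat N (rE TYPE('d) n)"
  and pinv_bound: "vec_l2 (pinv A *\<^sub>v e) \<le> sqrt (fact m / b) * vec_l2 x"
proof -
 let ?r = "rE TYPE('d) n" and ?q = "rE TYPE('d) m" and ?D = "moment_mat \<alpha> n \<mu>"
 let ?Dh = "moment_mat \<alpha> n (empirical_measure N z0)"
 define U where "U = U_mat \<alpha> p n N (%i. p + z0 i)"
 have U: "U \<in> carrier_mat N ?r" by (simp add: U_def U_mat_def)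
 have A: "A \<in> carrier_mat ?r N" unfolding A_def U_def[symmetric] by (rule mat_adjoint_carrier[OF U])
 have AU: "mat_adjoint A = U" unfolding A_def U_def[symmetric] by (rule mat_adjoint_adjoint[OF U])
 have Dc: "?D \<in> carrier_mat ?r ?r" "?Dh \<in> carrier_mat ?r ?r" by (simp_all add: moment_mat_def)
 have \<Lambda>: "min_eigenvalue ?D > 0" by (rule min_eigenvalue_pos[OF Dc(1) D rE_pos])
 have b: "b > 0" unfolding b_def using \<Lambda> \<gamma> \<kappa>(1) N by simp
 define G where "G = A * U"
 have G: "G \<in> carrier_mat ?r ?r" using A U by (simp add: G_def)
 \<comment> \<open>This removes the normalisation by factorials: up to a nonzero factor at each
   sample, \<open>U g\<close> evaluates the polynomial with coefficients \<open>W g\<close>.\<close>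
 define W where "W g = Matrix.vec ?r (%j. vec_index g j / of_real (sqrt (mi_fact (\<alpha> j))))" for g :: "complex Matrix.vec"
 have W: "W g \<in> carrier_vec ?r" for g by (simp add: W_def)
 have hipG: "hip g (G *\<^sub>v g) = of_real ((vec_l2 (U *\<^sub>v g))\<^sup>2)" if g: "g \<in> carrier_vec ?r" for g
 proof -
  have Ug: "U *\<^sub>v g \<in> carrier_vec N" using U g by simp
  have "G *\<^sub>v g = A *\<^sub>v (U *\<^sub>v g)" unfolding G_def by (rule assoc_mult_mat_vec[OF A U g])
  then have "hip g (G *\<^sub>v g) = hip (U *\<^sub>v g) (U *\<^sub>v g)" using hip_adjoint[OF A g Ug] AU by simp
  then show ?thesis by (simp only: hip_self)
 qed
 \<comment> \<open>The factors of \<open>b\<close> are the squared scalar prefactor of the basis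
   functions, the number \<open>N\<close>, since the samples are summed and not averaged, and
   \<open>\<gamma>\<close> times the least eigenvalue from the comparison with the moment matrix of
   \<open>\<mu>\<close>.\<close>
 have lower: "b * (vec_l2 (W g))\<^sup>2 \<le> (vec_l2 (U *\<^sub>v g))\<^sup>2" if g: "g \<in> carrier_vec ?r" for g
 proof -
  let ?X = "%k. \<Sum>j<?r. mi_power (z0 k) (\<alpha> j) * vec_index (W g) j"
  define c where "c = exp (- (norm p)\<^sup>2) * \<kappa>\<^sup>2"
  have "c * (\<Sum>k<N. (cmod (?X k))\<^sup>2) \<le> (\<Sum>k<N. (cmod (vec_index (U *\<^sub>v g) k))\<^sup>2)"
   unfolding sum_distrib_left
  proof (rule sum_mono)
   fix k assume "k \<in> {..<N}"
   then have k: "k < N" by simp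
   have "vec_index (U *\<^sub>v g) k = (\<Sum>j<?r. u_fun \<alpha> p j (p + z0 k) * vec_index g j)"
    unfolding mult_mat_vec_index[OF U g k] using k by (simp add: U_def U_mat_def)
   also have "\<dots> = of_real (exp (- (norm p)\<^sup>2 / 2)) * exp_fun p (p + z0 k) * ?X k"
    unfolding sum_distrib_left by (rule sum.cong[OF refl]) (simp add: u_fun_def W_def)
   finally have "(cmod (vec_index (U *\<^sub>v g) k))\<^sup>2
     = exp (- (norm p)\<^sup>2) * (cmod (exp_fun p (p + z0 k)))\<^sup>2 * (cmod (?X k))\<^sup>2"
    by (simp add: norm_mult power_mult_distrib exp_double[symmetric])
   moreover have "c \<le> exp (- (norm p)\<^sup>2) * (cmod (exp_fun p (p + z0 k)))\<^sup>2"
    unfolding c_def using \<kappa> k by (intro mult_left_mono power_mono) auto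
   ultimately show "c * (cmod (?X k))\<^sup>2 \<le> (cmod (vec_index (U *\<^sub>v g) k))\<^sup>2"
    by (simp add: mult_right_mono)
  qed
  also have "\<dots> = (vec_l2 (U *\<^sub>v g))\<^sup>2" unfolding vec_l2_power2 using U by simp
  finally have 1: "c * (\<Sum>k<N. (cmod (?X k))\<^sup>2) \<le> (vec_l2 (U *\<^sub>v g))\<^sup>2" .
  have "\<gamma> * (min_eigenvalue ?D * (vec_l2 (W g))\<^sup>2) \<le> \<gamma> * Re (hip (W g) (?D *\<^sub>v W g))"
   using rayleigh_min_eigenvalue[OF Dc(1) mat_psdD(1)[OF D(1) Dc(1)] W[of g]] \<gamma> by simp
  also have "\<dots> \<le> Re (hip (W g) (?Dh *\<^sub>v W g))"
   by (rule whitened_lower_bound[OF Dc(1) D Dc(2) refl le W])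
  also have "\<dots> = (\<Sum>k<N. (cmod (?X k))\<^sup>2) / real N" by (simp add: hip_moment_mat_empirical[OF W])
  finally have "real N * (\<gamma> * (min_eigenvalue ?D * (vec_l2 (W g))\<^sup>2)) \<le> (\<Sum>k<N. (cmod (?X k))\<^sup>2)"
   using N by (simp add: field_simps)
  then have "c * (real N * (\<gamma> * (min_eigenvalue ?D * (vec_l2 (W g))\<^sup>2))) \<le> c * (\<Sum>k<N. (cmod (?X k))\<^sup>2)"
   by (intro mult_left_mono) (simp_all add: c_def)
  then show ?thesis using 1 by (simp add: b_def c_def mult_ac)
 qed
 have dG: "Determinant.det G \<noteq> 0"
 proof (rule det_nonzeroI[OF G])
  fix g assume g: "g \<in> carrier_vec ?r" and z: "G *\<^sub>v g = 0\<^sub>v ?r"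
  have "hip g (G *\<^sub>v g) = 0" unfolding z by (simp add: hip_def)
  then have "(vec_l2 (U *\<^sub>v g))\<^sup>2 = 0" unfolding hipG[OF g] of_real_eq_0_iff .
  then have "b * (vec_l2 (W g))\<^sup>2 \<le> 0" using lower[OF g] by simp
  then have "vec_l2 (W g) = 0" using b by (simp add: mult_le_0_iff)
  then have "W g = 0\<^sub>v ?r" using vec_l2_eq_0[OF W] by simp
  then have "vec_index (W g) i = 0" if "i < ?r" for i using that by simp
  moreover have "mi_fact (\<alpha> i) \<noteq> 0" for i using mi_fact_pos[of "\<alpha> i"] by simp
  ultimately show "g = 0\<^sub>v ?r" using g by (intro eq_vecI) (auto simp: W_def)
 qed
 have dG': "Determinant.det (A * mat_adjoint A) \<noteq> 0" using dG unfolding AU G_def .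
 note P = pinv_full_row_rank[OF A dG', unfolded AU G_def[symmetric]]
 show "A * pinv A = 1\<^sub>m ?r" by (rule P(2))
 note Gi = minv[OF G dG]
 show "pinv A \<in> carrier_mat N ?r" unfolding P(1) by (rule mult_carrier_mat[OF U Gi(1)])
 have e: "e \<in> carrier_vec ?r" by (simp add: e_def)
 define g where "g = minv G *\<^sub>v e"
 have g: "g \<in> carrier_vec ?r" using Gi(1) e by (simp add: g_def)
 have Gg: "G *\<^sub>v g = e" unfolding g_def using assoc_mult_mat_vec[OF G Gi(1) e] Gi(2) e by simp
 have y: "pinv A *\<^sub>v e = U *\<^sub>v g" unfolding P(1) g_def by (rule assoc_mult_mat_vec[OF U Gi(1) e])
 define Y where "Y = vec_l2 (U *\<^sub>v g)"
 have Y0: "Y \<ge> 0" by (simp add: Y_def vec_l2_nonneg)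
 define g' where "g' = Matrix.vec ?q (%i. vec_index g i)"
 have g': "g' \<in> carrier_vec ?q" by (simp add: g'_def)
 have qr: "?q \<le> ?r" by (rule rE_mono[OF mn])
 \<comment> \<open>As \<open>G g = e\<close>, the squared norm of \<open>U g\<close> is the pairing
   of \<open>g\<close> with \<open>e\<close>, which sees only the entries of low degree.\<close>
 have "hip g e = (\<Sum>i<?r. if i < ?q then cnj (vec_index g i) * vec_index x i else 0)"
  unfolding hip_def using carrier_vecD[OF e] by (auto simp: e_def intro!: sum.cong)
 also have "\<dots> = (\<Sum>i<?q. cnj (vec_index g i) * vec_index x i)"
  using qr by (intro sum.mono_neutral_cong_right) auto
 also have "\<dots> = hip g' x" unfolding hip_def using carrier_vecD[OF x] by (simp add: g'_def)
 finally have "of_real (Y\<^sup>2) = hip g' x" using hipG[OF g] by (simp add: Gg Y_def)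
 then have Y2: "Y\<^sup>2 \<le> vec_l2 g' * vec_l2 x"
  using hip_le[OF g' x] by (metis abs_of_nonneg norm_of_real zero_le_power2)
 have "(vec_l2 g')\<^sup>2 = (\<Sum>i<?q. (cmod (vec_index g i))\<^sup>2)" by (simp add: vec_l2_power2 g'_def)
 also have "\<dots> \<le> (\<Sum>i<?q. fact m * (cmod (vec_index (W g) i))\<^sup>2)"
 proof (rule sum_mono)
  fix i assume "i \<in> {..<?q}"
  then have i: "i < ?q" "i < ?r" using qr by auto
  have "mi_deg (\<alpha> i) \<le> m" using numbering_image[OF \<alpha>] i by blast
  then have "mi_fact (\<alpha> i) \<le> fact m" using mi_fact_le[of "\<alpha> i"] fact_mono[of "mi_deg (\<alpha> i)" m] by (meson order_trans)
  then have f: "real (mi_fact (\<alpha> i)) \<le> fact m" by (metis of_nat_fact of_nat_le_iff)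
  have p: "real (mi_fact (\<alpha> i)) > 0" using mi_fact_pos[of "\<alpha> i"] by simp
  have "(cmod (vec_index (W g) i))\<^sup>2 = (cmod (vec_index g i))\<^sup>2 / real (mi_fact (\<alpha> i))"
   using i p by (simp add: W_def norm_divide power_divide)
  then have "(cmod (vec_index g i))\<^sup>2 = real (mi_fact (\<alpha> i)) * (cmod (vec_index (W g) i))\<^sup>2" using p by simp
  also have "\<dots> \<le> fact m * (cmod (vec_index (W g) i))\<^sup>2" by (rule mult_right_mono[OF f]) simp
  finally show "(cmod (vec_index g i))\<^sup>2 \<le> fact m * (cmod (vec_index (W g) i))\<^sup>2" .
 qed
 also have "\<dots> \<le> (\<Sum>i<?r. fact m * (cmod (vec_index (W g) i))\<^sup>2)" using qr by (intro sum_mono2) auto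
 also have "\<dots> = fact m * (vec_l2 (W g))\<^sup>2" by (simp add: sum_distrib_left vec_l2_power2 W_def)
 also have "\<dots> \<le> fact m * (Y\<^sup>2 / b)"
  using lower[OF g] b by (intro mult_left_mono) (auto simp: Y_def field_simps)
 finally have "(vec_l2 g')\<^sup>2 \<le> (sqrt (fact m / b) * Y)\<^sup>2" using b by (simp add: power_mult_distrib)
 then have "vec_l2 g' \<le> sqrt (fact m / b) * Y" by (rule power2_le_imp_le) (use b Y0 in simp)
 then have "vec_l2 g' * vec_l2 x \<le> sqrt (fact m / b) * Y * vec_l2 x" by (rule mult_right_mono[OF _ vec_l2_nonneg])
 then have "Y * Y \<le> Y * (sqrt (fact m / b) * vec_l2 x)" using Y2 by (simp add: power2_eq_square mult_ac)
 then have "Y \<le> sqrt (fact m / b) * vec_l2 x \<or> Y = 0" using Y0 by (auto simp: mult_le_cancel_left)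
 moreover have "0 \<le> sqrt (fact m / b) * vec_l2 x" using b by (simp add: vec_l2_nonneg)
 ultimately show "vec_l2 (pinv A *\<^sub>v e) \<le> sqrt (fact m / b) * vec_l2 x" unfolding y Y_def[symmetric] by auto
qed

text \<open>The vector \<open>y = pinv A e\<close> reproduces \<open>e\<close> from the samples,
  that is, \<open>A y = e\<close>. Inserting this into the exact matrix turns the difference of the
  two matrices at \<open>x\<close> into the Taylor remainders at the samples, weighted by
  \<open>y\<close>.\<close>

lemma C_hat_error:
 fixes p :: "complex ^ 'd" and f :: "complex ^ 'd => complex ^ 'd"
 assumes K0: "compact K0" "absolutely_convex K0" "0 \<in> interior K0"
  and \<alpha>: "mi_numbering (\<alpha> :: nat => 'd => nat)" and mn: "m \<le> n"
  and U: "open U" and f: "!!i. hol_on (%z. f z $ i) U" and \<rho>: "\<rho> > 1" "!!x. x \<in> K0 ==> p + \<rho> *\<^sub>R x \<in> U"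
  and M: "M \<ge> 0" "!!x. x \<in> K0 ==> u_bound p (f (p + \<rho> *\<^sub>R x)) * cmod (exp_fun (- p) (p + \<rho> *\<^sub>R x)) \<le> M"
  and E: "!!z. z \<in> (+) p ` K0 ==> cmod (exp_fun p z) \<le> E"
  and z0: "!!k. k < N ==> z0 k \<in> K0" "!!k. k < N ==> gauge_norm K0 (z0 k) \<le> R" and R: "0 \<le> R" "R \<le> 1"
  and pU: "p \<in> U"
 defines "A \<equiv> mat_adjoint (U_mat \<alpha> p n N (%i. p + z0 i))"
 assumes P: "A * pinv A = 1\<^sub>m (rE TYPE('d) n)" "pinv A \<in> carrier_mat N (rE TYPE('d) n)"
  and \<beta>: "!!x. x \<in> carrier_vec (rE TYPE('d) m) ==>
   vec_l2 (pinv A *\<^sub>v Matrix.vec (rE TYPE('d) n) (%i. if i < rE TYPE('d) m then vec_index x i else 0)) \<le> \<beta> * vec_l2 x"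
  and \<beta>0: "\<beta> \<ge> 0"
 defines "C \<equiv> Matrix.mat (rE TYPE('d) m) (rE TYPE('d) m) (%(i, j). cnj (nu \<alpha> p j (%z. u_fun \<alpha> p i (f z))))"
 shows "op_norm (C - C_hat \<alpha> p f m n N (%i. p + z0 i)) \<le> E * (M * ((1 + \<rho>) / (\<rho> - 1))) * R ^ n * sqrt (real N) * \<beta>"
proof -
 let ?r = "rE TYPE('d) n" and ?q = "rE TYPE('d) m" and ?Z = "%i. p + z0 i"
 define c where "c = E * (M * ((1 + \<rho>) / (\<rho> - 1))) * R ^ n"
 have "cmod (exp_fun p p) \<le> E" using E zero_in_K0[OF K0] by force
 then have E0: "E \<ge> 0" by (rule order_trans[OF norm_ge_zero])
 have c0: "c \<ge> 0" unfolding c_def using E0 M(1) \<rho>(1) R by simp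
 define H where "H = C_hat \<alpha> p f m n N ?Z"
 have H: "H \<in> carrier_mat ?q ?q" and C: "C \<in> carrier_mat ?q ?q" by (simp_all add: H_def C_hat_def C_def)
 have CH: "C - H \<in> carrier_mat ?q ?q" by (rule minus_carrier_mat[OF H])
 have qr: "?q \<le> ?r" by (rule rE_mono[OF mn])
 define Uz where "Uz = U_mat \<alpha> p n N ?Z"
 define Uw where "Uw = U_mat \<alpha> p m N (f \<circ> ?Z)"
 have Uz: "Uz \<in> carrier_mat N ?r" and Uw: "Uw \<in> carrier_mat N ?q" by (simp_all add: Uz_def Uw_def U_mat_def)
 have A: "A \<in> carrier_mat ?r N" unfolding A_def Uz_def[symmetric] by (rule mat_adjoint_carrier[OF Uz])
 have Uwa: "mat_adjoint Uw \<in> carrier_mat ?q N" by (rule mat_adjoint_carrier[OF Uw])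
 have A_index: "A $$ (j, k) = cnj (u_fun \<alpha> p j (?Z k))" if "j < ?r" "k < N" for j k
  unfolding A_def Uz_def[symmetric] mat_adjoint_index[OF Uz that] using that by (simp add: Uz_def U_mat_def)
 have Uw_index: "mat_adjoint Uw $$ (i, k) = cnj (u_fun \<alpha> p i (f (?Z k)))" if "i < ?q" "k < N" for i k
  unfolding mat_adjoint_index[OF Uw that] using that by (simp add: Uw_def U_mat_def)
 have UP: "mat_adjoint Uw * pinv A \<in> carrier_mat ?q ?r" by (rule mult_carrier_mat[OF Uwa P(2)])
 define rem where "rem i k = u_fun \<alpha> p i (f (?Z k)) - (\<Sum>j<?r. nu \<alpha> p j (%z. u_fun \<alpha> p i (f z)) * u_fun \<alpha> p j (?Z k))" for i k
 have huf: "hol_on (%z. u_fun \<alpha> p i (f z)) U" for i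
  by (rule hol_on_compose[where U = UNIV]) (use f in \<open>auto simp: hol_on_iff_hol_at hol_at_u_fun\<close>)
 \<comment> \<open>The remainder is estimated for the whole combination with coefficients
   \<open>w\<close>, which by \<open>u_bound\<close> costs only the norm of \<open>w\<close>;
   separate bounds for each \<open>i\<close> would bring in the number of basis functions.\<close>
 have remw: "cmod (\<Sum>i<?q. vec_index w i * rem i k) \<le> c * vec_l2 w" if w: "w \<in> carrier_vec ?q" and k: "k < N" for w k
 proof -
  define h where "h z = (\<Sum>i<?q. vec_index w i * u_fun \<alpha> p i (f z))" for z
  have h: "hol_on h U"
   unfolding h_def[abs_def] hol_on_iff_hol_at
  proof
   fix z assume "z \<in> U"
   then have "hol_at (%z. u_fun \<alpha> p i (f z)) z" for i using huf by (simp add: hol_on_iff_hol_at)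
   then have c: "hol_at (%z. vec_index w i * u_fun \<alpha> p i (f z)) z" for i by (rule hol_at_cmult)
   show "hol_at (%z. \<Sum>i<?q. vec_index w i * u_fun \<alpha> p i (f z)) z"
    by (rule conjunct1[OF hol_at_sum[OF finite_lessThan c]])
  qed
  have nuh: "nu \<alpha> p j h = (\<Sum>i<?q. vec_index w i * nu \<alpha> p j (%z. u_fun \<alpha> p i (f z)))" for j
   unfolding h_def[abs_def] by (rule nu_sum[OF U pU]) (auto intro: huf)
  have "cmod (h (p + z0 k) - (\<Sum>j<?r. nu \<alpha> p j h * u_fun \<alpha> p j (p + z0 k)))
    \<le> E * ((vec_l2 w * M) * ((1 + \<rho>) / (\<rho> - 1))) * R ^ n"
  proof (rule taylor_gauge[OF K0 \<alpha> U h \<rho> _ _ E z0[OF k] R(2)])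
   show "0 \<le> vec_l2 w * M" using M(1) by (simp add: vec_l2_nonneg)
   fix x assume x: "x \<in> K0"
   have "cmod (h (p + \<rho> *\<^sub>R x) * exp_fun (- p) (p + \<rho> *\<^sub>R x))
     \<le> (vec_l2 w * u_bound p (f (p + \<rho> *\<^sub>R x))) * cmod (exp_fun (- p) (p + \<rho> *\<^sub>R x))"
    unfolding norm_mult h_def by (intro mult_right_mono u_fun_combination_le[OF \<alpha> w]) simp
   also have "\<dots> \<le> vec_l2 w * M" unfolding mult.assoc by (rule mult_left_mono[OF M(2)[OF x] vec_l2_nonneg])
   finally show "cmod (h (p + \<rho> *\<^sub>R x) * exp_fun (- p) (p + \<rho> *\<^sub>R x)) \<le> vec_l2 w * M" .
  qed
  also have "h (p + z0 k) - (\<Sum>j<?r. nu \<alpha> p j h * u_fun \<alpha> p j (p + z0 k)) = (\<Sum>i<?q. vec_index w i * rem i k)"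
  proof -
   have "(\<Sum>j<?r. nu \<alpha> p j h * u_fun \<alpha> p j (p + z0 k))
     = (\<Sum>j<?r. \<Sum>i<?q. vec_index w i * (nu \<alpha> p j (%z. u_fun \<alpha> p i (f z)) * u_fun \<alpha> p j (p + z0 k)))"
    unfolding nuh by (simp add: sum_distrib_right mult.assoc)
   also have "\<dots> = (\<Sum>i<?q. \<Sum>j<?r. vec_index w i * (nu \<alpha> p j (%z. u_fun \<alpha> p i (f z)) * u_fun \<alpha> p j (p + z0 k)))"
    by (rule sum.swap)
   finally show ?thesis by (simp add: h_def rem_def right_diff_distrib sum_subtractf sum_distrib_left)
  qed
  finally show ?thesis by (simp add: c_def mult_ac)
 qed
 have "op_norm (C - H) \<le> c * sqrt (real N) * \<beta>"
 proof (rule op_norm_leI[OF CH])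
  show "0 \<le> c * sqrt (real N) * \<beta>" using c0 \<beta>0 by simp
  fix x :: "complex Matrix.vec" assume x: "x \<in> carrier_vec ?q"
  define e where "e = Matrix.vec ?r (%i. if i < ?q then vec_index x i else 0)"
  have e: "e \<in> carrier_vec ?r" by (simp add: e_def)
  define y where "y = pinv A *\<^sub>v e"
  have y: "y \<in> carrier_vec N" using P(2) e by (simp add: y_def)
  have Ay: "A *\<^sub>v y = e" unfolding y_def using assoc_mult_mat_vec[OF A P(2) e] P(1) e by simp
  have restrict: "(\<Sum>j<?q. F j * vec_index x j) = (\<Sum>j<?r. F j * vec_index e j)" for F :: "nat => complex"
   using qr by (intro sum.mono_neutral_cong_left) (auto simp: e_def)
  have ej: "vec_index e j = (\<Sum>k<N. cnj (u_fun \<alpha> p j (?Z k)) * vec_index y k)" if j: "j < ?r" for j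
  proof -
   have "vec_index e j = (\<Sum>k<N. A $$ (j, k) * vec_index y k)"
    unfolding Ay[symmetric] by (rule mult_mat_vec_index[OF A y j])
   also have "\<dots> = (\<Sum>k<N. cnj (u_fun \<alpha> p j (?Z k)) * vec_index y k)"
    using j by (intro sum.cong refl) (simp add: A_index)
   finally show ?thesis .
  qed
  define v where "v = (C - H) *\<^sub>v x"
  have v: "v \<in> carrier_vec ?q" using CH x by (auto simp: v_def)
  have vi: "vec_index v i = - (\<Sum>k<N. cnj (rem i k) * vec_index y k)" if i: "i < ?q" for i
  proof -
   have "vec_index v i = (\<Sum>j<?q. C $$ (i, j) * vec_index x j) - (\<Sum>j<?q. H $$ (i, j) * vec_index x j)"
    unfolding v_def mult_mat_vec_index[OF CH x i] using i C H
    by (simp add: mat_minus_index[of _ ?q] left_diff_distrib sum_subtractf)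
   also have "(\<Sum>j<?q. H $$ (i, j) * vec_index x j) = (\<Sum>j<?q. (mat_adjoint Uw * pinv A) $$ (i, j) * vec_index x j)"
    using i by (intro sum.cong refl) (simp add: H_def C_hat_def Uw_def A_def)
   also have "\<dots> = vec_index ((mat_adjoint Uw * pinv A) *\<^sub>v e) i"
    unfolding restrict mult_mat_vec_index[OF UP e i] ..
   also have "(mat_adjoint Uw * pinv A) *\<^sub>v e = mat_adjoint Uw *\<^sub>v y"
    unfolding y_def by (rule assoc_mult_mat_vec[OF Uwa P(2) e])
   also have "vec_index (mat_adjoint Uw *\<^sub>v y) i = (\<Sum>k<N. cnj (u_fun \<alpha> p i (f (?Z k))) * vec_index y k)"
    unfolding mult_mat_vec_index[OF Uwa y i] using i
    by (intro sum.cong refl) (simp add: Uw_index)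
   also have "(\<Sum>j<?q. C $$ (i, j) * vec_index x j) = (\<Sum>j<?q. cnj (nu \<alpha> p j (%z. u_fun \<alpha> p i (f z))) * vec_index x j)"
    using i by (intro sum.cong refl) (simp add: C_def)
   also have "\<dots> = (\<Sum>j<?r. \<Sum>k<N. cnj (nu \<alpha> p j (%z. u_fun \<alpha> p i (f z))) * (cnj (u_fun \<alpha> p j (?Z k)) * vec_index y k))"
    unfolding restrict by (intro sum.cong refl) (simp add: ej sum_distrib_left)
   also have "\<dots> = (\<Sum>k<N. \<Sum>j<?r. cnj (nu \<alpha> p j (%z. u_fun \<alpha> p i (f z))) * (cnj (u_fun \<alpha> p j (?Z k)) * vec_index y k))"
    by (rule sum.swap)
   finally show ?thesis
    by (simp add: rem_def left_diff_distrib sum_subtractf sum_distrib_right mult.assoc)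
  qed
  \<comment> \<open>The error is paired with itself, so that the remainders occur as the combination
    with coefficients from \<open>v\<close>; afterwards one factor \<open>vec_l2 v\<close>
    cancels.\<close>
  have "hip v v = (\<Sum>i<?q. cnj (vec_index v i) * - (\<Sum>k<N. cnj (rem i k) * vec_index y k))"
   unfolding hip_def carrier_vecD[OF v] by (intro sum.cong refl) (simp add: vi)
  also have "\<dots> = - (\<Sum>i<?q. \<Sum>k<N. cnj (vec_index v i * rem i k) * vec_index y k)"
   by (simp add: sum_distrib_left sum_negf mult.assoc)
  also have "\<dots> = - (\<Sum>k<N. cnj (\<Sum>i<?q. vec_index v i * rem i k) * vec_index y k)"
   by (subst sum.swap) (simp add: sum_distrib_right)
  finally have "cmod (hip v v) \<le> (\<Sum>k<N. cmod (\<Sum>i<?q. vec_index v i * rem i k) * cmod (vec_index y k))"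
   by (simp del: cnj_sum) (rule order_trans[OF norm_sum], simp add: norm_mult del: cnj_sum)
  also have "\<dots> \<le> (\<Sum>k<N. \<bar>c * vec_l2 v\<bar> * \<bar>cmod (vec_index y k)\<bar>)"
   using remw[OF v] c0 by (intro sum_mono mult_mono) (auto simp: vec_l2_nonneg)
  \<comment> \<open>Cauchy-Schwarz over the samples; the constant sequence is the source of
    \<open>sqrt N\<close>.\<close>
  also have "\<dots> \<le> L2_set (%k. c * vec_l2 v) {..<N} * L2_set (%k. cmod (vec_index y k)) {..<N}"
   by (rule L2_set_mult_ineq)
  also have "L2_set (%k. cmod (vec_index y k)) {..<N} = vec_l2 y" using y by (simp add: vec_l2_L2_set)
  also have "L2_set (%k. c * vec_l2 v) {..<N} = c * vec_l2 v * sqrt (real N)"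
   using c0 by (simp add: L2_set_def real_sqrt_mult vec_l2_nonneg mult.commute)
  also have "cmod (hip v v) = vec_l2 v * vec_l2 v" unfolding hip_self norm_of_real by (simp add: power2_eq_square)
  finally have "vec_l2 v * vec_l2 v \<le> vec_l2 v * (c * sqrt (real N) * vec_l2 y)" by (simp add: mult_ac)
  then have "vec_l2 v \<le> c * sqrt (real N) * vec_l2 y \<or> vec_l2 v = 0"
   using vec_l2_nonneg[of v] by (auto simp: mult_le_cancel_left)
  moreover have "0 \<le> c * sqrt (real N) * vec_l2 y" using c0 by (simp add: vec_l2_nonneg)
  ultimately have "vec_l2 v \<le> c * sqrt (real N) * vec_l2 y" by auto
  also have "\<dots> \<le> c * sqrt (real N) * (\<beta> * vec_l2 x)"
   using \<beta>[OF x] c0 unfolding y_def e_def by (intro mult_left_mono) auto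
  finally show "vec_l2 ((C - H) *\<^sub>v x) \<le> c * sqrt (real N) * \<beta> * vec_l2 x" by (simp add: v_def mult.assoc)
 qed
 then show ?thesis by (simp add: c_def H_def)
qed

subsection \<open>The generator and its estimator\<close>

text \<open>The results on the linear system apply to the conjugated jets of the flow, since
  conjugation is real linear and therefore respects the time derivative.\<close>

lemma
 fixes V :: "complex ^ 'd => complex ^ 'd" and m :: nat
 assumes \<alpha>: "mi_numbering (\<alpha> :: nat => 'd => nat)" and U: "open U" "p \<in> U"
  and V: "!!i. hol_on (%z. V z $ i) U" "V p = 0" and T: "T \<ge> 0"
  and J: "\<forall>l v. v \<noteq> 0 \<and> complex_jacobian V p *v v = l *s v --> l \<in> \<real>"
 defines "A \<equiv> Matrix.mat (rE TYPE('d) m) (rE TYPE('d) m) (%(i, j). cnj (nu \<alpha> p j (Lie V (u_fun \<alpha> p i))))"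
  and "C \<equiv> %t. Matrix.mat (rE TYPE('d) m) (rE TYPE('d) m) (%(i, j). cnj (nu \<alpha> p j (%z. u_fun \<alpha> p i (flow V t z))))"
 shows mat_log_push_forward: "mat_log (C T) = complex_of_real T \<cdot>\<^sub>m A"
  and det_seg_push_forward: "s \<in> {0..1} ==> Determinant.det (seg (C T) s) \<noteq> 0"
proof -
 let ?r = "rE TYPE('d) m"
 have A: "A \<in> carrier_mat ?r ?r" by (simp add: A_def)
 have Cc: "C t \<in> carrier_mat ?r ?r" for t by (simp add: C_def)
 have Vp: "analytic_map V {p}" unfolding analytic_map_def using U V(1) by blast
 have spec: "a \<in> \<real>" if "eigenvalue A a" for a
 proof -
  have At: "transpose_mat A \<in> carrier_mat ?r ?r" using A by simp
  \<comment> \<open>Passing to the transpose is necessary because the coefficients of a function are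
    summed over the first index of \<open>A\<close>; the conjugates below account for the conjugated
    entries.\<close>
  have "eigenvalue (transpose_mat A) a"
   using that eigenvalue_root_char_poly[OF A] eigenvalue_root_char_poly[OF At] char_poly_transpose_mat[OF A] by simp
  then obtain v where v: "v \<in> carrier_vec ?r" "v \<noteq> 0\<^sub>v ?r" "transpose_mat A *\<^sub>v v = a \<cdot>\<^sub>v v"
   using A by (auto simp: eigenvalue_def eigenvector_def)
  have "cnj a \<in> \<real>"
  proof (rule generator_matrix_eigenvalue_real[OF \<alpha> U V J, where x = "%i. cnj (vec_index v i)" and n = m])
   show "\<exists>i<?r. cnj (vec_index v i) \<noteq> 0"
   proof (rule ccontr)
    assume "\<not> (\<exists>i<?r. cnj (vec_index v i) \<noteq> 0)"
    then have "v = 0\<^sub>v ?r" using v(1) by (intro eq_vecI) auto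
    then show False using v(2) by simp
   qed
   fix k assume k: "k < ?r"
   have "(\<Sum>i<?r. A $$ (i, k) * vec_index v i) = vec_index (transpose_mat A *\<^sub>v v) k"
    unfolding mult_mat_vec_index[OF At v(1) k] using k A by (intro sum.cong refl) auto
   also have "\<dots> = a * vec_index v k" unfolding v(3) using k v(1) by simp
   finally have "cnj (\<Sum>i<?r. A $$ (i, k) * vec_index v i) = cnj (a * vec_index v k)" by simp
   then show "(\<Sum>i<?r. cnj (vec_index v i) * nu \<alpha> p k (Lie V (u_fun \<alpha> p i))) = cnj a * cnj (vec_index v k)"
    using k by (simp add: A_def mult.commute)
  qed
  then show ?thesis by (simp add: complex_is_Real_iff)
 qed
 have der: "mat_der {0..T} ?r C (A * C t) t" if t: "t \<in> {0..T}" for t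
 proof (rule mat_derI[where f = "%i j t. cnj (nu \<alpha> p j (%z. u_fun \<alpha> p i (flow V t z)))", OF Cc _ t])
  show "A * C t \<in> carrier_mat ?r ?r" by (rule mult_carrier_mat[OF A Cc])
  fix i j assume ij: "i < ?r" "j < ?r"
  have eq: "(A * C t) $$ (i, j) = cnj (\<Sum>k<?r. nu \<alpha> p k (Lie V (u_fun \<alpha> p i)) * nu \<alpha> p j (%z. u_fun \<alpha> p k (flow V t z)))"
   unfolding mult_mat_index[OF A Cc ij] cnj_sum
   by (rule sum.cong[OF refl]) (use ij in \<open>simp add: A_def C_def\<close>)
  show "((%t. cnj (nu \<alpha> p j (%z. u_fun \<alpha> p i (flow V t z)))) has_vector_derivative (A * C t) $$ (i, j)) (at t within {0..T})"
   unfolding eq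
   by (rule bounded_linear.has_vector_derivative[OF bounded_linear_cnj nu_flow_ode[OF \<alpha> T Vp V(2) t ij(2)]])
 qed (simp add: C_def)
 have C0: "C 0 = 1\<^sub>m ?r"
  by (rule eq_matI) (auto simp: C_def nu_flow_0[OF \<alpha> Vp V(2)])
 show "mat_log (C T) = complex_of_real T \<cdot>\<^sub>m A" by (rule mat_log_flow[OF A spec der C0 T])
 show "Determinant.det (seg (C T) s) \<noteq> 0" if "s \<in> {0..1}"
  by (rule det_segment[OF A spec der C0 T _ that]) (use T in auto)
qed

text \<open>\<open>nu\<close> does not refer to \<open>K0\<close>, so the unit ball can play its
  part in \<open>nu_coord_aux\<close>.\<close>

lemma nu_coord: "nu \<alpha> p j (%z. z $ k) = cnj (partial_deriv k (u_fun \<alpha> p j) 0)" for p :: "complex ^ 'd"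
proof (rule nu_coord_aux)
 show "absolutely_convex (cball (0 :: complex ^ 'd) 1)"
  unfolding absolutely_convex_def
 proof (intro ballI allI impI)
  fix x y :: "complex ^ 'd" and a b
  assume xy: "x \<in> cball 0 1" "y \<in> cball 0 1" and ab: "cmod a + cmod b \<le> 1"
  have "norm (a *s x + b *s y) \<le> cmod a * norm x + cmod b * norm y"
   using norm_triangle_ineq[of "a *s x" "b *s y"] by (simp add: norm_smult_vec)
  also have "\<dots> \<le> cmod a * 1 + cmod b * 1" using xy by (intro add_mono mult_left_mono) auto
  finally show "a *s x + b *s y \<in> cball 0 1" using ab by simp
 qed
qed auto

text \<open>By \<open>nu_coord\<close> and \<open>nu_Lie\<close> the exact generator contributes the jet of the Lie derivative of a coordinate function, which
is a component of \<open>V\<close>.\<close>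

lemma V_hat_component:
 fixes V :: "complex ^ 'd => complex ^ 'd" and f :: "complex ^ 'd => complex ^ 'd" and m n N :: nat and Z :: "nat => complex ^ 'd"
  and z :: "complex ^ 'd" and k :: 'd
 assumes \<alpha>: "mi_numbering (\<alpha> :: nat => 'd => nat)" and U: "open U" "p \<in> U"
  and V: "!!i. hol_on (%z. V z $ i) U" "V p = 0" and T: "T > 0"
  and log: "mat_log C = complex_of_real T \<cdot>\<^sub>m
   Matrix.mat (rE TYPE('d) m) (rE TYPE('d) m) (%(i, j). cnj (nu \<alpha> p j (Lie V (u_fun \<alpha> p i))))"
 defines "L \<equiv> mat_log (C_hat \<alpha> p f m n N Z)"
  and "c \<equiv> Matrix.vec (rE TYPE('d) m) (%i. cnj (partial_deriv k (u_fun \<alpha> p i) 0))"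
  and "u \<equiv> Matrix.vec (rE TYPE('d) m) (%i. cnj (u_fun \<alpha> p i z))"
 shows "V_hat \<alpha> p f T m n N Z z $ k - (\<Sum>i<rE TYPE('d) m. nu \<alpha> p i (%z. V z $ k) * u_fun \<alpha> p i z)
  = of_real (1 / T) * cnj (hip c ((L - mat_log C) *\<^sub>v u))"
proof -
 let ?r = "rE TYPE('d) m"
 define A where "A = Matrix.mat ?r ?r (%(i, j). cnj (nu \<alpha> p j (Lie V (u_fun \<alpha> p i))))"
 have H: "C_hat \<alpha> p f m n N Z \<in> carrier_mat ?r ?r" by (simp add: C_hat_def)
 have L: "L \<in> carrier_mat ?r ?r"
  unfolding L_def mat_log_def using H minus_carrier_mat[OF one_carrier_mat] by (auto intro!: mult_carrier_mat)
 have A: "A \<in> carrier_mat ?r ?r" by (simp add: A_def)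
 have LC: "mat_log C = complex_of_real T \<cdot>\<^sub>m A" unfolding A_def by (rule log)
 have LCc: "mat_log C \<in> carrier_mat ?r ?r" unfolding LC using A by simp
 have c: "c \<in> carrier_vec ?r" and u: "u \<in> carrier_vec ?r" by (simp_all add: c_def u_def)
 have swap: "cnj (hip c (M *\<^sub>v u)) = (\<Sum>i<?r. u_fun \<alpha> p i z * (\<Sum>j<?r. cnj (M $$ (j, i)) * vec_index c j))"
  if M: "M \<in> carrier_mat ?r ?r" for M
 proof -
  have "dim_vec (M *\<^sub>v u) = ?r" using M by simp
  then have "hip c (M *\<^sub>v u) = (\<Sum>j<?r. \<Sum>i<?r. cnj (vec_index c j) * (M $$ (j, i) * vec_index u i))"
   unfolding hip_def by (auto simp: mult_mat_vec_index[OF M u] sum_distrib_left simp del: index_mult_mat_vec intro!: sum.cong)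
  also have "cnj \<dots> = (\<Sum>j<?r. \<Sum>i<?r. u_fun \<alpha> p i z * (cnj (M $$ (j, i)) * vec_index c j))"
   unfolding cnj_sum by (intro sum.cong refl) (simp add: u_def)
  also have "\<dots> = (\<Sum>i<?r. \<Sum>j<?r. u_fun \<alpha> p i z * (cnj (M $$ (j, i)) * vec_index c j))" by (rule sum.swap)
  finally show ?thesis by (simp add: sum_distrib_left)
 qed
 have Ah: "A_hat \<alpha> p f T m n N Z \<in> carrier_mat ?r ?r" unfolding A_hat_def using L by (simp add: L_def)
 have "V_hat \<alpha> p f T m n N Z z $ k
   = (\<Sum>i<?r. u_fun \<alpha> p i z * (\<Sum>j<?r. cnj (A_hat \<alpha> p f T m n N Z $$ (j, i)) * vec_index c j))"
 proof -
  have Aa: "mat_adjoint (A_hat \<alpha> p f T m n N Z) \<in> carrier_mat ?r ?r" by (rule mat_adjoint_carrier[OF Ah])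
  have "V_hat \<alpha> p f T m n N Z z $ k = (\<Sum>i<?r. u_fun \<alpha> p i z * vec_index (mat_adjoint (A_hat \<alpha> p f T m n N Z) *\<^sub>v c) i)"
   unfolding V_hat_def c_def using carrier_matD(1)[OF Aa]
   by (simp add: scalar_prod_def atLeast0LessThan del: index_mult_mat_vec)
  also have "\<dots> = (\<Sum>i<?r. u_fun \<alpha> p i z * (\<Sum>j<?r. cnj (A_hat \<alpha> p f T m n N Z $$ (j, i)) * vec_index c j))"
   by (intro sum.cong refl) (auto simp: mult_mat_vec_index[OF Aa c] mat_adjoint_index[OF Ah] simp del: index_mult_mat_vec intro!: sum.cong)
  finally show ?thesis .
 qed
 also have "\<dots> = (\<Sum>i<?r. u_fun \<alpha> p i z * (\<Sum>j<?r. of_real (1 / T) * (cnj (L $$ (j, i)) * vec_index c j)))"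
  by (rule sum.cong[OF refl], rule arg_cong2[where f = "(*)", OF refl], rule sum.cong[OF refl])
   (use L in \<open>auto simp: A_hat_def L_def\<close>)
 also have "\<dots> = of_real (1 / T) * cnj (hip c (L *\<^sub>v u))"
  unfolding swap[OF L] by (simp add: sum_distrib_left mult_ac)
 finally have 1: "V_hat \<alpha> p f T m n N Z z $ k = of_real (1 / T) * cnj (hip c (L *\<^sub>v u))" .
 have "cnj (hip c (mat_log C *\<^sub>v u)) = (\<Sum>i<?r. u_fun \<alpha> p i z * (\<Sum>j<?r. of_real T * (nu \<alpha> p i (Lie V (u_fun \<alpha> p j)) * vec_index c j)))"
  unfolding swap[OF LCc] unfolding LC
  by (rule sum.cong[OF refl], rule arg_cong2[where f = "(*)", OF refl], rule sum.cong[OF refl]) (auto simp: A_def)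
 also have "\<dots> = of_real T * (\<Sum>i<?r. u_fun \<alpha> p i z * (\<Sum>j<?r. nu \<alpha> p j (%z. z $ k) * nu \<alpha> p i (Lie V (u_fun \<alpha> p j))))"
  by (simp add: sum_distrib_left mult_ac c_def nu_coord)
 also have "(\<Sum>i<?r. u_fun \<alpha> p i z * (\<Sum>j<?r. nu \<alpha> p j (%z. z $ k) * nu \<alpha> p i (Lie V (u_fun \<alpha> p j))))
   = (\<Sum>i<?r. nu \<alpha> p i (%z. V z $ k) * u_fun \<alpha> p i z)"
 proof (rule sum.cong[OF refl])
  fix i assume i: "i \<in> {..<?r}"
  have "nu \<alpha> p i (Lie V (%z. z $ k)) = (\<Sum>j<?r. nu \<alpha> p j (%z. z $ k) * nu \<alpha> p i (Lie V (u_fun \<alpha> p j)))"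
   by (rule nu_Lie[OF \<alpha> U _ V]) (use i in \<open>auto simp: hol_on_iff_hol_at hol_at_coord\<close>)
  moreover have "Lie V (%z. z $ k) = (%z. V z $ k)"
   by (rule ext) (simp add: Lie_eq_dd[OF hol_at_coord] dd_coord)
  ultimately show "u_fun \<alpha> p i z * (\<Sum>j<?r. nu \<alpha> p j (%z. z $ k) * nu \<alpha> p i (Lie V (u_fun \<alpha> p j)))
    = nu \<alpha> p i (%z. V z $ k) * u_fun \<alpha> p i z" by simp
 qed
 finally have 2: "(\<Sum>i<?r. nu \<alpha> p i (%z. V z $ k) * u_fun \<alpha> p i z) = of_real (1 / T) * cnj (hip c (mat_log C *\<^sub>v u))"
  using T by simp
 have Lu: "L *\<^sub>v u \<in> carrier_vec ?r" "mat_log C *\<^sub>v u \<in> carrier_vec ?r" using L LCc u by auto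
 show ?thesis
  unfolding 1 2 minus_mult_distrib_mat_vec[OF L LCc u] hip_diff_right[OF Lu] by (simp add: right_diff_distrib)
qed

section \<open>Assembly of the estimates and of the constant\<close>

theorem theorem6p3:
  fixes p :: "complex ^ 'd"
    and K0 K1 :: "(complex ^ 'd) set"
    and V :: "complex ^ 'd \<Rightarrow> complex ^ 'd"
    and T :: real
    and \<mu> :: "(complex ^ 'd) measure"
  assumes "p \<in> real_points"
    and "compact K0" and "absolutely_convex K0" and "0 \<in> interior K0"
    and "analytic_map V ((+) p ` K0)" and "V p = 0"
    and "T > 0" and "\<forall>w\<in>(+) p ` K0. \<exists>z. ode_solution V T w z"
    and "prob_space \<mu>" and "sets \<mu> = sets borel" and "emeasure \<mu> (K0 \<inter> real_points) = 1"
    and "measure_supp \<mu> \<subseteq> K0 \<inter> real_points"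
    and real_eigenvalues: "\<forall>l v. v \<noteq> 0 \<and> complex_jacobian V p *v v = l *s v \<longrightarrow> l \<in> \<real>"
    and "compact K1" and "K1 \<subseteq> interior K0"
  shows "\<exists>C' :: real. \<forall>(\<alpha> :: nat \<Rightarrow> 'd \<Rightarrow> nat) (m :: nat) (n :: nat) (N :: nat)
           (z0 :: nat \<Rightarrow> complex ^ 'd) (\<gamma>1 :: real) (\<gamma>2 :: real).
      let K = (+) p ` K0;
          f = flow V T;
          Z = (\<lambda>i. p + z0 i);
          D = moment_mat \<alpha> n \<mu>;
          D_hat = moment_mat \<alpha> n (empirical_measure N z0);
          S = minv (mat_sqrt D);
          C = push_forward_mat \<alpha> p K f m;
          R_\<mu> = (SUP x\<in>measure_supp \<mu>. gauge_norm K0 x);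
          R_K1 = (SUP z\<in>K1. gauge_norm K0 z)
      in
        mi_numbering \<alpha> \<and> m \<le> n \<and> N > 0 \<and> (\<forall>i<N. z0 i \<in> measure_supp \<mu>) \<and>
        invertible_mat D \<and> \<gamma>1 \<in> {0<..<1} \<and>
        op_norm (1\<^sub>m (rE TYPE('d) n) - S * D_hat * S) \<le> 1 - \<gamma>1 \<and>
        \<gamma>2 \<in> {0<..<1} \<and>
        op_norm (C - C_hat \<alpha> p f m n N Z) < (1 - \<gamma>2) * inverse (B_const C)
        \<longrightarrow>
        (SUP z\<in>(+) p ` K1. ereal (norm (V_hat \<alpha> p f T m n N Z z - V z)))
          \<le> ereal (C' * ((B_const C)\<^sup>2 / \<gamma>2 * sqrt (fact m / \<gamma>1) *
                (R_\<mu> ^ n / sqrt (min_eigenvalue D)) + R_K1 ^ m))"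
proof -
 note K0 = assms(2,3,4)
 let ?K = "(+) p ` K0"
 define f where "f = flow V T"
 obtain UV where UV: "open UV" "?K \<subseteq> UV" "!!k. hol_on (%z. V z $ k) UV"
  using assms(5) unfolding analytic_map_def by blast
 have T: "T \<ge> 0" using assms(7) by simp
 have fan: "analytic_map f ?K" unfolding f_def using assms(8) by (intro flow_analytic[OF T]) blast
 then obtain Uf where Uf: "open Uf" "?K \<subseteq> Uf" "!!k. hol_on (%z. f z $ k) Uf" unfolding analytic_map_def by blast
 have pK: "p \<in> ?K" by (rule p_in[OF K0])
 have Vp: "analytic_map V {p}" unfolding analytic_map_def using UV pK by blast
 have fp: "f p = p" unfolding f_def by (rule flow_fixed_point(2)[OF T Vp assms(6)]) (use T in auto)
 \<comment> \<open>One neighbourhood, and below one dilation \<open>\<rho>\<close>, serve both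
   \<open>V\<close> and the flow, so that all constants are fixed before the numbering, the degrees
   and the sample.\<close>
 define U where "U = UV \<inter> Uf"
 have U: "open U" "?K \<subseteq> U" "p \<in> U" unfolding U_def using UV Uf pK by auto
 have VU: "hol_on (%z. V z $ k) U" and fU: "hol_on (%z. f z $ k) U" for k
  unfolding U_def by (rule hol_on_subset[OF UV(3)] hol_on_subset[OF Uf(3)]; blast)+
 obtain \<rho> where \<rho>: "\<rho> > 1" "!!x. x \<in> K0 ==> p + \<rho> *\<^sub>R x \<in> U" using nbhd_dilate[OF K0 U(1,2)] by blast
 have cK: "compact ?K" using compact_translation[OF K0(1)] .
 have ce: "continuous_on S (exp_fun w)" for S and w :: "complex ^ 'd"
  by (rule hol_on_continuous_on) (simp add: hol_on_iff_hol_at hol_at_exp_fun)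
 obtain E where E: "E > 0" "!!z. z \<in> ?K ==> cmod (exp_fun p z) \<le> E"
  using exp_fun_bound_on[OF compact_imp_bounded[OF cK]] by blast
 have "\<exists>x\<in>?K. \<forall>y\<in>?K. cmod (exp_fun p x) \<le> cmod (exp_fun p y)"
  by (rule continuous_attains_inf[OF cK]) (use pK ce in \<open>auto intro: continuous_on_norm\<close>)
 then obtain x where x: "!!y. y \<in> ?K ==> cmod (exp_fun p x) \<le> cmod (exp_fun p y)" by blast
 \<comment> \<open>A positive lower bound for the exponential factor of the basis functions on
   \<open>p + K0\<close>; it enters the lower bound for the Gram matrix of the samples.\<close>
 define \<kappa> where "\<kappa> = cmod (exp_fun p x)"
 have \<kappa>: "\<kappa> > 0" "!!y. y \<in> ?K ==> \<kappa> \<le> cmod (exp_fun p y)" using x by (auto simp: \<kappa>_def exp_fun_nonzero)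
 obtain S1 where S1: "S1 \<ge> 0" "!!z. z \<in> ?K ==> u_bound p z \<le> S1" using u_bound_compact[OF cK] by blast
 obtain S2 where S2: "S2 \<ge> 0" "!!z. z \<in> cball 0 1 ==> u_bound p z \<le> S2" using u_bound_compact[OF compact_cball] by blast
 have "\<exists>M. \<forall>x\<in>K0. u_bound p (f (p + \<rho> *\<^sub>R x)) * cmod (exp_fun (- p) (p + \<rho> *\<^sub>R x)) \<le> M"
 proof -
  have line: "continuous_on K0 (%x. p + \<rho> *\<^sub>R x)" by (intro continuous_intros)
  have "continuous_on K0 (%x. f (p + \<rho> *\<^sub>R x))"
   by (rule continuous_on_compose2[OF continuous_on_hol_vec[OF fU] line]) (use \<rho> in auto)
  then have "continuous_on K0 (%x. u_bound p (f (p + \<rho> *\<^sub>R x)) * cmod (exp_fun (- p) (p + \<rho> *\<^sub>R x)))"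
   by (intro continuous_on_mult continuous_on_norm
     continuous_on_compose2[OF continuous_on_u_bound[of UNIV]] continuous_on_compose2[OF ce[of UNIV] line]) auto
  from compact_imp_bounded[OF compact_continuous_image[OF this K0(1)]]
  obtain M where "\<forall>x\<in>K0. norm (u_bound p (f (p + \<rho> *\<^sub>R x)) * cmod (exp_fun (- p) (p + \<rho> *\<^sub>R x))) \<le> M"
   unfolding bounded_iff by blast
  then show ?thesis by (intro exI[of _ M]) (auto dest: bspec intro: order_trans[OF abs_ge_self])
 qed
 then obtain M where Mle: "!!x. x \<in> K0 ==> u_bound p (f (p + \<rho> *\<^sub>R x)) * cmod (exp_fun (- p) (p + \<rho> *\<^sub>R x)) \<le> M" by blast
 have M0: "M \<ge> 0"
  by (rule order_trans[OF _ Mle[OF zero_in_K0[OF K0]]]) (simp add: u_bound_nonneg)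
 have "\<exists>M. M \<ge> 0 \<and> (\<forall>x\<in>K0. cmod (V (p + \<rho> *\<^sub>R x) $ k * exp_fun (- p) (p + \<rho> *\<^sub>R x)) \<le> M)" for k
  by (rule mult_exp_bound_dilate[OF K0 U(1) VU[of k] \<rho>(2)]) blast+
 from choice[OF allI[OF this]] obtain Mk
  where "\<forall>k. Mk k \<ge> 0 \<and> (\<forall>x\<in>K0. cmod (V (p + \<rho> *\<^sub>R x) $ k * exp_fun (- p) (p + \<rho> *\<^sub>R x)) \<le> Mk k)" ..
 then have Mk: "!!k. Mk k \<ge> 0"
  "!!k x. x \<in> K0 ==> cmod (V (p + \<rho> *\<^sub>R x) $ k * exp_fun (- p) (p + \<rho> *\<^sub>R x)) \<le> Mk k"
  by blast+
 define q where "q = (1 + \<rho>) / (\<rho> - 1)"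
 have q: "q > 0" using \<rho>(1) by (simp add: q_def)
 \<comment> \<open>\<open>1 / T\<close> is the factor in the estimated generator, \<open>S1\<close>
   and \<open>S2\<close> bound the vectors of values and of derivatives at 0, and the last factor is
   what remains of the matrix error after \<open>sq\<close> has removed the sample size.\<close>
 define c1 where "c1 = 1 / T * S1 * S2 * (E * (M * q) * exp ((norm p)\<^sup>2 / 2) / \<kappa>)"
 define c2 where "c2 k = E * (Mk k * q)" for k
 have c1: "c1 \<ge> 0" unfolding c1_def using S1 S2 E M0 q \<kappa> assms(7) by simp
 have c2: "c2 k \<ge> 0" for k unfolding c2_def using Mk E q by simp
 define C' where "C' = (\<Sum>k\<in>(UNIV :: 'd set). c1 + c2 k)"
 show ?thesis
  unfolding Let_def f_def[symmetric]
 proof (intro exI[of _ C'] allI impI, elim conjE)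
  fix \<alpha> :: "nat => 'd => nat" and m n N :: nat and z0 :: "nat => complex ^ 'd" and \<gamma>1 \<gamma>2 :: real
  let ?Z = "%i. p + z0 i" and ?D = "moment_mat \<alpha> n \<mu>" and ?C = "push_forward_mat \<alpha> p ?K f m"
  let ?R\<mu> = "SUP x\<in>measure_supp \<mu>. gauge_norm K0 x" and ?R1 = "SUP z\<in>K1. gauge_norm K0 z"
  assume \<alpha>: "mi_numbering \<alpha>" and mn: "m \<le> n" and N: "0 < N" and z0: "\<forall>i<N. z0 i \<in> measure_supp \<mu>"
   and inv: "invertible_mat ?D" and \<gamma>1: "\<gamma>1 \<in> {0<..<1}"
   and le1: "op_norm (1\<^sub>m (rE TYPE('d) n) - minv (mat_sqrt ?D) * moment_mat \<alpha> n (empirical_measure N z0) * minv (mat_sqrt ?D)) \<le> 1 - \<gamma>1"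
   and \<gamma>2: "\<gamma>2 \<in> {0<..<1}"
   and le2: "op_norm (?C - C_hat \<alpha> p f m n N ?Z) < (1 - \<gamma>2) * inverse (B_const ?C)"
  let ?r = "rE TYPE('d) m"
  define H where "H = C_hat \<alpha> p f m n N ?Z"
  have H: "H \<in> carrier_mat ?r ?r" by (simp add: H_def C_hat_def)
  have Ceq: "?C = Matrix.mat ?r ?r (%(i, j). cnj (nu \<alpha> p j (%z. u_fun \<alpha> p i (f z))))"
   by (rule push_forward_mat_eq[OF K0 \<alpha> fan fp])
  then have C: "?C \<in> carrier_mat ?r ?r" by simp
  note log = mat_log_push_forward[OF \<alpha> U(1,3) VU assms(6) T real_eigenvalues, of m, folded f_def, folded Ceq]
  note det = det_seg_push_forward[OF \<alpha> U(1,3) VU assms(6) T real_eigenvalues, of _ m, folded f_def, folded Ceq]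
  have Dc: "?D \<in> carrier_mat (rE TYPE('d) n) (rE TYPE('d) n)" by (simp add: moment_mat_def)
  have psd: "mat_psd ?D" by (rule moment_mat_psd[OF assms(9,10) K0(1) assms(11)])
  have dD: "Determinant.det ?D \<noteq> 0" by (rule det_nonzero_of_invertible[OF Dc inv])
  define \<Lambda> where "\<Lambda> = min_eigenvalue ?D"
  have \<Lambda>: "\<Lambda> > 0" unfolding \<Lambda>_def by (rule min_eigenvalue_pos[OF Dc psd dD rE_pos])
  \<comment> \<open>A sample exists as \<open>N > 0\<close>, so the support is nonempty and the
    supremum of the gauge over it is meaningful.\<close>
  have supp: "measure_supp \<mu> \<subseteq> K0" "measure_supp \<mu> \<noteq> {}" using assms(12) z0 N by auto
  note R\<mu> = SUP_gauge_norm[OF K0 supp]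
  have z0K: "z0 k \<in> K0" if "k < N" for k using z0 supp that by blast
  define b where "b = exp (- (norm p)\<^sup>2) * \<kappa>\<^sup>2 * real N * \<gamma>1 * \<Lambda>"
  have b: "b > 0" unfolding b_def using \<kappa> N \<gamma>1 \<Lambda> by simp
  have \<kappa>': "\<kappa> \<le> cmod (exp_fun p (p + z0 k))" if "k < N" for k using \<kappa>(2) z0K[OF that] by blast
  have \<gamma>1': "\<gamma>1 > 0" using \<gamma>1 by simp
  note pinv = U_mat_pinv[OF \<alpha> mn N psd dD le1 \<gamma>1' \<kappa>(1) \<kappa>' zero_carrier_vec]
  note pinvb = pinv_bound[OF \<alpha> mn N psd dD le1 \<gamma>1' \<kappa>(1) \<kappa>', folded \<Lambda>_def, folded b_def]
  have err1: "op_norm (?C - H) \<le> E * (M * ((1 + \<rho>) / (\<rho> - 1))) * ?R\<mu> ^ n * sqrt (real N) * sqrt (fact m / b)"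
   unfolding H_def Ceq
   by (rule C_hat_error[OF K0 \<alpha> mn U(1) fU \<rho> M0 Mle E(2) z0K _ R\<mu>(1,2) U(3) pinv pinvb])
    (use z0 R\<mu>(3) b in auto)
  \<comment> \<open>Here the sample size cancels: \<open>b\<close> contains the factor
    \<open>N\<close>.\<close>
  have sq: "sqrt (real N) * sqrt (fact m / b) = exp ((norm p)\<^sup>2 / 2) / \<kappa> * (sqrt (fact m / \<gamma>1) / sqrt \<Lambda>)"
  proof (rule power2_eq_imp_eq)
   have "(exp ((norm p)\<^sup>2 / 2))\<^sup>2 = exp ((norm p)\<^sup>2)" by (simp add: exp_double[symmetric])
   then show "(sqrt (real N) * sqrt (fact m / b))\<^sup>2 = (exp ((norm p)\<^sup>2 / 2) / \<kappa> * (sqrt (fact m / \<gamma>1) / sqrt \<Lambda>))\<^sup>2"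
    using b \<kappa>(1) N \<gamma>1' \<Lambda> by (simp add: power_mult_distrib power_divide b_def exp_minus field_simps)
  qed (use b \<kappa>(1) N \<gamma>1' \<Lambda> in auto)
  have err: "op_norm (?C - H) \<le> E * (M * q) * exp ((norm p)\<^sup>2 / 2) / \<kappa> * (sqrt (fact m / \<gamma>1) * (?R\<mu> ^ n / sqrt \<Lambda>))"
   using err1 unfolding mult.assoc[of _ "sqrt (real N)"] sq by (simp add: q_def mult_ac)
  define Y where "Y = E * (M * q) * exp ((norm p)\<^sup>2 / 2) / \<kappa> * (sqrt (fact m / \<gamma>1) * (?R\<mu> ^ n / sqrt \<Lambda>))"
  have Y0: "Y \<ge> 0" using order_trans[OF op_norm_nonneg[OF minus_carrier_mat[OF H]] err] by (simp add: Y_def)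
  define X where "X = (B_const ?C)\<^sup>2 / \<gamma>2 * sqrt (fact m / \<gamma>1) * (?R\<mu> ^ n / sqrt \<Lambda>)"
  have X: "X \<ge> 0" unfolding X_def using \<gamma>2 \<gamma>1' \<Lambda> R\<mu>(1) by simp
  have bound: "norm (V_hat \<alpha> p f T m n N ?Z (p + v) - V (p + v)) \<le> C' * (X + ?R1 ^ m)" if v: "v \<in> K1" for v
  proof -
   have K1: "K1 \<subseteq> K0" "K1 \<noteq> {}" using assms(15) interior_subset v by auto
   note R1 = SUP_gauge_norm[OF K0 K1]
   have vK: "v \<in> K0" using v K1 by blast
   have comp: "cmod ((V_hat \<alpha> p f T m n N ?Z (p + v) - V (p + v)) $ k) \<le> (c1 + c2 k) * (X + ?R1 ^ m)" for k
   proof -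
    define c where "c = Matrix.vec ?r (%i. cnj (partial_deriv k (u_fun \<alpha> p i) 0))"
    define u where "u = Matrix.vec ?r (%i. cnj (u_fun \<alpha> p i (p + v)))"
    \<comment> \<open>The truncated expansion of component \<open>k\<close> of \<open>V\<close> is
      the intermediate term: the estimated field differs from it by the error of the logarithm, the
      exact one by a Taylor remainder.\<close>
    let ?S = "\<Sum>i<?r. nu \<alpha> p i (%z. V z $ k) * u_fun \<alpha> p i (p + v)"
    have cu: "c \<in> carrier_vec ?r" "u \<in> carrier_vec ?r" by (simp_all add: c_def u_def)
    have uS: "vec_l2 u \<le> S1"
     unfolding u_def using vec_l2_u_fun_le[OF \<alpha>, of m p "p + v"] S1(2)[of "p + v"] vK by force
    have cS: "vec_l2 c \<le> S2" unfolding c_def by (rule vec_l2_partial_deriv_u_fun_le[OF \<alpha> S2(2)])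
    have "cmod (V_hat \<alpha> p f T m n N ?Z (p + v) $ k - ?S) = 1 / T * cmod (hip c ((mat_log H - mat_log ?C) *\<^sub>v u))"
     unfolding V_hat_component[OF \<alpha> U(1,3) VU assms(6,7) log] H_def c_def u_def using assms(7)
     by (simp add: norm_mult norm_divide)
    also have "\<dots> \<le> 1 / T * ((B_const ?C)\<^sup>2 / \<gamma>2 * op_norm (?C - H) * vec_l2 u * vec_l2 c)"
     using assms(7) \<gamma>2 le2
     by (intro mult_left_mono mat_log_perturb[OF C det rE_pos H] cu) (auto simp: H_def)
    also have "\<dots> \<le> 1 / T * ((B_const ?C)\<^sup>2 / \<gamma>2 * Y * S1 * S2)"
     using assms(7) \<gamma>2 S1 Y0 op_norm_nonneg[OF minus_carrier_mat[OF H]]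
     by (intro mult_left_mono mult_mono err[folded Y_def] uS cS) (auto simp: vec_l2_nonneg)
    also have "\<dots> = c1 * X" by (simp add: c1_def X_def Y_def mult_ac)
    finally have 1: "cmod (V_hat \<alpha> p f T m n N ?Z (p + v) $ k - ?S) \<le> c1 * X" .
    have "cmod (V (p + v) $ k - ?S) \<le> E * (Mk k * ((1 + \<rho>) / (\<rho> - 1))) * ?R1 ^ m"
     by (rule taylor_gauge[OF K0 \<alpha> U(1) VU \<rho> Mk(1) Mk(2) E(2) vK R1(3)[OF v] R1(2)])
    then have 2: "cmod (V (p + v) $ k - ?S) \<le> c2 k * ?R1 ^ m" by (simp add: c2_def q_def)
    have "cmod ((V_hat \<alpha> p f T m n N ?Z (p + v) - V (p + v)) $ k)
      = cmod ((V_hat \<alpha> p f T m n N ?Z (p + v) $ k - ?S) - (V (p + v) $ k - ?S))" by simp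
    also have "\<dots> \<le> c1 * X + c2 k * ?R1 ^ m" using norm_triangle_ineq4 1 2 by (meson add_mono order_trans)
    also have "\<dots> \<le> (c1 + c2 k) * (X + ?R1 ^ m)"
     using c1 c2[of k] X R1(1) by (simp add: distrib_left distrib_right)
    finally show ?thesis .
   qed
   have "norm (V_hat \<alpha> p f T m n N ?Z (p + v) - V (p + v))
     \<le> (\<Sum>k\<in>UNIV. cmod ((V_hat \<alpha> p f T m n N ?Z (p + v) - V (p + v)) $ k))" by (rule norm_vec_le_sum)
   also have "\<dots> \<le> (\<Sum>k\<in>UNIV. (c1 + c2 k) * (X + ?R1 ^ m))" by (rule sum_mono) (rule comp)
   finally show ?thesis unfolding C'_def sum_distrib_right .
  qed
  show "(SUP z\<in>(+) p ` K1. ereal (norm (V_hat \<alpha> p f T m n N ?Z z - V z)))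
    \<le> ereal (C' * ((B_const ?C)\<^sup>2 / \<gamma>2 * sqrt (fact m / \<gamma>1) * (?R\<mu> ^ n / sqrt (min_eigenvalue ?D)) + ?R1 ^ m))"
   unfolding \<Lambda>_def[symmetric] X_def[symmetric] by (rule SUP_least) (use bound in auto)
 qed
qed

end
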